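(* The third blocked LRFC ensemble on $n$ qubits with patch size $\xi$ forms an approximate unitary $k$-design with measurable error $\mathcal{O}(nk^2/2^\xi)$.
   Context: It is implicitly assumed that $n/\xi$ is an integer. LRFC ensemble on $N$ qubits ($N$ even): $U=S_LS_RFC$, where $S_L|x_L\|x_R\rangle=|x_L\oplus h_L(x_R)\|x_R\rangle$ and $S_R|x_L\|x_R\rangle=|x_L\|x_R\oplus h_R(x_L)\rangle$ for uniformly random functions $h_L,h_R:\{0,1\}^{N/2}\to\{0,1\}^{N/2}$ ($x_L,x_R$ the left and right halves of $x$), $F|x\rangle=(-1)^{f(x)}|x\rangle$ with $f:\{0,1\}^N\to\{0,1\}$ uniformly random, and $C$ a uniformly random $N$-qubit Clifford, all independent. Third blocked LRFC ensemble: divide $n$ qubits into consecutive patches of $\xi$ qubits; $U=(\mathrm{LRFC})_e(\mathrm{LRFC})_o$, where $(\mathrm{LRFC})_o$ (resp. $(\mathrm{LRFC})_e$) is a tensor product of independent LRFC unitaries on $2\xi$ qubits acting on each odd (resp. even) pair of consecutive patches $(a,a+1)$. Measurable error: a $k$-query experiment prepares $W_{k+1}(U\otimes 1_m)W_k\cdots(U\otimes 1_m)W_1|0^{n+m}\rangle$ for arbitrary unitaries $W_i$; an ensemble has measurable error $\varepsilon$ if for every such experiment the expected outputs for $U$ from the ensemble and $U$ Haar-random on $U(2^n)$ are within trace-norm distance $\varepsilon$. *)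

theory Defs
  imports "Jordan_Normal_Form.Jordan_Normal_Form" "HOL-Probability.Probability"
begin

text \<open>Computational basis of N qubits: indices 0 ..< 2^N. Matrices are Jordan_Normal_Form
  complex matrices.\<close>

definition adj :: "complex mat \<Rightarrow> complex mat" where
  "adj A = Matrix.mat (dim_col A) (dim_row A) (\<lambda>(i,j). cnj (A $$ (j,i)))"

definition unitaries :: "nat \<Rightarrow> complex mat set" where
  "unitaries d = {U \<in> carrier_mat d d. adj U * U = 1\<^sub>m d}"

text \<open>Trace norm = sum of singular values, i.e. of square roots of the eigenvalues
  (with algebraic multiplicity) of adj A * A.\<close>
definition trace_norm :: "complex mat \<Rightarrow> real" where
  "trace_norm A = (let p = char_poly (adj A * A) in
     (\<Sum>z\<in>{z. poly p z = 0}. real (order z p) * sqrt (Re z)))"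

definition perm_mat :: "nat \<Rightarrow> (nat \<Rightarrow> nat) \<Rightarrow> complex mat" where
  "perm_mat d \<sigma> = Matrix.mat d d (\<lambda>(i,j). if i = \<sigma> j then 1 else 0)"

text \<open>Embedding of a 2^w-dimensional operator U acting on the qubits s, ..., s+w-1
  (bits s..s+w-1 of the basis index) of an N-qubit system, identity on all other qubits.\<close>
definition embed :: "nat \<Rightarrow> nat \<Rightarrow> nat \<Rightarrow> complex mat \<Rightarrow> complex mat" where
  "embed N s w U = Matrix.mat (2^N) (2^N) (\<lambda>(i,j).
     if i div 2^(s+w) = j div 2^(s+w) \<and> i mod 2^s = j mod 2^s
     then U $$ ((i div 2^s) mod 2^w, (j div 2^s) mod 2^w) else 0)"

text \<open>U \<otimes> 1_m on n+m qubits (U on the n system qubits = high bits, identity on m ancillas).\<close>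
definition tensor_id :: "nat \<Rightarrow> nat \<Rightarrow> complex mat \<Rightarrow> complex mat" where
  "tensor_id n m U = embed (n+m) m n U"

definition hadamard :: "complex mat" where
  "hadamard = Matrix.mat 2 2 (\<lambda>(i,j). (if i = 1 \<and> j = 1 then -1 else 1) / complex_of_real (sqrt 2))"

definition phase_gate :: "complex mat" where
  "phase_gate = Matrix.mat 2 2 (\<lambda>(i,j). if i = j then (if i = 0 then 1 else \<i>) else 0)"

definition cnot :: "nat \<Rightarrow> nat \<Rightarrow> nat \<Rightarrow> complex mat" where
  "cnot N c t = perm_mat (2^N) (\<lambda>x. if bit x c then Bit_Operations.xor x (2^t) else x)"

definition clifford_gens :: "nat \<Rightarrow> complex mat set" where
  "clifford_gens N = {embed N q 1 hadamard | q. q < N} \<union> {embed N q 1 phase_gate | q. q < N}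
     \<union> {cnot N c t | c t. c < N \<and> t < N \<and> c \<noteq> t}"

text \<open>The N-qubit Clifford group: the (finite) group generated by H, S and CNOT.
  Global phases are irrelevant for output states, so the uniform distribution on this
  group is the uniform distribution on the Clifford group.\<close>
inductive_set clifford_group :: "nat \<Rightarrow> complex mat set" for N where
  id: "1\<^sub>m (2^N) \<in> clifford_group N"
| gen: "C \<in> clifford_group N \<Longrightarrow> G \<in> clifford_gens N \<Longrightarrow> G * C \<in> clifford_group N"

text \<open>N = 2h qubits; basis index x = x_L * 2^h + x_R.\<close>
definition S_L :: "nat \<Rightarrow> (nat \<Rightarrow> nat) \<Rightarrow> complex mat" where
  "S_L h hL = perm_mat (2^(2*h)) (\<lambda>x. (Bit_Operations.xor (x div 2^h) (hL (x mod 2^h))) * 2^h + x mod 2^h)"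

definition S_R :: "nat \<Rightarrow> (nat \<Rightarrow> nat) \<Rightarrow> complex mat" where
  "S_R h hR = perm_mat (2^(2*h)) (\<lambda>x. (x div 2^h) * 2^h + (Bit_Operations.xor (x mod 2^h) (hR (x div 2^h))))"

definition F_mat :: "nat \<Rightarrow> (nat \<Rightarrow> bool) \<Rightarrow> complex mat" where
  "F_mat N f = Matrix.mat (2^N) (2^N) (\<lambda>(i,j). if i = j then (if f i then -1 else 1) else 0)"

definition bool_funs :: "nat \<Rightarrow> (nat \<Rightarrow> nat) set" where
  "bool_funs h = ({..<2^h} \<rightarrow>\<^sub>E {..<2^h})"

definition LRFC :: "nat \<Rightarrow> complex mat pmf" where
  "LRFC h = do {
     hL \<leftarrow> pmf_of_set (bool_funs h);
     hR \<leftarrow> pmf_of_set (bool_funs h);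
     f \<leftarrow> pmf_of_set ({..<2^(2*h)} \<rightarrow>\<^sub>E (UNIV :: bool set));
     C \<leftarrow> pmf_of_set (clifford_group (2*h));
     return_pmf (S_L h hL * S_R h hR * F_mat (2*h) f * C) }"

text \<open>A layer: independent LRFC unitaries on patch pairs (p, p+1), for the (0-indexed)
  starting patches p in the list ps, each patch having xi qubits; n qubits total.\<close>
fun layer :: "nat \<Rightarrow> nat \<Rightarrow> nat list \<Rightarrow> complex mat pmf" where
  "layer n xi [] = return_pmf (1\<^sub>m (2^n))"
| "layer n xi (p # ps) = do {
     V \<leftarrow> LRFC xi;
     R \<leftarrow> layer n xi ps;
     return_pmf (embed n (p * xi) (2 * xi) V * R) }"

text \<open>Patches 1..P (P = n div xi) in the paper are 0..P-1 here; paper-odd pairs (1,2),(3,4),...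
  are p = 0,2,4,... and paper-even pairs (2,3),(4,5),... are p = 1,3,...; pairs need p+1 < P.\<close>
definition odd_pairs :: "nat \<Rightarrow> nat list" where
  "odd_pairs P = filter (\<lambda>p. even p \<and> p + 1 < P) [0..<P]"

definition even_pairs :: "nat \<Rightarrow> nat list" where
  "even_pairs P = filter (\<lambda>p. odd p \<and> p + 1 < P) [0..<P]"

definition blocked_LRFC3 :: "nat \<Rightarrow> nat \<Rightarrow> complex mat pmf" where
  "blocked_LRFC3 n xi = do {
     Uo \<leftarrow> layer n xi (odd_pairs (n div xi));
     Ue \<leftarrow> layer n xi (even_pairs (n div xi));
     return_pmf (Ue * Uo) }"

definition haar_sets :: "nat \<Rightarrow> complex mat set set" where
  "haar_sets d = sigma_sets (unitaries d)
     {(\<lambda>A. A $$ (i,j)) -` B \<inter> unitaries d | i j B. i < d \<and> j < d \<and> B \<in> sets borel}"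

definition haar :: "nat \<Rightarrow> complex mat measure" where
  "haar d = (THE M. prob_space M \<and> space M = unitaries d \<and> sets M = haar_sets d \<and>
      (\<forall>V\<in>unitaries d. \<forall>A\<in>sets M.
         emeasure M ((\<lambda>U. V * U) -` A \<inter> space M) = emeasure M A))"

definition zero_state :: "nat \<Rightarrow> complex mat" where
  "zero_state d = Matrix.mat d 1 (\<lambda>(i,j). if i = 0 then 1 else 0)"

fun query_state :: "nat \<Rightarrow> nat \<Rightarrow> (nat \<Rightarrow> complex mat) \<Rightarrow> complex mat \<Rightarrow> nat \<Rightarrow> complex mat" where
  "query_state n m W U 0 = W 0 * zero_state (2^(n+m))"
| "query_state n m W U (Suc j) = W (Suc j) * (tensor_id n m U * query_state n m W U j)"

definition output_state :: "nat \<Rightarrow> nat \<Rightarrow> nat \<Rightarrow> (nat \<Rightarrow> complex mat) \<Rightarrow> complex mat \<Rightarrow> complex mat" where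
  "output_state n m k W U = (let \<psi> = query_state n m W U k in \<psi> * adj \<psi>)"

definition expected_output :: "complex mat measure \<Rightarrow> nat \<Rightarrow> nat \<Rightarrow> nat \<Rightarrow> (nat \<Rightarrow> complex mat) \<Rightarrow> complex mat" where
  "expected_output \<mu> n m k W = Matrix.mat (2^(n+m)) (2^(n+m))
     (\<lambda>(i,j). \<integral>U. output_state n m k W U $$ (i,j) \<partial>\<mu>)"

definition measurable_error :: "complex mat measure \<Rightarrow> nat \<Rightarrow> nat \<Rightarrow> real \<Rightarrow> bool" where
  "measurable_error \<mu> n k \<epsilon> \<longleftrightarrow>
     (\<forall>m W. (\<forall>i\<le>k. W i \<in> unitaries (2^(n+m))) \<longrightarrow>
        trace_norm (expected_output \<mu> n m k W - expected_output (haar (2^n)) n m k W) \<le> \<epsilon>)"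

end

theory Submission
  imports Defs "Jordan_Normal_Form.Schur_Decomposition" "HOL-Combinatorics.Permutations"
begin

text \<open>
  Expanding a \<open>k\<close>-query experiment over the inputs \<open>X\<close> and outputs \<open>Y\<close> of the queries turns the outcome
  probabilities into expected squared moduli of degree-\<open>k\<close> polynomials in the entries of \<open>U\<close>. For one LRFC
  block such an expectation is at least \<open>1 - O(k\<^sup>2/2^\<xi>)\<close> times its value for Gaussian entries, restricted to
  outputs whose left and right halves are pairwise distinct: the random functions project onto distinct
  strings, and a random Clifford makes collisions of half strings unlikely because its conjugation action
  on nontrivial Paulis is uniform. Since a sum over distinct intermediate values on the overlapping patch
  composes such bounds, they can be glued patch by patch along the two layers. The lower bound is
  invariant under multiplication by a fixed unitary, so invariance of Haar measure
  makes it a lower bound for the Haar average too. By orthogonality of the query amplitudes for distinct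
  outputs the bound has total weight \<open>1 - O(n k\<^sup>2/2^\<xi>)\<close>, and two states of trace one
  with a common lower bound of trace \<open>1 - \<delta>\<close> are \<open>2\<delta>\<close>-close in trace norm.
\<close>

section \<open>Unitary matrices and the trace norm\<close>

text \<open>The trace norm enters through an eigenbasis of the difference of the two expected
  states, which leaves outcome probabilities in one orthonormal basis. Right multiplication by a
  unitary acts on query inputs alone; that is why \<open>dominated\<close> restricts outputs but
  sums over all inputs. Two objects have to be secured first: the inductively generated Clifford
  group must be finite for \<open>pmf_of_set\<close> to be uniform on it, and \<open>haar\<close> is
  a definite description, so existence and uniqueness are needed. The constant 6 is 2 times 3: with
  \<open>P\<close> patches the weight shrinks by a factor no smaller than
  \<open>1 - k^2/2^\<xi>\<close> for each of \<open>P - 1\<close> Cliffords, \<open>P - 2\<close>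
  shared patches and \<open>P\<close> output patches, and \<open>P - 1 \<le> n\<close>.\<close>

definition ip :: "nat \<Rightarrow> (nat \<Rightarrow> complex) \<Rightarrow> (nat \<Rightarrow> complex) \<Rightarrow> complex" where
  "ip d u v = (\<Sum>i<d. cnj (u i) * v i)"

definition nrm :: "nat \<Rightarrow> (nat \<Rightarrow> complex) \<Rightarrow> real" where
  "nrm d u = sqrt (\<Sum>i<d. (cmod (u i))\<^sup>2)"

lemma ip_self: "ip d u u = complex_of_real ((nrm d u)\<^sup>2)"
  unfolding ip_def nrm_def
  by (simp add: sum_nonneg complex_norm_square mult.commute del: of_real_power)

lemma ip_cnj: "cnj (ip d u v) = ip d v u"
  unfolding ip_def by (simp add: mult.commute)

lemma ip_sum_right: "ip d u (\<lambda>i. \<Sum>a\<in>A. c a * w a i) = (\<Sum>a\<in>A. c a * ip d u (w a))"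
  unfolding ip_def by (simp add: sum_distrib_left mult.left_commute sum.swap[of _ A])

lemma ip_diff_right: "ip d u (\<lambda>i. v i - w i) = ip d u v - ip d u w"
  unfolding ip_def by (simp add: right_diff_distrib sum_subtractf)

lemma ip_scale_right: "ip d u (\<lambda>i. v i / c) = ip d u v / c"
  unfolding ip_def by (simp add: sum_divide_distrib)

lemma ip_scale_left: "ip d (\<lambda>i. v i / complex_of_real c) u = ip d v u / complex_of_real c"
  unfolding ip_def by (simp add: sum_divide_distrib)

lemma nrm_eq_0: "nrm d u = 0 \<longleftrightarrow> (\<forall>i<d. u i = 0)"
  unfolding nrm_def by (auto simp: sum_nonneg_eq_0_iff)

section \<open>Gram-Schmidt orthonormalisation\<close>

fun gs :: "nat \<Rightarrow> (nat \<Rightarrow> nat \<Rightarrow> complex) \<Rightarrow> nat \<Rightarrow> nat \<Rightarrow> complex" where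
  "gs d g j = (let r = (\<lambda>i. g j i - (\<Sum>l<j. ip d (gs d g l) (g j) * gs d g l i))
     in (\<lambda>i. r i / complex_of_real (nrm d r)))"

declare gs.simps [simp del]

text \<open>The vector before normalisation. Division by zero gives 0, so \<open>gs\<close> is
  total; linear independence enters only as \<open>nrm d (gs_res d g j) \<noteq> 0\<close>.\<close>

definition gs_res :: "nat \<Rightarrow> (nat \<Rightarrow> nat \<Rightarrow> complex) \<Rightarrow> nat \<Rightarrow> nat \<Rightarrow> complex" where
  "gs_res d g j = (\<lambda>i. g j i - (\<Sum>l<j. ip d (gs d g l) (g j) * gs d g l i))"

lemma gs_eq: "gs d g j = (\<lambda>i. gs_res d g j i / complex_of_real (nrm d (gs_res d g j)))"
  unfolding gs_res_def by (subst gs.simps) (simp add: Let_def)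

text \<open>Induction on the larger index: in the inner product of \<open>gs d g j\<close> with the
  residual at \<open>l\<close>, orthonormality below \<open>l\<close> leaves only the subtracted
  term with index \<open>j\<close>, which cancels \<open>ip d (gs d g j) (g l)\<close>. Conjugation
  covers the case \<open>l < j\<close>.\<close>

lemma gs_orthonormal:
  assumes "\<And>j. j < m \<Longrightarrow> nrm d (gs_res d g j) \<noteq> 0" "j < m" "l < m"
  shows "ip d (gs d g j) (gs d g l) = (if j = l then 1 else 0)"
proof -
  have main: "ip d (gs d g j) (gs d g l) = (if j = l then 1 else 0)" if "j \<le> l" "l < m" for j l
    using that
  proof (induction l arbitrary: j rule: less_induct)
    case (less l)
    have nz: "nrm d (gs_res d g l) \<noteq> 0" using assms less by auto
    show ?case
    proof (cases "j = l")
      case True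
      then show ?thesis using nz
        by (simp add: gs_eq[of d g l] ip_scale_left ip_scale_right ip_self power2_eq_square)
    next
      case False
      then have jl: "j < l" using less by auto
      have on: "ip d (gs d g j) (gs d g l') = (if j = l' then 1 else 0)" if "l' < l" for l'
      proof (cases "j \<le> l'")
        case True
        then show ?thesis using less that by auto
      next
        case False
        then have "ip d (gs d g l') (gs d g j) = 0" using less.IH[of j l'] jl less.prems by auto
        then show ?thesis using False ip_cnj[of d "gs d g l'" "gs d g j"] by auto
      qed
      have "ip d (gs d g j) (gs_res d g l) =
         ip d (gs d g j) (g l) - (\<Sum>l'<l. ip d (gs d g l') (g l) * ip d (gs d g j) (gs d g l'))"
        unfolding gs_res_def by (simp add: ip_diff_right ip_sum_right)
      also have "(\<Sum>l'<l. ip d (gs d g l') (g l) * ip d (gs d g j) (gs d g l'))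
          = (\<Sum>l'<l. if l' = j then ip d (gs d g j) (g l) else 0)"
        by (rule sum.cong) (auto simp: on)
      also have "\<dots> = ip d (gs d g j) (g l)" using jl by simp
      finally show ?thesis using False by (subst gs_eq[of d g l]) (simp add: ip_scale_right)
    qed
  qed
  show ?thesis
  proof (cases "j \<le> l")
    case True then show ?thesis using main assms by auto
  next
    case False
    then have "ip d (gs d g l) (gs d g j) = 0" using main[of l j] assms by auto
    then show ?thesis using False ip_cnj[of d "gs d g l" "gs d g j"] by auto
  qed
qed

text \<open>The coefficient 1 of \<open>g j\<close> in the residual is what later certifies that a
  residual is nonzero: a vanishing residual would be a nontrivial linear relation among
  \<open>g 0, ..., g j\<close>.\<close>

lemma gs_lincomb: "\<exists>c. \<forall>i. gs d g j i = (\<Sum>m\<le>j. c m * g m i)"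
  and gs_res_lincomb: "\<exists>c. c j = 1 \<and> (\<forall>i. gs_res d g j i = (\<Sum>m\<le>j. c m * g m i))"
proof -
  have *: "(\<exists>c. \<forall>i. gs d g j i = (\<Sum>m\<le>j. c m * g m i)) \<and>
     (\<exists>c. c j = 1 \<and> (\<forall>i. gs_res d g j i = (\<Sum>m\<le>j. c m * g m i)))"
  proof (induction j rule: less_induct)
    case (less j)
    then have "\<forall>l. \<exists>c. l < j \<longrightarrow> (\<forall>i. gs d g l i = (\<Sum>m\<le>l. c m * g m i))" by blast
    then obtain c where c: "\<And>l i. l < j \<Longrightarrow> gs d g l i = (\<Sum>m\<le>l. c l m * g m i)" by metis
    \<comment> \<open>Coefficients after substituting the expansions of the earlier
      \<open>gs d g l\<close>, each of which involves only indices \<open>m \<le> l\<close>.\<close>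
    define e where "e m = (if m = j then 1 else - (\<Sum>l<j. if m \<le> l then ip d (gs d g l) (g j) * c l m else 0))" for m
    have res: "gs_res d g j i = (\<Sum>m\<le>j. e m * g m i)" for i
    proof -
      have "(\<Sum>l<j. ip d (gs d g l) (g j) * gs d g l i)
         = (\<Sum>l<j. \<Sum>m<j. if m \<le> l then ip d (gs d g l) (g j) * c l m * g m i else 0)"
      proof (rule sum.cong)
        fix l assume "l \<in> {..<j}"
        then have l: "l < j" by auto
        have "(\<Sum>m<j. if m \<le> l then ip d (gs d g l) (g j) * c l m * g m i else 0)
          = (\<Sum>m\<in>{..<j} \<inter> {m. m \<le> l}. ip d (gs d g l) (g j) * c l m * g m i)"
          by (simp add: sum.inter_restrict)
        also have "{..<j} \<inter> {m. m \<le> l} = {..l}" using l by auto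
        also have "(\<Sum>m\<le>l. ip d (gs d g l) (g j) * c l m * g m i) = ip d (gs d g l) (g j) * (\<Sum>m\<le>l. c l m * g m i)"
          by (simp add: sum_distrib_left mult.assoc)
        finally show "ip d (gs d g l) (g j) * gs d g l i =
           (\<Sum>m<j. if m \<le> l then ip d (gs d g l) (g j) * c l m * g m i else 0)"
          using c[OF l, of i] by simp
      qed simp
      also have "\<dots> = (\<Sum>m<j. \<Sum>l<j. if m \<le> l then ip d (gs d g l) (g j) * c l m * g m i else 0)"
        by (rule sum.swap)
      also have "\<dots> = (\<Sum>m<j. - (e m * g m i))"
        unfolding e_def by (intro sum.cong) (auto simp: sum_distrib_right intro!: sum.cong)
      finally have "gs_res d g j i = g j i + (\<Sum>m<j. e m * g m i)"
        unfolding gs_res_def by (simp add: sum_negf)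
      then show ?thesis by (simp add: lessThan_Suc_atMost[symmetric] e_def)
    qed
    have ej: "e j = 1" by (simp add: e_def)
    have "gs d g j i = (\<Sum>m\<le>j. (e m / complex_of_real (nrm d (gs_res d g j))) * g m i)" for i
      by (subst gs_eq) (simp add: res sum_divide_distrib)
    then have "\<exists>c. \<forall>i. gs d g j i = (\<Sum>m\<le>j. c m * g m i)" by (intro exI allI)
    moreover have "\<exists>c. c j = 1 \<and> (\<forall>i. gs_res d g j i = (\<Sum>m\<le>j. c m * g m i))"
      using res ej by (intro exI[of _ e]) simp
    ultimately show ?case by blast
  qed
  show "\<exists>c. \<forall>i. gs d g j i = (\<Sum>m\<le>j. c m * g m i)"
    "\<exists>c. c j = 1 \<and> (\<forall>i. gs_res d g j i = (\<Sum>m\<le>j. c m * g m i))" using * by auto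
qed

section \<open>Adjoints and unitary matrices\<close>

lemma adj_carrier [simp]: "A \<in> carrier_mat a b \<Longrightarrow> adj A \<in> carrier_mat b a"
  unfolding adj_def by auto

lemma adj_index [simp]: "i < dim_col A \<Longrightarrow> j < dim_row A \<Longrightarrow> adj A $$ (i,j) = cnj (A $$ (j,i))"
  unfolding adj_def by auto

lemma adj_dims [simp]: "dim_row (adj A) = dim_col A" "dim_col (adj A) = dim_row A"
  unfolding adj_def by auto

lemma mat_mult_index:
  "A \<in> carrier_mat a b \<Longrightarrow> B \<in> carrier_mat b c \<Longrightarrow> i < a \<Longrightarrow> j < c \<Longrightarrow>
    (A * B) $$ (i,j) = (\<Sum>l<b. A $$ (i,l) * B $$ (l,j))"
  by (auto simp: scalar_prod_def lessThan_atLeast0 intro!: sum.cong)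

lemma adj_mult:
  "A \<in> carrier_mat a b \<Longrightarrow> B \<in> carrier_mat b c \<Longrightarrow> adj (A * B) = adj B * adj A"
  by (rule eq_matI) (auto simp: scalar_prod_def mult.commute intro!: sum.cong)

lemma adj_adj [simp]: "adj (adj A) = A"
  by (rule eq_matI) auto

lemma adj_one [simp]: "adj (1\<^sub>m d) = 1\<^sub>m d"
  unfolding adj_def by (rule eq_matI) auto

lemma unitariesD:
  assumes "U \<in> unitaries d"
  shows "U \<in> carrier_mat d d" "adj U * U = 1\<^sub>m d" "U * adj U = 1\<^sub>m d" "adj U \<in> unitaries d"
proof -
  show 1: "U \<in> carrier_mat d d" "adj U * U = 1\<^sub>m d" using assms unfolding unitaries_def by auto
  show "U * adj U = 1\<^sub>m d"
    by (rule mat_mult_left_right_inverse[OF adj_carrier[OF 1(1)] 1(1) 1(2)])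
  then show "adj U \<in> unitaries d" using 1 unfolding unitaries_def by auto
qed

lemma unitaries_mult: "U \<in> unitaries d \<Longrightarrow> V \<in> unitaries d \<Longrightarrow> U * V \<in> unitaries d"
proof -
  assume a: "U \<in> unitaries d" "V \<in> unitaries d"
  note u = unitariesD[OF a(1)] and v = unitariesD[OF a(2)]
  have "adj (U * V) * (U * V) = adj V * (adj U * U) * V"
    using u(1) v(1) by (simp add: adj_mult[OF u(1) v(1)] assoc_mult_mat[of _ d d _ d _ d] mult_carrier_mat[of _ d d _ d])
  also have "\<dots> = 1\<^sub>m d" using u v by simp
  finally show ?thesis using u v unfolding unitaries_def by auto
qed

lemma unitaries_one [simp]: "1\<^sub>m d \<in> unitaries d"
  unfolding unitaries_def by auto

lemma unitary_col_orthonormal: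
  assumes "U \<in> unitaries d" "a < d" "b < d"
  shows "(\<Sum>i<d. cnj (U $$ (i,a)) * U $$ (i,b)) = (if a = b then 1 else 0)"
proof -
  note u = unitariesD[OF assms(1)]
  have "(adj U * U) $$ (a,b) = (\<Sum>i<d. cnj (U $$ (i,a)) * U $$ (i,b))"
    using u(1) assms by (subst mat_mult_index[of _ d d _ d]) (auto intro!: sum.cong)
  then show ?thesis using u assms by simp
qed

lemma unitary_row_orthonormal:
  assumes "U \<in> unitaries d" "a < d" "b < d"
  shows "(\<Sum>i<d. U $$ (a,i) * cnj (U $$ (b,i))) = (if a = b then 1 else 0)"
proof -
  note u = unitariesD[OF assms(1)]
  have "(U * adj U) $$ (a,b) = (\<Sum>i<d. U $$ (a,i) * cnj (U $$ (b,i)))"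
    using u(1) assms by (subst mat_mult_index[of _ d d _ d]) (auto intro!: sum.cong)
  then show ?thesis using u assms by simp
qed

lemma unitaries_of_orthonormal:
  assumes "\<And>a b. a < d \<Longrightarrow> b < d \<Longrightarrow> ip d (q a) (q b) = (if a = b then 1 else 0)"
  shows "Matrix.mat d d (\<lambda>(i,j). q j i) \<in> unitaries d" (is "?U \<in> _")
proof -
  have "adj ?U * ?U = 1\<^sub>m d"
    by (rule eq_matI) (use assms in \<open>auto simp: scalar_prod_def ip_def lessThan_atLeast0\<close>)
  then show ?thesis unfolding unitaries_def by auto
qed

text \<open>The triangularising matrix \<open>P\<close> is merely invertible. Orthonormalising its
  columns gives a unitary \<open>U\<close> with the same flag of column spans; \<open>A\<close> maps
  this flag into itself, so \<open>adj U * A * U\<close> is still upper triangular, and a hermitian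
  triangular matrix is diagonal with real entries.\<close>

lemma hermitian_diagonalisable:
  assumes A: "A \<in> carrier_mat d d" and herm: "adj A = A"
  obtains U D where "U \<in> unitaries d" "D \<in> carrier_mat d d" "diagonal_mat D" "A = U * D * adj U"
    "\<And>i. i < d \<Longrightarrow> D $$ (i,i) \<in> \<real>"
proof -
  obtain es where "char_poly A = (\<Prod>e\<leftarrow>es. [:- e, 1:])"
    using char_poly_factorized[OF A] by auto
  then obtain B P Q where sim: "similar_mat_wit A B P Q" and ut: "upper_triangular B"
    using schur_decomposition[OF A] by (metis prod_cases3)
  note wit = similar_mat_witD2[OF A sim]
  have P: "P \<in> carrier_mat d d" and Q: "Q \<in> carrier_mat d d" and B: "B \<in> carrier_mat d d"
    and QP: "Q * P = 1\<^sub>m d" using wit by auto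
  have AP: "A * P = P * B"
  proof -
    have "A * P = P * B * (Q * P)"
      using wit(3) P Q B by (simp add: assoc_mult_mat[of _ d d _ d _ d] mult_carrier_mat[of _ d d _ d])
    then show ?thesis using P B QP by simp
  qed
  define g where "g j i = P $$ (i,j)" for j i
  have nz: "nrm d (gs_res d g j) \<noteq> 0" if j: "j < d" for j
  proof
    assume "nrm d (gs_res d g j) = 0"
    then have z: "\<And>i. i < d \<Longrightarrow> gs_res d g j i = 0" by (simp add: nrm_eq_0)
    obtain c where c: "c j = 1" "\<And>i. gs_res d g j i = (\<Sum>m\<le>j. c m * g m i)"
      using gs_res_lincomb by blast
    \<comment> \<open>Row \<open>j\<close> of \<open>Q\<close>, the inverse of \<open>P\<close>,
      reads off the coefficient of the column \<open>g j\<close>, which is 1 in the residual; a zero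
      residual would give 0 = 1.\<close>
    have "0 = (\<Sum>i<d. Q $$ (j,i) * (\<Sum>m\<le>j. c m * g m i))" using z c(2) by simp
    also have "\<dots> = (\<Sum>m\<le>j. c m * (\<Sum>i<d. Q $$ (j,i) * P $$ (i,m)))"
      by (simp add: sum_distrib_left mult.left_commute g_def sum.swap[of _ "{..j}"])
    also have "\<dots> = (\<Sum>m\<le>j. c m * (if j = m then 1 else 0))"
    proof (rule sum.cong)
      fix m assume "m \<in> {..j}"
      then have "(\<Sum>i<d. Q $$ (j,i) * P $$ (i,m)) = (Q * P) $$ (j,m)"
        using j by (subst mat_mult_index[OF Q P]) auto
      then show "c m * (\<Sum>i<d. Q $$ (j,i) * P $$ (i,m)) = c m * (if j = m then 1 else 0)"
        using QP j \<open>m \<in> {..j}\<close> by auto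
    qed simp
    also have "\<dots> = 1" using c(1) by (simp add: if_distrib cong: if_cong)
    finally show False by simp
  qed
  define q where "q = gs d g"
  have on: "ip d (q a) (q b) = (if a = b then 1 else 0)" if "a < d" "b < d" for a b
    unfolding q_def by (rule gs_orthonormal[where m=d]) (use that nz in auto)
  define U where "U = Matrix.mat d d (\<lambda>(i,j). q j i)"
  have U: "U \<in> unitaries d" unfolding U_def by (rule unitaries_of_orthonormal) (rule on)
  note u = unitariesD[OF U]
  define D where "D = adj U * A * U"
  have D: "D \<in> carrier_mat d d" unfolding D_def using u A by auto
  have AUD: "A = U * D * adj U"
  proof -
    have "U * D * adj U = (U * adj U) * A * (U * adj U)" unfolding D_def using u(1) A
      by (simp add: assoc_mult_mat[of _ d d _ d _ d] mult_carrier_mat[of _ d d _ d])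
    then show ?thesis using u A by simp
  qed
  have Dherm: "adj D = D"
    unfolding D_def using u(1) A herm
    by (simp add: adj_mult[of _ d d _ d] assoc_mult_mat[of _ d d _ d _ d] mult_carrier_mat[of _ d d _ d])
  \<comment> \<open>Gram--Schmidt preserves the flag spanned by the columns of \<open>P\<close>, which \<open>A\<close> respects.\<close>
  have gq: "\<exists>c. \<forall>i<d. g l i = (\<Sum>m\<le>l. c m * q m i)" if "l < d" for l
  proof -
    define c where "c m = (if m = l then complex_of_real (nrm d (gs_res d g l)) else ip d (q m) (g l))" for m
    have "g l i = gs_res d g l i + (\<Sum>m<l. ip d (q m) (g l) * q m i)" for i
      unfolding gs_res_def q_def by simp
    moreover have "gs_res d g l i = c l * q l i" for i
      using nz[OF that] unfolding q_def c_def by (subst gs_eq[of d g l]) simp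
    moreover have "(\<Sum>m<l. ip d (q m) (g l) * q m i) = (\<Sum>m<l. c m * q m i)" for i
      by (rule sum.cong) (auto simp: c_def)
    ultimately have "g l i = (\<Sum>m\<le>l. c m * q m i)" for i
      by (simp add: lessThan_Suc_atMost[symmetric])
    then show ?thesis by blast
  qed
  have ipg: "ip d (q a) (g l) = 0" if "l < a" "a < d" for a l
  proof -
    have "l < d" using that by linarith
    then obtain c where c: "\<And>i. i < d \<Longrightarrow> g l i = (\<Sum>m\<le>l. c m * q m i)" using gq by blast
    have "ip d (q a) (g l) = ip d (q a) (\<lambda>i. \<Sum>m\<le>l. c m * q m i)"
      unfolding ip_def using c by (intro sum.cong) auto
    also have "\<dots> = (\<Sum>m\<le>l. c m * ip d (q a) (q m))" by (rule ip_sum_right)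
    also have "\<dots> = 0" by (rule sum.neutral) (use that on in auto)
    finally show ?thesis .
  qed
  have Ag: "(\<Sum>i<d. A $$ (x,i) * g l i) = (\<Sum>m\<le>l. B $$ (m,l) * g m x)" if "x < d" "l < d" for x l
  proof -
    have "(\<Sum>i<d. A $$ (x,i) * g l i) = (A * P) $$ (x,l)"
      using that by (simp add: mat_mult_index[OF A P] g_def)
    also have "\<dots> = (\<Sum>m<d. P $$ (x,m) * B $$ (m,l))"
      unfolding AP using that by (simp add: mat_mult_index[OF P B])
    also have "\<dots> = (\<Sum>m\<le>l. P $$ (x,m) * B $$ (m,l))"
      by (rule sum.mono_neutral_right) (use that ut B in \<open>auto simp: upper_triangular_def\<close>)
    finally show ?thesis by (simp add: g_def mult.commute)
  qed
  have zero: "D $$ (a,b) = 0" if "b < a" "a < d" for a b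
  proof -
    have b: "b < d" using that by auto
    \<comment> \<open>\<open>q b\<close> lies in the span of the columns of \<open>P\<close> up to
      \<open>b\<close>, \<open>A\<close> keeps it there, and \<open>q a\<close> with
      \<open>a > b\<close> is orthogonal to that span.\<close>
    obtain c where c: "\<And>i. q b i = (\<Sum>l\<le>b. c l * g l i)" using gs_lincomb unfolding q_def by blast
    have "D $$ (a,b) = (adj U * (A * U)) $$ (a,b)" unfolding D_def using u A by (simp add: assoc_mult_mat[of _ d d _ d _ d] mult_carrier_mat[of _ d d _ d])
    also have "\<dots> = (\<Sum>x<d. cnj (q a x) * (A * U) $$ (x,b))"
      using that b u A by (subst mat_mult_index[of _ d d _ d]) (auto intro!: sum.cong simp: U_def)
    also have "\<dots> = (\<Sum>x<d. cnj (q a x) * (\<Sum>l\<le>b. c l * (\<Sum>m\<le>l. B $$ (m,l) * g m x)))"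
    proof (rule sum.cong)
      fix x assume "x \<in> {..<d}"
      then have x: "x < d" by auto
      have "(A * U) $$ (x,b) = (\<Sum>i<d. A $$ (x,i) * (\<Sum>l\<le>b. c l * g l i))"
        using x b u A by (subst mat_mult_index[of _ d d _ d]) (auto simp: U_def c intro!: sum.cong)
      also have "\<dots> = (\<Sum>l\<le>b. c l * (\<Sum>i<d. A $$ (x,i) * g l i))"
        by (simp add: sum_distrib_left mult.left_commute sum.swap[of _ "{..b}"])
      also have "\<dots> = (\<Sum>l\<le>b. c l * (\<Sum>m\<le>l. B $$ (m,l) * g m x))"
        by (rule sum.cong) (use Ag[OF x] b in auto)
      finally show "cnj (q a x) * (A * U) $$ (x,b) = cnj (q a x) * (\<Sum>l\<le>b. c l * (\<Sum>m\<le>l. B $$ (m,l) * g m x))"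
        by simp
    qed simp
    also have "\<dots> = ip d (q a) (\<lambda>x. \<Sum>l\<le>b. c l * (\<Sum>m\<le>l. B $$ (m,l) * g m x))"
      by (simp add: ip_def)
    also have "\<dots> = (\<Sum>l\<le>b. c l * (\<Sum>m\<le>l. B $$ (m,l) * ip d (q a) (g m)))"
      by (simp only: ip_sum_right)
    also have "\<dots> = 0" using ipg that by (intro sum.neutral) (auto intro!: sum.neutral)
    finally show ?thesis .
  qed
  have diag: "diagonal_mat D"
    unfolding diagonal_mat_def
  proof (intro allI impI)
    fix i j assume ij: "i < dim_row D" "j < dim_col D" "i \<noteq> j"
    then have ij': "i < d" "j < d" using D by auto
    show "D $$ (i,j) = 0"
    proof (cases "j < i")
      case True then show ?thesis using zero ij' by auto
    next
      case False
      then have "D $$ (j,i) = 0" using zero ij ij' by auto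
      then have "adj D $$ (i,j) = 0" using D ij' by auto
      then show ?thesis unfolding Dherm .
    qed
  qed
  have "D $$ (i,i) \<in> \<real>" if "i < d" for i
  proof -
    have "adj D $$ (i,i) = cnj (D $$ (i,i))" using D that by auto
    then show ?thesis unfolding Dherm by (simp add: Reals_cnj_iff)
  qed
  then show thesis using that[OF U D diag AUD] by blast
qed

text \<open>\<open>trace_norm\<close> sums over distinct roots weighted by multiplicity; grouping
  the indices \<open>i\<close> by the value \<open>a i\<close> turns this into a sum over the
  diagonal entries of a triangular form.\<close>

lemma sum_order_prod_linear:
  fixes a :: "nat \<Rightarrow> complex" and f :: "complex \<Rightarrow> real" and d :: nat
  defines "p \<equiv> (\<Prod>i<d. [:- a i, 1:])"
  shows "(\<Sum>z\<in>{z. poly p z = 0}. real (Polynomial.order z p) * f z) = (\<Sum>i<d. f (a i))"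
proof -
  have nz: "(\<Prod>i<m. [:- a i, 1:]) \<noteq> 0" for m by simp
  have ord: "Polynomial.order z (\<Prod>i<m. [:- a i, 1:]) = card {i. i < m \<and> a i = z}" for z m
  proof (induction m)
    case 0
    then show ?case by (simp add: order_0I)
  next
    case (Suc m)
    have "Polynomial.order z [:- a m, 1:] = (if a m = z then 1 else 0)"
      using order_linear_power'[of z "a m" 1] by (auto simp: order_0I)
    moreover have "{i. i < Suc m \<and> a i = z} = (if a m = z then insert m {i. i < m \<and> a i = z} else {i. i < m \<and> a i = z})"
      by (auto simp: less_Suc_eq)
    ultimately show ?case using Suc nz[of "Suc m"]
      by (simp only: prod.lessThan_Suc, subst order_mult) (auto simp: nz)
  qed
  have roots: "{z. poly p z = 0} = a ` {..<d}" unfolding p_def by (auto simp: poly_prod)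
  have "(\<Sum>z\<in>{z. poly p z = 0}. real (Polynomial.order z p) * f z) = (\<Sum>z\<in>a ` {..<d}. \<Sum>i\<in>{i\<in>{..<d}. a i = z}. f (a i))"
    unfolding roots
    by (rule sum.cong) (auto simp: p_def ord)
  also have "\<dots> = (\<Sum>i<d. f (a i))"
    by (rule sum.group) auto
  finally show ?thesis .
qed

text \<open>With \<open>A = U * D * adj U\<close> and \<open>D\<close> real diagonal, the
  eigenvalues of \<open>adj A * A\<close> are the squares of the entries of \<open>D\<close>, so the
  trace norm is the sum of the moduli of the eigenvalues of \<open>A\<close>. These are written as
  quadratic forms in eigenvectors because outcome probabilities have that shape.\<close>

lemma trace_norm_hermitian_le:
  assumes A: "A \<in> carrier_mat d d" and herm: "adj A = A"
  obtains u :: "nat \<Rightarrow> nat \<Rightarrow> complex" where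
    "\<And>a b. a < d \<Longrightarrow> b < d \<Longrightarrow> ip d (u a) (u b) = (if a = b then 1 else 0)"
    "trace_norm A = (\<Sum>a<d. cmod (\<Sum>i<d. \<Sum>j<d. cnj (u a i) * A $$ (i,j) * u a j))"
proof -
  obtain U D where U: "U \<in> unitaries d" and D: "D \<in> carrier_mat d d" and diag: "diagonal_mat D"
    and AU: "A = U * D * adj U" and re: "\<And>i. i < d \<Longrightarrow> D $$ (i,i) \<in> \<real>"
    using hermitian_diagonalisable[OF A herm] by blast
  note un = unitariesD[OF U]
  define q where "q j i = U $$ (i,j)" for j i
  have on: "ip d (q a) (q b) = (if a = b then 1 else 0)" if "a < d" "b < d" for a b
    using unitary_col_orthonormal[OF U that] unfolding ip_def q_def .
  have AA: "adj A * A = U * (D * D) * adj U"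
  proof -
    have "adj A * A = U * (D * ((adj U * U) * (D * adj U)))" unfolding herm
      unfolding AU using un(1) D by (simp add: assoc_mult_mat[of _ d d _ d _ d] mult_carrier_mat[of _ d d _ d])
    then show ?thesis using un(1) un(2) D by (simp add: assoc_mult_mat[of _ d d _ d _ d] mult_carrier_mat[of _ d d _ d])
  qed
  have DD: "(D * D) $$ (i,j) = (if i = j then (D $$ (i,i))\<^sup>2 else 0)" if "i < d" "j < d" for i j
  proof -
    have "(D * D) $$ (i,j) = (\<Sum>l<d. if l = i then (if i = j then (D $$ (i,i))\<^sup>2 else 0) else 0)"
      unfolding mat_mult_index[OF D D that]
      by (rule sum.cong) (use diag D that in \<open>auto simp: diagonal_mat_def power2_eq_square\<close>)
    then show ?thesis using that by simp
  qed
  have "similar_mat (adj A * A) (D * D)"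
    unfolding similar_mat_def
    by (intro exI, rule similar_mat_witI[of U "adj U" d]) (use un D A AA in auto)
  then have "char_poly (adj A * A) = char_poly (D * D)" by (rule char_poly_similar)
  also have "\<dots> = (\<Prod>a\<leftarrow>diag_mat (D * D). [:- a, 1:])"
    by (rule char_poly_upper_triangular[of _ d]) (use D DD in auto)
  also have "\<dots> = (\<Prod>i<d. [:- (D $$ (i,i))\<^sup>2, 1:])"
  proof -
    have "diag_mat (D * D) = map (\<lambda>i. (D $$ (i,i))\<^sup>2) [0..<d]"
      unfolding diag_mat_def using D DD by auto
    moreover have "(\<Prod>a\<leftarrow>map f [0..<m]. g a) = (\<Prod>i<m. g (f i))" for f :: "nat \<Rightarrow> complex" and g :: "complex \<Rightarrow> complex poly" and m
      by (induction m) (auto simp: mult.commute)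
    ultimately show ?thesis by simp
  qed
  finally have cp: "char_poly (adj A * A) = (\<Prod>i<d. [:- (D $$ (i,i))\<^sup>2, 1:])" .
  have tn: "trace_norm A = (\<Sum>i<d. sqrt (Re ((D $$ (i,i))\<^sup>2)))"
    unfolding trace_norm_def Let_def cp
    using sum_order_prod_linear[where d=d and a="\<lambda>i. (D $$ (i,i))\<^sup>2" and f="\<lambda>z. sqrt (Re z)"] by simp
  have sq: "sqrt (Re ((D $$ (i,i))\<^sup>2)) = cmod (D $$ (i,i))" if "i < d" for i
    using re[OF that] by (auto elim!: Reals_cases simp flip: of_real_power)
  have qd: "(\<Sum>i<d. \<Sum>j<d. cnj (q a i) * A $$ (i,j) * q a j) = D $$ (a,a)" if a: "a < d" for a
  proof -
    have DU: "D = adj U * A * U"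
    proof -
      have "adj U * A * U = (adj U * U) * D * (adj U * U)" unfolding AU using un(1) D
        by (simp add: assoc_mult_mat[of _ d d _ d _ d] mult_carrier_mat[of _ d d _ d])
      then show ?thesis using un D by simp
    qed
    have "D $$ (a,a) = (\<Sum>j<d. (adj U * A) $$ (a,j) * U $$ (j,a))"
      using a un A by (subst DU, subst mat_mult_index[of _ d d _ d]) auto
    also have "\<dots> = (\<Sum>j<d. (\<Sum>i<d. cnj (q a i) * A $$ (i,j)) * q a j)"
      using a un A by (intro sum.cong refl, subst mat_mult_index[of _ d d _ d]) (auto simp: q_def intro!: sum.cong)
    also have "\<dots> = (\<Sum>i<d. \<Sum>j<d. cnj (q a i) * A $$ (i,j) * q a j)"
      unfolding sum_distrib_right by (rule sum.swap)
    finally show ?thesis by simp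
  qed
  have "trace_norm A = (\<Sum>a<d. cmod (\<Sum>i<d. \<Sum>j<d. cnj (q a i) * A $$ (i,j) * q a j))"
    unfolding tn by (intro sum.cong refl) (use sq qd in auto)
  then show thesis using that[OF on] by blast
qed

section \<open>Local operators and Pauli matrices\<close>

text \<open>Coordinates of a basis index: \<open>r\<close> on the qubits below the embedded
  operator, \<open>m\<close> on those it acts on, \<open>h\<close> above; used with
  \<open>A = 2^s\<close> and \<open>B = 2^w\<close>.\<close>

lemma embed_pos_lemma:
  fixes A B h m r :: nat
  assumes "m < B" "r < A"
  shows "((h * B + m) * A + r) div A = h * B + m" "((h * B + m) * A + r) mod A = r"
    "((h * B + m) * A + r) div (A * B) = h" "(((h * B + m) * A + r) div A) mod B = m"
proof -
  show 1: "((h * B + m) * A + r) div A = h * B + m" using assms by simp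
  show "((h * B + m) * A + r) mod A = r" using assms by simp
  show "((h * B + m) * A + r) div (A * B) = h" unfolding div_mult2_eq 1 using assms by simp
  show "(((h * B + m) * A + r) div A) mod B = m" unfolding 1 using assms by simp
qed

lemma embed_pos_decomp: "((l div (A * B)) * B + (l div A) mod B) * A + l mod A = (l::nat)"
  by (simp add: div_mult2_eq)

lemma embed_pos_lt:
  fixes i :: nat
  assumes "i < 2^N" "s + w \<le> N" "m < 2^w" "r < 2^s"
  shows "((i div 2^(s+w)) * 2^w + m) * 2^s + r < 2^N"
proof -
  have "(2::nat)^N = 2^(N-(s+w)) * 2^(s+w)" using assms(2) by (simp flip: power_add)
  then have "i div 2^(s+w) < 2^(N-(s+w))" using assms(1) by (simp add: div_less_iff_less_mult)
  then have "(i div 2^(s+w) + 1) * 2^w \<le> 2^(N-(s+w)) * 2^w" by (intro mult_right_mono) auto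
  then have "(i div 2^(s+w)) * 2^w + m + 1 \<le> 2^(N-(s+w)) * 2^w" using assms(3) by (simp add: algebra_simps)
  then have "((i div 2^(s+w)) * 2^w + m + 1) * 2^s \<le> 2^(N-(s+w)) * 2^w * 2^s" by (intro mult_right_mono) auto
  also have "2^(N-(s+w)) * 2^w * 2^s = (2::nat)^N" using assms(2) by (simp flip: power_add)
  finally show ?thesis using assms(4) by (simp add: algebra_simps)
qed

text \<open>Row \<open>i\<close> of an embedded operator is supported on the columns that agree with
  \<open>i\<close> outside the acted qubits; the local index \<open>m\<close> parametrises them
  bijectively.\<close>

lemma embed_sum:
  fixes F :: "nat \<Rightarrow> complex"
  assumes "i < 2^N" "s + w \<le> N"
  shows "(\<Sum>l<2^N. if l div 2^(s+w) = i div 2^(s+w) \<and> l mod 2^s = i mod 2^s then F ((l div 2^s) mod 2^w) else 0) = (\<Sum>m<2^w. F m)"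
proof -
  let ?e = "\<lambda>m. ((i div 2^(s+w)) * 2^w + m) * 2^s + i mod 2^s"
  have "(\<Sum>m<2^w. F m) = (\<Sum>l\<in>{l\<in>{..<2^N}. l div 2^(s+w) = i div 2^(s+w) \<and> l mod 2^s = i mod 2^s}. F ((l div 2^s) mod 2^w))"
  proof (rule sum.reindex_bij_witness[of _ "\<lambda>l. (l div 2^s) mod 2^w" ?e])
    fix m :: nat assume "m \<in> {..<2^w}"
    then have m: "m < 2^w" by simp
    note l = embed_pos_lemma[of m "2^w" "i mod 2^s" "2^s" "i div 2^(s+w)", OF m]
    show "(?e m div 2^s) mod 2^w = m" by (rule l(4)) simp
    show "?e m \<in> {l \<in> {..<2^N}. l div 2^(s+w) = i div 2^(s+w) \<and> l mod 2^s = i mod 2^s}"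
      using embed_pos_lt[OF assms m, of "i mod 2^s"] l by (simp add: power_add)
    show "F ((?e m div 2^s) mod 2^w) = F m" using l(4) by simp
  next
    fix l :: nat assume l: "l \<in> {l \<in> {..<2^N}. l div 2^(s+w) = i div 2^(s+w) \<and> l mod 2^s = i mod 2^s}"
    show "(l div 2^s) mod 2^w \<in> {..<2^w}" by simp
    show "?e ((l div 2^s) mod 2^w) = l"
      using embed_pos_decomp[of l "2^s" "2^w"] l by (simp add: power_add)
  qed
  also have "\<dots> = (\<Sum>l<2^N. if l div 2^(s+w) = i div 2^(s+w) \<and> l mod 2^s = i mod 2^s then F ((l div 2^s) mod 2^w) else 0)"
    by (rule sum.inter_filter) simp
  finally show ?thesis by (rule sym)
qed

lemma embed_carrier [simp]: "embed N s w U \<in> carrier_mat (2^N) (2^N)"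
  unfolding embed_def by simp

lemma embed_mult_left:
  assumes "s + w \<le> N" "i < 2^N" "j < c" "R \<in> carrier_mat (2^N) c"
  shows "(embed N s w U * R) $$ (i,j) = (\<Sum>m<2^w. U $$ ((i div 2^s) mod 2^w, m) * R $$ (((i div 2^(s+w)) * 2^w + m) * 2^s + i mod 2^s, j))"
proof -
  let ?e = "\<lambda>m. ((i div 2^(s+w)) * 2^w + m) * 2^s + i mod 2^s"
  have "(embed N s w U * R) $$ (i,j) = (\<Sum>l<2^N. embed N s w U $$ (i,l) * R $$ (l,j))"
    using assms by (subst mat_mult_index[of _ "2^N" "2^N" _ c]) auto
  also have "\<dots> = (\<Sum>l<2^N. if l div 2^(s+w) = i div 2^(s+w) \<and> l mod 2^s = i mod 2^s then
      U $$ ((i div 2^s) mod 2^w, (l div 2^s) mod 2^w) * R $$ (?e ((l div 2^s) mod 2^w), j) else 0)"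
  proof (rule sum.cong[OF refl])
    fix l :: nat assume "l \<in> {..<2^N}"
    moreover have "?e ((l div 2^s) mod 2^w) = l" if "l div 2^(s+w) = i div 2^(s+w)" "l mod 2^s = i mod 2^s"
      using embed_pos_decomp[of l "2^s" "2^w"] that by (simp add: power_add)
    ultimately show "embed N s w U $$ (i,l) * R $$ (l,j) = (if l div 2^(s+w) = i div 2^(s+w) \<and> l mod 2^s = i mod 2^s then
      U $$ ((i div 2^s) mod 2^w, (l div 2^s) mod 2^w) * R $$ (?e ((l div 2^s) mod 2^w), j) else 0)"
      using assms(2) unfolding embed_def by auto
  qed
  also have "\<dots> = (\<Sum>m<2^w. U $$ ((i div 2^s) mod 2^w, m) * R $$ (?e m, j))"
    by (rule embed_sum[OF assms(2,1), of "\<lambda>m. U $$ ((i div 2^s) mod 2^w, m) * R $$ (?e m, j)"])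
  finally show ?thesis .
qed

lemma embed_mult:
  assumes "s + w \<le> N" "U \<in> carrier_mat (2^w) (2^w)" "V \<in> carrier_mat (2^w) (2^w)"
  shows "embed N s w U * embed N s w V = embed N s w (U * V)"
proof (rule eq_matI)
  fix i j assume "i < dim_row (embed N s w (U * V))" "j < dim_col (embed N s w (U * V))"
  then have ij: "i < 2^N" "j < 2^N" unfolding embed_def by auto
  let ?e = "\<lambda>m. ((i div 2^(s+w)) * 2^w + m) * 2^s + i mod 2^s"
  have V: "embed N s w V $$ (?e m, j) = (if i div 2^(s+w) = j div 2^(s+w) \<and> i mod 2^s = j mod 2^s then V $$ (m, (j div 2^s) mod 2^w) else 0)"
    if m: "m < 2^w" for m
    unfolding embed_def using embed_pos_lemma[of m "2^w" "i mod 2^s" "2^s" "i div 2^(s+w)", OF m] embed_pos_lt[OF ij(1) assms(1) m, of "i mod 2^s"] ij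
    by (simp add: power_add)
  have "(embed N s w U * embed N s w V) $$ (i,j) = (\<Sum>m<2^w. U $$ ((i div 2^s) mod 2^w, m) * embed N s w V $$ (?e m, j))"
    by (rule embed_mult_left[OF assms(1) ij embed_carrier])
  also have "\<dots> = (if i div 2^(s+w) = j div 2^(s+w) \<and> i mod 2^s = j mod 2^s then (\<Sum>m<2^w. U $$ ((i div 2^s) mod 2^w, m) * V $$ (m, (j div 2^s) mod 2^w)) else 0)"
  proof -
    have "(\<Sum>m<2^w. U $$ ((i div 2^s) mod 2^w, m) * embed N s w V $$ (?e m, j)) = (\<Sum>m<2^w. U $$ ((i div 2^s) mod 2^w, m) *
        (if i div 2^(s+w) = j div 2^(s+w) \<and> i mod 2^s = j mod 2^s then V $$ (m, (j div 2^s) mod 2^w) else 0))"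
      by (rule sum.cong) (use V in auto)
    moreover have "(\<Sum>m<2^w. f m * (if P then g m else 0)) = (if P then \<Sum>m<2^w. f m * g m else 0)" for P and f g :: "nat \<Rightarrow> complex"
      by (cases P) simp_all
    ultimately show ?thesis by (simp only:)
  qed
  also have "\<dots> = embed N s w (U * V) $$ (i,j)"
    using ij by (simp add: embed_def mat_mult_index[OF assms(2,3)] del: index_mult_mat)
  finally show "(embed N s w U * embed N s w V) $$ (i,j) = embed N s w (U * V) $$ (i,j)" .
qed (auto simp: embed_def)

lemma embed_one:
  assumes "s + w \<le> N"
  shows "embed N s w (1\<^sub>m (2^w)) = 1\<^sub>m (2^N)"
proof (rule eq_matI)
  fix i j :: nat assume "i < dim_row (1\<^sub>m (2^N))" "j < dim_col (1\<^sub>m (2^N))"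
  then have ij: "i < 2^N" "j < 2^N" by auto
  have "i div 2^(s+w) = j div 2^(s+w) \<and> i mod 2^s = j mod 2^s \<and> (i div 2^s) mod 2^w = (j div 2^s) mod 2^w \<longleftrightarrow> i = j"
    using embed_pos_decomp[of i "2^s" "2^w"] embed_pos_decomp[of j "2^s" "2^w"] by (metis power_add)
  then show "embed N s w (1\<^sub>m (2^w)) $$ (i,j) = 1\<^sub>m (2^N) $$ (i,j)" using ij by (auto simp: embed_def)
qed (auto simp: embed_def)

lemma embed_adj:
  assumes "U \<in> carrier_mat (2^w) (2^w)"
  shows "adj (embed N s w U) = embed N s w (adj U)"
  by (rule eq_matI) (use assms in \<open>auto simp: embed_def\<close>)

lemma embed_unitary:
  assumes "s + w \<le> N" "U \<in> unitaries (2^w)"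
  shows "embed N s w U \<in> unitaries (2^N)"
  using unitariesD[OF assms(2)] embed_mult[OF assms(1), of "adj U" U] embed_one[OF assms(1)]
  unfolding unitaries_def by (simp add: embed_adj)

lemma perm_mat_carrier [simp]: "perm_mat d \<sigma> \<in> carrier_mat d d"
  unfolding perm_mat_def by simp

lemma perm_mat_unitary:
  assumes "inj_on \<sigma> {..<d}" "\<And>x. x < d \<Longrightarrow> \<sigma> x < d"
  shows "perm_mat d \<sigma> \<in> unitaries d"
proof -
  have "adj (perm_mat d \<sigma>) * perm_mat d \<sigma> = 1\<^sub>m d"
  proof (rule eq_matI)
    fix i j assume "i < dim_row (1\<^sub>m d)" "j < dim_col (1\<^sub>m d)"
    then have ij: "i < d" "j < d" by auto
    have "(adj (perm_mat d \<sigma>) * perm_mat d \<sigma>) $$ (i,j) = (\<Sum>l<d. if l = \<sigma> i then (if \<sigma> i = \<sigma> j then 1 else 0) else 0)"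
      unfolding mat_mult_index[OF adj_carrier[OF perm_mat_carrier] perm_mat_carrier ij]
      by (rule sum.cong) (use ij in \<open>auto simp: perm_mat_def\<close>)
    also have "\<dots> = 1\<^sub>m d $$ (i,j)" using ij assms by (simp add: inj_on_eq_iff[OF assms(1)])
    finally show "(adj (perm_mat d \<sigma>) * perm_mat d \<sigma>) $$ (i,j) = 1\<^sub>m d $$ (i,j)" .
  qed (auto simp: perm_mat_def)
  then show ?thesis unfolding unitaries_def by simp
qed

section \<open>Bits of basis indices and Pauli operators\<close>

lemma nat_bit_ge: "i < 2^N \<Longrightarrow> N \<le> q \<Longrightarrow> \<not> bit (i::nat) q"
  by (metis bit_take_bit_iff leD take_bit_nat_eq_self)

lemma nat_eq_bits: "i < 2^N \<Longrightarrow> j < 2^N \<Longrightarrow> i = j \<longleftrightarrow> (\<forall>q<N. bit i q = bit (j::nat) q)"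
  by (metis bit_eqI nat_bit_ge not_le)

lemma xor_lt: "i < 2^N \<Longrightarrow> j < 2^N \<Longrightarrow> Bit_Operations.xor i j < (2::nat)^N"
  by (metis take_bit_nat_eq_self_iff take_bit_xor)

lemma nat_of_bits: "\<exists>i<2^N. \<forall>q<N. bit (i::nat) q = f q"
proof (induction N)
  case (Suc N)
  then obtain i where i: "i < 2^N" "\<forall>q<N. bit (i::nat) q = f q" by blast
  show ?case
  proof (cases "f N")
    case True
    have "bit (take_bit (Suc N) (set_bit N i)) q = f q" if "q < Suc N" for q
      using i True that by (cases "q = N") (auto simp: bit_set_bit_iff bit_take_bit_iff)
    then show ?thesis using take_bit_nat_less_exp[of "Suc N" "set_bit N i"] by blast
  next
    case False
    have "bit i q = f q" if "q < Suc N" for q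
      using i False that nat_bit_ge[OF i(1), of N] by (cases "q = N") auto
    then show ?thesis using i(1) by (intro exI[of _ i]) simp
  qed
qed simp

text \<open>Translates the arithmetic condition of \<open>embed\<close> for a single qubit into
  bits, in which the gates and the Pauli operators are computed.\<close>

lemma off_bit_iff:
  fixes i j :: nat
  shows "i div 2^(q+1) = j div 2^(q+1) \<and> i mod 2^q = j mod 2^q \<longleftrightarrow> (\<forall>p. p \<noteq> q \<longrightarrow> bit i p = bit j p)"
proof -
  have "i div 2^(q+1) = j div 2^(q+1) \<longleftrightarrow> (\<forall>p>q. bit i p = bit j p)"
  proof -
    have "i div 2^(q+1) = j div 2^(q+1) \<longleftrightarrow> drop_bit (q+1) i = drop_bit (q+1) j" by (simp add: drop_bit_eq_div)
    also have "\<dots> \<longleftrightarrow> (\<forall>n. bit i (q+1+n) = bit j (q+1+n))" by (simp add: bit_eq_iff bit_drop_bit_eq add_ac)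
    also have "\<dots> \<longleftrightarrow> (\<forall>p>q. bit i p = bit j p)"
      by (metis Suc_eq_plus1 less_add_Suc1 less_iff_Suc_add add.commute add_Suc_right add.left_commute)
    finally show ?thesis .
  qed
  moreover have "i mod 2^q = j mod 2^q \<longleftrightarrow> (\<forall>p<q. bit i p = bit j p)"
  proof -
    have "i mod 2^q = j mod 2^q \<longleftrightarrow> take_bit q i = take_bit q j" by (simp add: take_bit_eq_mod)
    also have "\<dots> \<longleftrightarrow> (\<forall>p<q. bit i p = bit j p)" by (auto simp: bit_eq_iff bit_take_bit_iff)
    finally show ?thesis .
  qed
  ultimately show ?thesis by (metis linorder_neqE_nat less_irrefl)
qed

lemma bit_val: "((i::nat) div 2^q) mod 2 = of_bool (bit i q)"
  by (simp add: bit_iff_odd odd_iff_mod_2_eq_one)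

text \<open>The sign (-1)^(f . g) with the inner product of bit strings taken modulo 2; as a
  function of \<open>g\<close> it is a character.\<close>

definition chi :: "nat \<Rightarrow> (nat \<Rightarrow> bool) \<Rightarrow> (nat \<Rightarrow> bool) \<Rightarrow> complex" where
  "chi N f g = (\<Prod>q<N. if f q \<and> g q then -1 else 1)"

text \<open>The Pauli operator with \<open>X\<close>-part \<open>f\<close> and \<open>Z\<close>-part \<open>g\<close>.\<close>
definition pmat :: "nat \<Rightarrow> (nat \<Rightarrow> bool) \<Rightarrow> (nat \<Rightarrow> bool) \<Rightarrow> complex mat" where
  "pmat N f g = Matrix.mat (2^N) (2^N) (\<lambda>(i,j). if \<forall>q<N. bit i q = (bit j q \<noteq> f q) then chi N g (bit j) else 0)"

lemma pmat_carrier [simp]: "pmat N f g \<in> carrier_mat (2^N) (2^N)"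
  unfolding pmat_def by simp

lemma pmat_dim [simp]: "dim_row (pmat N f g) = 2^N" "dim_col (pmat N f g) = 2^N"
  unfolding pmat_def by simp_all

text \<open>Translation of \<open>j\<close> by the bit string \<open>f\<close> modulo 2. It is
  specified through bits because \<open>f\<close> is an arbitrary predicate, of which only the
  values below \<open>N\<close> count.\<close>

definition flipb :: "nat \<Rightarrow> (nat \<Rightarrow> bool) \<Rightarrow> nat \<Rightarrow> nat" where
  "flipb N f j = (SOME i. i < 2^N \<and> (\<forall>q<N. bit i q = (bit j q \<noteq> f q)))"

lemma flipb: "flipb N f j < 2^N" "q < N \<Longrightarrow> bit (flipb N f j) q = (bit j q \<noteq> f q)"
proof -
  have "\<exists>i<2^N. \<forall>q<N. bit (i::nat) q = (bit j q \<noteq> f q)" by (rule nat_of_bits)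
  then have "flipb N f j < 2^N \<and> (\<forall>q<N. bit (flipb N f j) q = (bit j q \<noteq> f q))"
    unfolding flipb_def by (rule someI_ex)
  then show "flipb N f j < 2^N" "q < N \<Longrightarrow> bit (flipb N f j) q = (bit j q \<noteq> f q)" by auto
qed

lemma pmat_index:
  assumes "i < 2^N" "j < 2^N"
  shows "pmat N f g $$ (i,j) = (if i = flipb N f j then chi N g (bit j) else 0)"
  using assms nat_eq_bits[OF assms(1) flipb(1)[of N f j]] by (simp add: pmat_def flipb(2))

lemma flipb_flipb: "j < 2^N \<Longrightarrow> flipb N f (flipb N f j) = j"
  by (subst nat_eq_bits[of _ N]) (auto simp: flipb)

lemma flipb_eq_iff: "i < 2^N \<Longrightarrow> j < 2^N \<Longrightarrow> i = flipb N f j \<longleftrightarrow> j = flipb N f i"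
  using flipb_flipb by metis

lemma mult_pmat:
  assumes "G \<in> carrier_mat (2^N) (2^N)" "i < 2^N" "j < 2^N"
  shows "(G * pmat N f g) $$ (i,j) = G $$ (i, flipb N f j) * chi N g (bit j)"
proof -
  have "(G * pmat N f g) $$ (i,j) = (\<Sum>l<2^N. if l = flipb N f j then G $$ (i, flipb N f j) * chi N g (bit j) else 0)"
    unfolding mat_mult_index[OF assms(1) pmat_carrier assms(2,3)]
    by (rule sum.cong) (use assms in \<open>auto simp: pmat_index\<close>)
  then show ?thesis using flipb(1)[of N f j] by simp
qed

lemma pmat_mult:
  assumes "G \<in> carrier_mat (2^N) (2^N)" "i < 2^N" "j < 2^N"
  shows "(pmat N f g * G) $$ (i,j) = chi N g (bit (flipb N f i)) * G $$ (flipb N f i, j)"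
proof -
  have "(pmat N f g * G) $$ (i,j) = (\<Sum>l<2^N. if l = flipb N f i then chi N g (bit (flipb N f i)) * G $$ (flipb N f i, j) else 0)"
    unfolding mat_mult_index[OF pmat_carrier assms(1) assms(2,3)]
    by (rule sum.cong) (use assms flipb_eq_iff[OF assms(2)] in \<open>auto simp: pmat_index\<close>)
  then show ?thesis using flipb(1)[of N f i] by simp
qed

text \<open>Conjugation is expressed by moving a Pauli operator from the right of \<open>G\<close>
  to its left, so no inverse of \<open>G\<close> appears; as a Pauli operator has one nonzero entry
  per row and column, both sides reduce to a single entry of \<open>G\<close>.\<close>

lemma intertwineI:
  assumes "G \<in> carrier_mat (2^N) (2^N)"
    and "\<And>i j. i < 2^N \<Longrightarrow> j < 2^N \<Longrightarrow> G $$ (i, flipb N f j) * chi N g (bit j) = s * (chi N g' (bit (flipb N f' i)) * G $$ (flipb N f' i, j))"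
  shows "G * pmat N f g = s \<cdot>\<^sub>m (pmat N f' g' * G)"
proof (rule eq_matI)
  fix i j assume "i < dim_row (s \<cdot>\<^sub>m (pmat N f' g' * G))" "j < dim_col (s \<cdot>\<^sub>m (pmat N f' g' * G))"
  then have ij: "i < 2^N" "j < 2^N" using assms(1) by auto
  have "(s \<cdot>\<^sub>m (pmat N f' g' * G)) $$ (i,j) = s * (pmat N f' g' * G) $$ (i,j)"
    using ij assms(1) by (subst index_smult_mat(1)) auto
  then show "(G * pmat N f g) $$ (i,j) = (s \<cdot>\<^sub>m (pmat N f' g' * G)) $$ (i,j)"
    using assms(2)[OF ij] by (simp only: mult_pmat[OF assms(1) ij] pmat_mult[OF assms(1) ij])
qed (use assms(1) in auto)

lemma chi_split:
  assumes "q < N"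
  shows "chi N f g = (\<Prod>p\<in>{..<N}-{q}. if f p \<and> g p then -1 else 1) * (if f q \<and> g q then -1 else 1)"
  unfolding chi_def using assms by (subst prod.remove[of _ q]) (auto simp: mult.commute)

lemma off_cong: "(\<And>p. p < N \<Longrightarrow> p \<noteq> q \<Longrightarrow> (f p \<and> g p) = (f' p \<and> g' p)) \<Longrightarrow>
   (\<Prod>p\<in>{..<N}-{q}. if f p \<and> g p then -1 else 1 :: complex) = (\<Prod>p\<in>{..<N}-{q}. if f' p \<and> g' p then -1 else 1)"
  by (rule prod.cong) auto

section \<open>Action of the Clifford generators on Pauli operators\<close>

lemma hadamard_embed_index:
  assumes "q < N" "i < 2^N" "j < 2^N"
  shows "embed N q 1 hadamard $$ (i,j) = (if \<forall>p<N. p \<noteq> q \<longrightarrow> bit i p = bit j p then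
     (if bit i q \<and> bit j q then -1 else 1) / complex_of_real (sqrt 2) else 0)"
proof -
  have "(\<forall>p. p \<noteq> q \<longrightarrow> bit i p = bit j p) \<longleftrightarrow> (\<forall>p<N. p \<noteq> q \<longrightarrow> bit i p = bit j p)"
    using nat_bit_ge[OF assms(2)] nat_bit_ge[OF assms(3)] by (meson not_le)
  then have "i div 2^(q+1) = j div 2^(q+1) \<and> i mod 2^q = j mod 2^q \<longleftrightarrow> (\<forall>p<N. p \<noteq> q \<longrightarrow> bit i p = bit j p)"
    using off_bit_iff[of i q j] by blast
  moreover have "hadamard $$ ((i div 2^q) mod 2^1, (j div 2^q) mod 2^1) = (if bit i q \<and> bit j q then -1 else 1) / complex_of_real (sqrt 2)"
    by (auto simp: hadamard_def bit_val)
  ultimately show ?thesis unfolding embed_def using assms(2,3) by (simp only: index_mat prod.case)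
qed

lemma phase_embed_index:
  assumes "q < N" "i < 2^N" "j < 2^N"
  shows "embed N q 1 phase_gate $$ (i,j) = (if i = j then (if bit j q then \<i> else 1) else 0)"
proof -
  have "(\<forall>p. p \<noteq> q \<longrightarrow> bit i p = bit j p) \<and> bit i q = bit j q \<longleftrightarrow> i = j"
    by (metis bit_eqI)
  moreover have "phase_gate $$ ((i div 2^q) mod 2^1, (j div 2^q) mod 2^1) = (if bit i q = bit j q then (if bit j q then \<i> else 1) else 0)"
    by (auto simp: phase_gate_def bit_val)
  ultimately show ?thesis unfolding embed_def using assms(2,3) off_bit_iff[of i q j]
    by (simp only: index_mat prod.case) auto
qed

text \<open>The Hadamard gate exchanges X and Z on qubit \<open>q\<close>. In \<open>pmat\<close>
  the Z-part acts first, so when both are present XZ becomes ZX = -XZ, which is the sign.\<close>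

lemma hadamard_intertwine:
  assumes q: "q < N"
  shows "embed N q 1 hadamard * pmat N f g = (if f q \<and> g q then -1 else 1) \<cdot>\<^sub>m (pmat N (f(q := g q)) (g(q := f q)) * embed N q 1 hadamard)"
proof (rule intertwineI[OF embed_carrier])
  fix i j :: nat assume ij: "i < 2^N" "j < 2^N"
  let ?f = "f(q := g q)" and ?g = "g(q := f q)"
  have agree: "(\<forall>p<N. p \<noteq> q \<longrightarrow> bit i p = bit (flipb N f j) p) \<longleftrightarrow> (\<forall>p<N. p \<noteq> q \<longrightarrow> bit (flipb N ?f i) p = bit j p)"
    by (auto simp: flipb)
  show "embed N q 1 hadamard $$ (i, flipb N f j) * chi N g (bit j) =
    (if f q \<and> g q then -1 else 1) * (chi N ?g (bit (flipb N ?f i)) * embed N q 1 hadamard $$ (flipb N ?f i, j))"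
  proof (cases "\<forall>p<N. p \<noteq> q \<longrightarrow> bit i p = bit (flipb N f j) p")
    case True
    have "(\<Prod>p\<in>{..<N}-{q}. if ?g p \<and> bit (flipb N ?f i) p then -1 else 1 :: complex) = (\<Prod>p\<in>{..<N}-{q}. if g p \<and> bit j p then -1 else 1)"
      by (rule off_cong) (use True agree in auto)
    then show ?thesis
      unfolding hadamard_embed_index[OF q ij(1) flipb(1)] hadamard_embed_index[OF q flipb(1) ij(2)] agree[symmetric] chi_split[OF q]
      using True by (simp only: if_True flipb(2)[OF q])
        (cases "f q"; cases "g q"; cases "bit i q"; cases "bit j q"; simp)
  next
    case False
    then show ?thesis unfolding hadamard_embed_index[OF q ij(1) flipb(1)] hadamard_embed_index[OF q flipb(1) ij(2)] agree[symmetric]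
      by (simp only: if_False mult_zero_left mult_zero_right)
  qed
qed

text \<open>The phase gate fixes Z and sends X to Y = \<i> XZ, hence a factor \<i> exactly when an X
  is present, whether or not it comes with a Z.\<close>

lemma phase_intertwine:
  assumes q: "q < N"
  shows "embed N q 1 phase_gate * pmat N f g = (if f q then \<i> else 1) \<cdot>\<^sub>m (pmat N f (g(q := (g q \<noteq> f q))) * embed N q 1 phase_gate)"
proof (rule intertwineI[OF embed_carrier])
  fix i j :: nat assume ij: "i < 2^N" "j < 2^N"
  let ?g = "g(q := (g q \<noteq> f q))"
  show "embed N q 1 phase_gate $$ (i, flipb N f j) * chi N g (bit j) =
    (if f q then \<i> else 1) * (chi N ?g (bit (flipb N f i)) * embed N q 1 phase_gate $$ (flipb N f i, j))"
  proof (cases "i = flipb N f j")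
    case True
    have fi: "flipb N f i = j" using True flipb_flipb ij by simp
    define pr where "pr = (\<Prod>p\<in>{..<N}-{q}. if g p \<and> bit j p then -1 else 1 :: complex)"
    have "(\<Prod>p\<in>{..<N}-{q}. if ?g p \<and> bit j p then -1 else 1 :: complex) = pr"
      unfolding pr_def by (rule off_cong) auto
    then have c: "chi N ?g (bit j) = pr * (if (g q \<noteq> f q) \<and> bit j q then -1 else 1)"
      "chi N g (bit j) = pr * (if g q \<and> bit j q then -1 else 1)"
      unfolding chi_split[OF q] pr_def by simp_all
    have b: "bit i q = (bit j q \<noteq> f q)" unfolding True by (rule flipb(2)[OF q])
    show ?thesis unfolding fi True[symmetric] phase_embed_index[OF q ij(1) ij(1)] phase_embed_index[OF q ij(2) ij(2)] c b
      by (cases "f q"; cases "g q"; cases "bit j q"; simp add: mult.left_commute[of \<i> pr])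
  next
    case False
    then have "flipb N f i \<noteq> j" using flipb_flipb ij by auto
    then show ?thesis using False unfolding phase_embed_index[OF q ij(1) flipb(1)] phase_embed_index[OF q flipb(1) ij(2)]
      by (simp only: if_False mult_zero_left mult_zero_right)
  qed
qed

definition cnot_perm :: "nat \<Rightarrow> nat \<Rightarrow> nat \<Rightarrow> nat" where
  "cnot_perm c t x = (if bit x c then Bit_Operations.xor x (2^t) else x)"

lemma cnot_eq: "cnot N c t = perm_mat (2^N) (cnot_perm c t)"
  unfolding cnot_def cnot_perm_def[abs_def] ..

lemma bit_cnot_perm: "bit (cnot_perm c t x) q = (if q = t then bit x t \<noteq> bit x c else bit x q)"
  unfolding cnot_perm_def by (auto simp: bit_xor_iff bit_exp_iff)

lemma cnot_perm_lt: "t < N \<Longrightarrow> x < 2^N \<Longrightarrow> cnot_perm c t x < 2^N"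
  unfolding cnot_perm_def by (auto intro!: xor_lt)

lemma cnot_perm_cnot_perm: "c \<noteq> t \<Longrightarrow> cnot_perm c t (cnot_perm c t x) = x"
  by (rule bit_eqI) (auto simp: bit_cnot_perm)

lemma chi_split2:
  assumes "c < N" "t < N" "c \<noteq> t"
  shows "chi N f g = (\<Prod>p\<in>{..<N}-{c,t}. if f p \<and> g p then -1 else 1) * ((if f c \<and> g c then -1 else 1) * (if f t \<and> g t then -1 else 1))"
proof -
  have "{..<N} - {c} - {t} = {..<N} - {c,t}" by auto
  then show ?thesis unfolding chi_def using assms
    by (subst prod.remove[of _ c], simp, simp, subst prod.remove[of _ t]) (auto simp: mult_ac)
qed

text \<open>X spreads from control to target and Z from target to control; with the ordering chosen
  in \<open>pmat\<close> no sign arises.\<close>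

lemma cnot_intertwine:
  assumes ct: "c < N" "t < N" "c \<noteq> t"
  shows "cnot N c t * pmat N f g = 1 \<cdot>\<^sub>m (pmat N (f(t := (f t \<noteq> f c))) (g(c := (g c \<noteq> g t))) * cnot N c t)"
proof (rule intertwineI)
  let ?f = "f(t := (f t \<noteq> f c))" and ?g = "g(c := (g c \<noteq> g t))"
  show "cnot N c t \<in> carrier_mat (2^N) (2^N)" by (simp add: cnot_eq)
  fix i j :: nat assume ij: "i < 2^N" "j < 2^N"
  have e: "i = cnot_perm c t (flipb N f j) \<longleftrightarrow> flipb N ?f i = cnot_perm c t j"
  proof -
    have "i = cnot_perm c t (flipb N f j) \<longleftrightarrow> (\<forall>q<N. bit i q = bit (cnot_perm c t (flipb N f j)) q)"
      by (rule nat_eq_bits[OF ij(1) cnot_perm_lt[OF ct(2) flipb(1)]])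
    also have "\<dots> \<longleftrightarrow> (\<forall>q<N. bit (flipb N ?f i) q = bit (cnot_perm c t j) q)"
      using ct by (intro all_cong) (auto simp: bit_cnot_perm flipb)
    also have "\<dots> \<longleftrightarrow> flipb N ?f i = cnot_perm c t j"
      by (rule nat_eq_bits[OF flipb(1) cnot_perm_lt[OF ct(2) ij(2)], symmetric])
    finally show ?thesis .
  qed
  have ch: "chi N ?g (bit (cnot_perm c t j)) = chi N g (bit j)"
  proof -
    have "(\<Prod>p\<in>{..<N}-{c,t}. if ?g p \<and> bit (cnot_perm c t j) p then -1 else 1 :: complex) = (\<Prod>p\<in>{..<N}-{c,t}. if g p \<and> bit j p then -1 else 1)"
      by (rule prod.cong) (auto simp: bit_cnot_perm)
    then show ?thesis unfolding chi_split2[OF ct] using ct(3) by (auto simp: bit_cnot_perm)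
  qed
  show "cnot N c t $$ (i, flipb N f j) * chi N g (bit j) = 1 * (chi N ?g (bit (flipb N ?f i)) * cnot N c t $$ (flipb N ?f i, j))"
    using ij flipb(1) e ch by (auto simp: cnot_eq perm_mat_def)
qed

lemma hadamard_unitary: "hadamard \<in> unitaries 2" and hadamard_square: "hadamard * hadamard = 1\<^sub>m 2"
proof -
  have s: "complex_of_real (sqrt 2) * complex_of_real (sqrt 2) = 2"
    by (metis of_real_mult of_real_numeral real_sqrt_mult_self abs_numeral)
  have c: "hadamard \<in> carrier_mat 2 2" unfolding hadamard_def by simp
  show 2: "hadamard * hadamard = 1\<^sub>m 2"
    by (rule eq_matI) (auto simp: hadamard_def scalar_prod_def less_2_cases_iff numeral_2_eq_2 s field_simps)
  have "adj hadamard = hadamard"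
    by (rule eq_matI) (auto simp: hadamard_def)
  then show "hadamard \<in> unitaries 2" using c 2 unfolding unitaries_def by simp
qed

lemma phase_unitary: "phase_gate \<in> unitaries 2"
  and phase_fourth: "(phase_gate * phase_gate) * (phase_gate * phase_gate) = 1\<^sub>m 2"
proof -
  have c: "phase_gate \<in> carrier_mat 2 2" unfolding phase_gate_def by simp
  have "adj phase_gate * phase_gate = 1\<^sub>m 2"
    by (rule eq_matI) (auto simp: phase_gate_def adj_def scalar_prod_def less_2_cases_iff numeral_2_eq_2)
  then show "phase_gate \<in> unitaries 2" using c unfolding unitaries_def by simp
  have "phase_gate * phase_gate = Matrix.mat 2 2 (\<lambda>(i,j). if i = j then (if i = 0 then 1 else -1) else 0)"
    by (rule eq_matI) (auto simp: phase_gate_def scalar_prod_def less_2_cases_iff numeral_2_eq_2)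
  then show "(phase_gate * phase_gate) * (phase_gate * phase_gate) = 1\<^sub>m 2"
    by (intro eq_matI) (auto simp: scalar_prod_def less_2_cases_iff numeral_2_eq_2)
qed

text \<open>These facts feed the finiteness of the group: unitarity, order dividing 4 (which
  controls determinants), and conjugation of Pauli operators into Pauli operators with a phase among
  four values.\<close>

lemma clifford_gen_props:
  assumes "G \<in> clifford_gens N"
  shows "G \<in> unitaries (2^N)" "(G * G) * (G * G) = 1\<^sub>m (2^N)"
    "\<exists>f' g' s. s \<in> {1,-1,\<i>,-\<i>} \<and> G * pmat N f g = s \<cdot>\<^sub>m (pmat N f' g' * G)"
proof -
  have "(G \<in> unitaries (2^N) \<and> (G * G) * (G * G) = 1\<^sub>m (2^N)) \<and> (\<exists>f' g' s. s \<in> {1,-1,\<i>,-\<i>} \<and> G * pmat N f g = s \<cdot>\<^sub>m (pmat N f' g' * G))"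
    using assms unfolding clifford_gens_def
  proof (elim UnE CollectE exE conjE)
    fix q assume G: "G = embed N q 1 hadamard" and q: "q < N"
    have qN: "q + 1 \<le> N" using q by simp
    have u: "hadamard \<in> unitaries (2^1)" using hadamard_unitary by simp
    have "G * G = embed N q 1 (hadamard * hadamard)" unfolding G by (rule embed_mult[OF qN]) (use unitariesD(1)[OF u] in auto)
    then have "G * G = 1\<^sub>m (2^N)" using embed_one[OF qN] hadamard_square by simp
    then show ?thesis unfolding G using embed_unitary[OF qN u] hadamard_intertwine[OF q, of f g] by (auto split: if_splits)
  next
    fix q assume G: "G = embed N q 1 phase_gate" and q: "q < N"
    have qN: "q + 1 \<le> N" using q by simp
    have u: "phase_gate \<in> unitaries (2^1)" using phase_unitary by simp
    note c = unitariesD(1)[OF u]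
    have "(G * G) * (G * G) = embed N q 1 ((phase_gate * phase_gate) * (phase_gate * phase_gate))"
      unfolding G using c by (simp add: embed_mult[OF qN c c] embed_mult[OF qN mult_carrier_mat[OF c c] mult_carrier_mat[OF c c]] del: One_nat_def power_one_right)
    then have "(G * G) * (G * G) = 1\<^sub>m (2^N)" using embed_one[OF qN] phase_fourth by simp
    then show ?thesis unfolding G using embed_unitary[OF qN u] phase_intertwine[OF q, of f g] by (auto split: if_splits)
  next
    fix c t assume G: "G = cnot N c t" and ct: "c < N" "t < N" "c \<noteq> t"
    have inj: "inj_on (cnot_perm c t) {..<2^N}" by (metis cnot_perm_cnot_perm[OF ct(3)] inj_onI)
    have u: "G \<in> unitaries (2^N)" unfolding G cnot_eq
      by (rule perm_mat_unitary[OF inj]) (use cnot_perm_lt ct in auto)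
    have "G * G = 1\<^sub>m (2^N)"
    proof (rule eq_matI)
      fix i j assume "i < dim_row (1\<^sub>m (2^N))" "j < dim_col (1\<^sub>m (2^N))"
      then have ij: "i < 2^N" "j < 2^N" by auto
      have "(G * G) $$ (i,j) = (\<Sum>l<2^N. if l = cnot_perm c t j then (if i = cnot_perm c t (cnot_perm c t j) then 1 else 0) else 0)"
        unfolding G cnot_eq mat_mult_index[OF perm_mat_carrier perm_mat_carrier ij]
        by (rule sum.cong) (use ij in \<open>auto simp: perm_mat_def\<close>)
      then show "(G * G) $$ (i,j) = 1\<^sub>m (2^N) $$ (i,j)"
        using ij cnot_perm_lt[OF ct(2) ij(2), of c] by (simp add: cnot_perm_cnot_perm[OF ct(3)])
    qed (use unitariesD(1)[OF u] in auto)
    then show ?thesis using u cnot_intertwine[OF ct, of f g] unfolding G by auto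
  qed
  then show "G \<in> unitaries (2^N)" "(G * G) * (G * G) = 1\<^sub>m (2^N)"
    "\<exists>f' g' s. s \<in> {1,-1,\<i>,-\<i>} \<and> G * pmat N f g = s \<cdot>\<^sub>m (pmat N f' g' * G)" by auto
qed

section \<open>Finiteness of the Clifford group\<close>

lemma clifford_unitary: "C \<in> clifford_group N \<Longrightarrow> C \<in> unitaries (2^N)"
  by (induction rule: clifford_group.induct) (auto intro: unitaries_mult clifford_gen_props(1))

lemma clifford_intertwine:
  assumes "C \<in> clifford_group N"
  shows "\<exists>f' g' s. s \<in> {1,-1,\<i>,-\<i>} \<and> C * pmat N f g = s \<cdot>\<^sub>m (pmat N f' g' * C)"
  using assms
proof (induction rule: clifford_group.induct)
  case id
  show ?case by (rule exI[of _ f], rule exI[of _ g], rule exI[of _ 1]) (auto intro!: eq_matI)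
next
  case (gen C G)
  obtain f' g' s where 1: "s \<in> {1,-1,\<i>,-\<i>}" "C * pmat N f g = s \<cdot>\<^sub>m (pmat N f' g' * C)" using gen by blast
  obtain f2 g2 s2 where 2: "s2 \<in> {1,-1,\<i>,-\<i>}" "G * pmat N f' g' = s2 \<cdot>\<^sub>m (pmat N f2 g2 * G)"
    using clifford_gen_props(3)[OF gen(2)] by blast
  have C: "C \<in> carrier_mat (2^N) (2^N)" using unitariesD(1)[OF clifford_unitary[OF gen(1)]] .
  have G: "G \<in> carrier_mat (2^N) (2^N)" using unitariesD(1)[OF clifford_gen_props(1)[OF gen(2)]] .
  have "G * C * pmat N f g = G * (s \<cdot>\<^sub>m (pmat N f' g' * C))"
    using assoc_mult_mat[OF G C pmat_carrier] 1 by simp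
  also have "\<dots> = s \<cdot>\<^sub>m (G * (pmat N f' g' * C))"
    by (rule mult_smult_distrib[OF G mult_carrier_mat[OF pmat_carrier C]])
  also have "G * (pmat N f' g' * C) = (s2 \<cdot>\<^sub>m (pmat N f2 g2 * G)) * C"
    unfolding 2(2)[symmetric] by (rule assoc_mult_mat[OF G pmat_carrier C, symmetric])
  also have "\<dots> = s2 \<cdot>\<^sub>m (pmat N f2 g2 * G * C)"
    by (rule mult_smult_assoc_mat[OF mult_carrier_mat[OF pmat_carrier G] C])
  also have "pmat N f2 g2 * G * C = pmat N f2 g2 * (G * C)" by (rule assoc_mult_mat[OF pmat_carrier G C])
  also have "s \<cdot>\<^sub>m (s2 \<cdot>\<^sub>m (pmat N f2 g2 * (G * C))) = (s * s2) \<cdot>\<^sub>m (pmat N f2 g2 * (G * C))"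
    by (rule eq_matI) auto
  finally have "G * C * pmat N f g = (s * s2) \<cdot>\<^sub>m (pmat N f2 g2 * (G * C))" .
  moreover have "s * s2 \<in> {1,-1,\<i>,-\<i>}" using 1(1) 2(1) by auto
  ultimately show ?case by blast
qed

text \<open>Pins down global phases: a scalar relating two group elements must be a root of unity of
  bounded order.\<close>

lemma clifford_det: "C \<in> clifford_group N \<Longrightarrow> Determinant.det C ^ 4 = 1"
proof (induction rule: clifford_group.induct)
  case (gen C G)
  have C: "C \<in> carrier_mat (2^N) (2^N)" using unitariesD(1)[OF clifford_unitary[OF gen(1)]] .
  have G: "G \<in> carrier_mat (2^N) (2^N)" using unitariesD(1)[OF clifford_gen_props(1)[OF gen(2)]] .
  have "Determinant.det ((G * G) * (G * G)) = 1" using clifford_gen_props(2)[OF gen(2)] by simp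
  then have "Determinant.det G ^ 4 = 1"
    using Determinant.det_mult[OF mult_carrier_mat[OF G G] mult_carrier_mat[OF G G]] Determinant.det_mult[OF G G]
    by (simp add: power4_eq_xxxx mult.assoc)
  then show ?case using gen.IH Determinant.det_mult[OF G C] by (simp add: power_mult_distrib)
qed simp

lemma flipb_none: "j < 2^N \<Longrightarrow> (\<And>q. q < N \<Longrightarrow> \<not> f q) \<Longrightarrow> flipb N f j = j"
  by (subst nat_eq_bits[of _ N]) (auto simp: flipb)

lemma chi_none: "(\<And>q. q < N \<Longrightarrow> \<not> (f q \<and> g q)) \<Longrightarrow> chi N f g = 1"
  unfolding chi_def by (intro prod.neutral) auto

text \<open>Commuting with a single Z on qubit \<open>q\<close> kills every entry whose indices
  differ in bit \<open>q\<close>; commuting with the X-string given by the bits of \<open>i\<close>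
  identifies the diagonal entry at \<open>i\<close> with the one at 0.\<close>

lemma pmat_commutant_scalar:
  assumes M: "M \<in> carrier_mat (2^N) (2^N)"
    and comm: "\<And>A B. A \<subseteq> {..<N} \<Longrightarrow> B \<subseteq> {..<N} \<Longrightarrow>
      M * pmat N (\<lambda>q. q \<in> A) (\<lambda>q. q \<in> B) = pmat N (\<lambda>q. q \<in> A) (\<lambda>q. q \<in> B) * M"
  shows "M = M $$ (0,0) \<cdot>\<^sub>m 1\<^sub>m (2^N)"
proof -
  have e: "M $$ (i, flipb N (\<lambda>q. q \<in> A) j) * chi N (\<lambda>q. q \<in> B) (bit j) =
     chi N (\<lambda>q. q \<in> B) (bit (flipb N (\<lambda>q. q \<in> A) i)) * M $$ (flipb N (\<lambda>q. q \<in> A) i, j)"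
    if "A \<subseteq> {..<N}" "B \<subseteq> {..<N}" "i < 2^N" "j < 2^N" for A B i j
    using comm[OF that(1,2)] mult_pmat[OF M that(3,4)] pmat_mult[OF M that(3,4)] by metis
  have off: "M $$ (i,j) = 0" if ij: "i < 2^N" "j < 2^N" "i \<noteq> j" for i j
  proof -
    obtain q where q: "q < N" "bit i q \<noteq> bit j q" using ij nat_eq_bits[OF ij(1,2)] by blast
    have ch: "chi N (\<lambda>p. p \<in> {q}) (bit x) = (if bit x q then -1 else 1)" for x :: nat
      unfolding chi_split[OF q(1)] by (simp add: prod.neutral)
    have "M $$ (i,j) * chi N (\<lambda>p. p \<in> {q}) (bit j) = chi N (\<lambda>p. p \<in> {q}) (bit i) * M $$ (i,j)"
      using e[of "{}" "{q}" i j] ij q by (simp add: flipb_none)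
    then show ?thesis unfolding ch using q(2) by (cases "bit i q") auto
  qed
  have diag: "M $$ (i,i) = M $$ (0,0)" if i: "i < 2^N" for i
  proof -
    define A where "A = {q. q < N \<and> bit i q}"
    have f0: "flipb N (\<lambda>q. q \<in> A) 0 = i"
      by (subst nat_eq_bits[OF flipb(1) i]) (auto simp: flipb A_def)
    have fi: "flipb N (\<lambda>q. q \<in> A) i = 0"
      by (subst nat_eq_bits[of _ N]) (auto simp: flipb A_def)
    have "A \<subseteq> {..<N}" unfolding A_def by auto
    then show ?thesis using e[of A "{}" i 0] i by (simp add: f0 fi chi_none)
  qed
  show ?thesis
  proof (rule eq_matI)
    fix i j assume "i < dim_row (M $$ (0,0) \<cdot>\<^sub>m 1\<^sub>m (2^N))" "j < dim_col (M $$ (0,0) \<cdot>\<^sub>m 1\<^sub>m (2^N))"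
    then have ij: "i < 2^N" "j < 2^N" by auto
    then show "M $$ (i,j) = (M $$ (0,0) \<cdot>\<^sub>m 1\<^sub>m (2^N)) $$ (i,j)"
      using off[OF ij] diag[OF ij(1)] by (cases "i = j") simp_all
  qed (use M in auto)
qed

lemma pmat_cong:
  assumes "\<And>q. q < N \<Longrightarrow> f q = f' q" "\<And>q. q < N \<Longrightarrow> g q = g' q"
  shows "pmat N f g = pmat N f' g'"
proof -
  have "chi N g h = chi N g' h" for h unfolding chi_def using assms by (intro prod.cong) auto
  then show ?thesis unfolding pmat_def using assms by (intro cong_mat) auto
qed

text \<open>Send a group element to its conjugation action on Pauli operators. The possible actions
  form a finite set, and two elements with the same action differ by an operator commuting with all
  Pauli operators, that is a scalar, which \<open>clifford_det\<close> forces to be a root of unity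
  of order dividing \<open>4 * 2^N\<close>.\<close>

lemma finite_clifford_group: "finite (clifford_group N)"
proof -
  let ?P = "\<lambda>A B. pmat N (\<lambda>q. q \<in> A) (\<lambda>q. q \<in> B)"
  let ?I = "Pow {..<N} \<times> Pow {..<N}"
  define FP where "FP = (\<lambda>(s,A,B). s \<cdot>\<^sub>m ?P A B) ` ({1,-1,\<i>,-\<i>} \<times> Pow {..<N} \<times> Pow {..<N})"
  define \<Theta> where "\<Theta> C = (\<lambda>(A,B)\<in>?I. C * ?P A B * adj C)" for C
  have finFP: "finite FP" unfolding FP_def by simp
  have inFP: "C * ?P A B * adj C \<in> FP" if C: "C \<in> clifford_group N" for C A B
  proof -
    note u = unitariesD[OF clifford_unitary[OF C]]
    obtain f' g' s where 1: "s \<in> {1,-1,\<i>,-\<i>}" "C * ?P A B = s \<cdot>\<^sub>m (pmat N f' g' * C)"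
      using clifford_intertwine[OF C] by blast
    have "C * ?P A B * adj C = s \<cdot>\<^sub>m (pmat N f' g' * C * adj C)"
      unfolding 1(2) by (rule mult_smult_assoc_mat[OF mult_carrier_mat[OF pmat_carrier u(1)] adj_carrier[OF u(1)]])
    also have "pmat N f' g' * C * adj C = pmat N f' g'"
      using assoc_mult_mat[OF pmat_carrier u(1) adj_carrier[OF u(1)]] u(3) right_mult_one_mat[OF pmat_carrier] by simp
    also have "pmat N f' g' = ?P {q. q < N \<and> f' q} {q. q < N \<and> g' q}"
      by (rule pmat_cong) auto
    finally show ?thesis using 1(1) unfolding FP_def
      by (intro image_eqI[of _ _ "(s, {q. q < N \<and> f' q}, {q. q < N \<and> g' q})"]) auto
  qed
  have "\<Theta> ` clifford_group N \<subseteq> PiE ?I (\<lambda>_. FP)"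
    unfolding \<Theta>_def by (auto intro!: inFP simp: PiE_iff split: if_splits)
  then have fin1: "finite (\<Theta> ` clifford_group N)"
    by (rule finite_subset) (use finFP in \<open>auto intro!: finite_PiE\<close>)
  have fib: "finite {C \<in> clifford_group N. \<Theta> C = \<Theta> D}" if D: "D \<in> clifford_group N" for D
  proof -
    note v = unitariesD[OF clifford_unitary[OF D]]
    have "\<exists>z. z ^ (4 * 2^N) = 1 \<and> C = z \<cdot>\<^sub>m D" if C: "C \<in> clifford_group N" and eq: "\<Theta> C = \<Theta> D" for C
    proof -
      note u = unitariesD[OF clifford_unitary[OF C]]
      define M where "M = adj D * C"
      have Mc: "M \<in> carrier_mat (2^N) (2^N)" unfolding M_def using u v by auto

      have "M * ?P A B = ?P A B * M" if AB: "A \<subseteq> {..<N}" "B \<subseteq> {..<N}" for A B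
      proof -
        have e: "C * ?P A B * adj C = D * ?P A B * adj D"
          using fun_cong[OF eq, of "(A,B)"] AB unfolding \<Theta>_def by simp
        have "M * ?P A B = adj D * ((C * ?P A B * adj C) * C)"
        proof -
          have "(C * ?P A B * adj C) * C = C * ?P A B * (adj C * C)"
            by (rule assoc_mult_mat) (use u in auto)
          also have "\<dots> = C * ?P A B" unfolding u(2) by (rule right_mult_one_mat) (use u in auto)
          finally show ?thesis unfolding M_def using assoc_mult_mat[OF adj_carrier[OF v(1)] u(1) pmat_carrier] by simp
        qed
        also have "\<dots> = adj D * (D * (?P A B * (adj D * C)))"
          unfolding e using u(1) v(1) by (simp add: assoc_mult_mat[of _ "2^N" "2^N" _ "2^N" _ "2^N"] mult_carrier_mat[of _ "2^N" "2^N" _ "2^N"])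
        also have "\<dots> = (adj D * D) * (?P A B * (adj D * C))"
          by (rule assoc_mult_mat[symmetric]) (use u v in auto)
        also have "\<dots> = ?P A B * M" unfolding v(2) M_def by (rule left_mult_one_mat) (use u v in auto)
        finally show ?thesis .
      qed
      then have Msc: "M = M $$ (0,0) \<cdot>\<^sub>m 1\<^sub>m (2^N)" by (rule pmat_commutant_scalar[OF Mc])
      have "C = (D * adj D) * C" unfolding v(3) using u(1) by simp
      also have "\<dots> = D * M" unfolding M_def by (rule assoc_mult_mat) (use u v in auto)
      also have "\<dots> = M $$ (0,0) \<cdot>\<^sub>m D"
        by (subst Msc, subst mult_smult_distrib[OF v(1) one_carrier_mat]) (use v(1) in simp)
      finally have CD: "C = M $$ (0,0) \<cdot>\<^sub>m D" .
      \<comment> \<open>A scalar factor enters the determinant with exponent \<open>2^N\<close>, and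
        the fourth powers of both determinants are 1.\<close>
      have "Determinant.det C = (M $$ (0,0)) ^ (2^N) * Determinant.det D" using v(1) by (subst CD) simp
      then have "(M $$ (0,0)) ^ (4 * 2^N) = 1"
        using clifford_det[OF C] clifford_det[OF D] by (simp add: power_mult_distrib power_mult[symmetric] mult.commute)
      then show ?thesis using CD by blast
    qed
    then have "{C \<in> clifford_group N. \<Theta> C = \<Theta> D} \<subseteq> (\<lambda>z. z \<cdot>\<^sub>m D) ` {z. z ^ (4 * 2^N) = 1}" by blast
    then show ?thesis by (rule finite_subset) (auto intro!: finite_imageI finite_roots_unity)
  qed
  have "clifford_group N = (\<Union>t\<in>\<Theta> ` clifford_group N. {C \<in> clifford_group N. \<Theta> C = t})" by auto
  moreover have "finite (\<Union>t\<in>\<Theta> ` clifford_group N. {C \<in> clifford_group N. \<Theta> C = t})"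
    by (rule finite_UN_I[OF fin1]) (use fib in auto)
  ultimately show ?thesis by simp
qed

text \<open>The inductive definition provides closure under left multiplication by generators, not
  under inverses; surjectivity comes from finiteness and injectivity.\<close>

lemma clifford_left_mult_bij:
  assumes G: "G \<in> clifford_gens N"
  shows "bij_betw (\<lambda>C. G * C) (clifford_group N) (clifford_group N)"
proof -
  note g = unitariesD[OF clifford_gen_props(1)[OF G]]
  have inj: "inj_on (\<lambda>C. G * C) (clifford_group N)"
  proof (rule inj_onI)
    fix C D assume C: "C \<in> clifford_group N" and D: "D \<in> clifford_group N" and e: "G * C = G * D"
    note c = unitariesD(1)[OF clifford_unitary[OF C]] and d = unitariesD(1)[OF clifford_unitary[OF D]]
    have "adj G * (G * C) = adj G * (G * D)" using e by simp
    then have "(adj G * G) * C = (adj G * G) * D"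
      using assoc_mult_mat[OF adj_carrier[OF g(1)] g(1) c] assoc_mult_mat[OF adj_carrier[OF g(1)] g(1) d] by simp
    then show "C = D" using g(2) c d by simp
  qed
  have "(\<lambda>C. G * C) ` clifford_group N \<subseteq> clifford_group N" using G by (auto intro: clifford_group.gen)
  then have "(\<lambda>C. G * C) ` clifford_group N = clifford_group N"
    using inj finite_clifford_group by (simp add: endo_inj_surj)
  then show ?thesis using inj unfolding bij_betw_def by blast
qed

section \<open>Two copies of an operator and Pauli expectation values\<close>

definition op2 :: "nat \<Rightarrow> complex mat \<Rightarrow> complex mat \<Rightarrow> (nat \<Rightarrow> nat \<Rightarrow> complex) \<Rightarrow> nat \<Rightarrow> nat \<Rightarrow> complex" where
  "op2 d A B h u u' = (\<Sum>v<d. \<Sum>v'<d. A $$ (u,v) * B $$ (u',v') * h v v')"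

definition ip2 :: "nat \<Rightarrow> (nat \<Rightarrow> nat \<Rightarrow> complex) \<Rightarrow> (nat \<Rightarrow> nat \<Rightarrow> complex) \<Rightarrow> complex" where
  "ip2 d h k = (\<Sum>u<d. \<Sum>u'<d. cnj (h u u') * k u u')"

lemma op2_cong: "(\<And>v v'. v < d \<Longrightarrow> v' < d \<Longrightarrow> h v v' = k v v') \<Longrightarrow> op2 d A B h u u' = op2 d A B k u u'"
  unfolding op2_def by (intro sum.cong refl) auto

lemma ip2_cong:
  assumes "\<And>v v'. v < d \<Longrightarrow> v' < d \<Longrightarrow> h v v' = h' v v'" "\<And>v v'. v < d \<Longrightarrow> v' < d \<Longrightarrow> k v v' = k' v v'"
  shows "ip2 d h k = ip2 d h' k'"
  unfolding ip2_def by (intro sum.cong refl) (use assms in auto)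

lemma sum4_swap:
  "(\<Sum>a\<in>A. \<Sum>b\<in>B. \<Sum>c\<in>C. \<Sum>e\<in>E. f a b c e) = (\<Sum>c\<in>C. \<Sum>e\<in>E. \<Sum>a\<in>A. \<Sum>b\<in>B. f a b c e)"
proof -
  have "(\<Sum>a\<in>A. \<Sum>b\<in>B. \<Sum>c\<in>C. \<Sum>e\<in>E. f a b c e) = (\<Sum>a\<in>A. \<Sum>c\<in>C. \<Sum>b\<in>B. \<Sum>e\<in>E. f a b c e)"
    by (intro sum.cong refl sum.swap)
  also have "\<dots> = (\<Sum>a\<in>A. \<Sum>c\<in>C. \<Sum>e\<in>E. \<Sum>b\<in>B. f a b c e)" by (intro sum.cong refl sum.swap)
  also have "\<dots> = (\<Sum>c\<in>C. \<Sum>a\<in>A. \<Sum>e\<in>E. \<Sum>b\<in>B. f a b c e)" by (rule sum.swap)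
  also have "\<dots> = (\<Sum>c\<in>C. \<Sum>e\<in>E. \<Sum>a\<in>A. \<Sum>b\<in>B. f a b c e)" by (intro sum.cong refl sum.swap)
  finally show ?thesis .
qed

lemma op2_comp:
  assumes A: "A \<in> carrier_mat d d" "B \<in> carrier_mat d d" "A' \<in> carrier_mat d d" "B' \<in> carrier_mat d d"
    and u: "u < d" "u' < d"
  shows "op2 d A B (op2 d A' B' h) u u' = op2 d (A * A') (B * B') h u u'"
proof -
  have "op2 d A B (op2 d A' B' h) u u' = (\<Sum>v<d. \<Sum>v'<d. \<Sum>w<d. \<Sum>w'<d. A $$ (u,v) * B $$ (u',v') * (A' $$ (v,w) * B' $$ (v',w') * h w w'))"
    unfolding op2_def by (simp add: sum_distrib_left)
  also have "\<dots> = (\<Sum>w<d. \<Sum>w'<d. \<Sum>v<d. \<Sum>v'<d. A $$ (u,v) * B $$ (u',v') * (A' $$ (v,w) * B' $$ (v',w') * h w w'))"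
    by (rule sum4_swap)
  also have "\<dots> = (\<Sum>w<d. \<Sum>w'<d. (A * A') $$ (u,w) * (B * B') $$ (u',w') * h w w')"
  proof (intro sum.cong refl)
    fix w w' assume "w \<in> {..<d}" "w' \<in> {..<d}"
    then have w: "w < d" "w' < d" by auto
    show "(\<Sum>v<d. \<Sum>v'<d. A $$ (u,v) * B $$ (u',v') * (A' $$ (v,w) * B' $$ (v',w') * h w w')) = (A * A') $$ (u,w) * (B * B') $$ (u',w') * h w w'"
      unfolding mat_mult_index[OF A(1,3) u(1) w(1)] mat_mult_index[OF A(2,4) u(2) w(2)] sum_product
      by (simp add: sum_distrib_right sum_distrib_left mult_ac)
  qed
  finally show ?thesis unfolding op2_def .
qed

lemma ip2_op2:
  assumes "A \<in> carrier_mat d d" "B \<in> carrier_mat d d"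
  shows "ip2 d h (op2 d A B k) = ip2 d (op2 d (adj A) (adj B) h) k"
proof -
  have "ip2 d h (op2 d A B k) = (\<Sum>u<d. \<Sum>u'<d. \<Sum>v<d. \<Sum>v'<d. cnj (h u u') * (A $$ (u,v) * B $$ (u',v') * k v v'))"
    unfolding ip2_def op2_def by (simp add: sum_distrib_left)
  also have "\<dots> = (\<Sum>v<d. \<Sum>v'<d. \<Sum>u<d. \<Sum>u'<d. cnj (h u u') * (A $$ (u,v) * B $$ (u',v') * k v v'))"
    by (rule sum4_swap)
  also have "\<dots> = ip2 d (op2 d (adj A) (adj B) h) k"
    unfolding ip2_def op2_def cnj_sum sum_distrib_right
    by (intro sum.cong refl) (use assms in \<open>auto simp: mult_ac\<close>)
  finally show ?thesis .
qed

lemma op2_one: "u < d \<Longrightarrow> u' < d \<Longrightarrow> op2 d (1\<^sub>m d) (1\<^sub>m d) h u u' = h u u'"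
proof -
  assume u: "u < d" "u' < d"
  have "op2 d (1\<^sub>m d) (1\<^sub>m d) h u u' = (\<Sum>v<d. if v = u then (\<Sum>v'<d. if v' = u' then h u u' else 0) else 0)"
    unfolding op2_def
  proof (rule sum.cong[OF refl])
    fix v assume "v \<in> {..<d}"
    then show "(\<Sum>v'<d. 1\<^sub>m d $$ (u,v) * 1\<^sub>m d $$ (u',v') * h v v') = (if v = u then (\<Sum>v'<d. if v' = u' then h u u' else 0) else 0)"
      using u by (cases "v = u") (auto intro!: sum.cong sum.neutral simp del: sum.delta sum.delta')
  qed
  then show ?thesis using u by simp
qed

lemma ip2_unitary:
  assumes "G \<in> unitaries d"
  shows "ip2 d (op2 d G G h) (op2 d G G k) = ip2 d h k"
proof -
  note g = unitariesD[OF assms]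
  have "ip2 d (op2 d G G h) (op2 d G G k) = ip2 d (op2 d (adj G) (adj G) (op2 d G G h)) k"
    by (rule ip2_op2[OF g(1) g(1)])
  also have "\<dots> = ip2 d h k"
  proof (rule ip2_cong)
    fix v v' assume v: "v < d" "v' < d"
    show "op2 d (adj G) (adj G) (op2 d G G h) v v' = h v v'"
      unfolding op2_comp[OF adj_carrier[OF g(1)] adj_carrier[OF g(1)] g(1) g(1) v] g(2) by (rule op2_one[OF v])
  qed simp
  finally show ?thesis .
qed

definition nr2 :: "nat \<Rightarrow> (nat \<Rightarrow> nat \<Rightarrow> complex) \<Rightarrow> real" where
  "nr2 d h = (\<Sum>u<d. \<Sum>u'<d. (cmod (h u u'))\<^sup>2)"

lemma ip2_self: "ip2 d h h = complex_of_real (nr2 d h)"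
  unfolding ip2_def nr2_def of_real_sum
  by (intro sum.cong refl) (simp add: complex_norm_square mult.commute del: of_real_power)

text \<open>The expectation of P tensor \<open>adj\<close> P in the two-copy vector
  \<open>h\<close>, where \<open>op2\<close> is the action of a tensor product on such vectors.
  Pairing P with its adjoint removes the dependence on the phase of P.\<close>

definition pauli_form :: "nat \<Rightarrow> (nat \<Rightarrow> bool) \<Rightarrow> (nat \<Rightarrow> bool) \<Rightarrow> (nat \<Rightarrow> nat \<Rightarrow> complex) \<Rightarrow> complex" where
  "pauli_form N f g h = ip2 (2^N) h (op2 (2^N) (pmat N f g) (adj (pmat N f g)) h)"

lemma pauli_form_eq:
  "pauli_form N f g h = (\<Sum>u<2^N. \<Sum>u'<2^N. cnj (h u u') * (chi N g (bit (flipb N f u)) * chi N g (bit u') * h (flipb N f u) (flipb N f u')))"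
proof -
  have "op2 (2^N) (pmat N f g) (adj (pmat N f g)) h u u' = chi N g (bit (flipb N f u)) * chi N g (bit u') * h (flipb N f u) (flipb N f u')"
    if u: "u < 2^N" "u' < 2^N" for u u'
  proof -
    have cr: "cnj (chi N g x) = chi N g x" for x unfolding chi_def by (simp add: if_distrib[of cnj] cong: if_cong)
    have p: "pmat N f g $$ (u,v) = (if v = flipb N f u then chi N g (bit (flipb N f u)) else 0)" if "v < 2^N" for v
      unfolding pmat_index[OF u(1) that] using flipb_eq_iff[OF u(1) that, of f] by auto
    have "op2 (2^N) (pmat N f g) (adj (pmat N f g)) h u u' = (\<Sum>v<2^N. if v = flipb N f u then
       (\<Sum>v'<2^N. if v' = flipb N f u' then chi N g (bit (flipb N f u)) * chi N g (bit u') * h (flipb N f u) (flipb N f u') else 0) else 0)"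
      unfolding op2_def
    proof (rule sum.cong[OF refl])
      fix v :: nat assume "v \<in> {..<2^N}"
      then have v: "v < 2^N" by simp
      have "(\<Sum>v'<2^N. pmat N f g $$ (u,v) * adj (pmat N f g) $$ (u',v') * h v v') =
        (\<Sum>v'<2^N. if v' = flipb N f u' then pmat N f g $$ (u,v) * chi N g (bit u') * h v (flipb N f u') else 0)"
        by (rule sum.cong[OF refl]) (use u in \<open>simp add: pmat_index cr\<close>)
      then show "(\<Sum>v'<2^N. pmat N f g $$ (u,v) * adj (pmat N f g) $$ (u',v') * h v v') = (if v = flipb N f u then
       (\<Sum>v'<2^N. if v' = flipb N f u' then chi N g (bit (flipb N f u)) * chi N g (bit u') * h (flipb N f u) (flipb N f u') else 0) else 0)"
        unfolding p[OF v] by (cases "v = flipb N f u") simp_all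
    qed
    then show ?thesis using flipb(1) by simp
  qed
  then show ?thesis unfolding pauli_form_def ip2_def by simp
qed

lemma pauli_form_cong:
  assumes "\<And>q. q < N \<Longrightarrow> f q = f' q" "\<And>q. q < N \<Longrightarrow> g q = g' q"
  shows "pauli_form N f g h = pauli_form N f' g' h"
  unfolding pauli_form_def using pmat_cong[OF assms] by simp

text \<open>The phase from one copy meets its conjugate from the other and they cancel, so a gate
  acts on these forms by permuting Pauli labels alone.\<close>

lemma pauli_form_conj:
  assumes G: "G \<in> unitaries (2^N)" and s: "cmod s = 1" and i: "G * pmat N f g = s \<cdot>\<^sub>m (pmat N f' g' * G)"
  shows "pauli_form N f' g' (op2 (2^N) G G h) = pauli_form N f g h"
proof -
  let ?d = "2^N :: nat"
  note c = unitariesD[OF G]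
  let ?P = "pmat N f g" and ?P' = "pmat N f' g'"
  have ss: "cnj s * s = 1" using s by (metis complex_norm_square mult.commute of_real_1 power_one)
  have 1: "?P' * G = cnj s \<cdot>\<^sub>m (G * ?P)"
    unfolding i by (rule eq_matI) (use ss c(1) in \<open>auto simp: mult.assoc[symmetric]\<close>)
  have 2: "adj ?P' * G = s \<cdot>\<^sub>m (G * adj ?P)"
  proof -
    have "adj (?P' * G) = adj (cnj s \<cdot>\<^sub>m (G * ?P))" using 1 by simp
    then have a: "adj G * adj ?P' = s \<cdot>\<^sub>m (adj ?P * adj G)"
    proof -
      have "adj (cnj s \<cdot>\<^sub>m (G * ?P)) = s \<cdot>\<^sub>m adj (G * ?P)"
        by (rule eq_matI) (use c(1) in auto)
      then show ?thesis using \<open>adj (?P' * G) = adj (cnj s \<cdot>\<^sub>m (G * ?P))\<close> adj_mult[OF pmat_carrier c(1)] adj_mult[OF c(1) pmat_carrier] by simp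
    qed
    have ac: "adj ?P \<in> carrier_mat ?d ?d" "adj ?P' \<in> carrier_mat ?d ?d" "adj G \<in> carrier_mat ?d ?d" using c(1) by auto
    have "adj ?P' * G = (G * adj G) * (adj ?P' * G)" unfolding c(3) using ac c(1) by simp
    also have "\<dots> = G * ((adj G * adj ?P') * G)"
      using ac c(1) by (simp add: assoc_mult_mat[of _ ?d ?d _ ?d _ ?d] mult_carrier_mat[of _ ?d ?d _ ?d])
    also have "(adj G * adj ?P') * G = s \<cdot>\<^sub>m (adj ?P * adj G * G)"
      unfolding a by (rule mult_smult_assoc_mat[OF mult_carrier_mat[OF ac(1,3)] c(1)])
    also have "adj ?P * adj G * G = adj ?P"
      using assoc_mult_mat[OF ac(1,3) c(1)] c(2) ac(1) by simp
    also have "G * (s \<cdot>\<^sub>m adj ?P) = s \<cdot>\<^sub>m (G * adj ?P)" by (rule mult_smult_distrib[OF c(1) ac(1)])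
    finally show ?thesis .
  qed
  have ac: "adj ?P \<in> carrier_mat ?d ?d" "adj ?P' \<in> carrier_mat ?d ?d" by auto
  have "op2 ?d ?P' (adj ?P') (op2 ?d G G h) v v' = op2 ?d G G (op2 ?d ?P (adj ?P) h) v v'" if v: "v < ?d" "v' < ?d" for v v'
  proof -
    have "op2 ?d ?P' (adj ?P') (op2 ?d G G h) v v' = op2 ?d (cnj s \<cdot>\<^sub>m (G * ?P)) (s \<cdot>\<^sub>m (G * adj ?P)) h v v'"
      unfolding op2_comp[OF pmat_carrier ac(2) c(1) c(1) v] 1 2 ..
    also have "\<dots> = op2 ?d (G * ?P) (G * adj ?P) h v v'"
    proof -
      have "(cnj s * a) * (s * b) * x = a * b * x" for a b x :: complex
      proof -
        have "(cnj s * a) * (s * b) * x = (cnj s * s) * (a * b * x)" by (simp only: mult_ac)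
        then show ?thesis unfolding ss by simp
      qed
      then show ?thesis unfolding op2_def using v c(1) by (intro sum.cong refl) (simp del: index_mult_mat(1))
    qed
    also have "\<dots> = op2 ?d G G (op2 ?d ?P (adj ?P) h) v v'"
      by (rule op2_comp[OF c(1) c(1) pmat_carrier ac(1) v, symmetric])
    finally show ?thesis .
  qed
  then have "pauli_form N f' g' (op2 ?d G G h) = ip2 ?d (op2 ?d G G h) (op2 ?d G G (op2 ?d ?P (adj ?P) h))"
    unfolding pauli_form_def by (intro ip2_cong) auto
  then show ?thesis unfolding ip2_unitary[OF G] pauli_form_def .
qed

section \<open>Domination by Gaussian matrices\<close>

text \<open>Tuples are extensional: equality means agreement on \<open>{..<k}\<close>, and composing
  with a permutation of \<open>{..<k}\<close> stays inside the set, since such permutations fix all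
  other indices.\<close>

definition tup :: "nat \<Rightarrow> 'a set \<Rightarrow> (nat \<Rightarrow> 'a) set" where
  "tup k S = (\<Pi>\<^sub>E j\<in>{..<k}. S)"

definition perms :: "nat \<Rightarrow> (nat \<Rightarrow> nat) set" where
  "perms k = {\<pi>. \<pi> permutes {..<k}}"

definition zipt :: "nat \<Rightarrow> (nat \<Rightarrow> 'a) \<Rightarrow> (nat \<Rightarrow> 'b) \<Rightarrow> nat \<Rightarrow> 'a \<times> 'b" where
  "zipt k a b = (\<lambda>j\<in>{..<k}. (a j, b j))"

lemma finite_tup [simp]: "finite S \<Longrightarrow> finite (tup k S)"
  unfolding tup_def by (rule finite_PiE) auto

lemma finite_perms [simp]: "finite (perms k)"
  unfolding perms_def by (rule finite_permutations) simp

lemma card_perms: "card (perms k) = fact k"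
  unfolding perms_def by (rule card_permutations) auto

lemma perms_comp: "\<pi> \<in> perms k \<Longrightarrow> \<kappa> \<in> perms k \<Longrightarrow> \<pi> \<circ> \<kappa> \<in> perms k"
  unfolding perms_def by (auto intro: permutes_compose)

lemma perms_lt: "\<pi> \<in> perms k \<Longrightarrow> \<pi> j < k \<longleftrightarrow> j < k"
  unfolding perms_def using permutes_in_image[of \<pi> "{..<k}" j] by auto

lemma perms_bij: "\<pi> \<in> perms k \<Longrightarrow> bij_betw \<pi> {..<k} {..<k}"
  unfolding perms_def by (auto intro: permutes_imp_bij)

lemma tup_app: "X \<in> tup k S \<Longrightarrow> j < k \<Longrightarrow> X j \<in> S"
  unfolding tup_def by auto

lemma tup_undef: "X \<in> tup k S \<Longrightarrow> \<not> j < k \<Longrightarrow> X j = undefined"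
  unfolding tup_def by (drule PiE_arb[of _ _ _ j]) simp_all

lemma tupI: "(\<And>j. j < k \<Longrightarrow> X j \<in> S) \<Longrightarrow> (\<And>j. \<not> j < k \<Longrightarrow> X j = undefined) \<Longrightarrow> X \<in> tup k S"
  unfolding tup_def by (rule PiE_I) simp_all

lemma tup_eqI: "X \<in> tup k S \<Longrightarrow> Y \<in> tup k T \<Longrightarrow> (\<And>j. j < k \<Longrightarrow> X j = Y j) \<Longrightarrow> X = Y"
  by (rule ext) (metis tup_undef)

lemma tup_comp: "X \<in> tup k S \<Longrightarrow> \<pi> \<in> perms k \<Longrightarrow> X \<circ> \<pi> \<in> tup k S"
  by (rule tupI) (metis comp_apply perms_lt tup_app, metis comp_apply perms_lt tup_undef)

lemma perms_inv: "\<pi> \<in> perms k \<Longrightarrow> inv_into UNIV \<pi> \<in> perms k"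
  unfolding perms_def by (auto intro: permutes_inv)

lemma perms_o_inv: "\<pi> \<in> perms k \<Longrightarrow> \<pi> \<circ> inv_into UNIV \<pi> = id" "\<pi> \<in> perms k \<Longrightarrow> inv_into UNIV \<pi> \<circ> \<pi> = id"
  unfolding perms_def using permutes_inv_o by auto

lemma sum_tup_comp:
  assumes "\<pi> \<in> perms k"
  shows "(\<Sum>X\<in>tup k S. f (X \<circ> \<pi>)) = (\<Sum>X\<in>tup k S. f X)"
  by (rule sum.reindex_bij_witness[of _ "\<lambda>X. X \<circ> inv_into UNIV \<pi>" "\<lambda>X. X \<circ> \<pi>"])
    (use assms in \<open>auto intro!: tup_comp perms_inv simp: comp_assoc perms_o_inv\<close>)

lemma sum_perms_comp:
  assumes "\<theta> \<in> perms k"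
  shows "(\<Sum>\<kappa>\<in>perms k. f (\<theta> \<circ> \<kappa>)) = (\<Sum>\<kappa>\<in>perms k. f \<kappa>)"
  by (rule sum.reindex_bij_witness[of _ "\<lambda>\<kappa>. inv_into UNIV \<theta> \<circ> \<kappa>" "\<lambda>\<kappa>. \<theta> \<circ> \<kappa>"])
    (use assms in \<open>auto intro!: perms_comp perms_inv simp: comp_assoc[symmetric] perms_o_inv\<close>)

lemma prod_perm_comp:
  assumes "\<pi> \<in> perms k"
  shows "(\<Prod>j<k. f (\<pi> j)) = (\<Prod>j<k. f j)"
  using prod.reindex_bij_betw[OF perms_bij[OF assms], of f] .

lemma zipt_comp: "\<pi> \<in> perms k \<Longrightarrow> zipt k a b \<circ> \<pi> = zipt k (a \<circ> \<pi>) (b \<circ> \<pi>)"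
  unfolding zipt_def by (rule ext) (auto simp: perms_lt)

lemma zipt_app: "j < k \<Longrightarrow> zipt k a b j = (a j, b j)"
  unfolding zipt_def by simp

lemma sum_tup_zipt:
  assumes "finite A" "finite B"
  shows "(\<Sum>Y\<in>tup k (A \<times> B). f Y) = (\<Sum>a\<in>tup k A. \<Sum>b\<in>tup k B. f (zipt k a b))"
proof -
  have "(\<Sum>Y\<in>tup k (A \<times> B). f Y) = (\<Sum>(a,b)\<in>tup k A \<times> tup k B. f (zipt k a b))"
  proof (rule sum.reindex_bij_witness[of _ "\<lambda>(a,b). zipt k a b" "\<lambda>Y. (\<lambda>j\<in>{..<k}. fst (Y j), \<lambda>j\<in>{..<k}. snd (Y j))"])
    fix Y assume Y: "Y \<in> tup k (A \<times> B)"
    then have m: "\<And>j. j < k \<Longrightarrow> Y j \<in> A \<times> B" by (rule tup_app)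
    then have m': "\<And>j. j < k \<Longrightarrow> fst (Y j) \<in> A" "\<And>j. j < k \<Longrightarrow> snd (Y j) \<in> B" by (metis mem_Times_iff)+
    show eq: "(case (\<lambda>j\<in>{..<k}. fst (Y j), \<lambda>j\<in>{..<k}. snd (Y j)) of (a,b) \<Rightarrow> zipt k a b) = Y"
      unfolding zipt_def by (rule ext) (auto simp: tup_undef[OF Y])
    show "(\<lambda>j\<in>{..<k}. fst (Y j), \<lambda>j\<in>{..<k}. snd (Y j)) \<in> tup k A \<times> tup k B"
      by (intro SigmaI tupI) (auto simp: m')
    show "(case (\<lambda>j\<in>{..<k}. fst (Y j), \<lambda>j\<in>{..<k}. snd (Y j)) of (a,b) \<Rightarrow> f (zipt k a b)) = f Y"
      using eq by (simp only: prod.case)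
  next
    fix ab assume "ab \<in> tup k A \<times> tup k B"
    then obtain a b where ab: "ab = (a,b)" "a \<in> tup k A" "b \<in> tup k B" by auto
    show "(\<lambda>j\<in>{..<k}. fst ((case ab of (a,b) \<Rightarrow> zipt k a b) j), \<lambda>j\<in>{..<k}. snd ((case ab of (a,b) \<Rightarrow> zipt k a b) j)) = ab"
      unfolding zipt_def ab(1) by (auto simp: fun_eq_iff tup_undef[OF ab(2)] tup_undef[OF ab(3)])
    show "(case ab of (a,b) \<Rightarrow> zipt k a b) \<in> tup k (A \<times> B)"
      unfolding zipt_def ab(1) prod.case by (rule tupI) (auto simp: tup_app[OF ab(2)] tup_app[OF ab(3)])
  qed
  then show ?thesis by (simp add: sum.cartesian_product)
qed

lemma prod_sum_tup:
  fixes f :: "nat \<Rightarrow> 'a \<Rightarrow> complex"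
  assumes "finite S"
  shows "(\<Prod>j<k. \<Sum>s\<in>S. f j s) = (\<Sum>X\<in>tup k S. \<Prod>j<k. f j (X j))"
  unfolding tup_def by (rule prod_sum_PiE) (use assms in auto)

text \<open>An entry of the \<open>k\<close>-th tensor power of \<open>T\<close>, from the input
  tuple \<open>X\<close> to the output tuple \<open>Y\<close>.\<close>

definition amp :: "nat \<Rightarrow> ('o \<Rightarrow> 'i \<Rightarrow> complex) \<Rightarrow> (nat \<Rightarrow> 'i) \<Rightarrow> (nat \<Rightarrow> 'o) \<Rightarrow> complex" where
  "amp k T X Y = (\<Prod>j<k. T (Y j) (X j))"

definition form :: "nat \<Rightarrow> 'i set \<Rightarrow> 'o set \<Rightarrow> ('o \<Rightarrow> 'i \<Rightarrow> complex) \<Rightarrow> ((nat \<Rightarrow> 'i) \<Rightarrow> (nat \<Rightarrow> 'o) \<Rightarrow> complex) \<Rightarrow> complex" where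
  "form k I O' T \<phi> = (\<Sum>X\<in>tup k I. \<Sum>Y\<in>tup k O'. amp k T X Y * \<phi> X Y)"

text \<open>\<open>amp\<close> is unchanged when \<open>X\<close> and \<open>Y\<close> are permuted
  jointly, so \<open>form\<close> sees \<open>\<phi>\<close> only through this symmetrisation. By
  Wick's rule, for independent standard complex Gaussian entries the expected squared modulus of
  \<open>form\<close> is \<open>1 / fact k\<close> times the sum of the squared moduli of
  \<open>symz k \<phi>\<close>; this is the origin of the factorial in
  \<open>dominated\<close>.\<close>

definition symz :: "nat \<Rightarrow> ((nat \<Rightarrow> 'i) \<Rightarrow> (nat \<Rightarrow> 'o) \<Rightarrow> complex) \<Rightarrow> (nat \<Rightarrow> 'i) \<Rightarrow> (nat \<Rightarrow> 'o) \<Rightarrow> complex" where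
  "symz k \<phi> X Y = (\<Sum>\<pi>\<in>perms k. \<phi> (X \<circ> \<pi>) (Y \<circ> \<pi>))"

definition good :: "nat \<Rightarrow> ('o \<Rightarrow> nat) set \<Rightarrow> (nat \<Rightarrow> 'o) \<Rightarrow> bool" where
  "good k Ds Y \<longleftrightarrow> (\<forall>d\<in>Ds. inj_on (\<lambda>j. d (Y j)) {..<k})"

text \<open>The expectation of the squared modulus of any degree-\<open>k\<close> polynomial is bounded below by \<open>\<alpha>\<close>
  times its value for a matrix of independent complex Gaussian entries, restricted to
  outputs all of whose digits \<open>Ds\<close> are pairwise distinct.\<close>
definition dominated :: "nat \<Rightarrow> 'i set \<Rightarrow> 'o set \<Rightarrow> ('o \<Rightarrow> nat) set \<Rightarrow> real \<Rightarrow> 'r pmf \<Rightarrow> ('r \<Rightarrow> 'o \<Rightarrow> 'i \<Rightarrow> complex) \<Rightarrow> bool" where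
  "dominated k I O' Ds \<alpha> p K \<longleftrightarrow> finite (set_pmf p) \<and> (\<forall>\<phi>.
     \<alpha> / fact k * (\<Sum>X\<in>tup k I. \<Sum>Y\<in>{Y\<in>tup k O'. good k Ds Y}. (cmod (symz k \<phi> X Y))\<^sup>2)
       \<le> measure_pmf.expectation p (\<lambda>r. (cmod (form k I O' (K r) \<phi>))\<^sup>2))"

lemma good_comp:
  assumes "\<pi> \<in> perms k"
  shows "good k Ds (Y \<circ> \<pi>) \<longleftrightarrow> good k Ds Y"
proof -
  have *: "good k Ds (Y \<circ> \<kappa>)" if "\<kappa> \<in> perms k" "good k Ds Y" for \<kappa> and Y :: "nat \<Rightarrow> 'a"
    unfolding good_def
  proof
    fix d assume "d \<in> Ds"
    then have inj: "inj_on (\<lambda>j. d (Y j)) {..<k}" using that unfolding good_def by blast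
    have b: "bij_betw \<kappa> {..<k} {..<k}" using perms_bij that by blast
    have "inj_on ((\<lambda>j. d (Y j)) \<circ> \<kappa>) {..<k}"
      using b inj by (intro comp_inj_on) (auto simp: bij_betw_def)
    then show "inj_on (\<lambda>j. d ((Y \<circ> \<kappa>) j)) {..<k}" by (simp add: o_def)
  qed
  show ?thesis
  proof
    assume "good k Ds (Y \<circ> \<pi>)"
    then have "good k Ds ((Y \<circ> \<pi>) \<circ> inv_into UNIV \<pi>)" using * perms_inv[OF assms] by blast
    then show "good k Ds Y" by (simp add: comp_assoc perms_o_inv[OF assms])
  qed (use * assms in blast)
qed

lemma good_cong: "(\<And>j. j < k \<Longrightarrow> Y j = Z j) \<Longrightarrow> good k Ds Y \<longleftrightarrow> good k Ds Z"
  unfolding good_def by (simp add: inj_on_def)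

lemma sum_good_comp:
  assumes "\<pi> \<in> perms k" "finite S"
  shows "(\<Sum>Y\<in>{Y\<in>tup k S. good k Ds Y}. f (Y \<circ> \<pi>)) = (\<Sum>Y\<in>{Y\<in>tup k S. good k Ds Y}. f Y)"
proof -
  have "(\<Sum>Y\<in>{Y\<in>tup k S. good k Ds Y}. f (Y \<circ> \<pi>)) = (\<Sum>Y\<in>tup k S. if good k Ds (Y \<circ> \<pi>) then f (Y \<circ> \<pi>) else 0)"
    using assms(2) by (simp add: sum.inter_filter good_comp[OF assms(1)])
  also have "\<dots> = (\<Sum>Y\<in>tup k S. if good k Ds Y then f Y else 0)" by (rule sum_tup_comp[OF assms(1)])
  finally show ?thesis using assms by (simp add: sum.inter_filter)
qed

lemma expectation_finite:
  fixes f :: "'r \<Rightarrow> real"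
  assumes "finite (set_pmf p)"
  shows "measure_pmf.expectation p f = (\<Sum>r\<in>set_pmf p. pmf p r * f r)"
  using integral_measure_pmf_real[OF assms, of p f] by (simp add: mult.commute)

lemma expectation_mono_finite:
  fixes f g :: "'r \<Rightarrow> real"
  assumes "finite (set_pmf p)" "\<And>r. r \<in> set_pmf p \<Longrightarrow> f r \<le> g r"
  shows "measure_pmf.expectation p f \<le> measure_pmf.expectation p g"
  unfolding expectation_finite[OF assms(1)] by (intro sum_mono mult_left_mono assms(2)) auto

lemma expectation_sum_finite:
  fixes f :: "'a \<Rightarrow> 'r \<Rightarrow> real"
  assumes "finite (set_pmf p)"
  shows "measure_pmf.expectation p (\<lambda>r. \<Sum>a\<in>A. f a r) = (\<Sum>a\<in>A. measure_pmf.expectation p (f a))"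
  unfolding expectation_finite[OF assms] by (simp add: sum_distrib_left) (rule sum.swap)

lemma expectation_pair_finite:
  fixes f :: "'r \<times> 's \<Rightarrow> real"
  assumes "finite (set_pmf p)" "finite (set_pmf q)"
  shows "measure_pmf.expectation (pair_pmf p q) f = measure_pmf.expectation q (\<lambda>s. measure_pmf.expectation p (\<lambda>r. f (r,s)))"
proof -
  have "measure_pmf.expectation (pair_pmf p q) f = (\<Sum>(r,s)\<in>set_pmf p \<times> set_pmf q. pmf p r * pmf q s * f (r,s))"
    using assms by (subst expectation_finite) (auto simp: pmf_pair intro!: sum.cong)
  also have "\<dots> = (\<Sum>s\<in>set_pmf q. \<Sum>r\<in>set_pmf p. pmf p r * pmf q s * f (r,s))"
    by (subst sum.cartesian_product[symmetric]) (rule sum.swap)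
  finally show ?thesis using assms by (simp add: expectation_finite sum_distrib_left mult_ac)
qed

lemma zipt_cong: "(\<And>j. j < k \<Longrightarrow> a j = a' j) \<Longrightarrow> (\<And>j. j < k \<Longrightarrow> b j = b' j) \<Longrightarrow> zipt k a b = zipt k a' b'"
  unfolding zipt_def by (auto simp: fun_eq_iff)

lemma sum_good_zipt:
  fixes A :: "'l set" and B :: "'b set" and f :: "(nat \<Rightarrow> 'l \<times> 'b) \<Rightarrow> real"
  assumes that: "finite A" "finite B"
  shows "(\<Sum>Y\<in>{Y\<in>tup k (A \<times> B). good k ((\<lambda>d. d \<circ> fst) ` DA \<union> (\<lambda>d. d \<circ> snd) ` DB) Y}. f Y)
    = (\<Sum>a\<in>{a\<in>tup k A. good k DA a}. \<Sum>b\<in>{b\<in>tup k B. good k DB b}. f (zipt k a b))"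
proof -
  have g: "good k ((\<lambda>d. d \<circ> fst) ` DA \<union> (\<lambda>d. d \<circ> snd) ` DB) (zipt k a b) \<longleftrightarrow> good k DA a \<and> good k DB b" for a b
  proof -
    have "inj_on (\<lambda>j. d (fst (zipt k a b j))) {..<k} = inj_on (\<lambda>j. d (a j)) {..<k}" for d :: "'l \<Rightarrow> nat"
      by (rule inj_on_cong) (simp add: zipt_app)
    moreover have "inj_on (\<lambda>j. d (snd (zipt k a b j))) {..<k} = inj_on (\<lambda>j. d (b j)) {..<k}" for d :: "'b \<Rightarrow> nat"
      by (rule inj_on_cong) (simp add: zipt_app)
    ultimately show ?thesis unfolding good_def by (simp add: ball_Un)
  qed
  have "(\<Sum>Y\<in>{Y\<in>tup k (A \<times> B). good k ((\<lambda>d. d \<circ> fst) ` DA \<union> (\<lambda>d. d \<circ> snd) ` DB) Y}. f Y)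
    = (\<Sum>a\<in>tup k A. \<Sum>b\<in>tup k B. if good k DA a then if good k DB b then f (zipt k a b) else 0 else 0)"
    using that by (simp add: sum.inter_filter sum_tup_zipt g) (intro sum.cong refl, auto)
  also have "\<dots> = (\<Sum>a\<in>tup k A. if good k DA a then (\<Sum>b\<in>tup k B. if good k DB b then f (zipt k a b) else 0) else 0)"
    by (intro sum.cong refl) auto
  finally show ?thesis using that by (simp add: sum.inter_filter)
qed

text \<open>Fix the randomness of the second operator: the composite is a form in \<open>K1\<close>
  with coefficients \<open>\<phi>1\<close>, and \<open>d1\<close> bounds it below by squared
  symmetrisations at outputs \<open>(l,m)\<close> with \<open>m\<close> injective. Each of these is
  itself a form in \<open>K2\<close> with coefficients \<open>\<phi>2\<close>, so \<open>d2\<close>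
  applies. Injectivity of \<open>m\<close> makes the symmetrisation of \<open>\<phi>2\<close> give
  back \<open>symz k \<phi>\<close> on rearrangements of \<open>m\<close>; summing over
  \<open>m\<close> yields the factor counting injective tuples.\<close>

theorem dominated_glue:
  fixes K1 :: "'r1 \<Rightarrow> 'l \<times> nat \<Rightarrow> 'i \<Rightarrow> complex" and K2 :: "'r2 \<Rightarrow> 'o \<Rightarrow> nat \<times> 'n \<Rightarrow> complex"
  assumes d1: "dominated k I (L \<times> M) ((\<lambda>d. d \<circ> fst) ` DL \<union> {snd}) \<alpha>1 p1 K1"
    and d2: "dominated k (M \<times> N) O' D2 \<alpha>2 p2 K2"
    and fin: "finite I" "finite L" "finite M" "finite N" "finite O'"
    and nn: "0 \<le> \<alpha>1" "0 \<le> \<alpha>2"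
  shows "dominated k (I \<times> N) (L \<times> O') ((\<lambda>d. d \<circ> fst) ` DL \<union> (\<lambda>d. d \<circ> snd) ` D2)
     (\<alpha>1 * \<alpha>2 * real (card {m \<in> tup k M. inj_on m {..<k}})) (pair_pmf p1 p2)
     (\<lambda>(r1,r2) (l,w) (i,n). \<Sum>m\<in>M. K1 r1 (l,m) i * K2 r2 w (m,n))" (is "dominated _ _ _ ?D _ _ ?K")
proof -
  have f1: "finite (set_pmf p1)" and f2: "finite (set_pmf p2)" using d1 d2 unfolding dominated_def by auto
  have bound: "\<alpha>1 * \<alpha>2 * real (card {m \<in> tup k M. inj_on m {..<k}}) / fact k *
      (\<Sum>X\<in>tup k (I \<times> N). \<Sum>Y\<in>{Y\<in>tup k (L \<times> O'). good k ?D Y}. (cmod (symz k \<phi> X Y))\<^sup>2)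
    \<le> measure_pmf.expectation (pair_pmf p1 p2) (\<lambda>r. (cmod (form k (I \<times> N) (L \<times> O') (?K r) \<phi>))\<^sup>2)" for \<phi>
  proof -
    \<comment> \<open>Everything behind the first operator: the second operator contracted with
      \<open>\<phi>\<close>, summed over its free inputs \<open>n\<close> and its outputs
      \<open>w\<close>.\<close>
    define \<phi>1 where "\<phi>1 r2 X Y = (\<Sum>n\<in>tup k N. \<Sum>w\<in>tup k O'. (\<Prod>j<k. K2 r2 (w j) (snd (Y j), n j)) *
        \<phi> (zipt k X n) (zipt k (\<lambda>j. fst (Y j)) w))" for r2 X Y
    \<comment> \<open>The input \<open>A\<close> of the second operator must carry a rearrangement
      of \<open>m\<close> in its first component; the permutations that symmetrise
      \<open>\<phi>1\<close> reappear as the sum over \<open>\<pi>\<close>.\<close>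
    define \<phi>2 where "\<phi>2 X l m A w = (\<Sum>\<pi>\<in>perms k. if (\<forall>j<k. fst (A j) = m (\<pi> j)) then
        \<phi> (zipt k (X \<circ> \<pi>) (\<lambda>j. snd (A j))) (zipt k (l \<circ> \<pi>) w) else 0)"
      for X l and m :: "nat \<Rightarrow> nat" and A w
    define GM where "GM = {m \<in> tup k M. inj_on m {..<k}}"
    define GL where "GL = {l \<in> tup k L. good k DL l}"
    define GO where "GO = {w \<in> tup k O'. good k D2 w}"
    define S where "S X n l w = (cmod (symz k \<phi> (zipt k X n) (zipt k l w)))\<^sup>2" for X n l w
    have finG: "finite GM" "finite GL" "finite GO" unfolding GM_def GL_def GO_def using fin by auto
    have form1: "form k (I \<times> N) (L \<times> O') (?K (r1,r2)) \<phi> = form k I (L \<times> M) (K1 r1) (\<phi>1 r2)" for r1 r2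
    proof -
      have "form k (I \<times> N) (L \<times> O') (?K (r1,r2)) \<phi> =
        (\<Sum>X\<in>tup k I. \<Sum>n\<in>tup k N. \<Sum>l\<in>tup k L. \<Sum>w\<in>tup k O'.
          (\<Prod>j<k. \<Sum>m\<in>M. K1 r1 (l j,m) (X j) * K2 r2 (w j) (m,n j)) * \<phi> (zipt k X n) (zipt k l w))"
        unfolding form_def amp_def using fin by (simp add: sum_tup_zipt zipt_app)
      also have "\<dots> = (\<Sum>X\<in>tup k I. \<Sum>n\<in>tup k N. \<Sum>l\<in>tup k L. \<Sum>w\<in>tup k O'. \<Sum>m\<in>tup k M.
          (\<Prod>j<k. K1 r1 (l j,m j) (X j)) * ((\<Prod>j<k. K2 r2 (w j) (m j,n j)) * \<phi> (zipt k X n) (zipt k l w)))"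
        using fin by (simp add: prod_sum_tup sum_distrib_right prod.distrib mult.assoc)
      also have "\<dots> = (\<Sum>X\<in>tup k I. \<Sum>l\<in>tup k L. \<Sum>m\<in>tup k M. \<Sum>n\<in>tup k N. \<Sum>w\<in>tup k O'.
          (\<Prod>j<k. K1 r1 (l j,m j) (X j)) * ((\<Prod>j<k. K2 r2 (w j) (m j,n j)) * \<phi> (zipt k X n) (zipt k l w)))"
      proof (rule sum.cong[OF refl])
        fix X
        let ?f = "\<lambda>l m n w. (\<Prod>j<k. K1 r1 (l j,m j) (X j)) * ((\<Prod>j<k. K2 r2 (w j) (m j,n j)) * \<phi> (zipt k X n) (zipt k l w))"
        have "(\<Sum>n\<in>tup k N. \<Sum>l\<in>tup k L. \<Sum>w\<in>tup k O'. \<Sum>m\<in>tup k M. ?f l m n w)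
          = (\<Sum>l\<in>tup k L. \<Sum>n\<in>tup k N. \<Sum>w\<in>tup k O'. \<Sum>m\<in>tup k M. ?f l m n w)" by (rule sum.swap)
        also have "\<dots> = (\<Sum>l\<in>tup k L. \<Sum>n\<in>tup k N. \<Sum>m\<in>tup k M. \<Sum>w\<in>tup k O'. ?f l m n w)"
          by (intro sum.cong refl sum.swap)
        also have "\<dots> = (\<Sum>l\<in>tup k L. \<Sum>m\<in>tup k M. \<Sum>n\<in>tup k N. \<Sum>w\<in>tup k O'. ?f l m n w)"
          by (intro sum.cong refl sum.swap)
        finally show "(\<Sum>n\<in>tup k N. \<Sum>l\<in>tup k L. \<Sum>w\<in>tup k O'. \<Sum>m\<in>tup k M. ?f l m n w)
          = (\<Sum>l\<in>tup k L. \<Sum>m\<in>tup k M. \<Sum>n\<in>tup k N. \<Sum>w\<in>tup k O'. ?f l m n w)" .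
      qed
      also have "\<dots> = form k I (L \<times> M) (K1 r1) (\<phi>1 r2)"
      proof -
        have "zipt k (\<lambda>j. fst (zipt k l m j)) w = zipt k l w" for l :: "nat \<Rightarrow> 'l" and m :: "nat \<Rightarrow> nat" and w :: "nat \<Rightarrow> 'o"
          by (rule zipt_cong) (auto simp: zipt_app)
        then show ?thesis
          unfolding form_def amp_def \<phi>1_def using fin by (simp add: sum_tup_zipt zipt_app sum_distrib_left)
      qed
      finally show ?thesis .
    qed
    have sym1: "symz k (\<phi>1 r2) X (zipt k l m) = form k (M \<times> N) O' (K2 r2) (\<phi>2 X l m)"
      if m: "m \<in> tup k M" for r2 X l m
    proof -
      have z: "zipt k (\<lambda>j. fst ((zipt k l m \<circ> \<pi>) j)) w = zipt k (l \<circ> \<pi>) w" if "\<pi> \<in> perms k" for \<pi> and w :: "nat \<Rightarrow> 'o"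
        by (rule zipt_cong) (auto simp: zipt_app perms_lt[OF that])
      have "form k (M \<times> N) O' (K2 r2) (\<phi>2 X l m) = (\<Sum>a\<in>tup k M. \<Sum>n\<in>tup k N. \<Sum>w\<in>tup k O'. \<Sum>\<pi>\<in>perms k.
          if a = m \<circ> \<pi> then (\<Prod>j<k. K2 r2 (w j) (a j,n j)) * \<phi> (zipt k (X \<circ> \<pi>) n) (zipt k (l \<circ> \<pi>) w) else 0)"
      proof -
        have e1: "(\<forall>j<k. a j = m (\<pi> j)) \<longleftrightarrow> a = m \<circ> \<pi>" if "a \<in> tup k M" "\<pi> \<in> perms k" for a \<pi>
          using tup_eqI[OF that(1) tup_comp[OF m that(2)]] by auto
        have e2: "zipt k (X \<circ> \<pi>) (\<lambda>j. snd (zipt k a n j)) = zipt k (X \<circ> \<pi>) n" for \<pi> and a :: "nat \<Rightarrow> nat" and n :: "nat \<Rightarrow> 'n"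
          by (rule zipt_cong) (auto simp: zipt_app)
        show ?thesis unfolding form_def amp_def \<phi>2_def using fin
          by (simp add: sum_tup_zipt zipt_app e2 sum_distrib_left if_distrib[of "\<lambda>x. _ * x"] e1 cong: if_cong)
      qed
      also have "\<dots> = (\<Sum>\<pi>\<in>perms k. \<Sum>n\<in>tup k N. \<Sum>w\<in>tup k O'. \<Sum>a\<in>tup k M.
          if a = m \<circ> \<pi> then (\<Prod>j<k. K2 r2 (w j) (a j,n j)) * \<phi> (zipt k (X \<circ> \<pi>) n) (zipt k (l \<circ> \<pi>) w) else 0)"
      proof -
        let ?f = "\<lambda>a n w \<pi>. if a = m \<circ> \<pi> then (\<Prod>j<k. K2 r2 (w j) (a j,n j)) * \<phi> (zipt k (X \<circ> \<pi>) n) (zipt k (l \<circ> \<pi>) w) else 0"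
        have "(\<Sum>a\<in>tup k M. \<Sum>n\<in>tup k N. \<Sum>w\<in>tup k O'. \<Sum>\<pi>\<in>perms k. ?f a n w \<pi>)
          = (\<Sum>n\<in>tup k N. \<Sum>a\<in>tup k M. \<Sum>w\<in>tup k O'. \<Sum>\<pi>\<in>perms k. ?f a n w \<pi>)" by (rule sum.swap)
        also have "\<dots> = (\<Sum>n\<in>tup k N. \<Sum>w\<in>tup k O'. \<Sum>a\<in>tup k M. \<Sum>\<pi>\<in>perms k. ?f a n w \<pi>)"
          by (intro sum.cong refl sum.swap)
        also have "\<dots> = (\<Sum>n\<in>tup k N. \<Sum>w\<in>tup k O'. \<Sum>\<pi>\<in>perms k. \<Sum>a\<in>tup k M. ?f a n w \<pi>)"
          by (intro sum.cong refl sum.swap)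
        also have "\<dots> = (\<Sum>n\<in>tup k N. \<Sum>\<pi>\<in>perms k. \<Sum>w\<in>tup k O'. \<Sum>a\<in>tup k M. ?f a n w \<pi>)"
          by (intro sum.cong refl sum.swap)
        also have "\<dots> = (\<Sum>\<pi>\<in>perms k. \<Sum>n\<in>tup k N. \<Sum>w\<in>tup k O'. \<Sum>a\<in>tup k M. ?f a n w \<pi>)"
          by (rule sum.swap)
        finally show ?thesis .
      qed
      also have "\<dots> = (\<Sum>\<pi>\<in>perms k. \<Sum>n\<in>tup k N. \<Sum>w\<in>tup k O'.
          (\<Prod>j<k. K2 r2 (w j) (m (\<pi> j),n j)) * \<phi> (zipt k (X \<circ> \<pi>) n) (zipt k (l \<circ> \<pi>) w))"
        using fin tup_comp[OF m] by (intro sum.cong refl) simp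
      also have "\<dots> = symz k (\<phi>1 r2) X (zipt k l m)"
        unfolding symz_def \<phi>1_def using z by (intro sum.cong refl) (simp add: zipt_app perms_lt)
      finally show ?thesis by simp
    qed
    \<comment> \<open>At a rearrangement \<open>m \<circ> \<theta>\<close>, injectivity of
      \<open>m\<close> leaves for each \<open>\<kappa>\<close> the single term
      \<open>\<pi> = \<theta> \<circ> \<kappa>\<close>, so the double sum over permutations
      collapses to the symmetrisation of \<open>\<phi>\<close>.\<close>
    have sym2: "symz k (\<phi>2 X l m) (zipt k (m \<circ> \<theta>) (n \<circ> \<theta>)) (w \<circ> \<theta>) = symz k \<phi> (zipt k X n) (zipt k l w)"
      if m: "m \<in> GM" and t: "\<theta> \<in> perms k" for X l m \<theta> n w
    proof -
      have inj: "inj_on m {..<k}" using m unfolding GM_def by simp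
      have e: "(\<forall>j<k. fst ((zipt k (m \<circ> \<theta>) (n \<circ> \<theta>) \<circ> \<kappa>) j) = m (\<pi> j)) \<longleftrightarrow> \<pi> = \<theta> \<circ> \<kappa>"
        if "\<kappa> \<in> perms k" "\<pi> \<in> perms k" for \<kappa> \<pi>
      proof -
        have "(\<forall>j<k. fst ((zipt k (m \<circ> \<theta>) (n \<circ> \<theta>) \<circ> \<kappa>) j) = m (\<pi> j)) \<longleftrightarrow> (\<forall>j<k. m (\<theta> (\<kappa> j)) = m (\<pi> j))"
          by (simp add: zipt_app perms_lt that)
        also have "\<dots> \<longleftrightarrow> (\<forall>j<k. \<theta> (\<kappa> j) = \<pi> j)"
          using inj that t by (simp add: inj_on_eq_iff[OF inj] perms_lt)
        also have "\<dots> \<longleftrightarrow> \<pi> = \<theta> \<circ> \<kappa>"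
        proof
          assume a: "\<forall>j<k. \<theta> (\<kappa> j) = \<pi> j"
          show "\<pi> = \<theta> \<circ> \<kappa>"
          proof
            fix j show "\<pi> j = (\<theta> \<circ> \<kappa>) j"
              using a that t by (cases "j < k") (auto simp: perms_def permutes_not_in)
          qed
        qed simp
        finally show ?thesis .
      qed
      have "symz k (\<phi>2 X l m) (zipt k (m \<circ> \<theta>) (n \<circ> \<theta>)) (w \<circ> \<theta>)
        = (\<Sum>\<kappa>\<in>perms k. \<phi> (zipt k (X \<circ> (\<theta> \<circ> \<kappa>)) (n \<circ> (\<theta> \<circ> \<kappa>))) (zipt k (l \<circ> (\<theta> \<circ> \<kappa>)) (w \<circ> (\<theta> \<circ> \<kappa>))))"
        unfolding symz_def
      proof (rule sum.cong[OF refl])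
        fix \<kappa> assume k: "\<kappa> \<in> perms k"
        have z: "zipt k (X \<circ> \<pi>) (\<lambda>j. snd ((zipt k (m \<circ> \<theta>) (n \<circ> \<theta>) \<circ> \<kappa>) j)) = zipt k (X \<circ> \<pi>) (n \<circ> (\<theta> \<circ> \<kappa>))" for \<pi>
          by (rule zipt_cong) (auto simp: zipt_app perms_lt k)
        have "\<phi>2 X l m (zipt k (m \<circ> \<theta>) (n \<circ> \<theta>) \<circ> \<kappa>) (w \<circ> \<theta> \<circ> \<kappa>) = (\<Sum>\<pi>\<in>perms k. if \<pi> = \<theta> \<circ> \<kappa> then
            \<phi> (zipt k (X \<circ> \<pi>) (n \<circ> (\<theta> \<circ> \<kappa>))) (zipt k (l \<circ> \<pi>) (w \<circ> \<theta> \<circ> \<kappa>)) else 0)"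
          unfolding \<phi>2_def z by (intro sum.cong refl) (simp only: e[OF k])
        also have "\<dots> = \<phi> (zipt k (X \<circ> (\<theta> \<circ> \<kappa>)) (n \<circ> (\<theta> \<circ> \<kappa>))) (zipt k (l \<circ> (\<theta> \<circ> \<kappa>)) (w \<circ> (\<theta> \<circ> \<kappa>)))"
          using perms_comp[OF t k] by (simp add: comp_assoc)
        finally show "\<phi>2 X l m (zipt k (m \<circ> \<theta>) (n \<circ> \<theta>) \<circ> \<kappa>) (w \<circ> \<theta> \<circ> \<kappa>) = \<dots>" .
      qed
      also have "\<dots> = (\<Sum>\<kappa>\<in>perms k. \<phi> (zipt k (X \<circ> \<kappa>) (n \<circ> \<kappa>)) (zipt k (l \<circ> \<kappa>) (w \<circ> \<kappa>)))"
        by (rule sum_perms_comp[OF t])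
      also have "\<dots> = symz k \<phi> (zipt k X n) (zipt k l w)"
        unfolding symz_def by (intro sum.cong refl) (simp add: zipt_comp)
      finally show ?thesis .
    qed
    have step2: "\<alpha>2 * (\<Sum>n\<in>tup k N. \<Sum>w\<in>GO. S X n l w)
       \<le> measure_pmf.expectation p2 (\<lambda>r2. (cmod (symz k (\<phi>1 r2) X (zipt k l m)))\<^sup>2)"
      if m: "m \<in> GM" for X l m
    proof -
      have mt: "m \<in> tup k M" and inj: "inj_on m {..<k}" using m unfolding GM_def by auto
      let ?h = "\<lambda>a. \<Sum>n\<in>tup k N. \<Sum>w\<in>GO. (cmod (symz k (\<phi>2 X l m) (zipt k a n) w))\<^sup>2"
      have injth: "inj_on (\<lambda>\<theta>. m \<circ> \<theta>) (perms k)"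
      proof (rule inj_onI)
        fix \<theta> \<theta>' assume t: "\<theta> \<in> perms k" "\<theta>' \<in> perms k" "m \<circ> \<theta> = m \<circ> \<theta>'"
        show "\<theta> = \<theta>'"
        proof
          fix j show "\<theta> j = \<theta>' j"
          proof (cases "j < k")
            case True
            have "m (\<theta> j) = m (\<theta>' j)" using fun_cong[OF t(3), of j] by simp
            then show ?thesis using inj t True by (simp add: inj_on_eq_iff[OF inj] perms_lt)
          qed (use t in \<open>auto simp: perms_def permutes_not_in\<close>)
        qed
      qed
      have "fact k * (\<Sum>n\<in>tup k N. \<Sum>w\<in>GO. S X n l w) = (\<Sum>\<theta>\<in>perms k. \<Sum>n\<in>tup k N. \<Sum>w\<in>GO. S X n l w)"
        by (simp add: card_perms)
      also have "\<dots> = (\<Sum>\<theta>\<in>perms k. ?h (m \<circ> \<theta>))"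
      proof (rule sum.cong[OF refl])
        fix \<theta> assume t: "\<theta> \<in> perms k"
        have "?h (m \<circ> \<theta>) = (\<Sum>n\<in>tup k N. \<Sum>w\<in>GO. (cmod (symz k (\<phi>2 X l m) (zipt k (m \<circ> \<theta>) (n \<circ> \<theta>)) w))\<^sup>2)"
          by (rule sum_tup_comp[OF t, symmetric])
        also have "\<dots> = (\<Sum>n\<in>tup k N. \<Sum>w\<in>GO. (cmod (symz k (\<phi>2 X l m) (zipt k (m \<circ> \<theta>) (n \<circ> \<theta>)) (w \<circ> \<theta>)))\<^sup>2)"
          unfolding GO_def by (rule sum.cong[OF refl]) (rule sum_good_comp[OF t fin(5), symmetric])
        finally show "(\<Sum>n\<in>tup k N. \<Sum>w\<in>GO. S X n l w) = ?h (m \<circ> \<theta>)"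
          unfolding S_def sym2[OF m t] by simp
      qed
      also have "\<dots> = (\<Sum>a\<in>(\<lambda>\<theta>. m \<circ> \<theta>) ` perms k. ?h a)" by (simp add: sum.reindex[OF injth])
      \<comment> \<open>Of all middle inputs of the second operator only the rearrangements of
        \<open>m\<close> are kept; there are \<open>fact k\<close> distinct ones, which cancels the
        \<open>1 / fact k\<close> in \<open>d2\<close>.\<close>
      also have "\<dots> \<le> (\<Sum>a\<in>tup k M. ?h a)"
        by (rule sum_mono2) (use fin tup_comp[OF mt] in \<open>auto intro!: sum_nonneg\<close>)
      also have "\<dots> = (\<Sum>A\<in>tup k (M \<times> N). \<Sum>w\<in>{w\<in>tup k O'. good k D2 w}. (cmod (symz k (\<phi>2 X l m) A w))\<^sup>2)"
        using fin by (simp add: sum_tup_zipt GO_def)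
      finally have "\<alpha>2 / fact k * (fact k * (\<Sum>n\<in>tup k N. \<Sum>w\<in>GO. S X n l w)) \<le>
        \<alpha>2 / fact k * (\<Sum>A\<in>tup k (M \<times> N). \<Sum>w\<in>{w\<in>tup k O'. good k D2 w}. (cmod (symz k (\<phi>2 X l m) A w))\<^sup>2)"
        using nn by (intro mult_left_mono) auto
      also have "\<dots> \<le> measure_pmf.expectation p2 (\<lambda>r2. (cmod (form k (M \<times> N) O' (K2 r2) (\<phi>2 X l m)))\<^sup>2)"
        using d2 unfolding dominated_def by blast
      finally show ?thesis using sym1[OF mt] by simp
    qed
    have "\<alpha>1 * \<alpha>2 * real (card GM) / fact k *
      (\<Sum>X\<in>tup k (I \<times> N). \<Sum>Y\<in>{Y\<in>tup k (L \<times> O'). good k ?D Y}. (cmod (symz k \<phi> X Y))\<^sup>2)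
      = \<alpha>1 / fact k * (\<Sum>X\<in>tup k I. \<Sum>l\<in>GL. \<Sum>m\<in>GM. \<alpha>2 * (\<Sum>n\<in>tup k N. \<Sum>w\<in>GO. S X n l w))"
    proof -
      have "(\<Sum>X\<in>tup k (I \<times> N). \<Sum>Y\<in>{Y\<in>tup k (L \<times> O'). good k ?D Y}. (cmod (symz k \<phi> X Y))\<^sup>2)
         = (\<Sum>X\<in>tup k I. \<Sum>n\<in>tup k N. \<Sum>l\<in>GL. \<Sum>w\<in>GO. S X n l w)"
        unfolding sum_good_zipt[OF fin(2,5)] sum_tup_zipt[OF fin(1,4)] GL_def GO_def S_def ..
      also have "\<dots> = (\<Sum>X\<in>tup k I. \<Sum>l\<in>GL. \<Sum>n\<in>tup k N. \<Sum>w\<in>GO. S X n l w)"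
        by (intro sum.cong refl sum.swap)
      finally show ?thesis by (simp add: sum_distrib_left sum_divide_distrib mult_ac)
    qed
    also have "\<dots> \<le> \<alpha>1 / fact k * (\<Sum>X\<in>tup k I. \<Sum>l\<in>GL. \<Sum>m\<in>GM.
        measure_pmf.expectation p2 (\<lambda>r2. (cmod (symz k (\<phi>1 r2) X (zipt k l m)))\<^sup>2))"
      using nn step2 by (intro mult_left_mono sum_mono) auto
    also have "\<dots> = measure_pmf.expectation p2 (\<lambda>r2. \<alpha>1 / fact k * (\<Sum>X\<in>tup k I. \<Sum>l\<in>GL. \<Sum>m\<in>GM.
        (cmod (symz k (\<phi>1 r2) X (zipt k l m)))\<^sup>2))"
      by (simp add: expectation_sum_finite[OF f2])
    also have "\<dots> \<le> measure_pmf.expectation p2 (\<lambda>r2. measure_pmf.expectation p1 (\<lambda>r1. (cmod (form k I (L \<times> M) (K1 r1) (\<phi>1 r2)))\<^sup>2))"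
    proof (rule expectation_mono_finite[OF f2])
      fix r2
      have GMg: "GM = {m\<in>tup k M. good k {\<lambda>x. x} m}" unfolding GM_def good_def by simp
      have "(\<Sum>l\<in>GL. \<Sum>m\<in>GM. (cmod (symz k (\<phi>1 r2) X (zipt k l m)))\<^sup>2)
        = (\<Sum>Y\<in>{Y\<in>tup k (L \<times> M). good k ((\<lambda>d. d \<circ> fst) ` DL \<union> {snd}) Y}. (cmod (symz k (\<phi>1 r2) X Y))\<^sup>2)" for X
        using sum_good_zipt[where DA = DL and DB = "{\<lambda>x. x}" and f = "\<lambda>Y. (cmod (symz k (\<phi>1 r2) X Y))\<^sup>2" and k = k, OF fin(2,3)]
        unfolding GMg GL_def by (simp add: o_def)
      then show "\<alpha>1 / fact k * (\<Sum>X\<in>tup k I. \<Sum>l\<in>GL. \<Sum>m\<in>GM. (cmod (symz k (\<phi>1 r2) X (zipt k l m)))\<^sup>2)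
        \<le> measure_pmf.expectation p1 (\<lambda>r1. (cmod (form k I (L \<times> M) (K1 r1) (\<phi>1 r2)))\<^sup>2)"
        using d1 unfolding dominated_def by simp
    qed
    also have "\<dots> = measure_pmf.expectation (pair_pmf p1 p2) (\<lambda>r. (cmod (form k (I \<times> N) (L \<times> O') (?K r) \<phi>))\<^sup>2)"
      unfolding expectation_pair_finite[OF f1 f2] form1 ..
    finally show ?thesis unfolding GM_def .
  qed
  show ?thesis unfolding dominated_def using bound f1 f2 by simp
qed

text \<open>Gluing wants pairs where the circuit has basis indices. Coefficients are transported
  along the inverse bijections, so symmetrisations and forms coincide term by term.\<close>

lemma dominated_relabel:
  assumes d: "dominated k I O' Ds \<alpha> p K"
    and b1: "bij_betw \<beta> I' I" and b2: "bij_betw \<gamma> O2 O'"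
    and fin: "finite I" "finite O'"
  shows "dominated k I' O2 ((\<lambda>d. d \<circ> \<gamma>) ` Ds) \<alpha> p (\<lambda>r y x. K r (\<gamma> y) (\<beta> x))"
proof -
  have re: "(\<Sum>X\<in>tup k A. f X) = (\<Sum>X\<in>tup k B. f (\<lambda>j\<in>{..<k}. g (X j)))"
    if b: "bij_betw g B A" for g :: "'x \<Rightarrow> 'y" and A B and f :: "(nat \<Rightarrow> 'y) \<Rightarrow> 'z::comm_monoid_add"
  proof (rule sum.reindex_bij_witness[of _ "\<lambda>X. \<lambda>j\<in>{..<k}. g (X j)" "\<lambda>X. \<lambda>j\<in>{..<k}. inv_into B g (X j)"])
    fix X assume X: "X \<in> tup k A"
    then have m: "\<And>j. j < k \<Longrightarrow> X j \<in> g ` B" using b by (auto simp: bij_betw_def dest: tup_app)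
    show eq: "(\<lambda>j\<in>{..<k}. g ((\<lambda>j\<in>{..<k}. inv_into B g (X j)) j)) = X"
      by (auto simp: fun_eq_iff f_inv_into_f[OF m] tup_undef[OF X])
    show "(\<lambda>j\<in>{..<k}. inv_into B g (X j)) \<in> tup k B"
      by (rule tupI) (auto simp: inv_into_into[OF m])
    show "f (\<lambda>j\<in>{..<k}. g ((\<lambda>j\<in>{..<k}. inv_into B g (X j)) j)) = f X" by (simp only: eq)
  next
    fix X assume X: "X \<in> tup k B"
    show "(\<lambda>j\<in>{..<k}. inv_into B g ((\<lambda>j\<in>{..<k}. g (X j)) j)) = X"
      using b by (auto simp: fun_eq_iff bij_betw_def tup_undef[OF X] tup_app[OF X])
    show "(\<lambda>j\<in>{..<k}. g (X j)) \<in> tup k A"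
      by (rule tupI) (use tup_app[OF X] b in \<open>auto simp: bij_betw_def\<close>)
  qed
  have rc: "(\<lambda>j\<in>{..<k}. g (X j)) \<circ> \<pi> = (\<lambda>j\<in>{..<k}. g ((X \<circ> \<pi>) j))" if "\<pi> \<in> perms k" for g :: "'x \<Rightarrow> 'y" and X \<pi>
    by (rule ext) (auto simp: perms_lt[OF that])
  have main: "\<alpha> / fact k * (\<Sum>X\<in>tup k I'. \<Sum>Y\<in>{Y\<in>tup k O2. good k ((\<lambda>d. d \<circ> \<gamma>) ` Ds) Y}. (cmod (symz k \<phi> X Y))\<^sup>2)
     \<le> measure_pmf.expectation p (\<lambda>r. (cmod (form k I' O2 (\<lambda>y x. K r (\<gamma> y) (\<beta> x)) \<phi>))\<^sup>2)" for \<phi>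
  proof -
    define \<beta>' where "\<beta>' = inv_into I' \<beta>"
    define \<gamma>' where "\<gamma>' = inv_into O2 \<gamma>"
    define \<psi> where "\<psi> X Y = \<phi> (\<lambda>j\<in>{..<k}. \<beta>' (X j)) (\<lambda>j\<in>{..<k}. \<gamma>' (Y j))" for X Y
    have bb: "\<beta>' (\<beta> x) = x" if "x \<in> I'" for x using b1 that unfolding \<beta>'_def bij_betw_def by simp
    have gg: "\<gamma>' (\<gamma> x) = x" if "x \<in> O2" for x using b2 that unfolding \<gamma>'_def bij_betw_def by simp
    have ps: "\<psi> (\<lambda>j\<in>{..<k}. \<beta> (X j)) (\<lambda>j\<in>{..<k}. \<gamma> (Y j)) = \<phi> X Y" if "X \<in> tup k I'" "Y \<in> tup k O2" for X Y
    proof -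
      have "(\<lambda>j\<in>{..<k}. \<beta>' ((\<lambda>j\<in>{..<k}. \<beta> (X j)) j)) = X"
        by (auto simp: fun_eq_iff bb tup_app[OF that(1)] tup_undef[OF that(1)])
      moreover have "(\<lambda>j\<in>{..<k}. \<gamma>' ((\<lambda>j\<in>{..<k}. \<gamma> (Y j)) j)) = Y"
        by (auto simp: fun_eq_iff gg tup_app[OF that(2)] tup_undef[OF that(2)])
      ultimately show ?thesis unfolding \<psi>_def by simp
    qed
    have sy: "symz k \<psi> (\<lambda>j\<in>{..<k}. \<beta> (X j)) (\<lambda>j\<in>{..<k}. \<gamma> (Y j)) = symz k \<phi> X Y" if "X \<in> tup k I'" "Y \<in> tup k O2" for X Y
      unfolding symz_def by (rule sum.cong[OF refl]) (simp only: rc ps tup_comp that)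
    have fo: "form k I O' (K r) \<psi> = form k I' O2 (\<lambda>y x. K r (\<gamma> y) (\<beta> x)) \<phi>" for r
      unfolding form_def re[OF b1] re[OF b2] by (intro sum.cong refl) (simp add: ps amp_def)
    have finO2: "finite O2" using b2 fin(2) bij_betw_finite by blast
    have go: "good k Ds (\<lambda>j\<in>{..<k}. \<gamma> (Y j)) \<longleftrightarrow> good k ((\<lambda>d. d \<circ> \<gamma>) ` Ds) Y" for Y
    proof -
      have "good k Ds (\<lambda>j\<in>{..<k}. \<gamma> (Y j)) \<longleftrightarrow> good k Ds (\<lambda>j. \<gamma> (Y j))" by (rule good_cong) simp
      then show ?thesis unfolding good_def by simp
    qed
    have su: "(\<Sum>X\<in>tup k I. \<Sum>Y\<in>{Y\<in>tup k O'. good k Ds Y}. (cmod (symz k \<psi> X Y))\<^sup>2)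
       = (\<Sum>X\<in>tup k I'. \<Sum>Y\<in>{Y\<in>tup k O2. good k ((\<lambda>d. d \<circ> \<gamma>) ` Ds) Y}. (cmod (symz k \<phi> X Y))\<^sup>2)"
    proof -
      have "(\<Sum>X\<in>tup k I. \<Sum>Y\<in>{Y\<in>tup k O'. good k Ds Y}. (cmod (symz k \<psi> X Y))\<^sup>2)
        = (\<Sum>X\<in>tup k I. \<Sum>Y\<in>tup k O'. if good k Ds Y then (cmod (symz k \<psi> X Y))\<^sup>2 else 0)"
        using fin by (simp add: sum.inter_filter)
      also have "\<dots> = (\<Sum>X\<in>tup k I'. \<Sum>Y\<in>tup k O2. if good k ((\<lambda>d. d \<circ> \<gamma>) ` Ds) Y then (cmod (symz k \<phi> X Y))\<^sup>2 else 0)"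
        unfolding re[OF b1] re[OF b2] go by (intro sum.cong refl) (simp only: sy)
      also have "\<dots> = (\<Sum>X\<in>tup k I'. \<Sum>Y\<in>{Y\<in>tup k O2. good k ((\<lambda>d. d \<circ> \<gamma>) ` Ds) Y}. (cmod (symz k \<phi> X Y))\<^sup>2)"
        using finO2 by (simp add: sum.inter_filter)
      finally show ?thesis .
    qed
    have "\<alpha> / fact k * (\<Sum>X\<in>tup k I. \<Sum>Y\<in>{Y\<in>tup k O'. good k Ds Y}. (cmod (symz k \<psi> X Y))\<^sup>2)
      \<le> measure_pmf.expectation p (\<lambda>r. (cmod (form k I O' (K r) \<psi>))\<^sup>2)"
      using d unfolding dominated_def by blast
    then show ?thesis unfolding su fo .
  qed
  then show ?thesis using d unfolding dominated_def by blast
qed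

lemma dominated_cong:
  assumes d: "dominated k I O' Ds \<alpha> p K"
    and eq: "\<And>r y x. r \<in> set_pmf p \<Longrightarrow> y \<in> O' \<Longrightarrow> x \<in> I \<Longrightarrow> K r y x = K' r y x"
  shows "dominated k I O' Ds \<alpha> p K'"
proof -
  have fin: "finite (set_pmf p)" using d unfolding dominated_def by simp
  have "form k I O' (K r) \<phi> = form k I O' (K' r) \<phi>" if "r \<in> set_pmf p" for r \<phi>
    unfolding form_def
  proof (intro sum.cong refl)
    fix X Y assume "X \<in> tup k I" "Y \<in> tup k O'"
    then have "amp k (K r) X Y = amp k (K' r) X Y"
      unfolding amp_def by (intro prod.cong refl eq[OF that]) (auto intro: tup_app)
    then show "amp k (K r) X Y * \<phi> X Y = amp k (K' r) X Y * \<phi> X Y" by simp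
  qed
  then have "measure_pmf.expectation p (\<lambda>r. (cmod (form k I O' (K r) \<phi>))\<^sup>2) = measure_pmf.expectation p (\<lambda>r. (cmod (form k I O' (K' r) \<phi>))\<^sup>2)" for \<phi>
    unfolding expectation_finite[OF fin] by (intro sum.cong refl) simp
  then show ?thesis using d unfolding dominated_def by simp
qed

lemma dominated_map:
  assumes "dominated k I O' Ds \<alpha> p (\<lambda>r. K (h r))"
  shows "dominated k I O' Ds \<alpha> (map_pmf h p) K"
  using assms unfolding dominated_def by simp

lemma dominated_digits_cong:
  assumes "dominated k I O' Ds \<alpha> p K" "\<And>Y. Y \<in> tup k O' \<Longrightarrow> good k Ds Y = good k Ds' Y"
  shows "dominated k I O' Ds' \<alpha> p K"
proof -
  have "{Y\<in>tup k O'. good k Ds Y} = {Y\<in>tup k O'. good k Ds' Y}" using assms(2) by blast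
  then show ?thesis using assms(1) unfolding dominated_def by simp
qed

text \<open>A tensor product of isometries is an isometry, by orthogonality in each factor. The
  index set is arbitrary because the collision estimate applies this to all tensor positions but
  two.\<close>

lemma parseval_PiE:
  fixes g :: "('j \<Rightarrow> nat) \<Rightarrow> complex"
  assumes J: "finite J" and U: "\<And>a b. a < d \<Longrightarrow> b < d \<Longrightarrow> (\<Sum>i<d. cnj (U i a) * U i b) = (if a = b then 1 else 0)"
  shows "(\<Sum>Z\<in>(\<Pi>\<^sub>E j\<in>J. {..<d}). (cmod (\<Sum>X\<in>(\<Pi>\<^sub>E j\<in>J. {..<d}). (\<Prod>j\<in>J. U (Z j) (X j)) * g X))\<^sup>2)
    = (\<Sum>X\<in>(\<Pi>\<^sub>E j\<in>J. {..<d}). (cmod (g X))\<^sup>2)"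
proof -
  let ?T = "\<Pi>\<^sub>E j\<in>J. {..<d}"
  let ?a = "\<lambda>X Z. \<Prod>j\<in>J. U (Z j) (X j)"
  have fT: "finite ?T" using J by (intro finite_PiE) auto
  have orth: "(\<Sum>Z\<in>?T. cnj (?a X Z) * ?a X' Z) = (if X = X' then 1 else 0)" if X: "X \<in> ?T" "X' \<in> ?T" for X X'
  proof -
    have m: "\<And>j. j \<in> J \<Longrightarrow> X j < d" "\<And>j. j \<in> J \<Longrightarrow> X' j < d" using PiE_mem[OF X(1)] PiE_mem[OF X(2)] by auto
    have "(\<Sum>Z\<in>?T. cnj (?a X Z) * ?a X' Z) = (\<Sum>Z\<in>?T. \<Prod>j\<in>J. cnj (U (Z j) (X j)) * U (Z j) (X' j))"
      by (simp add: prod.distrib)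
    also have "\<dots> = (\<Prod>j\<in>J. \<Sum>z<d. cnj (U z (X j)) * U z (X' j))"
      by (rule prod_sum_PiE[symmetric]) (use J in auto)
    also have "\<dots> = (\<Prod>j\<in>J. if X j = X' j then 1 else 0)"
      by (rule prod.cong) (use m in \<open>auto simp: U\<close>)
    also have "\<dots> = (if X = X' then 1 else 0)"
    proof (cases "X = X'")
      case False
      then obtain j where "j \<in> J" "X j \<noteq> X' j" using PiE_ext[OF X] by blast
      then show ?thesis using False J by (auto intro!: prod_zero)
    qed simp
    finally show ?thesis .
  qed
  have "complex_of_real (\<Sum>Z\<in>?T. (cmod (\<Sum>X\<in>?T. ?a X Z * g X))\<^sup>2)
     = (\<Sum>Z\<in>?T. (\<Sum>X\<in>?T. cnj (?a X Z * g X)) * (\<Sum>X\<in>?T. ?a X Z * g X))"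
    unfolding of_real_sum by (intro sum.cong refl) (simp add: complex_norm_square mult.commute del: of_real_power)
  also have "\<dots> = (\<Sum>Z\<in>?T. \<Sum>X\<in>?T. \<Sum>X'\<in>?T. (cnj (?a X Z) * ?a X' Z) * (cnj (g X) * g X'))"
    unfolding sum_product by (intro sum.cong refl) (simp add: mult_ac)
  also have "\<dots> = (\<Sum>X\<in>?T. \<Sum>X'\<in>?T. \<Sum>Z\<in>?T. (cnj (?a X Z) * ?a X' Z) * (cnj (g X) * g X'))"
    by (subst sum.swap) (intro sum.cong refl sum.swap)
  also have "\<dots> = (\<Sum>X\<in>?T. \<Sum>X'\<in>?T. (if X = X' then 1 else 0) * (cnj (g X) * g X'))"
    unfolding sum_distrib_right[symmetric] by (intro sum.cong refl) (simp only: orth)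
  also have "\<dots> = (\<Sum>X\<in>?T. cnj (g X) * g X)"
    using fT by (intro sum.cong refl) (simp add: if_distrib[of "\<lambda>x. x * _"] cong: if_cong)
  also have "\<dots> = complex_of_real (\<Sum>X\<in>?T. (cmod (g X))\<^sup>2)"
    unfolding of_real_sum by (intro sum.cong refl) (simp add: complex_norm_square mult.commute del: of_real_power)
  finally show ?thesis using of_real_eq_iff by blast
qed

lemma tensor_parseval:
  fixes g :: "(nat \<Rightarrow> nat) \<Rightarrow> complex"
  assumes U: "\<And>a b. a < d \<Longrightarrow> b < d \<Longrightarrow> (\<Sum>i<d. cnj (U i a) * U i b) = (if a = b then 1 else 0)"
  shows "(\<Sum>Z\<in>tup k {..<d}. (cmod (\<Sum>X\<in>tup k {..<d}. amp k U X Z * g X))\<^sup>2) = (\<Sum>X\<in>tup k {..<d}. (cmod (g X))\<^sup>2)"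
  unfolding tup_def amp_def by (rule parseval_PiE[OF _ U]) auto

section \<open>Clifford collision probabilities\<close>

lemma pauli_form_cong_fun:
  assumes "\<And>u u'. u < 2^N \<Longrightarrow> u' < 2^N \<Longrightarrow> h u u' = h' u u'"
  shows "pauli_form N f g h = pauli_form N f g h'"
  unfolding pauli_form_def by (rule ip2_cong) (use assms in \<open>auto intro: op2_cong\<close>)

text \<open>An unnormalised group average; the aim is that it takes one and the same value at all
  nontrivial Pauli labels.\<close>

definition qf :: "nat \<Rightarrow> (nat \<Rightarrow> nat \<Rightarrow> complex) \<Rightarrow> (nat \<Rightarrow> bool) \<Rightarrow> (nat \<Rightarrow> bool) \<Rightarrow> complex" where
  "qf N h f g = (\<Sum>C\<in>clifford_group N. pauli_form N f g (op2 (2^N) C C h))"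

lemma qf_cong:
  assumes "\<And>q. q < N \<Longrightarrow> f q = f' q" "\<And>q. q < N \<Longrightarrow> g q = g' q"
  shows "qf N h f g = qf N h f' g'"
  unfolding qf_def using pauli_form_cong[OF assms] by simp

text \<open>Reindexing the group sum by \<open>C \<mapsto> G * C\<close> moves the generator onto
  the Pauli label, so \<open>qf\<close> is constant on orbits of labels under the
  generators.\<close>

lemma qf_step:
  assumes G: "G \<in> clifford_gens N" and s: "cmod s = 1" and i: "G * pmat N f g = s \<cdot>\<^sub>m (pmat N f' g' * G)"
  shows "qf N h f' g' = qf N h f g"
proof -
  note u = clifford_gen_props(1)[OF G]
  have "qf N h f' g' = (\<Sum>C\<in>clifford_group N. pauli_form N f' g' (op2 (2^N) (G * C) (G * C) h))"
    unfolding qf_def by (rule sum.reindex_bij_betw[OF clifford_left_mult_bij[OF G], symmetric])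
  also have "\<dots> = (\<Sum>C\<in>clifford_group N. pauli_form N f' g' (op2 (2^N) G G (op2 (2^N) C C h)))"
  proof (rule sum.cong[OF refl], rule pauli_form_cong_fun)
    fix C and u' u'' :: nat assume C: "C \<in> clifford_group N" and v: "u' < 2^N" "u'' < (2::nat)^N"
    note c = unitariesD(1)[OF clifford_unitary[OF C]] and g = unitariesD(1)[OF u]
    show "op2 (2^N) (G * C) (G * C) h u' u'' = op2 (2^N) G G (op2 (2^N) C C h) u' u''"
      by (rule op2_comp[OF g g c c v, symmetric])
  qed
  also have "\<dots> = qf N h f g" unfolding qf_def by (rule sum.cong[OF refl], rule pauli_form_conj[OF u s i])
  finally show ?thesis .
qed

lemma qf_hadamard: "q < N \<Longrightarrow> qf N h (f(q := g q)) (g(q := f q)) = qf N h f g"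
  by (rule qf_step[OF _ _ hadamard_intertwine]) (auto simp: clifford_gens_def)

lemma qf_phase: "q < N \<Longrightarrow> qf N h f (g(q := (g q \<noteq> f q))) = qf N h f g"
  by (rule qf_step[OF _ _ phase_intertwine]) (auto simp: clifford_gens_def)

lemma qf_cnot: "c < N \<Longrightarrow> t < N \<Longrightarrow> c \<noteq> t \<Longrightarrow> qf N h (f(t := (f t \<noteq> f c))) (g(c := (g c \<noteq> g t))) = qf N h f g"
  by (rule qf_step[OF _ _ cnot_intertwine]) (auto simp: clifford_gens_def)

text \<open>Each further occupied qubit is brought to a pure X by a phase or Hadamard gate and then
  erased by a CNOT controlled by \<open>q\<close>, whose own X makes the two X-parts cancel. The
  induction counts the occupied qubits other than \<open>q\<close>.\<close>

lemma qf_clear: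
  assumes q: "q < N"
  shows "card {t. t < N \<and> t \<noteq> q \<and> (f t \<or> g t)} = n \<Longrightarrow> f q \<Longrightarrow> qf N h f g = qf N h (\<lambda>p. p = q) (\<lambda>_. False)"
proof (induction n arbitrary: f g)
  case 0
  have "finite {t. t < N \<and> t \<noteq> q \<and> (f t \<or> g t)}" by simp
  then have e: "\<And>t. t < N \<Longrightarrow> t \<noteq> q \<Longrightarrow> \<not> f t \<and> \<not> g t" using 0 by auto
  show ?case
  proof (cases "g q")
    case True
    have "qf N h f g = qf N h f (g(q := (g q \<noteq> f q)))" by (rule qf_phase[OF q, symmetric])
    also have "\<dots> = qf N h (\<lambda>p. p = q) (\<lambda>_. False)" by (rule qf_cong) (use e 0 True in auto)
    finally show ?thesis .
  next
    case False
    show ?thesis by (rule qf_cong) (use e 0 False in auto)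
  qed
next
  case (Suc n)
  have fin: "finite {t. t < N \<and> t \<noteq> q \<and> (f t \<or> g t)}" by simp
  obtain t where t: "t < N" "t \<noteq> q" "f t \<or> g t" using Suc.prems(1) by (metis (mono_tags, lifting) card.empty empty_Collect_eq nat.distinct(1))
  \<comment> \<open>The same label with qubit \<open>t\<close> turned into a pure X: Y goes to X by
    the phase gate, Z by the Hadamard gate.\<close>
  obtain f1 g1 where 1: "qf N h f1 g1 = qf N h f g" "f1 t" "\<not> g1 t" "\<And>p. p \<noteq> t \<Longrightarrow> f1 p = f p \<and> g1 p = g p"
  proof (cases "f t")
    case True
    show thesis
    proof (cases "g t")
      case True
      show thesis by (rule that[of f "g(t := (g t \<noteq> f t))"]) (use qf_phase[OF t(1), of h f g] True \<open>f t\<close> in auto)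
    next
      case False
      show thesis by (rule that[of f g]) (use False True in auto)
    qed
  next
    case False
    show thesis by (rule that[of "f(t := g t)" "g(t := f t)"]) (use qf_hadamard[OF t(1), of h f g] False t(3) in auto)
  qed
  define f2 where "f2 = f1(t := (f1 t \<noteq> f1 q))"
  define g2 where "g2 = g1(q := (g1 q \<noteq> g1 t))"
  have 2: "qf N h f2 g2 = qf N h f1 g1" unfolding f2_def g2_def by (rule qf_cnot[OF q t(1)]) (use t in auto)
  have f1q: "f1 q" using 1(4)[of q] t(2) Suc.prems(2) by auto
  have "{p. p < N \<and> p \<noteq> q \<and> (f2 p \<or> g2 p)} = {t. t < N \<and> t \<noteq> q \<and> (f t \<or> g t)} - {t}"
    using 1 f1q unfolding f2_def g2_def by auto
  then have "card {p. p < N \<and> p \<noteq> q \<and> (f2 p \<or> g2 p)} = n" using Suc.prems(1) t fin by simp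
  moreover have "f2 q" using f1q t(2) unfolding f2_def by simp
  ultimately have "qf N h f2 g2 = qf N h (\<lambda>p. p = q) (\<lambda>_. False)" by (rule Suc.IH)
  then show ?case unfolding 2 1(1) .
qed

text \<open>\<open>qf_clear\<close>, after a Hadamard gate if qubit \<open>q\<close> carries only a
  Z, reaches a single X on qubit \<open>q\<close>, and two CNOTs carry that X to qubit 0. This is
  the transitivity of the Clifford group on nontrivial Pauli operators.\<close>

lemma qf_nonid:
  assumes "q < N" "f q \<or> g q"
  shows "qf N h f g = qf N h (\<lambda>p. p = 0) (\<lambda>_. False)"
proof -
  have X: "qf N h f g = qf N h (\<lambda>p. p = q) (\<lambda>_. False)"
  proof (cases "f q")
    case True
    then show ?thesis by (rule qf_clear[OF assms(1) refl])
  next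
    case False
    then have "g q" using assms by simp
    then have "qf N h (f(q := g q)) (g(q := f q)) = qf N h (\<lambda>p. p = q) (\<lambda>_. False)"
      by (intro qf_clear[OF assms(1) refl]) simp
    then show ?thesis unfolding qf_hadamard[OF assms(1)] .
  qed
  show ?thesis
  proof (cases "q = 0")
    case False
    then have N: "0 < N" using assms by auto
    let ?f = "\<lambda>p. p = q" and ?g = "\<lambda>_::nat. False"
    have "qf N h ?f ?g = qf N h (?f(0 := (?f 0 \<noteq> ?f q))) (?g(q := (?g q \<noteq> ?g 0)))"
      by (rule qf_cnot[OF assms(1) N False, symmetric])
    also have "\<dots> = qf N h (\<lambda>p. p = q \<or> p = 0) ?g" by (rule qf_cong) (use False in auto)
    also have "\<dots> = qf N h ((\<lambda>p. p = q \<or> p = 0)(q := ((q = q \<or> q = 0) \<noteq> (0 = q \<or> (0::nat) = 0)))) (?g(0 := (?g 0 \<noteq> ?g q)))"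
      by (rule qf_cnot[OF N assms(1), symmetric]) (use False in auto)
    also have "\<dots> = qf N h (\<lambda>p. p = 0) ?g" by (rule qf_cong) (use False in auto)
    finally show ?thesis using X by simp
  qed (use X in simp)
qed

lemma sum_Pow_prod:
  fixes c :: "nat \<Rightarrow> complex"
  assumes "finite J"
  shows "(\<Sum>B\<in>Pow J. \<Prod>q\<in>B. c q) = (\<Prod>q\<in>J. 1 + c q)"
  using assms
proof (induction J rule: finite_induct)
  case (insert x J)
  have inj: "inj_on (insert x) (Pow J)" using insert by (auto simp: inj_on_def)
  have disj: "Pow J \<inter> insert x ` Pow J = {}" using insert by auto
  have "(\<Sum>B\<in>Pow (insert x J). \<Prod>q\<in>B. c q) = (\<Sum>B\<in>Pow J. \<Prod>q\<in>B. c q) + (\<Sum>B\<in>Pow J. \<Prod>q\<in>insert x B. c q)"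
    unfolding Pow_insert using insert disj by (simp add: sum.union_disjoint sum.reindex[OF inj] o_def)
  also have "(\<Sum>B\<in>Pow J. \<Prod>q\<in>insert x B. c q) = (\<Sum>B\<in>Pow J. c x * (\<Prod>q\<in>B. c q))"
  proof (rule sum.cong[OF refl])
    fix B assume "B \<in> Pow J"
    then have "finite B" "x \<notin> B" using insert finite_subset by auto
    then show "(\<Prod>q\<in>insert x B. c q) = c x * (\<Prod>q\<in>B. c q)" by simp
  qed
  finally show ?case using insert by (simp add: sum_distrib_left[symmetric] distrib_right)
qed simp

text \<open>Character orthogonality on the qubits in \<open>J\<close>: the sum over subsets is a
  product of factors 1 + 1 or 1 - 1.\<close>

lemma sum_chi:
  fixes v w :: nat
  assumes J: "J \<subseteq> {..<N}"
  shows "(\<Sum>B\<in>Pow J. chi N (\<lambda>q. q \<in> B) (bit v) * chi N (\<lambda>q. q \<in> B) (bit w)) = (if \<forall>q\<in>J. bit v q = bit w q then 2 ^ card J else 0)"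
proof -
  have fJ: "finite J" using J finite_subset by auto
  have c: "chi N (\<lambda>q. q \<in> B) (bit v) * chi N (\<lambda>q. q \<in> B) (bit w) = (\<Prod>q\<in>B. if bit v q = bit w q then 1 else -1)" if "B \<in> Pow J" for B
  proof -
    have "chi N (\<lambda>q. q \<in> B) (bit v) * chi N (\<lambda>q. q \<in> B) (bit w) = (\<Prod>q<N. if q \<in> B then (if bit v q = bit w q then 1 else -1) else 1)"
      unfolding chi_def prod.distrib[symmetric] by (rule prod.cong) auto
    also have "\<dots> = (\<Prod>q\<in>{..<N} \<inter> B. if bit v q = bit w q then 1 else -1)"
      by (simp add: prod.inter_restrict)
    also have "{..<N} \<inter> B = B" using that J by auto
    finally show ?thesis .
  qed
  have "(\<Sum>B\<in>Pow J. chi N (\<lambda>q. q \<in> B) (bit v) * chi N (\<lambda>q. q \<in> B) (bit w)) = (\<Prod>q\<in>J. 1 + (if bit v q = bit w q then 1 else -1))"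
    unfolding sum_Pow_prod[OF fJ, symmetric] by (rule sum.cong[OF refl c])
  also have "\<dots> = (if \<forall>q\<in>J. bit v q = bit w q then 2 ^ card J else 0)"
  proof (cases "\<forall>q\<in>J. bit v q = bit w q")
    case False
    then show ?thesis using fJ by (auto intro!: prod_zero)
  qed simp
  finally show ?thesis .
qed

text \<open>The sum of P tensor \<open>adj\<close> P over all Pauli operators is \<open>2^N\<close>
  times the swap of the two copies: summing over Z-parts forces the X-part to carry \<open>u\<close>
  to \<open>u'\<close>, which selects a single X-part.\<close>

lemma sum_pauli_form:
  "(\<Sum>A\<in>Pow {..<N}. \<Sum>B\<in>Pow {..<N}. pauli_form N (\<lambda>q. q \<in> A) (\<lambda>q. q \<in> B) h) =
     2^N * (\<Sum>u<2^N. \<Sum>u'<2^N. cnj (h u u') * h u' u)"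
proof -
  let ?J = "Pow {..<N}"
  have "(\<Sum>A\<in>?J. \<Sum>B\<in>?J. pauli_form N (\<lambda>q. q \<in> A) (\<lambda>q. q \<in> B) h) =
    (\<Sum>A\<in>?J. \<Sum>B\<in>?J. \<Sum>u<2^N. \<Sum>u'<2^N. cnj (h u u') * (chi N (\<lambda>q. q \<in> B) (bit (flipb N (\<lambda>q. q \<in> A) u)) * chi N (\<lambda>q. q \<in> B) (bit u') * h (flipb N (\<lambda>q. q \<in> A) u) (flipb N (\<lambda>q. q \<in> A) u')))"
    unfolding pauli_form_eq ..
  also have "\<dots> = (\<Sum>u<2^N. \<Sum>u'<2^N. \<Sum>A\<in>?J. \<Sum>B\<in>?J. cnj (h u u') * (chi N (\<lambda>q. q \<in> B) (bit (flipb N (\<lambda>q. q \<in> A) u)) * chi N (\<lambda>q. q \<in> B) (bit u') * h (flipb N (\<lambda>q. q \<in> A) u) (flipb N (\<lambda>q. q \<in> A) u')))"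
    by (rule sum4_swap)
  also have "\<dots> = (\<Sum>u<2^N. \<Sum>u'<2^N. 2^N * (cnj (h u u') * h u' u))"
  proof (intro sum.cong refl)
    fix u u' :: nat assume "u \<in> {..<2^N}" "u' \<in> {..<2^N}"
    then have u: "u < 2^N" "u' < 2^N" by auto
    define A0 where "A0 = {q. q < N \<and> bit u q \<noteq> bit u' q}"
    have A0: "A0 \<in> ?J" unfolding A0_def by auto
    have "(\<Sum>A\<in>?J. \<Sum>B\<in>?J. cnj (h u u') * (chi N (\<lambda>q. q \<in> B) (bit (flipb N (\<lambda>q. q \<in> A) u)) * chi N (\<lambda>q. q \<in> B) (bit u') * h (flipb N (\<lambda>q. q \<in> A) u) (flipb N (\<lambda>q. q \<in> A) u')))
      = (\<Sum>A\<in>?J. cnj (h u u') * h (flipb N (\<lambda>q. q \<in> A) u) (flipb N (\<lambda>q. q \<in> A) u') *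
          (\<Sum>B\<in>?J. chi N (\<lambda>q. q \<in> B) (bit (flipb N (\<lambda>q. q \<in> A) u)) * chi N (\<lambda>q. q \<in> B) (bit u')))"
      by (simp add: sum_distrib_left mult_ac)
    also have "\<dots> = (\<Sum>A\<in>?J. if A = A0 then 2^N * (cnj (h u u') * h u' u) else 0)"
    proof (rule sum.cong[OF refl])
      fix A assume A: "A \<in> ?J"
      have iff: "(\<forall>q\<in>{..<N}. bit (flipb N (\<lambda>q. q \<in> A) u) q = bit u' q) \<longleftrightarrow> A = A0"
      proof
        assume "\<forall>q\<in>{..<N}. bit (flipb N (\<lambda>q. q \<in> A) u) q = bit u' q"
        then have "\<forall>q<N. q \<in> A \<longleftrightarrow> bit u q \<noteq> bit u' q" by (auto simp: flipb)
        then show "A = A0" using A unfolding A0_def by auto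
      qed (auto simp: flipb A0_def)
      have fl: "flipb N (\<lambda>q. q \<in> A0) u = u'" "flipb N (\<lambda>q. q \<in> A0) u' = u"
        by (subst nat_eq_bits[OF flipb(1)], use u in simp, auto simp: flipb A0_def)+
      show "cnj (h u u') * h (flipb N (\<lambda>q. q \<in> A) u) (flipb N (\<lambda>q. q \<in> A) u') *
          (\<Sum>B\<in>?J. chi N (\<lambda>q. q \<in> B) (bit (flipb N (\<lambda>q. q \<in> A) u)) * chi N (\<lambda>q. q \<in> B) (bit u')) =
          (if A = A0 then 2^N * (cnj (h u u') * h u' u) else 0)"
        unfolding sum_chi[OF subset_refl] iff by (cases "A = A0") (simp_all add: fl mult_ac)
    qed
    also have "\<dots> = 2^N * (cnj (h u u') * h u' u)" using A0 by simp
    finally show "(\<Sum>A\<in>?J. \<Sum>B\<in>?J. cnj (h u u') * (chi N (\<lambda>q. q \<in> B) (bit (flipb N (\<lambda>q. q \<in> A) u)) * chi N (\<lambda>q. q \<in> B) (bit u') * h (flipb N (\<lambda>q. q \<in> A) u) (flipb N (\<lambda>q. q \<in> A) u')))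
      = 2^N * (cnj (h u u') * h u' u)" .
  qed
  finally show ?thesis by (simp add: sum_distrib_left)
qed

lemma swap_form_le: "cmod (\<Sum>u<d. \<Sum>u'<d. cnj (h u u') * h u' u) \<le> nr2 d h"
proof -
  have "cmod (\<Sum>u<d. \<Sum>u'<d. cnj (h u u') * h u' u) \<le> (\<Sum>u<d. \<Sum>u'<d. ((cmod (h u u'))\<^sup>2 + (cmod (h u' u))\<^sup>2) / 2)"
  proof (intro sum_norm_le)
    fix u u'
    have "0 \<le> (cmod (h u u') - cmod (h u' u))\<^sup>2" by simp
    then show "cmod (cnj (h u u') * h u' u) \<le> ((cmod (h u u'))\<^sup>2 + (cmod (h u' u))\<^sup>2) / 2"
      by (simp add: norm_mult power2_eq_square algebra_simps)
  qed
  also have "\<dots> = (nr2 d h + (\<Sum>u<d. \<Sum>u'<d. (cmod (h u' u))\<^sup>2)) / 2"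
    unfolding nr2_def by (simp add: sum.distrib sum_divide_distrib[symmetric] add_divide_distrib)
  also have "(\<Sum>u<d. \<Sum>u'<d. (cmod (h u' u))\<^sup>2) = nr2 d h" unfolding nr2_def by (rule sum.swap)
  finally show ?thesis by simp
qed

lemma nr2_unitary: "G \<in> unitaries d \<Longrightarrow> nr2 d (op2 d G G h) = nr2 d h"
  using ip2_unitary[of G d h h] unfolding ip2_self by (metis of_real_eq_iff)

lemma qf_id: "qf N h (\<lambda>_. False) (\<lambda>_. False) = of_nat (card (clifford_group N)) * complex_of_real (nr2 (2^N) h)"
proof -
  have "pauli_form N (\<lambda>_. False) (\<lambda>_. False) k = complex_of_real (nr2 (2^N) k)" for k
    unfolding pauli_form_eq ip2_self[symmetric] ip2_def
    by (intro sum.cong refl) (simp add: flipb_none chi_none)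
  then show ?thesis unfolding qf_def using nr2_unitary[OF clifford_unitary] by simp
qed

text \<open>Agreement of the left halves is the projector \<open>2^-m\<close> times the sum of P
  tensor \<open>adj\<close> P over the Z-strings P on the left qubits. Its group average consists of
  the identity term and \<open>2^m - 1\<close> copies of the common nontrivial value
  \<open>q0\<close>. The sum over all Pauli operators, bounded through the swap, shows that
  \<open>q0\<close> is at most the identity term divided by \<open>d - 1\<close>, and
  \<open>2^m \<le> d\<close>; so both contributions are bounded by the identity term, which gives
  the 2.\<close>

theorem clifford_half_collision:
  assumes m: "0 < m"
  shows "(\<Sum>C\<in>clifford_group (2*m). \<Sum>u<2^(2*m). \<Sum>u'<2^(2*m). if u div 2^m = u' div 2^m then (cmod (op2 (2^(2*m)) C C h u u'))\<^sup>2 else 0)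
    \<le> real (card (clifford_group (2*m))) * (2 / 2^m * nr2 (2^(2*m)) h)"
proof -
  define N where "N = 2*m"
  define d where "d = (2::real)^N"
  define c where "c = real (card (clifford_group N))"
  define n where "n = nr2 (2^N) h"
  define q0 where "q0 = qf N h (\<lambda>p. p = 0) (\<lambda>_. False)"
  have n0: "0 \<le> n" unfolding n_def nr2_def by (intro sum_nonneg) auto
  have c0: "0 \<le> c" unfolding c_def by simp
  have d2: "2 \<le> d" unfolding d_def N_def using m by (metis One_nat_def Suc_leI mult_pos_pos pos2 power_increasing power_one_right one_le_numeral)
  have nonid: "qf N h (\<lambda>q. q \<in> A) (\<lambda>q. q \<in> B) = q0" if AB: "A \<subseteq> {..<N}" "B \<subseteq> {..<N}" "A \<noteq> {} \<or> B \<noteq> {}" for A B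
  proof -
    obtain q where "q \<in> A \<or> q \<in> B" using AB by blast
    then show ?thesis unfolding q0_def using AB by (intro qf_nonid[of q]) auto
  qed
  have idv: "qf N h (\<lambda>q. q \<in> {}) (\<lambda>q. q \<in> {}) = complex_of_real (c * n)"
    using qf_id[of N h] unfolding c_def n_def by simp
  have tot: "(\<Sum>A\<in>Pow {..<N}. \<Sum>B\<in>Pow {..<N}. qf N h (\<lambda>q. q \<in> A) (\<lambda>q. q \<in> B)) = complex_of_real (c * n) + complex_of_real (d * d - 1) * q0"
  proof -
    have "(\<Sum>A\<in>Pow {..<N}. \<Sum>B\<in>Pow {..<N}. qf N h (\<lambda>q. q \<in> A) (\<lambda>q. q \<in> B))
      = (\<Sum>p\<in>Pow {..<N} \<times> Pow {..<N}. qf N h (\<lambda>q. q \<in> fst p) (\<lambda>q. q \<in> snd p))"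
      by (simp add: sum.cartesian_product case_prod_beta')
    also have "\<dots> = complex_of_real (c * n) + (\<Sum>p\<in>Pow {..<N} \<times> Pow {..<N} - {({},{})}. qf N h (\<lambda>q. q \<in> fst p) (\<lambda>q. q \<in> snd p))"
      by (subst sum.remove[of _ "({},{})"]) (use idv in auto)
    also have "(\<Sum>p\<in>Pow {..<N} \<times> Pow {..<N} - {({},{})}. qf N h (\<lambda>q. q \<in> fst p) (\<lambda>q. q \<in> snd p)) = (\<Sum>p\<in>Pow {..<N} \<times> Pow {..<N} - {({},{})}. q0)"
      by (rule sum.cong[OF refl], rule nonid) auto
    also have "\<dots> = complex_of_real (d * d - 1) * q0"
    proof -
      have "card (Pow {..<N} \<times> Pow {..<N} - {({},{})}) = 2^N * 2^N - 1"
        by (subst card_Diff_singleton) (auto simp: card_cartesian_product card_Pow)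
      moreover have "real (2^N * 2^N - 1) = d * d - 1" unfolding d_def by (simp add: of_nat_diff)
      ultimately have "complex_of_real (real (card (Pow {..<N} \<times> Pow {..<N} - {({},{})}))) = complex_of_real (d * d - 1)" by (simp only:)
      then show ?thesis by (simp only: sum_constant of_real_of_nat_eq)
    qed
    finally show ?thesis .
  qed
  have totle: "cmod (\<Sum>A\<in>Pow {..<N}. \<Sum>B\<in>Pow {..<N}. qf N h (\<lambda>q. q \<in> A) (\<lambda>q. q \<in> B)) \<le> d * (c * n)"
  proof -
    have "(\<Sum>A\<in>Pow {..<N}. \<Sum>B\<in>Pow {..<N}. qf N h (\<lambda>q. q \<in> A) (\<lambda>q. q \<in> B))
      = (\<Sum>C\<in>clifford_group N. \<Sum>A\<in>Pow {..<N}. \<Sum>B\<in>Pow {..<N}. pauli_form N (\<lambda>q. q \<in> A) (\<lambda>q. q \<in> B) (op2 (2^N) C C h))"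
    proof -
      have "(\<Sum>A\<in>Pow {..<N}. \<Sum>B\<in>Pow {..<N}. qf N h (\<lambda>q. q \<in> A) (\<lambda>q. q \<in> B)) =
        (\<Sum>A\<in>Pow {..<N}. \<Sum>C\<in>clifford_group N. \<Sum>B\<in>Pow {..<N}. pauli_form N (\<lambda>q. q \<in> A) (\<lambda>q. q \<in> B) (op2 (2^N) C C h))"
        unfolding qf_def by (intro sum.cong refl sum.swap)
      also have "\<dots> = (\<Sum>C\<in>clifford_group N. \<Sum>A\<in>Pow {..<N}. \<Sum>B\<in>Pow {..<N}. pauli_form N (\<lambda>q. q \<in> A) (\<lambda>q. q \<in> B) (op2 (2^N) C C h))"
        by (rule sum.swap)
      finally show ?thesis .
    qed
    also have "cmod \<dots> \<le> (\<Sum>C\<in>clifford_group N. d * n)"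
    proof (rule sum_norm_le)
      fix C assume C: "C \<in> clifford_group N"
      show "cmod (\<Sum>A\<in>Pow {..<N}. \<Sum>B\<in>Pow {..<N}. pauli_form N (\<lambda>q. q \<in> A) (\<lambda>q. q \<in> B) (op2 (2^N) C C h)) \<le> d * n"
        unfolding sum_pauli_form d_def
        using swap_form_le[where d = "2^N" and h = "op2 (2^N) C C h"] nr2_unitary[OF clifford_unitary[OF C], of h]
        by (simp add: norm_mult norm_power n_def)
    qed
    finally show ?thesis unfolding c_def by (simp add: mult_ac)
  qed
  have q0le: "(d - 1) * cmod q0 \<le> c * n"
  proof -
    have "(d * d - 1) * cmod q0 = cmod (complex_of_real (d * d - 1) * q0)"
      using d2 mult_mono[of 1 d 1 d] by (simp add: norm_mult del: of_real_diff)
    also have "\<dots> \<le> cmod (complex_of_real (c * n) + complex_of_real (d * d - 1) * q0) + cmod (complex_of_real (c * n))"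
      by (metis add_diff_cancel_left' norm_triangle_ineq4 add.commute)
    also have "\<dots> \<le> d * (c * n) + c * n" using totle c0 n0 unfolding tot by (simp add: norm_mult)
    \<comment> \<open>Uses \<open>d * d - 1 = (d + 1) * (d - 1)\<close>; the common factor
      \<open>d + 1\<close> is then cancelled.\<close>
    finally have "(d + 1) * ((d - 1) * cmod q0) \<le> (d + 1) * (c * n)" by (simp add: algebra_simps)
    then show ?thesis by (rule mult_left_le_imp_le) (use d2 in simp)
  qed
  \<comment> \<open>The positions of the left half: \<open>x div 2^m\<close> consists of the bits
    from \<open>m\<close> upwards.\<close>
  define J where "J = {m..<2*m}"
  have JN: "J \<subseteq> {..<N}" unfolding J_def N_def by auto
  have cJ: "card J = m" unfolding J_def by simp
  have ag: "(u div 2^m = u' div 2^m) \<longleftrightarrow> (\<forall>q\<in>J. bit u q = bit u' q)" if u: "u < 2^N" "u' < 2^N" for u u' :: nat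
  proof -
    have "u div 2^m = u' div 2^m \<longleftrightarrow> drop_bit m u = drop_bit m u'" by (simp add: drop_bit_eq_div)
    also have "\<dots> \<longleftrightarrow> (\<forall>p. bit u (m + p) = bit u' (m + p))" by (simp add: bit_eq_iff bit_drop_bit_eq)
    also have "\<dots> \<longleftrightarrow> (\<forall>q\<in>J. bit u q = bit u' q)"
    proof
      assume a: "\<forall>q\<in>J. bit u q = bit u' q"
      show "\<forall>p. bit u (m + p) = bit u' (m + p)"
      proof
        fix p show "bit u (m + p) = bit u' (m + p)"
          using a nat_bit_ge[OF u(1), of "m + p"] nat_bit_ge[OF u(2), of "m + p"]
          by (cases "m + p < N") (auto simp: J_def N_def)
      qed
    next
      assume a: "\<forall>p. bit u (m + p) = bit u' (m + p)"
      show "\<forall>q\<in>J. bit u q = bit u' q"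
      proof
        fix q assume "q \<in> J"
        then show "bit u q = bit u' q" using a[rule_format, of "q - m"] by (simp add: J_def)
      qed
    qed
    finally show ?thesis .
  qed
  let ?L = "\<Sum>C\<in>clifford_group N. \<Sum>u<2^N. \<Sum>u'<2^N. if u div 2^m = u' div 2^m then (cmod (op2 (2^N) C C h u u'))\<^sup>2 else 0"
  have "complex_of_real (2^m * ?L) = (\<Sum>B\<in>Pow J. qf N h (\<lambda>q. q \<in> {}) (\<lambda>q. q \<in> B))"
  proof -
    have zf: "(\<Sum>B\<in>Pow J. pauli_form N (\<lambda>q. q \<in> {}) (\<lambda>q. q \<in> B) k) =
      complex_of_real (2^m * (\<Sum>u<2^N. \<Sum>u'<2^N. if u div 2^m = u' div 2^m then (cmod (k u u'))\<^sup>2 else 0))" for k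
    proof -
      have "(\<Sum>B\<in>Pow J. pauli_form N (\<lambda>q. q \<in> {}) (\<lambda>q. q \<in> B) k) =
        (\<Sum>B\<in>Pow J. \<Sum>u<2^N. \<Sum>u'<2^N. (chi N (\<lambda>q. q \<in> B) (bit u) * chi N (\<lambda>q. q \<in> B) (bit u')) * complex_of_real ((cmod (k u u'))\<^sup>2))"
        unfolding pauli_form_eq
        by (intro sum.cong refl) (simp add: flipb_none complex_norm_square mult_ac del: of_real_power)
      also have "\<dots> = (\<Sum>u<2^N. \<Sum>B\<in>Pow J. \<Sum>u'<2^N. (chi N (\<lambda>q. q \<in> B) (bit u) * chi N (\<lambda>q. q \<in> B) (bit u')) * complex_of_real ((cmod (k u u'))\<^sup>2))"
        by (rule sum.swap)
      also have "\<dots> = (\<Sum>u<2^N. \<Sum>u'<2^N. (\<Sum>B\<in>Pow J. chi N (\<lambda>q. q \<in> B) (bit u) * chi N (\<lambda>q. q \<in> B) (bit u')) * complex_of_real ((cmod (k u u'))\<^sup>2))"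
        unfolding sum_distrib_right by (intro sum.cong refl sum.swap)
      also have "\<dots> = (\<Sum>u<2^N. \<Sum>u'<2^N. complex_of_real (2^m * (if u div 2^m = u' div 2^m then (cmod (k u u'))\<^sup>2 else 0)))"
        by (intro sum.cong refl) (simp add: sum_chi[OF JN] cJ ag)
      finally show ?thesis by (simp add: sum_distrib_left)
    qed
    have "(\<Sum>B\<in>Pow J. qf N h (\<lambda>q. q \<in> {}) (\<lambda>q. q \<in> B)) = (\<Sum>C\<in>clifford_group N. \<Sum>B\<in>Pow J. pauli_form N (\<lambda>q. q \<in> {}) (\<lambda>q. q \<in> B) (op2 (2^N) C C h))"
      unfolding qf_def by (rule sum.swap)
    then show ?thesis unfolding zf by (simp add: sum_distrib_left)
  qed
  also have "\<dots> = complex_of_real (c * n) + complex_of_real (2^m - 1) * q0"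
  proof -
    have fJ: "finite (Pow J)" unfolding J_def by simp
    have "(\<Sum>B\<in>Pow J. qf N h (\<lambda>q. q \<in> {}) (\<lambda>q. q \<in> B)) = complex_of_real (c * n) + (\<Sum>B\<in>Pow J - {{}}. qf N h (\<lambda>q. q \<in> {}) (\<lambda>q. q \<in> B))"
      by (subst sum.remove[OF fJ, of "{}"]) (use idv in auto)
    also have "(\<Sum>B\<in>Pow J - {{}}. qf N h (\<lambda>q. q \<in> {}) (\<lambda>q. q \<in> B)) = (\<Sum>B\<in>Pow J - {{}}. q0)"
      by (rule sum.cong[OF refl], rule nonid) (use JN in auto)
    also have "\<dots> = complex_of_real (2^m - 1) * q0"
    proof -
      have "card (Pow J - {{}}) = 2^m - 1" using fJ cJ by (subst card_Diff_singleton) (auto simp: card_Pow J_def)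
      moreover have "real (2^m - 1) = 2^m - 1" by (simp add: of_nat_diff)
      ultimately have "complex_of_real (real (card (Pow J - {{}}))) = complex_of_real (2^m - 1)" by (simp only:)
      then show ?thesis by (simp only: sum_constant of_real_of_nat_eq)
    qed
    finally show ?thesis .
  qed
  finally have eq: "complex_of_real (2^m * ?L) = complex_of_real (c * n) + complex_of_real (2^m - 1) * q0" .
  have pm: "(2::real)^m \<le> d" unfolding d_def N_def by (intro power_increasing) auto
  have pm1: "(1::real) \<le> 2^m" by simp
  have "2^m * ?L \<le> cmod (complex_of_real (2^m * ?L))" unfolding norm_of_real by (rule abs_ge_self)
  also have "\<dots> \<le> c * n + (2^m - 1) * cmod q0"
  proof -
    have "cmod (complex_of_real (c * n) + complex_of_real (2^m - 1) * q0) \<le> cmod (complex_of_real (c * n)) + cmod (complex_of_real (2^m - 1) * q0)"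
      by (rule norm_triangle_ineq)
    also have "\<dots> = c * n + (2^m - 1) * cmod q0"
      unfolding norm_mult norm_of_real using c0 n0 pm1 by simp
    finally show ?thesis unfolding eq .
  qed
  also have "\<dots> \<le> c * n + (d - 1) * cmod q0" using pm by (intro add_left_mono mult_right_mono) auto
  also have "\<dots> \<le> 2 * (c * n)" using q0le by simp
  finally have "?L \<le> 2 * (c * n) / 2^m" by (simp add: field_simps)
  then show ?thesis unfolding c_def n_def N_def by (simp add: mult_ac)
qed

section \<open>The LRFC block\<close>

definition sg :: "(nat \<Rightarrow> bool) \<Rightarrow> nat \<Rightarrow> complex" where
  "sg f u = (if f u then -1 else 1)"

text \<open>The sign that the diagonal operator \<open>F\<close> contributes to a
  \<open>k\<close>-tuple of basis states.\<close>

definition chr :: "nat \<Rightarrow> (nat \<Rightarrow> bool) \<Rightarrow> (nat \<Rightarrow> nat) \<Rightarrow> complex" where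
  "chr k f U = (\<Prod>j<k. sg f (U j))"

definition bfun :: "nat \<Rightarrow> (nat \<Rightarrow> bool) set" where
  "bfun d = ({..<d} \<rightarrow>\<^sub>E (UNIV :: bool set))"

lemma finite_bfun [simp]: "finite (bfun d)" unfolding bfun_def by (intro finite_PiE) auto

lemma bfun_nonempty [simp]: "bfun d \<noteq> {}" unfolding bfun_def by (auto simp: PiE_eq_empty_iff)

text \<open>If \<open>U'\<close> is not a rearrangement of the injective \<open>U\<close>, counting
  shows that some value \<open>U i\<close> is missing from \<open>U'\<close>; flipping
  \<open>f\<close> at that value changes the sign of the first factor only, so the sum is its own
  negative. For a rearrangement the two signs agree and multiply to 1.\<close>

lemma chr_orth:
  assumes U: "U \<in> tup k {..<d}" "inj_on U {..<k}" and U': "U' \<in> tup k {..<d}"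
  shows "(\<Sum>f\<in>bfun d. chr k f U * chr k f U') = (if U' \<in> (\<lambda>\<pi>. U \<circ> \<pi>) ` perms k then of_nat (card (bfun d)) else 0)"
proof (cases "U' \<in> (\<lambda>\<pi>. U \<circ> \<pi>) ` perms k")
  case True
  then obtain \<pi> where p: "\<pi> \<in> perms k" "U' = U \<circ> \<pi>" by auto
  have "chr k f U * chr k f U' = 1" for f
  proof -
    have "chr k f U' = chr k f U" unfolding chr_def p(2) using prod_perm_comp[OF p(1), of "\<lambda>j. sg f (U j)"] by simp
    moreover have "chr k f U * chr k f U = (\<Prod>j<k. 1)"
      unfolding chr_def prod.distrib[symmetric] by (rule prod.cong) (auto simp: sg_def)
    ultimately show ?thesis by simp
  qed
  then show ?thesis using True by simp
next
  case False
  have "\<not> U ` {..<k} \<subseteq> U' ` {..<k}"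
  proof
    assume sub: "U ` {..<k} \<subseteq> U' ` {..<k}"
    have cU: "card (U ` {..<k}) = k" using U(2) by (simp add: card_image)
    have "card (U' ` {..<k}) \<le> k" using card_image_le[of "{..<k}" U'] by simp
    then have eq: "U ` {..<k} = U' ` {..<k}" using sub cU by (intro card_seteq) auto
    define \<pi> where "\<pi> j = (if j < k then inv_into {..<k} U (U' j) else j)" for j
    have pj: "\<pi> j < k \<and> U (\<pi> j) = U' j" if "j < k" for j
    proof -
      have "U' j \<in> U ` {..<k}" using eq that by auto
      then show ?thesis using that inv_into_into[of "U' j" U "{..<k}"] f_inv_into_f[of "U' j" U "{..<k}"]
        unfolding \<pi>_def by simp
    qed
    have injU': "inj_on U' {..<k}" using eq cU by (intro eq_card_imp_inj_on) auto
    have "inj_on \<pi> {..<k}"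
    proof (rule inj_onI)
      fix i j assume ij: "i \<in> {..<k}" "j \<in> {..<k}" "\<pi> i = \<pi> j"
      then have "U' i = U' j" using pj[of i] pj[of j] by auto
      then show "i = j" using injU' ij by (auto dest: inj_onD)
    qed
    moreover have "\<pi> ` {..<k} \<subseteq> {..<k}" using pj by auto
    ultimately have bij: "bij_betw \<pi> {..<k} {..<k}" unfolding bij_betw_def by (simp add: endo_inj_surj)
    have "\<pi> x = x" if "x \<notin> {..<k}" for x using that by (simp add: \<pi>_def)
    then have perm: "\<pi> \<in> perms k" unfolding perms_def using bij_imp_permutes[OF bij] by blast
    have "U' = U \<circ> \<pi>" by (rule tup_eqI[OF U' tup_comp[OF U(1) perm]]) (use pj in auto)
    then show False using False perm by blast
  qed
  then obtain i where i: "i < k" "U i \<notin> U' ` {..<k}" by auto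
  define v where "v = U i"
  have vd: "v < d" using tup_app[OF U(1) i(1)] unfolding v_def by simp
  define flip where "flip f = f(v := \<not> f v)" for f :: "nat \<Rightarrow> bool"
  have ff: "flip (flip f) = f" for f unfolding flip_def by auto
  have fl: "flip f \<in> bfun d" if "f \<in> bfun d" for f
    using that vd unfolding flip_def bfun_def by (auto simp: PiE_iff extensional_def)
  have c1: "chr k (flip f) U = - chr k f U" for f
  proof -
    have e: "chr k g U = sg g (U i) * (\<Prod>j\<in>{..<k}-{i}. sg g (U j))" for g unfolding chr_def
      using i(1) by (subst prod.remove[of _ i]) auto
    have "(\<Prod>j\<in>{..<k}-{i}. sg (flip f) (U j)) = (\<Prod>j\<in>{..<k}-{i}. sg f (U j))"
    proof (rule prod.cong[OF refl])
      fix j assume "j \<in> {..<k}-{i}"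
      then have "U j \<noteq> v" unfolding v_def using U(2) i(1) by (auto dest: inj_onD)
      then show "sg (flip f) (U j) = sg f (U j)" unfolding sg_def flip_def by simp
    qed
    moreover have "sg (flip f) (U i) = - sg f (U i)" unfolding sg_def flip_def v_def by simp
    ultimately show ?thesis unfolding e by simp
  qed
  have c2: "chr k (flip f) U' = chr k f U'" for f
    unfolding chr_def
  proof (rule prod.cong[OF refl])
    fix j assume "j \<in> {..<k}"
    then have "U' j \<noteq> v" using i(2) unfolding v_def by force
    then show "sg (flip f) (U' j) = sg f (U' j)" unfolding sg_def flip_def by simp
  qed
  have "(\<Sum>f\<in>bfun d. chr k f U * chr k f U') = (\<Sum>f\<in>bfun d. chr k (flip f) U * chr k (flip f) U')"
    by (rule sum.reindex_bij_witness[of _ flip flip]) (auto simp: ff fl)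
  also have "\<dots> = - (\<Sum>f\<in>bfun d. chr k f U * chr k f U')" unfolding c1 c2 by (simp add: sum_negf)
  finally show ?thesis using False by simp
qed

text \<open>Random signs decouple tuples that are not rearrangements of each other. As
  \<open>W\<close> is closed under permutations, the part over \<open>W\<close> is orthogonal to the
  rest, so the rest can only add; within \<open>W\<close> the surviving terms are the symmetrised
  squares, each orbit being counted \<open>fact k\<close> times.\<close>

lemma phase_average:
  fixes G :: "(nat \<Rightarrow> nat) \<Rightarrow> complex"
  assumes W: "W \<subseteq> tup k {..<d}" "\<And>U. U \<in> W \<Longrightarrow> inj_on U {..<k}" "\<And>U \<pi>. U \<in> W \<Longrightarrow> \<pi> \<in> perms k \<Longrightarrow> U \<circ> \<pi> \<in> W"
  shows "real (card (bfun d)) / fact k * (\<Sum>U\<in>W. (cmod (\<Sum>\<pi>\<in>perms k. G (U \<circ> \<pi>)))\<^sup>2)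
    \<le> (\<Sum>f\<in>bfun d. (cmod (\<Sum>U\<in>tup k {..<d}. chr k f U * G U))\<^sup>2)"
proof -
  let ?T = "tup k {..<d}"
  define n where "n = card (bfun d)"
  have finW: "finite W" using W(1) finite_subset finite_tup by blast
  define Sg where "Sg f = (\<Sum>U\<in>W. chr k f U * G U)" for f
  define Sb where "Sb f = (\<Sum>U\<in>?T - W. chr k f U * G U)" for f
  have split: "(\<Sum>U\<in>?T. chr k f U * G U) = Sg f + Sb f" for f
    unfolding Sg_def Sb_def using W(1) by (subst sum.subset_diff[of W]) auto
  have cc: "cnj (chr k f U) = chr k f U" for f U unfolding chr_def sg_def by (simp add: if_distrib[of cnj] cong: if_cong)
  have prod: "(\<Sum>f\<in>bfun d. cnj (Sg f) * (\<Sum>U'\<in>V. chr k f U' * G U')) = (\<Sum>U\<in>W. \<Sum>U'\<in>V. cnj (G U) * G U' * (if U' \<in> (\<lambda>\<pi>. U \<circ> \<pi>) ` perms k then of_nat n else 0))"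
    if V: "V \<subseteq> ?T" for V
  proof -
    have "(\<Sum>f\<in>bfun d. cnj (Sg f) * (\<Sum>U'\<in>V. chr k f U' * G U')) = (\<Sum>f\<in>bfun d. \<Sum>U\<in>W. \<Sum>U'\<in>V. cnj (G U) * G U' * (chr k f U * chr k f U'))"
      unfolding Sg_def cnj_sum sum_product by (intro sum.cong refl) (simp add: cc mult_ac)
    also have "\<dots> = (\<Sum>U\<in>W. \<Sum>f\<in>bfun d. \<Sum>U'\<in>V. cnj (G U) * G U' * (chr k f U * chr k f U'))" by (rule sum.swap)
    also have "\<dots> = (\<Sum>U\<in>W. \<Sum>U'\<in>V. \<Sum>f\<in>bfun d. cnj (G U) * G U' * (chr k f U * chr k f U'))" by (intro sum.cong refl sum.swap)
    also have "\<dots> = (\<Sum>U\<in>W. \<Sum>U'\<in>V. cnj (G U) * G U' * (if U' \<in> (\<lambda>\<pi>. U \<circ> \<pi>) ` perms k then of_nat n else 0))"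
    proof (intro sum.cong refl)
      fix U U' assume "U \<in> W" "U' \<in> V"
      then have "(\<Sum>f\<in>bfun d. chr k f U * chr k f U') = (if U' \<in> (\<lambda>\<pi>. U \<circ> \<pi>) ` perms k then of_nat n else 0)"
        unfolding n_def using W V by (intro chr_orth) auto
      then show "(\<Sum>f\<in>bfun d. cnj (G U) * G U' * (chr k f U * chr k f U')) = cnj (G U) * G U' * (if U' \<in> (\<lambda>\<pi>. U \<circ> \<pi>) ` perms k then of_nat n else 0)"
        by (simp only: sum_distrib_left[symmetric])
    qed
    finally show ?thesis .
  qed
  have cross: "(\<Sum>f\<in>bfun d. cnj (Sg f) * Sb f) = 0"
  proof -
    have "(\<Sum>f\<in>bfun d. cnj (Sg f) * Sb f) = (\<Sum>U\<in>W. \<Sum>U'\<in>?T - W. cnj (G U) * G U' * (if U' \<in> (\<lambda>\<pi>. U \<circ> \<pi>) ` perms k then of_nat n else 0))"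
      unfolding Sb_def by (rule prod) auto
    also have "\<dots> = 0"
    proof (intro sum.neutral ballI)
      fix U U' assume "U \<in> W" "U' \<in> ?T - W"
      then have "U' \<notin> (\<lambda>\<pi>. U \<circ> \<pi>) ` perms k" using W(3) by auto
      then show "cnj (G U) * G U' * (if U' \<in> (\<lambda>\<pi>. U \<circ> \<pi>) ` perms k then of_nat n else 0) = 0" by simp
    qed
    finally show ?thesis .
  qed
  have inj: "inj_on (\<lambda>\<pi>. U \<circ> \<pi>) (perms k)" if "U \<in> W" for U
  proof (rule inj_onI)
    fix \<pi> \<kappa> assume p: "\<pi> \<in> perms k" "\<kappa> \<in> perms k" "U \<circ> \<pi> = U \<circ> \<kappa>"
    show "\<pi> = \<kappa>"
    proof
      fix j show "\<pi> j = \<kappa> j"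
      proof (cases "j < k")
        case True
        have "U (\<pi> j) = U (\<kappa> j)" using fun_cong[OF p(3), of j] by simp
        then show ?thesis using W(2)[OF that] p True by (auto dest!: inj_onD simp: perms_lt)
      qed (use p in \<open>auto simp: perms_def permutes_not_in\<close>)
    qed
  qed
  have diag: "(\<Sum>f\<in>bfun d. cnj (Sg f) * Sg f) = of_nat n * (\<Sum>U\<in>W. cnj (G U) * (\<Sum>\<pi>\<in>perms k. G (U \<circ> \<pi>)))"
  proof -
    have "(\<Sum>f\<in>bfun d. cnj (Sg f) * Sg f) = (\<Sum>U\<in>W. \<Sum>U'\<in>W. cnj (G U) * G U' * (if U' \<in> (\<lambda>\<pi>. U \<circ> \<pi>) ` perms k then of_nat n else 0))"
      using prod[OF W(1)] unfolding Sg_def .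
    also have "\<dots> = (\<Sum>U\<in>W. of_nat n * (cnj (G U) * (\<Sum>\<pi>\<in>perms k. G (U \<circ> \<pi>))))"
    proof (rule sum.cong[OF refl])
      fix U assume U: "U \<in> W"
      have "(\<Sum>U'\<in>W. cnj (G U) * G U' * (if U' \<in> (\<lambda>\<pi>. U \<circ> \<pi>) ` perms k then of_nat n else 0)) = (\<Sum>U'\<in>W \<inter> (\<lambda>\<pi>. U \<circ> \<pi>) ` perms k. cnj (G U) * G U' * of_nat n)"
        unfolding sum.inter_restrict[OF finW] by (rule sum.cong) auto
      also have "W \<inter> (\<lambda>\<pi>. U \<circ> \<pi>) ` perms k = (\<lambda>\<pi>. U \<circ> \<pi>) ` perms k" using W(3)[OF U] by auto
      also have "(\<Sum>U'\<in>(\<lambda>\<pi>. U \<circ> \<pi>) ` perms k. cnj (G U) * G U' * of_nat n) = (\<Sum>\<pi>\<in>perms k. cnj (G U) * G (U \<circ> \<pi>) * of_nat n)"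
        by (simp add: sum.reindex[OF inj[OF U]])
      also have "\<dots> = of_nat n * (cnj (G U) * (\<Sum>\<pi>\<in>perms k. G (U \<circ> \<pi>)))"
        by (simp add: sum_distrib_left mult_ac)
      finally show "(\<Sum>U'\<in>W. cnj (G U) * G U' * (if U' \<in> (\<lambda>\<pi>. U \<circ> \<pi>) ` perms k then of_nat n else 0)) = of_nat n * (cnj (G U) * (\<Sum>\<pi>\<in>perms k. G (U \<circ> \<pi>)))" .
    qed
    finally show ?thesis by (simp add: sum_distrib_left)
  qed
  have bijW: "(\<Sum>U\<in>W. h (U \<circ> \<kappa>)) = (\<Sum>U\<in>W. h U)" if k: "\<kappa> \<in> perms k" for \<kappa> and h :: "(nat \<Rightarrow> nat) \<Rightarrow> complex"
    by (rule sum.reindex_bij_witness[of _ "\<lambda>X. X \<circ> inv_into UNIV \<kappa>" "\<lambda>X. X \<circ> \<kappa>"])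
      (use k W(3) in \<open>auto intro!: perms_inv simp: comp_assoc perms_o_inv\<close>)
  have sq: "complex_of_real (\<Sum>U\<in>W. (cmod (\<Sum>\<pi>\<in>perms k. G (U \<circ> \<pi>)))\<^sup>2) = fact k * (\<Sum>U\<in>W. cnj (G U) * (\<Sum>\<pi>\<in>perms k. G (U \<circ> \<pi>)))"
  proof -
    have "complex_of_real (\<Sum>U\<in>W. (cmod (\<Sum>\<pi>\<in>perms k. G (U \<circ> \<pi>)))\<^sup>2) = (\<Sum>U\<in>W. (\<Sum>\<kappa>\<in>perms k. cnj (G (U \<circ> \<kappa>))) * (\<Sum>\<pi>\<in>perms k. G (U \<circ> \<pi>)))"
      unfolding of_real_sum by (intro sum.cong refl) (simp add: complex_norm_square mult.commute del: of_real_power)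
    also have "\<dots> = (\<Sum>U\<in>W. \<Sum>\<kappa>\<in>perms k. cnj (G (U \<circ> \<kappa>)) * (\<Sum>\<pi>\<in>perms k. G (U \<circ> \<kappa> \<circ> \<pi>)))"
      unfolding sum_distrib_right
    proof (intro sum.cong refl)
      fix U \<kappa> assume "\<kappa> \<in> perms k"
      then show "cnj (G (U \<circ> \<kappa>)) * (\<Sum>\<pi>\<in>perms k. G (U \<circ> \<pi>)) = cnj (G (U \<circ> \<kappa>)) * (\<Sum>\<pi>\<in>perms k. G (U \<circ> \<kappa> \<circ> \<pi>))"
        using sum_perms_comp[of \<kappa> k "\<lambda>\<pi>. G (U \<circ> \<pi>)"] by (simp add: comp_assoc)
    qed
    also have "\<dots> = (\<Sum>\<kappa>\<in>perms k. \<Sum>U\<in>W. cnj (G (U \<circ> \<kappa>)) * (\<Sum>\<pi>\<in>perms k. G (U \<circ> \<kappa> \<circ> \<pi>)))" by (rule sum.swap)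
    also have "\<dots> = (\<Sum>\<kappa>\<in>perms k. \<Sum>U\<in>W. cnj (G U) * (\<Sum>\<pi>\<in>perms k. G (U \<circ> \<pi>)))"
      by (rule sum.cong[OF refl], rule bijW)
    finally show ?thesis by (simp add: card_perms)
  qed
  have "complex_of_real (\<Sum>f\<in>bfun d. (cmod (Sg f))\<^sup>2) = (\<Sum>f\<in>bfun d. cnj (Sg f) * Sg f)"
    unfolding of_real_sum by (intro sum.cong refl) (simp add: complex_norm_square mult.commute del: of_real_power)
  also have "\<dots> = complex_of_real (real n / fact k * (\<Sum>U\<in>W. (cmod (\<Sum>\<pi>\<in>perms k. G (U \<circ> \<pi>)))\<^sup>2))"
    unfolding diag of_real_mult sq by simp
  finally have "(\<Sum>f\<in>bfun d. (cmod (Sg f))\<^sup>2) = real n / fact k * (\<Sum>U\<in>W. (cmod (\<Sum>\<pi>\<in>perms k. G (U \<circ> \<pi>)))\<^sup>2)"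
    using of_real_eq_iff by blast
  \<comment> \<open>Expanding the square, the mixed term averages to zero by \<open>cross\<close>,
    and the contribution of \<open>Sb\<close> is nonnegative.\<close>
  moreover have "(\<Sum>f\<in>bfun d. (cmod (Sg f))\<^sup>2) \<le> (\<Sum>f\<in>bfun d. (cmod (Sg f + Sb f))\<^sup>2)"
  proof -
    have "(cmod (Sg f + Sb f))\<^sup>2 = (cmod (Sg f))\<^sup>2 + (cmod (Sb f))\<^sup>2 + 2 * Re (cnj (Sg f) * Sb f)" for f
      unfolding cmod_power2 by (simp add: algebra_simps power2_eq_square)
    then have "(\<Sum>f\<in>bfun d. (cmod (Sg f + Sb f))\<^sup>2) = (\<Sum>f\<in>bfun d. (cmod (Sg f))\<^sup>2) + (\<Sum>f\<in>bfun d. (cmod (Sb f))\<^sup>2) + 2 * Re (\<Sum>f\<in>bfun d. cnj (Sg f) * Sb f)"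
      by (simp add: sum.distrib sum_distrib_left)
    then show ?thesis unfolding cross by (simp add: sum_nonneg)
  qed
  ultimately show ?thesis unfolding split n_def by simp
qed

text \<open>Prescribing values at \<open>k\<close> distinct points leaves free choices at the other
  \<open>card A - k\<close>; stated as a product to stay within the naturals.\<close>

lemma card_prescribed:
  assumes A: "finite A" "a ` {..<k} \<subseteq> A" "inj_on a {..<k}" and b: "\<And>j. j < k \<Longrightarrow> b j \<in> B" and B: "finite B"
  shows "card {h \<in> A \<rightarrow>\<^sub>E B. \<forall>j<k. h (a j) = b j} * card B ^ k = card (A \<rightarrow>\<^sub>E B)"
proof -
  let ?S = "\<lambda>x. if x \<in> a ` {..<k} then {b (inv_into {..<k} a x)} else B"
  have "{h \<in> A \<rightarrow>\<^sub>E B. \<forall>j<k. h (a j) = b j} = Pi\<^sub>E A ?S"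
  proof (rule Set.set_eqI, rule iffI)
    fix h assume "h \<in> {h \<in> A \<rightarrow>\<^sub>E B. \<forall>j<k. h (a j) = b j}"
    then have h: "h \<in> A \<rightarrow>\<^sub>E B" "\<And>j. j < k \<Longrightarrow> h (a j) = b j" by auto
    show "h \<in> Pi\<^sub>E A ?S"
    proof (rule PiE_I)
      fix x assume "x \<in> A"
      then show "h x \<in> ?S x" using h(2) PiE_mem[OF h(1)] A(3) by (auto simp: inv_into_f_f)
    next
      fix x assume "x \<notin> A" then show "h x = undefined" by (rule PiE_arb[OF h(1)])
    qed
  next
    fix h assume h: "h \<in> Pi\<^sub>E A ?S"
    have "h (a j) = b j" if "j < k" for j
      using PiE_mem[OF h, of "a j"] A that by (auto simp: inv_into_f_f)
    moreover have "h \<in> A \<rightarrow>\<^sub>E B"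
    proof (rule PiE_I)
      fix x assume x: "x \<in> A"
      show "h x \<in> B"
      proof (cases "x \<in> a ` {..<k}")
        case True
        then obtain j where "j < k" "x = a j" by auto
        then show ?thesis using calculation b by simp
      next
        case False then show ?thesis using PiE_mem[OF h x] by simp
      qed
    next
      fix x assume "x \<notin> A" then show "h x = undefined" by (rule PiE_arb[OF h])
    qed
    ultimately show "h \<in> {h \<in> A \<rightarrow>\<^sub>E B. \<forall>j<k. h (a j) = b j}" by simp
  qed
  then have "card {h \<in> A \<rightarrow>\<^sub>E B. \<forall>j<k. h (a j) = b j} = (\<Prod>x\<in>A. card (?S x))"
    using A(1) by (simp add: card_PiE)
  also have "\<dots> = (\<Prod>x\<in>a ` {..<k}. card (?S x)) * (\<Prod>x\<in>A - a ` {..<k}. card (?S x))"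
    using A by (subst prod.subset_diff[of "a ` {..<k}"]) (auto simp: mult.commute)
  also have "\<dots> = card B ^ (card A - k)"
    using A by (simp add: card_Diff_subset card_image)
  finally have "card {h \<in> A \<rightarrow>\<^sub>E B. \<forall>j<k. h (a j) = b j} * card B ^ k = card B ^ (card A - k + k)"
    by (simp add: power_add)
  also have "card A - k + k = card A" using A card_mono[OF A(1,2)] by (simp add: card_image)
  finally show ?thesis using A(1) by (simp add: card_PiE)
qed

definition pR :: "nat \<Rightarrow> (nat \<Rightarrow> nat) \<Rightarrow> nat \<Rightarrow> nat" where
  "pR m h u = (u div 2^m) * 2^m + Bit_Operations.xor (u mod 2^m) (h (u div 2^m))"

definition pL :: "nat \<Rightarrow> (nat \<Rightarrow> nat) \<Rightarrow> nat \<Rightarrow> nat" where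
  "pL m h u = Bit_Operations.xor (u div 2^m) (h (u mod 2^m)) * 2^m + u mod 2^m"

lemma S_L_perm: "S_L m h = perm_mat (2^(2*m)) (pL m h)" and S_R_perm: "S_R m h = perm_mat (2^(2*m)) (pR m h)"
  unfolding S_L_def S_R_def pL_def[abs_def] pR_def[abs_def] by simp_all

lemma half_lt: "u < 2^(2*m) \<Longrightarrow> u div 2^m < (2::nat)^m"
  by (rule less_mult_imp_div_less) (simp add: mult_2 power_add)

lemma halves_lt: "a < 2^m \<Longrightarrow> b < 2^m \<Longrightarrow> a * 2^m + b < (2::nat)^(2*m)"
proof -
  assume a: "a < 2^m" "b < (2::nat)^m"
  then have "(a + 1) * 2^m \<le> 2^m * (2::nat)^m" by (intro mult_right_mono) auto
  then show ?thesis using a by (simp add: mult_2 power_add)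
qed

lemma bool_funs_lt: "h \<in> bool_funs m \<Longrightarrow> x < 2^m \<Longrightarrow> h x < 2^m"
  unfolding bool_funs_def by (drule PiE_mem[of _ _ _ x]) auto

lemma pR_props:
  assumes "u < 2^(2*m)" "h \<in> bool_funs m"
  shows "pR m h u < 2^(2*m)" "pR m h u div 2^m = u div 2^m" "pR m h u mod 2^m = Bit_Operations.xor (u mod 2^m) (h (u div 2^m))"
proof -
  have x: "Bit_Operations.xor (u mod 2^m) (h (u div 2^m)) < 2^m"
    using assms half_lt bool_funs_lt by (intro xor_lt) auto
  show "pR m h u < 2^(2*m)" unfolding pR_def by (rule halves_lt[OF half_lt[OF assms(1)] x])
  show "pR m h u div 2^m = u div 2^m" "pR m h u mod 2^m = Bit_Operations.xor (u mod 2^m) (h (u div 2^m))"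
    unfolding pR_def using x by simp_all
qed

lemma pL_props:
  assumes "u < 2^(2*m)" "h \<in> bool_funs m"
  shows "pL m h u < 2^(2*m)" "pL m h u mod 2^m = u mod 2^m" "pL m h u div 2^m = Bit_Operations.xor (u div 2^m) (h (u mod 2^m))"
proof -
  have x: "Bit_Operations.xor (u div 2^m) (h (u mod 2^m)) < 2^m"
    using assms half_lt bool_funs_lt by (intro xor_lt) auto
  show "pL m h u < 2^(2*m)" unfolding pL_def by (rule halves_lt[OF x]) simp
  show "pL m h u mod 2^m = u mod 2^m" "pL m h u div 2^m = Bit_Operations.xor (u div 2^m) (h (u mod 2^m))"
    unfolding pL_def by simp_all
qed

lemma xor_eq_iff: "Bit_Operations.xor a b = c \<longleftrightarrow> b = Bit_Operations.xor a (c::nat)"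
  by (metis xor.assoc xor.commute xor.right_neutral xor_self_eq)

text \<open>The output \<open>z\<close> constrains \<open>hR\<close> at the left half of
  \<open>u\<close> and \<open>hL\<close> at the right half of \<open>z\<close>. Distinct left halves
  of the inputs and distinct right halves of the outputs therefore make all constraints of a tuple
  independent.\<close>

lemma pLR_eq_iff:
  assumes "u < 2^(2*m)" "z < 2^(2*m)" "hL \<in> bool_funs m" "hR \<in> bool_funs m"
  shows "pL m hL (pR m hR u) = z \<longleftrightarrow> hR (u div 2^m) = Bit_Operations.xor (u mod 2^m) (z mod 2^m) \<and>
     hL (z mod 2^m) = Bit_Operations.xor (u div 2^m) (z div 2^m)"
proof -
  have "pL m hL (pR m hR u) = z \<longleftrightarrow> pL m hL (pR m hR u) mod 2^m = z mod 2^m \<and> pL m hL (pR m hR u) div 2^m = z div 2^m"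
    by (metis div_mult_mod_eq)
  also have "\<dots> \<longleftrightarrow> Bit_Operations.xor (u mod 2^m) (hR (u div 2^m)) = z mod 2^m \<and> Bit_Operations.xor (u div 2^m) (hL (z mod 2^m)) = z div 2^m"
    using pL_props[OF pR_props(1)[OF assms(1,4)] assms(3)] pR_props[OF assms(1,4)] by auto
  finally show ?thesis unfolding xor_eq_iff .
qed

lemma pL_inj: "h \<in> bool_funs m \<Longrightarrow> inj_on (pL m h) {..<2^(2*m)}"
proof (rule inj_onI)
  fix u v assume h: "h \<in> bool_funs m" and u: "u \<in> {..<2^(2*m)}" "v \<in> {..<2^(2*m)}" and e: "pL m h u = pL m h v"
  have "u mod 2^m = v mod 2^m" using pL_props(2)[of u m h] pL_props(2)[of v m h] u e h by simp
  moreover have "u div 2^m = v div 2^m"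
    using pL_props(3)[of u m h] pL_props(3)[of v m h] u e h calculation by (metis lessThan_iff xor.commute xor_eq_iff)
  ultimately show "u = v" by (metis div_mult_mod_eq)
qed

lemma pR_inj: "h \<in> bool_funs m \<Longrightarrow> inj_on (pR m h) {..<2^(2*m)}"
proof (rule inj_onI)
  fix u v assume h: "h \<in> bool_funs m" and u: "u \<in> {..<2^(2*m)}" "v \<in> {..<2^(2*m)}" and e: "pR m h u = pR m h v"
  have "u div 2^m = v div 2^m" using pR_props(2)[of u m h] pR_props(2)[of v m h] u e h by simp
  moreover have "u mod 2^m = v mod 2^m"
    using pR_props(3)[of u m h] pR_props(3)[of v m h] u e h calculation by (metis lessThan_iff xor.commute xor_eq_iff)
  ultimately show "u = v" by (metis div_mult_mod_eq)
qed

lemma F_mat_carrier [simp]: "F_mat N f \<in> carrier_mat (2^N) (2^N)" unfolding F_mat_def by simp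

lemma F_mat_unitary: "F_mat N f \<in> unitaries (2^N)"
proof -
  have "adj (F_mat N f) * F_mat N f = 1\<^sub>m (2^N)"
  proof (rule eq_matI)
    fix i j assume "i < dim_row (1\<^sub>m (2^N))" "j < dim_col (1\<^sub>m (2^N))"
    then have ij: "i < 2^N" "j < 2^N" by auto
    have "(adj (F_mat N f) * F_mat N f) $$ (i,j) = (\<Sum>l<2^N. if l = i then (if i = j then 1 else 0) else 0)"
      unfolding mat_mult_index[OF adj_carrier[OF F_mat_carrier] F_mat_carrier ij]
      by (rule sum.cong) (use ij in \<open>auto simp: F_mat_def\<close>)
    then show "(adj (F_mat N f) * F_mat N f) $$ (i,j) = 1\<^sub>m (2^N) $$ (i,j)" using ij by simp
  qed (auto simp: F_mat_def)
  then show ?thesis unfolding unitaries_def by simp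
qed

lemma LRF_index:
  assumes "y < 2^(2*m)" "u < 2^(2*m)" "hL \<in> bool_funs m" "hR \<in> bool_funs m"
  shows "(S_L m hL * S_R m hR * F_mat (2*m) f) $$ (y,u) = (if y = pL m hL (pR m hR u) then sg f u else 0)"
proof -
  let ?d = "2^(2*m) :: nat"
  have c: "S_L m hL \<in> carrier_mat ?d ?d" "S_R m hR \<in> carrier_mat ?d ?d" unfolding S_L_perm S_R_perm by simp_all
  have LR: "(S_L m hL * S_R m hR) $$ (y,v) = (if y = pL m hL (pR m hR v) then 1 else 0)" if v: "v < ?d" for v
  proof -
    have "(S_L m hL * S_R m hR) $$ (y,v) = (\<Sum>l<?d. if l = pR m hR v then (if y = pL m hL (pR m hR v) then 1 else 0) else 0)"
      unfolding mat_mult_index[OF c assms(1) v]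
      by (rule sum.cong) (use assms v in \<open>auto simp: S_L_perm S_R_perm perm_mat_def\<close>)
    then show ?thesis using pR_props(1)[OF v assms(4)] by simp
  qed
  have "(S_L m hL * S_R m hR * F_mat (2*m) f) $$ (y,u) = (\<Sum>l<?d. if l = u then (if y = pL m hL (pR m hR u) then sg f u else 0) else 0)"
    unfolding mat_mult_index[OF mult_carrier_mat[OF c] F_mat_carrier assms(1,2)]
    by (rule sum.cong) (use assms LR in \<open>auto simp: F_mat_def sg_def simp del: index_mult_mat\<close>)
  then show ?thesis using assms(2) by simp
qed

definition ptup :: "nat \<Rightarrow> nat \<Rightarrow> (nat \<Rightarrow> nat) \<Rightarrow> (nat \<Rightarrow> nat) \<Rightarrow> (nat \<Rightarrow> nat) \<Rightarrow> nat \<Rightarrow> nat" where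
  "ptup m k hL hR U = (\<lambda>j\<in>{..<k}. pL m hL (pR m hR (U j)))"

lemma ptup_in: "U \<in> tup k {..<2^(2*m)} \<Longrightarrow> hL \<in> bool_funs m \<Longrightarrow> hR \<in> bool_funs m \<Longrightarrow> ptup m k hL hR U \<in> tup k {..<2^(2*m)}"
  unfolding ptup_def by (rule tupI) (auto intro!: pL_props(1) pR_props(1) dest: tup_app)

lemma ptup_comp: "\<pi> \<in> perms k \<Longrightarrow> ptup m k hL hR (U \<circ> \<pi>) = ptup m k hL hR U \<circ> \<pi>"
  unfolding ptup_def by (rule ext) (auto simp: perms_lt)

definition ctrans :: "nat \<Rightarrow> nat \<Rightarrow> complex mat \<Rightarrow> ((nat \<Rightarrow> nat) \<Rightarrow> complex) \<Rightarrow> (nat \<Rightarrow> nat) \<Rightarrow> complex" where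
  "ctrans k d C g U = (\<Sum>X\<in>tup k {..<d}. amp k (\<lambda>y x. C $$ (y,x)) X U * g X)"

text \<open>\<open>S_L\<close>, \<open>S_R\<close> and \<open>F\<close> send each basis tuple
  \<open>U\<close> to one basis tuple with a sign: the permutation is absorbed into the output
  argument of \<open>\<phi>\<close>, and only the sign stays in front of the Clifford
  amplitude.\<close>

lemma LRFC_form:
  fixes m :: nat
  defines "d \<equiv> 2^(2*m)"
  assumes h: "hL \<in> bool_funs m" "hR \<in> bool_funs m" and C: "C \<in> carrier_mat d d"
  shows "form k {..<d} {..<d} (\<lambda>y x. (S_L m hL * S_R m hR * F_mat (2*m) f * C) $$ (y,x)) \<phi> =
    (\<Sum>U\<in>tup k {..<d}. chr k f U * ctrans k d C (\<lambda>X. \<phi> X (ptup m k hL hR U)) U)"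
proof -
  let ?T = "tup k {..<d}"
  let ?R = "S_L m hL * S_R m hR * F_mat (2*m) f"
  have Rc: "?R \<in> carrier_mat d d" unfolding d_def S_L_perm S_R_perm
    by (intro mult_carrier_mat[of _ _ "2^(2*m)"] perm_mat_carrier F_mat_carrier)
  have R: "(\<Prod>j<k. ?R $$ (Y j, U j)) = (if Y = ptup m k hL hR U then chr k f U else 0)" if Y: "Y \<in> ?T" and U: "U \<in> ?T" for Y U
  proof -
    have lt: "\<And>j. j < k \<Longrightarrow> Y j < 2^(2*m)" "\<And>j. j < k \<Longrightarrow> U j < 2^(2*m)"
      using tup_app[OF Y] tup_app[OF U] unfolding d_def by auto
    have "(\<Prod>j<k. ?R $$ (Y j, U j)) = (\<Prod>j<k. if Y j = pL m hL (pR m hR (U j)) then sg f (U j) else 0)"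
      by (rule prod.cong[OF refl], rule LRF_index) (use lt h in auto)
    also have "\<dots> = (if Y = ptup m k hL hR U then chr k f U else 0)"
    proof (cases "Y = ptup m k hL hR U")
      case True
      then show ?thesis unfolding chr_def by (auto simp: ptup_def intro!: prod.cong)
    next
      case False
      have "ptup m k hL hR U \<in> ?T" using ptup_in[of U k m] U h unfolding d_def by blast
      then obtain j where "j < k" "Y j \<noteq> ptup m k hL hR U j" using False tup_eqI[OF Y] by blast
      then show ?thesis using False by (auto simp: ptup_def intro!: prod_zero)
    qed
    finally show ?thesis .
  qed
  have a: "amp k (\<lambda>y x. (?R * C) $$ (y,x)) X Y = (\<Sum>U\<in>?T. (if Y = ptup m k hL hR U then chr k f U else 0) * amp k (\<lambda>y x. C $$ (y,x)) X U)"
    if X: "X \<in> ?T" and Y: "Y \<in> ?T" for X Y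
  proof -
    have "amp k (\<lambda>y x. (?R * C) $$ (y,x)) X Y = (\<Prod>j<k. \<Sum>u\<in>{..<d}. ?R $$ (Y j,u) * C $$ (u, X j))"
      unfolding amp_def by (rule prod.cong[OF refl], rule mat_mult_index[OF Rc C]) (use tup_app[OF X] tup_app[OF Y] in auto)
    also have "\<dots> = (\<Sum>U\<in>?T. \<Prod>j<k. ?R $$ (Y j, U j) * C $$ (U j, X j))" by (rule prod_sum_tup) simp
    also have "\<dots> = (\<Sum>U\<in>?T. (if Y = ptup m k hL hR U then chr k f U else 0) * amp k (\<lambda>y x. C $$ (y,x)) X U)"
      unfolding prod.distrib amp_def by (rule sum.cong[OF refl]) (simp only: R[OF Y])
    finally show ?thesis .
  qed
  have "form k {..<d} {..<d} (\<lambda>y x. (?R * C) $$ (y,x)) \<phi> =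
     (\<Sum>X\<in>?T. \<Sum>Y\<in>?T. \<Sum>U\<in>?T. (if Y = ptup m k hL hR U then chr k f U else 0) * amp k (\<lambda>y x. C $$ (y,x)) X U * \<phi> X Y)"
    unfolding form_def by (intro sum.cong refl) (simp only: a sum_distrib_right)
  also have "\<dots> = (\<Sum>X\<in>?T. \<Sum>U\<in>?T. \<Sum>Y\<in>?T. (if Y = ptup m k hL hR U then chr k f U else 0) * amp k (\<lambda>y x. C $$ (y,x)) X U * \<phi> X Y)"
    by (intro sum.cong refl sum.swap)
  also have "\<dots> = (\<Sum>X\<in>?T. \<Sum>U\<in>?T. chr k f U * (amp k (\<lambda>y x. C $$ (y,x)) X U * \<phi> X (ptup m k hL hR U)))"
  proof (intro sum.cong refl)
    fix X U assume "X \<in> ?T" "U \<in> ?T"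
    then have "ptup m k hL hR U \<in> ?T" using ptup_in[of U k m] h unfolding d_def by blast
    then have "(\<Sum>Y\<in>?T. if Y = ptup m k hL hR U then chr k f U * (amp k (\<lambda>y x. C $$ (y,x)) X U * \<phi> X Y) else 0) = chr k f U * (amp k (\<lambda>y x. C $$ (y,x)) X U * \<phi> X (ptup m k hL hR U))"
      by simp
    moreover have "(\<Sum>Y\<in>?T. (if Y = ptup m k hL hR U then chr k f U else 0) * amp k (\<lambda>y x. C $$ (y,x)) X U * \<phi> X Y) = (\<Sum>Y\<in>?T. if Y = ptup m k hL hR U then chr k f U * (amp k (\<lambda>y x. C $$ (y,x)) X U * \<phi> X Y) else 0)"
      by (rule sum.cong) auto
    ultimately show "(\<Sum>Y\<in>?T. (if Y = ptup m k hL hR U then chr k f U else 0) * amp k (\<lambda>y x. C $$ (y,x)) X U * \<phi> X Y) = chr k f U * (amp k (\<lambda>y x. C $$ (y,x)) X U * \<phi> X (ptup m k hL hR U))"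
      by simp
  qed
  also have "\<dots> = (\<Sum>U\<in>?T. \<Sum>X\<in>?T. chr k f U * (amp k (\<lambda>y x. C $$ (y,x)) X U * \<phi> X (ptup m k hL hR U)))" by (rule sum.swap)
  finally show ?thesis unfolding ctrans_def by (simp add: sum_distrib_left)
qed

lemma ctrans_comp:
  assumes p: "\<pi> \<in> perms k"
  shows "ctrans k d C g (U \<circ> \<pi>) = ctrans k d C (\<lambda>X. g (X \<circ> \<pi>)) U"
proof -
  have "ctrans k d C g (U \<circ> \<pi>) = (\<Sum>X\<in>tup k {..<d}. amp k (\<lambda>y x. C $$ (y,x)) (X \<circ> \<pi>) (U \<circ> \<pi>) * g (X \<circ> \<pi>))"
    unfolding ctrans_def by (rule sum_tup_comp[OF p, symmetric])
  also have "\<dots> = ctrans k d C (\<lambda>X. g (X \<circ> \<pi>)) U"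
  proof -
    have "amp k (\<lambda>y x. C $$ (y,x)) (X \<circ> \<pi>) (U \<circ> \<pi>) = amp k (\<lambda>y x. C $$ (y,x)) X U" for X
      unfolding amp_def comp_apply by (rule prod_perm_comp[OF p])
    then show ?thesis unfolding ctrans_def by (simp only:)
  qed
  finally show ?thesis .
qed

lemma ctrans_parseval:
  assumes "C \<in> unitaries d"
  shows "(\<Sum>U\<in>tup k {..<d}. (cmod (ctrans k d C g U))\<^sup>2) = (\<Sum>X\<in>tup k {..<d}. (cmod (g X))\<^sup>2)"
  unfolding ctrans_def by (rule tensor_parseval) (rule unitary_col_orthonormal[OF assms])

lemma sum_tup_pair:
  fixes f :: "(nat \<Rightarrow> nat) \<Rightarrow> 'z :: comm_monoid_add"
  assumes ij: "i < j" "j < k"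
  shows "(\<Sum>U\<in>tup k {..<d}. f U) = (\<Sum>r\<in>(\<Pi>\<^sub>E l\<in>{..<k}-{i,j}. {..<d}). \<Sum>a<d. \<Sum>b<d. f (r(j := b, i := a)))"
proof -
  let ?J = "{..<k}-{i,j}"
  have k: "{..<k} = insert i (insert j ?J)" using ij by auto
  have ins: "(\<Sum>U\<in>Pi\<^sub>E (insert x S) (\<lambda>_. {..<d}). g U) = (\<Sum>a<d. \<Sum>r\<in>Pi\<^sub>E S (\<lambda>_. {..<d}). g (r(x := a)))"
    if "x \<notin> S" for x and S :: "nat set" and g :: "(nat \<Rightarrow> nat) \<Rightarrow> 'z"
  proof -
    have "(\<Sum>U\<in>Pi\<^sub>E (insert x S) (\<lambda>_. {..<d}). g U) = (\<Sum>p\<in>{..<d} \<times> Pi\<^sub>E S (\<lambda>_. {..<d}). g ((snd p)(x := fst p)))"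
      unfolding PiE_insert_eq
      by (subst sum.reindex[OF inj_combinator[OF that, of "\<lambda>_. {..<d}"]]) (simp add: case_prod_beta' o_def)
    then show ?thesis by (simp add: sum.cartesian_product case_prod_beta')
  qed
  have "(\<Sum>U\<in>tup k {..<d}. f U) = (\<Sum>a<d. \<Sum>b<d. \<Sum>r\<in>Pi\<^sub>E ?J (\<lambda>_. {..<d}). f (r(j := b, i := a)))"
    unfolding tup_def by (subst k, subst ins, use ij in simp, subst ins) (use ij in auto)
  also have "\<dots> = (\<Sum>a<d. \<Sum>r\<in>Pi\<^sub>E ?J (\<lambda>_. {..<d}). \<Sum>b<d. f (r(j := b, i := a)))" by (intro sum.cong refl sum.swap)
  also have "\<dots> = (\<Sum>r\<in>Pi\<^sub>E ?J (\<lambda>_. {..<d}). \<Sum>a<d. \<Sum>b<d. f (r(j := b, i := a)))" by (rule sum.swap)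
  finally show ?thesis .
qed

text \<open>The tensor factors at positions other than \<open>i\<close> and \<open>j\<close> act
  isometrically and do not affect the collision event. Parseval removes them, and the two-copy
  estimate applies for each fixed value of the remaining inputs.\<close>

lemma ctrans_collision:
  fixes m :: nat
  defines "d \<equiv> 2^(2*m)"
  assumes m: "0 < m" and ij: "i < j" "j < k"
  shows "(\<Sum>C\<in>clifford_group (2*m). \<Sum>U\<in>tup k {..<d}. if U i div 2^m = U j div 2^m then (cmod (ctrans k d C g U))\<^sup>2 else 0)
    \<le> real (card (clifford_group (2*m))) * (2 / 2^m * (\<Sum>X\<in>tup k {..<d}. (cmod (g X))\<^sup>2))"
proof -
  let ?J = "{..<k}-{i,j}"
  let ?P = "\<Pi>\<^sub>E l\<in>?J. {..<d}"
  define h where "h r a b = g (r(j := b, i := a))" for r a b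
  have ne: "i \<noteq> j" using ij by auto
  have key: "(\<Sum>U\<in>tup k {..<d}. if U i div 2^m = U j div 2^m then (cmod (ctrans k d C g U))\<^sup>2 else 0) =
     (\<Sum>r\<in>?P. \<Sum>a<d. \<Sum>b<d. if a div 2^m = b div 2^m then (cmod (op2 d C C (h r) a b))\<^sup>2 else 0)"
    if C: "C \<in> clifford_group (2*m)" for C
  proof -
    have Cu: "C \<in> unitaries d" using clifford_unitary[OF C] unfolding d_def .
    have am: "amp k (\<lambda>y x. C $$ (y,x)) (r'(j := y, i := x)) (r(j := b, i := a)) = C $$ (a,x) * C $$ (b,y) * (\<Prod>l\<in>?J. C $$ (r l, r' l))" for r r' a b x y
    proof -
      have k: "{..<k} = insert i (insert j ?J)" using ij by auto
      have "amp k (\<lambda>y x. C $$ (y,x)) (r'(j := y, i := x)) (r(j := b, i := a)) =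
         C $$ (a,x) * (C $$ (b,y) * (\<Prod>l\<in>?J. C $$ ((r(j := b, i := a)) l, (r'(j := y, i := x)) l)))"
        unfolding amp_def by (subst k) (use ij ne in simp)
      also have "(\<Prod>l\<in>?J. C $$ ((r(j := b, i := a)) l, (r'(j := y, i := x)) l)) = (\<Prod>l\<in>?J. C $$ (r l, r' l))"
        by (rule prod.cong) auto
      finally show ?thesis unfolding mult.assoc .
    qed
    have ct: "ctrans k d C g (r(j := b, i := a)) = (\<Sum>r'\<in>?P. (\<Prod>l\<in>?J. C $$ (r l, r' l)) * op2 d C C (h r') a b)" for r a b
      unfolding ctrans_def sum_tup_pair[OF ij] am op2_def h_def sum_distrib_left
      by (intro sum.cong refl) (simp add: mult_ac)
    have "(\<Sum>U\<in>tup k {..<d}. if U i div 2^m = U j div 2^m then (cmod (ctrans k d C g U))\<^sup>2 else 0)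
      = (\<Sum>r\<in>?P. \<Sum>a<d. \<Sum>b<d. if a div 2^m = b div 2^m then (cmod (\<Sum>r'\<in>?P. (\<Prod>l\<in>?J. C $$ (r l, r' l)) * op2 d C C (h r') a b))\<^sup>2 else 0)"
      unfolding sum_tup_pair[OF ij] ct using ne by simp
    also have "\<dots> = (\<Sum>a<d. \<Sum>b<d. \<Sum>r\<in>?P. if a div 2^m = b div 2^m then (cmod (\<Sum>r'\<in>?P. (\<Prod>l\<in>?J. C $$ (r l, r' l)) * op2 d C C (h r') a b))\<^sup>2 else 0)"
      by (subst sum.swap) (intro sum.cong refl sum.swap)
    also have "\<dots> = (\<Sum>a<d. \<Sum>b<d. \<Sum>r\<in>?P. if a div 2^m = b div 2^m then (cmod (op2 d C C (h r) a b))\<^sup>2 else 0)"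
    proof (rule sum.cong[OF refl], rule sum.cong[OF refl])
      fix a b
      show "(\<Sum>r\<in>?P. if a div 2^m = b div 2^m then (cmod (\<Sum>r'\<in>?P. (\<Prod>l\<in>?J. C $$ (r l, r' l)) * op2 d C C (h r') a b))\<^sup>2 else 0)
        = (\<Sum>r\<in>?P. if a div 2^m = b div 2^m then (cmod (op2 d C C (h r) a b))\<^sup>2 else 0)"
        using parseval_PiE[of ?J d "\<lambda>y x. C $$ (y,x)" "\<lambda>r. op2 d C C (h r) a b", OF _ unitary_col_orthonormal[OF Cu]]
        by (cases "a div 2^m = b div 2^m") simp_all
    qed
    also have "\<dots> = (\<Sum>r\<in>?P. \<Sum>a<d. \<Sum>b<d. if a div 2^m = b div 2^m then (cmod (op2 d C C (h r) a b))\<^sup>2 else 0)"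
      by (subst (2) sum.swap) (intro sum.cong refl sum.swap)
    finally show ?thesis .
  qed
  have "(\<Sum>C\<in>clifford_group (2*m). \<Sum>U\<in>tup k {..<d}. if U i div 2^m = U j div 2^m then (cmod (ctrans k d C g U))\<^sup>2 else 0)
    = (\<Sum>C\<in>clifford_group (2*m). \<Sum>r\<in>?P. \<Sum>a<d. \<Sum>b<d. if a div 2^m = b div 2^m then (cmod (op2 d C C (h r) a b))\<^sup>2 else 0)"
    by (rule sum.cong[OF refl key])
  also have "\<dots> = (\<Sum>r\<in>?P. \<Sum>C\<in>clifford_group (2*m). \<Sum>a<d. \<Sum>b<d. if a div 2^m = b div 2^m then (cmod (op2 d C C (h r) a b))\<^sup>2 else 0)"
    by (rule sum.swap)
  also have "\<dots> \<le> (\<Sum>r\<in>?P. real (card (clifford_group (2*m))) * (2 / 2^m * nr2 d (h r)))"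
    unfolding d_def by (rule sum_mono, rule clifford_half_collision[OF m])
  also have "\<dots> = real (card (clifford_group (2*m))) * (2 / 2^m * (\<Sum>r\<in>?P. nr2 d (h r)))"
    by (simp add: sum_distrib_left)
  also have "(\<Sum>r\<in>?P. nr2 d (h r)) = (\<Sum>X\<in>tup k {..<d}. (cmod (g X))\<^sup>2)"
    unfolding sum_tup_pair[OF ij] nr2_def h_def ..
  finally show ?thesis .
qed

lemma finite_bool_funs [simp]: "finite (bool_funs m)" unfolding bool_funs_def by (intro finite_PiE) auto

lemma bool_funs_nonempty [simp]: "bool_funs m \<noteq> {}"
  unfolding bool_funs_def by (auto simp: PiE_eq_empty_iff)

lemma clifford_nonempty [simp]: "clifford_group N \<noteq> {}" using clifford_group.id by blast

lemma expectation_bind_pmf_of_set: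
  fixes F :: "'b \<Rightarrow> real"
  assumes "A \<noteq> {}" "finite A" "\<And>x. x \<in> A \<Longrightarrow> finite (set_pmf (f x))"
  shows "measure_pmf.expectation (pmf_of_set A \<bind> f) F = (\<Sum>a\<in>A. measure_pmf.expectation (f a) F) / real (card A)"
proof -
  have "measure_pmf.expectation (pmf_of_set A \<bind> f) F = (\<Sum>a\<in>A. measure_pmf.expectation (f a) F /\<^sub>R real (card A))"
    by (rule pmf_expectation_bind_pmf_of_set[OF assms])
  also have "\<dots> = (\<Sum>a\<in>A. measure_pmf.expectation (f a) F) / real (card A)"
    unfolding sum_divide_distrib by (rule sum.cong) (simp_all add: divide_inverse mult.commute)
  finally show ?thesis .
qed

lemma LRFC_expectation:
  fixes F :: "complex mat \<Rightarrow> real"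
  shows "measure_pmf.expectation (LRFC m) F =
    (\<Sum>hL\<in>bool_funs m. \<Sum>hR\<in>bool_funs m. \<Sum>f\<in>bfun (2^(2*m)). \<Sum>C\<in>clifford_group (2*m). F (S_L m hL * S_R m hR * F_mat (2*m) f * C))
     / (real (card (bool_funs m)) * real (card (bool_funs m)) * real (card (bfun (2^(2*m)))) * real (card (clifford_group (2*m))))"
    and LRFC_finite: "finite (set_pmf (LRFC m))"
proof -
  let ?d = "2^(2*m) :: nat"
  have L: "LRFC m = pmf_of_set (bool_funs m) \<bind> (\<lambda>hL. pmf_of_set (bool_funs m) \<bind> (\<lambda>hR.
      pmf_of_set (bfun ?d) \<bind> (\<lambda>f. pmf_of_set (clifford_group (2*m)) \<bind> (\<lambda>C. return_pmf (S_L m hL * S_R m hR * F_mat (2*m) f * C)))))"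
    unfolding LRFC_def bfun_def ..
  note fc = finite_clifford_group[of "2*m"]
  show fin: "finite (set_pmf (LRFC m))"
    unfolding L by (auto simp: fc)
  show "measure_pmf.expectation (LRFC m) F =
    (\<Sum>hL\<in>bool_funs m. \<Sum>hR\<in>bool_funs m. \<Sum>f\<in>bfun ?d. \<Sum>C\<in>clifford_group (2*m). F (S_L m hL * S_R m hR * F_mat (2*m) f * C))
     / (real (card (bool_funs m)) * real (card (bool_funs m)) * real (card (bfun ?d)) * real (card (clifford_group (2*m))))"
    unfolding L
    apply (subst expectation_bind_pmf_of_set)
       apply (simp_all add: fc)[3]
    apply (subst expectation_bind_pmf_of_set)
       apply (simp_all add: fc)[3]
    apply (subst expectation_bind_pmf_of_set)
       apply (simp_all add: fc)[3]
    apply (subst expectation_bind_pmf_of_set)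
       apply (simp_all add: fc)[3]
    by (simp add: sum_divide_distrib[symmetric] mult_ac)
qed

lemma ctrans_sum: "ctrans k d C (\<lambda>X. \<Sum>a\<in>A. g a X) U = (\<Sum>a\<in>A. ctrans k d C (g a) U)"
  unfolding ctrans_def by (simp add: sum_distrib_left) (rule sum.swap)

lemma sum_lessThan_le: "2 * (\<Sum>j<k. real j) \<le> (real k)\<^sup>2"
  by (induction k) (auto simp: power2_eq_square algebra_simps)

text \<open>Union bound over the \<open>k (k - 1) / 2\<close> pairs of positions, each costing on
  average at most a fraction \<open>2 / 2^m\<close> of the norm.\<close>

lemma ctrans_distinct_halves:
  fixes m :: nat
  defines "d \<equiv> 2^(2*m)"
  assumes m: "0 < m"
  shows "real (card (clifford_group (2*m))) * ((1 - (real k)\<^sup>2 / 2^m) * (\<Sum>X\<in>tup k {..<d}. (cmod (g X))\<^sup>2))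
    \<le> (\<Sum>C\<in>clifford_group (2*m). \<Sum>U\<in>{U\<in>tup k {..<d}. inj_on (\<lambda>j. U j div 2^m) {..<k}}. (cmod (ctrans k d C g U))\<^sup>2)"
proof -
  let ?T = "tup k {..<d}" and ?W = "{U\<in>tup k {..<d}. inj_on (\<lambda>j. U j div 2^m) {..<k}}" and ?C = "clifford_group (2*m)"
  define n where "n = (\<Sum>X\<in>?T. (cmod (g X))\<^sup>2)"
  have n0: "0 \<le> n" unfolding n_def by (intro sum_nonneg) auto
  define coll where "coll C i j = (\<Sum>U\<in>?T. if U i div 2^m = U j div 2^m then (cmod (ctrans k d C g U))\<^sup>2 else 0)" for C and i j :: nat
  have one: "n \<le> (\<Sum>U\<in>?W. (cmod (ctrans k d C g U))\<^sup>2) + (\<Sum>j<k. \<Sum>i<j. coll C i j)" if C: "C \<in> ?C" for C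
  proof -
    let ?v = "\<lambda>U. (cmod (ctrans k d C g U))\<^sup>2"
    have "n = (\<Sum>U\<in>?T. ?v U)" unfolding n_def
      using ctrans_parseval[of C d k g] clifford_unitary[OF C] unfolding d_def by simp
    also have "\<dots> \<le> (\<Sum>U\<in>?T. (if inj_on (\<lambda>j. U j div 2^m) {..<k} then ?v U else 0) + (\<Sum>j<k. \<Sum>i<j. if U i div 2^m = U j div 2^m then ?v U else 0))"
    proof (rule sum_mono)
      fix U
      have nn: "0 \<le> (\<Sum>i<j. if U i div 2^m = U j div 2^m then ?v U else 0)" for j by (intro sum_nonneg) auto
      show "?v U \<le> (if inj_on (\<lambda>j. U j div 2^m) {..<k} then ?v U else 0) + (\<Sum>j<k. \<Sum>i<j. if U i div 2^m = U j div 2^m then ?v U else 0)"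
      proof (cases "inj_on (\<lambda>j. U j div 2^m) {..<k}")
        case True
        then show ?thesis using nn by (simp add: sum_nonneg)
      next
        case False
        then obtain a b where ab: "a < k" "b < k" "a \<noteq> b" "U a div 2^m = U b div 2^m" unfolding inj_on_def by auto
        obtain i j where ij: "i < j" "j < k" "U i div 2^m = U j div 2^m"
          using ab by (metis linorder_neqE_nat)
        have "?v U = (if U i div 2^m = U j div 2^m then ?v U else 0)" using ij by simp
        also have "\<dots> \<le> (\<Sum>i<j. if U i div 2^m = U j div 2^m then ?v U else 0)"
          by (rule member_le_sum) (use ij in auto)
        also have "\<dots> \<le> (\<Sum>j<k. \<Sum>i<j. if U i div 2^m = U j div 2^m then ?v U else 0)"
          by (rule member_le_sum[of j _ "\<lambda>j. \<Sum>i<j. if U i div 2^m = U j div 2^m then ?v U else 0"]) (use ij nn in auto)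
        finally show ?thesis using False by simp
      qed
    qed
    also have "\<dots> = (\<Sum>U\<in>?W. ?v U) + (\<Sum>U\<in>?T. \<Sum>j<k. \<Sum>i<j. if U i div 2^m = U j div 2^m then ?v U else 0)"
      by (simp add: sum.distrib sum.inter_filter)
    also have "(\<Sum>U\<in>?T. \<Sum>j<k. \<Sum>i<j. if U i div 2^m = U j div 2^m then ?v U else 0) = (\<Sum>j<k. \<Sum>i<j. coll C i j)"
      unfolding coll_def by (subst sum.swap) (intro sum.cong refl sum.swap)
    finally show ?thesis .
  qed
  have "real (card ?C) * n = (\<Sum>C\<in>?C. n)" by simp
  also have "\<dots> \<le> (\<Sum>C\<in>?C. (\<Sum>U\<in>?W. (cmod (ctrans k d C g U))\<^sup>2) + (\<Sum>j<k. \<Sum>i<j. coll C i j))"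
    by (rule sum_mono[OF one])
  also have "\<dots> = (\<Sum>C\<in>?C. \<Sum>U\<in>?W. (cmod (ctrans k d C g U))\<^sup>2) + (\<Sum>j<k. \<Sum>i<j. \<Sum>C\<in>?C. coll C i j)"
    unfolding sum.distrib by (intro arg_cong2[of _ _ _ _ "(+)"] refl, subst sum.swap) (intro sum.cong refl sum.swap)
  also have "(\<Sum>j<k. \<Sum>i<j. \<Sum>C\<in>?C. coll C i j) \<le> (\<Sum>j<k. \<Sum>i<j. real (card ?C) * (2 / 2^m * n))"
    unfolding coll_def n_def d_def by (intro sum_mono ctrans_collision[OF m]) auto
  also have "\<dots> = (2 * (\<Sum>j<k. real j)) * (real (card ?C) * n / 2^m)" by (simp add: sum_distrib_right sum_distrib_left sum_divide_distrib mult_ac)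
  also have "\<dots> \<le> (real k)\<^sup>2 * (real (card ?C) * n / 2^m)"
    using n0 by (intro mult_right_mono sum_lessThan_le) auto
  finally show ?thesis unfolding n_def[symmetric] by (simp add: algebra_simps)
qed

text \<open>Every admissible \<open>Z\<close> is hit by the same number of pairs
  \<open>(hL, hR)\<close>: \<open>k\<close> values of \<open>hR\<close> are prescribed at the
  distinct left halves of \<open>U\<close> and \<open>k\<close> values of \<open>hL\<close> at the
  distinct right halves of \<open>Z\<close>, so one pair in \<open>(2^m)^(2*k)\<close> works. Random
  functions thus spread \<open>U\<close> evenly over these outputs.\<close>

lemma ptup_count:
  fixes m k :: nat and \<Psi> :: "(nat \<Rightarrow> nat) \<Rightarrow> real"
  defines "d \<equiv> 2^(2*m)"
  assumes U: "U \<in> tup k {..<d}" "inj_on (\<lambda>j. U j div 2^m) {..<k}" and nn: "\<And>Z. 0 \<le> \<Psi> Z"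
  shows "real (card (bool_funs m)) * real (card (bool_funs m)) / (2^m)^(2*k) *
      (\<Sum>Z\<in>{Z\<in>tup k {..<d}. good k {\<lambda>z. z mod 2^m, \<lambda>z. z div 2^m} Z}. \<Psi> Z)
    \<le> (\<Sum>hL\<in>bool_funs m. \<Sum>hR\<in>bool_funs m. \<Psi> (ptup m k hL hR U))"
proof -
  let ?B = "bool_funs m" and ?Q = "2^m :: nat"
  let ?Z = "{Z\<in>tup k {..<d}. good k {\<lambda>z. z mod 2^m, \<lambda>z. z div 2^m} Z}"
  have fZ: "finite ?Z" by simp
  have cnt: "real (card {p\<in>?B \<times> ?B. ptup m k (fst p) (snd p) U = Z}) = real (card ?B) * real (card ?B) / (2^m)^(2*k)" if Z: "Z \<in> ?Z" for Z
  proof -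
    have Zt: "Z \<in> tup k {..<d}" and Zi: "inj_on (\<lambda>j. Z j mod 2^m) {..<k}" using Z unfolding good_def by auto
    have lt: "\<And>j. j < k \<Longrightarrow> U j < 2^(2*m)" "\<And>j. j < k \<Longrightarrow> Z j < 2^(2*m)"
      using tup_app[OF U(1)] tup_app[OF Zt] unfolding d_def by auto
    let ?R = "{h\<in>?B. \<forall>j<k. h (U j div 2^m) = Bit_Operations.xor (U j mod 2^m) (Z j mod 2^m)}"
    let ?L = "{h\<in>?B. \<forall>j<k. h (Z j mod 2^m) = Bit_Operations.xor (U j div 2^m) (Z j div 2^m)}"
    have "{p\<in>?B \<times> ?B. ptup m k (fst p) (snd p) U = Z} = ?L \<times> ?R"
    proof -
      have iffh: "ptup m k hL hR U = Z \<longleftrightarrow> (\<forall>j<k. hR (U j div 2^m) = Bit_Operations.xor (U j mod 2^m) (Z j mod 2^m)) \<and>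
         (\<forall>j<k. hL (Z j mod 2^m) = Bit_Operations.xor (U j div 2^m) (Z j div 2^m))" if "hL \<in> ?B" "hR \<in> ?B" for hL hR
      proof -
        have "ptup m k hL hR U \<in> tup k {..<d}" using ptup_in[of U k m hL hR] U that unfolding d_def by simp
        then have "ptup m k hL hR U = Z \<longleftrightarrow> (\<forall>j<k. ptup m k hL hR U j = Z j)" using tup_eqI[OF _ Zt] by auto
        also have "\<dots> \<longleftrightarrow> (\<forall>j<k. pL m hL (pR m hR (U j)) = Z j)" by (simp add: ptup_def)
        also have "\<dots> \<longleftrightarrow> (\<forall>j<k. hR (U j div 2^m) = Bit_Operations.xor (U j mod 2^m) (Z j mod 2^m) \<and> hL (Z j mod 2^m) = Bit_Operations.xor (U j div 2^m) (Z j div 2^m))"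
          using pLR_eq_iff[OF lt(1) lt(2) that] by blast
        finally show ?thesis by blast
      qed
      show ?thesis
      proof (rule Set.set_eqI)
        fix p show "p \<in> {p\<in>?B \<times> ?B. ptup m k (fst p) (snd p) U = Z} \<longleftrightarrow> p \<in> ?L \<times> ?R"
          using iffh[of "fst p" "snd p"] by (simp add: mem_Times_iff) blast
      qed
    qed
    then have c: "card {p\<in>?B \<times> ?B. ptup m k (fst p) (snd p) U = Z} = card ?L * card ?R" by (simp add: card_cartesian_product)
    have xl: "Bit_Operations.xor (U j mod 2^m) (Z j mod 2^m) < 2^m" for j by (intro xor_lt) simp_all
    have xl': "Bit_Operations.xor (U j div 2^m) (Z j div 2^m) < 2^m" if "j < k" for j
      using half_lt[OF lt(1)[OF that]] half_lt[OF lt(2)[OF that]] by (rule xor_lt)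
    have "card ?R * ?Q ^ k = card ?B"
      using card_prescribed[of "{..<?Q}" "\<lambda>j. U j div 2^m" k "\<lambda>j. Bit_Operations.xor (U j mod 2^m) (Z j mod 2^m)" "{..<?Q}"] U(2) half_lt[OF lt(1)]
      unfolding bool_funs_def by (auto simp: image_subset_iff xl)
    moreover have "card ?L * ?Q ^ k = card ?B"
      using card_prescribed[of "{..<?Q}" "\<lambda>j. Z j mod 2^m" k "\<lambda>j. Bit_Operations.xor (U j div 2^m) (Z j div 2^m)" "{..<?Q}"] Zi
      unfolding bool_funs_def by (auto simp: image_subset_iff xl')
    ultimately have "(card ?L * ?Q ^ k) * (card ?R * ?Q ^ k) = card ?B * card ?B" by simp
    then have "real (card ?L * card ?R) * (2^m)^(2*k) = real (card ?B) * real (card ?B)"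
      by (simp add: power_mult power2_eq_square power_mult_distrib mult_ac flip: of_nat_mult of_nat_power power_add)
         (metis (no_types, lifting) mult.assoc mult.left_commute mult_2 of_nat_mult of_nat_numeral of_nat_power power_add)
    then show ?thesis unfolding c by (simp add: field_simps)
  qed
  have "real (card ?B) * real (card ?B) / (2^m)^(2*k) * (\<Sum>Z\<in>?Z. \<Psi> Z) = (\<Sum>Z\<in>?Z. real (card {p\<in>?B \<times> ?B. ptup m k (fst p) (snd p) U = Z}) * \<Psi> Z)"
    unfolding sum_distrib_left by (rule sum.cong[OF refl]) (simp only: cnt)
  also have "\<dots> = (\<Sum>Z\<in>?Z. \<Sum>p\<in>{p\<in>?B \<times> ?B. ptup m k (fst p) (snd p) U = Z}. \<Psi> (ptup m k (fst p) (snd p) U))"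
    by (rule sum.cong[OF refl]) simp
  also have "\<dots> = (\<Sum>p\<in>(\<Union>Z\<in>?Z. {p\<in>?B \<times> ?B. ptup m k (fst p) (snd p) U = Z}). \<Psi> (ptup m k (fst p) (snd p) U))"
    by (rule sum.UNION_disjoint[symmetric]) (use fZ in auto)
  also have "\<dots> \<le> (\<Sum>p\<in>?B \<times> ?B. \<Psi> (ptup m k (fst p) (snd p) U))"
    by (rule sum_mono2) (use nn in auto)
  also have "\<dots> = (\<Sum>hL\<in>?B. \<Sum>hR\<in>?B. \<Psi> (ptup m k hL hR U))" by (simp add: sum.cartesian_product case_prod_beta')
  finally show ?thesis .
qed

text \<open>The sources of randomness share the work: the signs leave symmetrised sums over tuples
  \<open>U\<close> with distinct left halves, the functions spread each such \<open>U\<close> evenly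
  over the outputs, and the Clifford makes these \<open>U\<close> carry almost all of the norm. The
  divisor \<open>(2^m)^(2*k)\<close> is the \<open>k\<close>-th power of the dimension
  \<open>2^(2*m)\<close>, matching Gaussian entries whose variance is the inverse dimension.\<close>

theorem LRFC_dominated:
  fixes m k :: nat
  assumes m: "0 < m"
  shows "dominated k {..<2^(2*m)} {..<2^(2*m)} {\<lambda>z. z mod 2^m, \<lambda>z. z div 2^m}
    ((1 - (real k)\<^sup>2 / 2^m) / (2^m)^(2*k)) (LRFC m) (\<lambda>V y x. V $$ (y,x))"
proof -
  define d where "d = (2::nat)^(2*m)"
  let ?T = "tup k {..<d}" and ?B = "bool_funs m" and ?F = "bfun d" and ?C = "clifford_group (2*m)"
  let ?W = "{U\<in>tup k {..<d}. inj_on (\<lambda>j. U j div 2^m) {..<k}}"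
  let ?Z = "{Z\<in>tup k {..<d}. good k {\<lambda>z. z mod 2^m, \<lambda>z. z div 2^m} Z}"
  have "(1 - (real k)\<^sup>2 / 2^m) / (2^m)^(2*k) / fact k * (\<Sum>X\<in>?T. \<Sum>Z\<in>?Z. (cmod (symz k \<phi> X Z))\<^sup>2)
    \<le> measure_pmf.expectation (LRFC m) (\<lambda>V. (cmod (form k {..<d} {..<d} (\<lambda>y x. V $$ (y,x)) \<phi>))\<^sup>2)" for \<phi>
  proof -
    define b f c where "b = real (card ?B)" and "f = real (card ?F)" and "c = real (card ?C)"
    have pos: "0 < b" "0 < f" "0 < c"
      unfolding b_def f_def c_def using finite_clifford_group by (simp_all add: card_gt_0_iff)
    define \<Psi> where "\<Psi> C U Z = (cmod (ctrans k d C (\<lambda>X. symz k \<phi> X Z) U))\<^sup>2" for C U Z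
    let ?V = "\<lambda>hL hR f C. S_L m hL * S_R m hR * F_mat (2*m) f * C"
    have stepf: "f / fact k * (\<Sum>U\<in>?W. \<Psi> C U (ptup m k hL hR U)) \<le> (\<Sum>g\<in>?F. (cmod (form k {..<d} {..<d} (\<lambda>y x. ?V hL hR g C $$ (y,x)) \<phi>))\<^sup>2)"
      if h: "hL \<in> ?B" "hR \<in> ?B" and C: "C \<in> ?C" for hL hR C
    proof -
      have Cc: "C \<in> carrier_mat d d" using unitariesD(1)[OF clifford_unitary[OF C]] unfolding d_def .
      let ?G = "\<lambda>U. ctrans k d C (\<lambda>X. \<phi> X (ptup m k hL hR U)) U"
      have injW: "inj_on U {..<k}" if "U \<in> ?W" for U using that by (auto simp: inj_on_def)
      have compW: "U \<circ> \<pi> \<in> ?W" if "U \<in> ?W" "\<pi> \<in> perms k" for U \<pi>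
      proof -
        have "good k {\<lambda>z. z div 2^m} U" using that by (simp add: good_def)
        then have "good k {\<lambda>z. z div 2^m} (U \<circ> \<pi>)" using good_comp[OF that(2)] by blast
        then show ?thesis using that tup_comp by (auto simp: good_def)
      qed
      have lf: "form k {..<d} {..<d} (\<lambda>y x. ?V hL hR g C $$ (y,x)) \<phi> = (\<Sum>U\<in>?T. chr k g U * ?G U)" for g
        using LRFC_form[of hL m hR C k g \<phi>] h Cc unfolding d_def by blast
      have Gs: "(\<Sum>\<pi>\<in>perms k. ?G (U \<circ> \<pi>)) = ctrans k d C (\<lambda>X. symz k \<phi> X (ptup m k hL hR U)) U" for U
        unfolding symz_def ctrans_sum by (rule sum.cong[OF refl]) (simp only: ctrans_comp ptup_comp)
      have "f / fact k * (\<Sum>U\<in>?W. (cmod (\<Sum>\<pi>\<in>perms k. ?G (U \<circ> \<pi>)))\<^sup>2) \<le> (\<Sum>g\<in>?F. (cmod (\<Sum>U\<in>?T. chr k g U * ?G U))\<^sup>2)"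
        unfolding f_def by (rule phase_average[OF _ injW compW]) blast
      also have "(\<Sum>g\<in>?F. (cmod (\<Sum>U\<in>?T. chr k g U * ?G U))\<^sup>2) = (\<Sum>g\<in>?F. (cmod (form k {..<d} {..<d} (\<lambda>y x. ?V hL hR g C $$ (y,x)) \<phi>))\<^sup>2)"
        unfolding lf ..
      finally show ?thesis unfolding \<Psi>_def Gs .
    qed
    have "(1 - (real k)\<^sup>2 / 2^m) / (2^m)^(2*k) / fact k * (\<Sum>X\<in>?T. \<Sum>Z\<in>?Z. (cmod (symz k \<phi> X Z))\<^sup>2)
      = (1 / (2^m)^(2*k) / fact k / c) * (\<Sum>Z\<in>?Z. c * ((1 - (real k)\<^sup>2 / 2^m) * (\<Sum>X\<in>?T. (cmod (symz k \<phi> X Z))\<^sup>2)))"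
      using pos by (subst sum.swap) (simp add: sum_distrib_left[symmetric])
    also have "\<dots> \<le> (1 / (2^m)^(2*k) / fact k / c) * (\<Sum>Z\<in>?Z. \<Sum>C\<in>?C. \<Sum>U\<in>?W. \<Psi> C U Z)"
      unfolding \<Psi>_def c_def d_def using ctrans_distinct_halves[OF m]
      by (intro mult_left_mono sum_mono) auto
    also have "\<dots> = (1 / fact k / c / (b * b)) * (\<Sum>C\<in>?C. \<Sum>U\<in>?W. b * b / (2^m)^(2*k) * (\<Sum>Z\<in>?Z. \<Psi> C U Z))"
    proof -
      have "(\<Sum>Z\<in>?Z. \<Sum>C\<in>?C. \<Sum>U\<in>?W. \<Psi> C U Z) = (\<Sum>C\<in>?C. \<Sum>U\<in>?W. \<Sum>Z\<in>?Z. \<Psi> C U Z)"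
        by (subst sum.swap) (intro sum.cong refl sum.swap)
      then show ?thesis using pos unfolding sum_distrib_left[symmetric] by simp
    qed
    also have "\<dots> \<le> (1 / fact k / c / (b * b)) * (\<Sum>C\<in>?C. \<Sum>U\<in>?W. \<Sum>hL\<in>?B. \<Sum>hR\<in>?B. \<Psi> C U (ptup m k hL hR U))"
    proof (intro mult_left_mono sum_mono)
      fix C U assume "U \<in> ?W"
      then show "b * b / (2^m)^(2*k) * (\<Sum>Z\<in>?Z. \<Psi> C U Z) \<le> (\<Sum>hL\<in>?B. \<Sum>hR\<in>?B. \<Psi> C U (ptup m k hL hR U))"
        unfolding b_def d_def by (intro ptup_count) (auto simp: \<Psi>_def)
    qed (use pos in auto)
    also have "\<dots> = (1 / c / (b * b) / f) * (\<Sum>hL\<in>?B. \<Sum>hR\<in>?B. \<Sum>C\<in>?C. f / fact k * (\<Sum>U\<in>?W. \<Psi> C U (ptup m k hL hR U)))"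
    proof -
      have "(\<Sum>C\<in>?C. \<Sum>U\<in>?W. \<Sum>hL\<in>?B. \<Sum>hR\<in>?B. \<Psi> C U (ptup m k hL hR U)) = (\<Sum>hL\<in>?B. \<Sum>hR\<in>?B. \<Sum>C\<in>?C. \<Sum>U\<in>?W. \<Psi> C U (ptup m k hL hR U))"
        by (rule sum4_swap)
      then show ?thesis using pos unfolding sum_distrib_left[symmetric] by simp
    qed
    also have "\<dots> \<le> (1 / c / (b * b) / f) * (\<Sum>hL\<in>?B. \<Sum>hR\<in>?B. \<Sum>C\<in>?C. \<Sum>g\<in>?F. (cmod (form k {..<d} {..<d} (\<lambda>y x. ?V hL hR g C $$ (y,x)) \<phi>))\<^sup>2)"
      using pos stepf by (intro mult_left_mono sum_mono) auto
    also have "\<dots> = (1 / c / (b * b) / f) * (\<Sum>hL\<in>?B. \<Sum>hR\<in>?B. \<Sum>g\<in>?F. \<Sum>C\<in>?C. (cmod (form k {..<d} {..<d} (\<lambda>y x. ?V hL hR g C $$ (y,x)) \<phi>))\<^sup>2)"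
      by (intro arg_cong2[of _ _ _ _ "(*)"] refl sum.cong sum.swap)
    also have "\<dots> = measure_pmf.expectation (LRFC m) (\<lambda>V. (cmod (form k {..<d} {..<d} (\<lambda>y x. V $$ (y,x)) \<phi>))\<^sup>2)"
      unfolding LRFC_expectation b_def c_def f_def d_def by (simp add: field_simps)
    finally show ?thesis .
  qed
  then show ?thesis unfolding dominated_def d_def using LRFC_finite by blast
qed

section \<open>Patch-by-patch structure of the circuit\<close>

lemma embed_dims [simp]: "dim_row (embed N s w U) = 2^N" "dim_col (embed N s w U) = 2^N"
  unfolding embed_def by simp_all

lemma embed_index: "i < 2^N \<Longrightarrow> j < 2^N \<Longrightarrow> embed N s w U $$ (i,j) = (if i div 2^(s+w) = j div 2^(s+w) \<and> i mod 2^s = j mod 2^s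
     then U $$ ((i div 2^s) mod 2^w, (j div 2^s) mod 2^w) else 0)"
  unfolding embed_def by simp

lemma mod_div_pow: "c \<le> a \<Longrightarrow> ((i::nat) mod 2^a) div 2^c = (i div 2^c) mod 2^(a-c)"
  using drop_bit_take_bit[of c a i] by (simp add: drop_bit_eq_div take_bit_eq_mod)

lemma embed_nest:
  assumes "s + w \<le> a" "a \<le> N"
  shows "embed N 0 a (embed a s w U) = embed N s w U"
proof (rule eq_matI)
  fix i j assume "i < dim_row (embed N s w U)" "j < dim_col (embed N s w U)"
  then have ij: "i < 2^N" "j < 2^N" by simp_all
  let ?e = "a - (s+w)"
  have da: "x div 2^a = (x div 2^(s+w)) div 2^?e" for x :: nat
    using assms(1) by (simp add: div_mult2_eq[symmetric] flip: power_add)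
  have hi: "(i div 2^a = j div 2^a \<and> (i mod 2^a) div 2^(s+w) = (j mod 2^a) div 2^(s+w)) \<longleftrightarrow> i div 2^(s+w) = j div 2^(s+w)"
    unfolding mod_div_pow[OF assms(1)] da by (metis div_mult_mod_eq)
  have lo: "(x mod 2^a) mod 2^s = x mod 2^s" for x :: nat
    using assms(1) by (simp add: mod_mod_cancel le_imp_power_dvd)
  have mid: "((x mod 2^a) div 2^s) mod 2^w = (x div 2^s) mod 2^w" for x :: nat
  proof -
    have "s \<le> a" "w \<le> a - s" using assms(1) by auto
    then show ?thesis by (simp add: mod_div_pow mod_mod_cancel le_imp_power_dvd)
  qed
  show "embed N 0 a (embed a s w U) $$ (i,j) = embed N s w U $$ (i,j)"
    using hi by (auto simp: embed_index ij lo mid)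
qed simp_all

text \<open>The operators act on disjoint groups of digits, so in either order the intermediate
  index is forced and the entry is the same product \<open>?r\<close>.\<close>

lemma embed_commute_adjacent:
  assumes a: "a + w \<le> N" and X: "X \<in> carrier_mat (2^a) (2^a)"
  shows "embed N 0 a X * embed N a w V = embed N a w V * embed N 0 a X"
proof (rule eq_matI)
  fix i j assume "i < dim_row (embed N a w V * embed N 0 a X)" "j < dim_col (embed N a w V * embed N 0 a X)"
  then have ij: "i < 2^N" "j < 2^N" by simp_all
  have aN: "0 + a \<le> N" using a by simp
  let ?r = "if i div 2^(a+w) = j div 2^(a+w) then X $$ (i mod 2^a, j mod 2^a) * V $$ ((i div 2^a) mod 2^w, (j div 2^a) mod 2^w) else 0"
  have "(embed N 0 a X * embed N a w V) $$ (i,j) = (\<Sum>c<2^a. X $$ (i mod 2^a, c) * embed N a w V $$ ((i div 2^a) * 2^a + c, j))"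
    using embed_mult_left[OF aN ij embed_carrier, of X a w V] by simp
  also have "\<dots> = (\<Sum>c<2^a. if c = j mod 2^a then ?r else 0)"
  proof (rule sum.cong[OF refl])
    fix c :: nat assume "c \<in> {..<2^a}"
    then have c: "c < 2^a" by simp
    have lt: "(i div 2^a) * 2^a + c < 2^N" using embed_pos_lt[OF ij(1) aN c, of 0] by simp
    have z: "((i div 2^a) * 2^a + c) div 2^a = i div 2^a" "((i div 2^a) * 2^a + c) mod 2^a = c" using c by simp_all
    have z2: "((i div 2^a) * 2^a + c) div 2^(a+w) = i div 2^(a+w)" unfolding power_add div_mult2_eq z ..
    show "X $$ (i mod 2^a, c) * embed N a w V $$ ((i div 2^a) * 2^a + c, j) = (if c = j mod 2^a then ?r else 0)"
      unfolding embed_index[OF lt ij(2)] z z2 by auto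
  qed
  also have "\<dots> = ?r" by simp
  finally have 1: "(embed N 0 a X * embed N a w V) $$ (i,j) = ?r" .
  have "(embed N a w V * embed N 0 a X) $$ (i,j) = (\<Sum>b<2^w. V $$ ((i div 2^a) mod 2^w, b) * embed N 0 a X $$ (((i div 2^(a+w)) * 2^w + b) * 2^a + i mod 2^a, j))"
    by (rule embed_mult_left[OF a ij embed_carrier])
  also have "\<dots> = (\<Sum>b<2^w. if b = (j div 2^a) mod 2^w then ?r else 0)"
  proof (rule sum.cong[OF refl])
    fix b :: nat assume "b \<in> {..<2^w}"
    then have b: "b < 2^w" by simp
    let ?z = "((i div 2^(a+w)) * 2^w + b) * 2^a + i mod 2^a"
    have lt: "?z < 2^N" by (rule embed_pos_lt[OF ij(1) a b]) simp
    have z: "?z div 2^a = (i div 2^(a+w)) * 2^w + b" "?z mod 2^a = i mod 2^a" by simp_all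
    have "(i div 2^(a+w)) * 2^w + b = j div 2^a \<longleftrightarrow> i div 2^(a+w) = j div 2^(a+w) \<and> b = (j div 2^a) mod 2^w"
    proof -
      have "(i div 2^(a+w)) * 2^w + b = j div 2^a \<longleftrightarrow> i div 2^(a+w) = (j div 2^a) div 2^w \<and> b = (j div 2^a) mod 2^w"
      proof
        assume e: "(i div 2^(a+w)) * 2^w + b = j div 2^a"
        show "i div 2^(a+w) = (j div 2^a) div 2^w \<and> b = (j div 2^a) mod 2^w"
          unfolding e[symmetric] using b by simp
      next
        assume "i div 2^(a+w) = (j div 2^a) div 2^w \<and> b = (j div 2^a) mod 2^w"
        then show "(i div 2^(a+w)) * 2^w + b = j div 2^a" by (metis div_mult_mod_eq)
      qed
      then show ?thesis by (simp add: power_add div_mult2_eq)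
    qed
    then show "V $$ ((i div 2^a) mod 2^w, b) * embed N 0 a X $$ (?z, j) = (if b = (j div 2^a) mod 2^w then ?r else 0)"
      unfolding embed_index[OF lt ij(2)] using z by (auto simp: mult.commute)
  qed
  also have "\<dots> = ?r" by simp
  finally show "(embed N 0 a X * embed N a w V) $$ (i,j) = (embed N a w V * embed N 0 a X) $$ (i,j)" using 1 by simp
qed simp_all

text \<open>\<open>U\<close> is first regarded as an operator on all \<open>s'\<close> lower qubits,
  which makes the two blocks adjacent.\<close>

lemma embed_commute_disjoint:
  assumes "s + w \<le> s'" "s' + w' \<le> N"
  shows "embed N s w U * embed N s' w' V = embed N s' w' V * embed N s w U"
  using embed_commute_adjacent[OF assms(2) embed_carrier, of s w U V] embed_nest[of s w s' N U] assms by simp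

lemma LRFC_unitary:
  assumes "V \<in> set_pmf (LRFC m)"
  shows "V \<in> unitaries (2^(2*m))"
proof -
  have fin: "finite (bool_funs m)" "bool_funs m \<noteq> {}" "finite (clifford_group (2*m))" "clifford_group (2*m) \<noteq> {}"
    using finite_clifford_group clifford_group.id by (auto simp: bool_funs_def PiE_eq_empty_iff intro!: finite_PiE)
  obtain hL hR f C where V: "hL \<in> bool_funs m" "hR \<in> bool_funs m" "C \<in> clifford_group (2*m)" "V = S_L m hL * S_R m hR * F_mat (2*m) f * C"
    using assms fin unfolding LRFC_def by auto
  have "S_L m hL \<in> unitaries (2^(2*m))" unfolding S_L_perm
    by (rule perm_mat_unitary[OF pL_inj[OF V(1)]]) (rule pL_props(1)[OF _ V(1)])
  moreover have "S_R m hR \<in> unitaries (2^(2*m))" unfolding S_R_perm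
    by (rule perm_mat_unitary[OF pR_inj[OF V(2)]]) (rule pR_props(1)[OF _ V(2)])
  ultimately show ?thesis unfolding V(4) by (intro unitaries_mult F_mat_unitary clifford_unitary[OF V(3)])
qed

lemma layer_unitary:
  assumes "R \<in> set_pmf (layer n m ps)" "\<And>p. p \<in> set ps \<Longrightarrow> p * m + 2 * m \<le> n"
  shows "R \<in> unitaries (2^n)"
  using assms
proof (induction ps arbitrary: R)
  case (Cons p ps)
  obtain V R' where "V \<in> set_pmf (LRFC m)" "R' \<in> set_pmf (layer n m ps)" "R = embed n (p * m) (2 * m) V * R'"
    using Cons.prems(1) by auto
  then show ?case using Cons by (auto intro!: unitaries_mult embed_unitary LRFC_unitary)
qed simp

lemma layer_carrier:
  assumes "R \<in> set_pmf (layer n m ps)"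
  shows "R \<in> carrier_mat (2^n) (2^n)"
  using assms
proof (induction ps arbitrary: R)
  case (Cons p ps)
  then obtain V R' where "R' \<in> set_pmf (layer n m ps)" "R = embed n (p * m) (2 * m) V * R'" by auto
  then show ?case using Cons.IH by (auto intro!: mult_carrier_mat)
qed simp

text \<open>\<open>layer\<close> puts a new block in front, whereas the circuit grows at its last
  patch; this is the recursion from the other end.\<close>

lemma layer_append:
  "layer n m (ps @ [p]) = bind_pmf (layer n m ps) (\<lambda>R. bind_pmf (LRFC m) (\<lambda>V. return_pmf (R * embed n (p * m) (2 * m) V)))"
proof (induction ps)
  case Nil
  show ?case by (simp add: bind_return_pmf right_mult_one_mat[OF embed_carrier] left_mult_one_mat[OF embed_carrier])
next
  case (Cons q ps)
  have "layer n m ((q # ps) @ [p]) = bind_pmf (LRFC m) (\<lambda>V0. bind_pmf (layer n m ps) (\<lambda>R. bind_pmf (LRFC m) (\<lambda>V.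
      return_pmf (embed n (q * m) (2 * m) V0 * (R * embed n (p * m) (2 * m) V)))))"
    by (simp add: Cons.IH bind_assoc_pmf bind_return_pmf)
  also have "\<dots> = bind_pmf (LRFC m) (\<lambda>V0. bind_pmf (layer n m ps) (\<lambda>R. bind_pmf (LRFC m) (\<lambda>V.
      return_pmf (embed n (q * m) (2 * m) V0 * R * embed n (p * m) (2 * m) V))))"
  proof (rule bind_pmf_cong[OF refl], rule bind_pmf_cong[OF refl], rule bind_pmf_cong[OF refl])
    fix V0 R V assume "R \<in> set_pmf (layer n m ps)"
    then have "R \<in> carrier_mat (2^n) (2^n)" by (rule layer_carrier)
    then show "return_pmf (embed n (q * m) (2 * m) V0 * (R * embed n (p * m) (2 * m) V)) = return_pmf (embed n (q * m) (2 * m) V0 * R * embed n (p * m) (2 * m) V)"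
      using assoc_mult_mat[OF embed_carrier _ embed_carrier] by simp
  qed
  also have "\<dots> = bind_pmf (layer n m (q # ps)) (\<lambda>R. bind_pmf (LRFC m) (\<lambda>V. return_pmf (R * embed n (p * m) (2 * m) V)))"
    by (simp add: bind_assoc_pmf bind_return_pmf)
  finally show ?case .
qed

text \<open>Lets a layer of the shorter circuit be reused in the longer one, where it acts trivially
  on the new patch.\<close>

lemma layer_extend:
  assumes "n \<le> N" "\<And>p. p \<in> set ps \<Longrightarrow> p * m + 2 * m \<le> n"
  shows "layer N m ps = map_pmf (embed N 0 n) (layer n m ps)"
  using assms(2)
proof (induction ps)
  case Nil
  then show ?case using embed_one[of 0 n N] assms(1) by simp
next
  case (Cons p ps)
  have "layer N m (p # ps) = bind_pmf (LRFC m) (\<lambda>V. bind_pmf (layer n m ps) (\<lambda>R. return_pmf (embed N (p * m) (2 * m) V * embed N 0 n R)))"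
    using Cons by (simp add: map_pmf_def bind_assoc_pmf bind_return_pmf)
  also have "\<dots> = bind_pmf (LRFC m) (\<lambda>V. bind_pmf (layer n m ps) (\<lambda>R. return_pmf (embed N 0 n (embed n (p * m) (2 * m) V * R))))"
  proof (rule bind_pmf_cong[OF refl], rule bind_pmf_cong[OF refl])
    fix V R assume "R \<in> set_pmf (layer n m ps)"
    then have R: "R \<in> carrier_mat (2^n) (2^n)" by (rule layer_carrier)
    show "return_pmf (embed N (p * m) (2 * m) V * embed N 0 n R) = return_pmf (embed N 0 n (embed n (p * m) (2 * m) V * R))"
      using embed_mult[of 0 n N "embed n (p * m) (2 * m) V" R] embed_nest[of "p * m" "2 * m" n N V] R assms(1) Cons.prems[of p] by simp
  qed
  finally show ?case by (simp add: map_pmf_def bind_assoc_pmf bind_return_pmf)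
qed

lemma layer_commute:
  assumes "R \<in> set_pmf (layer N m ps)" "\<And>q. q \<in> set ps \<Longrightarrow> q + 2 \<le> p" "p * m + 2 * m \<le> N"
  shows "R * embed N (p * m) (2 * m) V = embed N (p * m) (2 * m) V * R"
  using assms(1,2)
proof (induction ps arbitrary: R)
  case Nil
  then show ?case by (simp add: right_mult_one_mat[OF embed_carrier] left_mult_one_mat[OF embed_carrier])
next
  case (Cons q ps)
  let ?E = "embed N (p * m) (2 * m) V"
  obtain V' R' where R': "R' \<in> set_pmf (layer N m ps)" "R = embed N (q * m) (2 * m) V' * R'" using Cons.prems(1) by auto
  let ?D = "embed N (q * m) (2 * m) V'"
  have c: "R' \<in> carrier_mat (2^N) (2^N)" by (rule layer_carrier[OF R'(1)])
  have "q + 2 \<le> p" using Cons.prems(2) by simp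
  then have "(q + 2) * m \<le> p * m" by (rule mult_le_mono1)
  then have le: "q * m + 2 * m \<le> p * m" by (simp add: algebra_simps)
  have "?D * R' * ?E = ?D * (R' * ?E)" by (rule assoc_mult_mat[OF embed_carrier c embed_carrier])
  also have "R' * ?E = ?E * R'" by (rule Cons.IH[OF R'(1)]) (use Cons.prems in auto)
  also have "?D * (?E * R') = ?D * ?E * R'" by (rule assoc_mult_mat[OF embed_carrier embed_carrier c, symmetric])
  also have "?D * ?E = ?E * ?D" by (rule embed_commute_disjoint[OF le assms(3)])
  also have "?E * ?D * R' = ?E * (?D * R')" by (rule assoc_mult_mat[OF embed_carrier embed_carrier c])
  finally show ?case unfolding R'(2) .
qed

text \<open>One more patch creates at most one new pair, starting at \<open>P - 1\<close>; its
  parity decides the layer.\<close>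

lemma odd_pairs_Suc: "odd_pairs (Suc P) = odd_pairs P @ (if P \<ge> 1 \<and> even (P - 1) then [P - 1] else [])"
  and even_pairs_Suc: "even_pairs (Suc P) = even_pairs P @ (if P \<ge> 1 \<and> odd (P - 1) then [P - 1] else [])"
proof -
  have f: "filter (\<lambda>p. Pr p \<and> p + 1 < Suc P) [0..<Suc P] = filter (\<lambda>p. Pr p \<and> p + 1 < P) [0..<P] @ (if P \<ge> 1 \<and> Pr (P - 1) then [P - 1] else [])" for Pr
  proof (cases P)
    case (Suc r)
    have "filter (\<lambda>p. Pr p \<and> p + 1 < Suc P) [0..<r] = filter Pr [0..<r]"
      "filter (\<lambda>p. Pr p \<and> p + 1 < P) [0..<r] = filter Pr [0..<r]" by (rule filter_cong; auto simp: Suc)+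
    then show ?thesis unfolding Suc by (simp add: upt_Suc)
  qed simp
  show "odd_pairs (Suc P) = odd_pairs P @ (if P \<ge> 1 \<and> even (P - 1) then [P - 1] else [])"
    "even_pairs (Suc P) = even_pairs P @ (if P \<ge> 1 \<and> odd (P - 1) then [P - 1] else [])"
    unfolding odd_pairs_def even_pairs_def by (rule f)+
qed

lemma pairs_bounds:
  "p \<in> set (odd_pairs P) \<Longrightarrow> p + 2 \<le> P" "p \<in> set (even_pairs P) \<Longrightarrow> p + 2 \<le> P"
  "p \<in> set (even_pairs P) \<Longrightarrow> odd p"
  unfolding odd_pairs_def even_pairs_def by auto

lemma pairs_bounds_mult:
  assumes "p + 2 \<le> P"
  shows "p * m + 2 * m \<le> m * (P::nat)"
  using mult_le_mono1[OF assms, of m] by (simp add: algebra_simps)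

text \<open>The two ways to add a block on the last two patches: \<open>ext_right\<close> lets it
  act before the old circuit, as a block of the first layer does, and \<open>ext_left\<close> after
  it, for the second layer.\<close>

definition ext_right :: "nat \<Rightarrow> nat \<Rightarrow> complex mat \<times> complex mat \<Rightarrow> complex mat" where
  "ext_right m P = (\<lambda>(t,V). embed (m * Suc P) 0 (m * P) t * embed (m * Suc P) (m * (P-1)) (2*m) V)"

definition ext_left :: "nat \<Rightarrow> nat \<Rightarrow> complex mat \<times> complex mat \<Rightarrow> complex mat" where
  "ext_left m P = (\<lambda>(t,V). embed (m * Suc P) (m * (P-1)) (2*m) V * embed (m * Suc P) 0 (m * P) t)"

lemma blocked_unitary:
  assumes "T \<in> set_pmf (blocked_LRFC3 (m * P) m)" "0 < m"
  shows "T \<in> unitaries (2^(m * P))"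
proof -
  obtain Uo Ue where U: "Uo \<in> set_pmf (layer (m * P) m (odd_pairs P))" "Ue \<in> set_pmf (layer (m * P) m (even_pairs P))" "T = Ue * Uo"
    using assms unfolding blocked_LRFC3_def by auto
  show ?thesis unfolding U(3)
    by (intro unitaries_mult layer_unitary[OF U(1)] layer_unitary[OF U(2)] pairs_bounds_mult) (auto dest: pairs_bounds)
qed

text \<open>A new block of the first layer already stands rightmost in \<open>Ue * Uo\<close>. A new
  block of the second layer stands between \<open>Ue\<close> and \<open>Uo\<close> and is moved to
  the front past the other blocks of its layer, which act on disjoint patches. Adding blocks one
  patch at a time therefore reproduces the two-layer circuit.\<close>

lemma blocked_step:
  assumes m: "0 < m" and P: "2 \<le> P"
  shows "blocked_LRFC3 (m * Suc P) m = map_pmf (if even (P - 1) then ext_right m P else ext_left m P) (pair_pmf (blocked_LRFC3 (m * P) m) (LRFC m))"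
proof -
  let ?N = "m * Suc P" and ?n = "m * P"
  let ?e = "embed ?N 0 ?n"
  let ?E = "\<lambda>V. embed ?N ((P - 1) * m) (2 * m) V"
  have nN: "?n \<le> ?N" by simp
  have c0: "0 + ?n \<le> ?N" by simp
  have lo: "layer ?N m (odd_pairs P) = map_pmf ?e (layer ?n m (odd_pairs P))"
    by (rule layer_extend[OF nN]) (use pairs_bounds pairs_bounds_mult in blast)
  have le: "layer ?N m (even_pairs P) = map_pmf ?e (layer ?n m (even_pairs P))"
    by (rule layer_extend[OF nN]) (use pairs_bounds pairs_bounds_mult in blast)
  have pos: "(P - 1) * m + 2 * m \<le> ?N" using P by (cases P) (auto simp: algebra_simps)
  have base: "pair_pmf (blocked_LRFC3 ?n m) (LRFC m) = bind_pmf (layer ?n m (odd_pairs P)) (\<lambda>Uo. bind_pmf (layer ?n m (even_pairs P)) (\<lambda>Ue. bind_pmf (LRFC m) (\<lambda>V. return_pmf (Ue * Uo, V))))"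
    unfolding pair_pmf_def blocked_LRFC3_def using m by (simp add: bind_assoc_pmf bind_return_pmf)
  have emb: "?e Ue * ?e Uo = ?e (Ue * Uo)" if "Uo \<in> set_pmf (layer ?n m (odd_pairs P))" "Ue \<in> set_pmf (layer ?n m (even_pairs P))" for Uo Ue
    by (rule embed_mult[OF c0 layer_carrier[OF that(2)] layer_carrier[OF that(1)]])
  have div: "?N div m = Suc P" using m by simp
  show ?thesis
  proof (cases "even (P - 1)")
    case True
    have o: "odd_pairs (Suc P) = odd_pairs P @ [P - 1]" and e: "even_pairs (Suc P) = even_pairs P"
      using True P odd_pairs_Suc[of P] even_pairs_Suc[of P] by auto
    have "blocked_LRFC3 ?N m = bind_pmf (layer ?n m (odd_pairs P)) (\<lambda>Uo. bind_pmf (LRFC m) (\<lambda>V. bind_pmf (layer ?n m (even_pairs P)) (\<lambda>Ue. return_pmf (?e Ue * (?e Uo * ?E V)))))"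
      unfolding blocked_LRFC3_def div o e layer_append lo le by (simp add: map_pmf_def bind_assoc_pmf bind_return_pmf)
    also have "\<dots> = bind_pmf (layer ?n m (odd_pairs P)) (\<lambda>Uo. bind_pmf (layer ?n m (even_pairs P)) (\<lambda>Ue. bind_pmf (LRFC m) (\<lambda>V. return_pmf (?e Ue * (?e Uo * ?E V)))))"
      by (subst bind_commute_pmf[of "LRFC m"]) simp
    also have "\<dots> = bind_pmf (layer ?n m (odd_pairs P)) (\<lambda>Uo. bind_pmf (layer ?n m (even_pairs P)) (\<lambda>Ue. bind_pmf (LRFC m) (\<lambda>V. return_pmf (ext_right m P (Ue * Uo, V)))))"
    proof (rule bind_pmf_cong[OF refl], rule bind_pmf_cong[OF refl], rule bind_pmf_cong[OF refl])
      fix Uo Ue V assume "Uo \<in> set_pmf (layer ?n m (odd_pairs P))" "Ue \<in> set_pmf (layer ?n m (even_pairs P))"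
      then show "return_pmf (?e Ue * (?e Uo * ?E V)) = return_pmf (ext_right m P (Ue * Uo, V))"
        unfolding ext_right_def prod.case using emb assoc_mult_mat[OF embed_carrier embed_carrier embed_carrier, of ?N 0 ?n Ue 0 ?n Uo "(P-1)*m" "2*m" V]
        by (simp add: mult.commute)
    qed
    also have "\<dots> = map_pmf (ext_right m P) (pair_pmf (blocked_LRFC3 ?n m) (LRFC m))"
      unfolding base by (simp add: map_pmf_def bind_assoc_pmf bind_return_pmf)
    finally show ?thesis using True by simp
  next
    case False
    have o: "odd_pairs (Suc P) = odd_pairs P" and e: "even_pairs (Suc P) = even_pairs P @ [P - 1]"
      using False P odd_pairs_Suc[of P] even_pairs_Suc[of P] by auto
    have "blocked_LRFC3 ?N m = bind_pmf (layer ?N m (odd_pairs P)) (\<lambda>Uo. bind_pmf (layer ?N m (even_pairs P)) (\<lambda>Ue. bind_pmf (LRFC m) (\<lambda>V. return_pmf (Ue * ?E V * Uo))))"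
      unfolding blocked_LRFC3_def div o e layer_append by (simp add: bind_assoc_pmf bind_return_pmf)
    also have "\<dots> = bind_pmf (layer ?N m (odd_pairs P)) (\<lambda>Uo. bind_pmf (layer ?N m (even_pairs P)) (\<lambda>Ue. bind_pmf (LRFC m) (\<lambda>V. return_pmf (?E V * (Ue * Uo)))))"
    proof (rule bind_pmf_cong[OF refl], rule bind_pmf_cong[OF refl], rule bind_pmf_cong[OF refl])
      fix Uo Ue V assume U: "Uo \<in> set_pmf (layer ?N m (odd_pairs P))" "Ue \<in> set_pmf (layer ?N m (even_pairs P))"
      have "Ue * ?E V = ?E V * Ue"
      proof (rule layer_commute[OF U(2) _ pos])
        \<comment> \<open>All starting patches of this layer are odd, and so is
          \<open>P - 1\<close>; an earlier one is therefore smaller by at least 2, which makes the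
          blocks disjoint.\<close>
        fix q assume q: "q \<in> set (even_pairs P)"
        then have "q + 2 \<le> P" "odd q" using pairs_bounds by auto
        then show "q + 2 \<le> P - 1" using False P by (metis Suc_1 add_Suc_right diff_Suc_1 even_Suc le_SucE le_antisym not_less_eq_eq One_nat_def add.right_neutral add_2_eq_Suc' Suc_diff_1 diff_is_0_eq even_zero gr0I)
      qed
      then show "return_pmf (Ue * ?E V * Uo) = return_pmf (?E V * (Ue * Uo))"
        using assoc_mult_mat[OF embed_carrier layer_carrier[OF U(2)] layer_carrier[OF U(1)], of "(P-1)*m" "2*m" V] by simp
    qed
    also have "\<dots> = bind_pmf (layer ?n m (odd_pairs P)) (\<lambda>Uo. bind_pmf (layer ?n m (even_pairs P)) (\<lambda>Ue. bind_pmf (LRFC m) (\<lambda>V. return_pmf (?E V * (?e Ue * ?e Uo)))))"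
      unfolding lo le by (simp add: map_pmf_def bind_assoc_pmf bind_return_pmf)
    also have "\<dots> = bind_pmf (layer ?n m (odd_pairs P)) (\<lambda>Uo. bind_pmf (layer ?n m (even_pairs P)) (\<lambda>Ue. bind_pmf (LRFC m) (\<lambda>V. return_pmf (ext_left m P (Ue * Uo, V)))))"
    proof (rule bind_pmf_cong[OF refl], rule bind_pmf_cong[OF refl], rule bind_pmf_cong[OF refl])
      fix Uo Ue V assume "Uo \<in> set_pmf (layer ?n m (odd_pairs P))" "Ue \<in> set_pmf (layer ?n m (even_pairs P))"
      then show "return_pmf (?E V * (?e Ue * ?e Uo)) = return_pmf (ext_left m P (Ue * Uo, V))"
        unfolding ext_left_def prod.case mult.commute[of "P - 1" m] by (simp only: emb)
    qed
    also have "\<dots> = map_pmf (ext_left m P) (pair_pmf (blocked_LRFC3 ?n m) (LRFC m))"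
      unfolding base by (simp add: map_pmf_def bind_assoc_pmf bind_return_pmf)
    finally show ?thesis using False by simp
  qed
qed

section \<open>Haar measure\<close>

text \<open>Lebesgue measure on complex arrays, from which Haar measure is built by
  Gram-Schmidt.\<close>

definition lam :: "'i set \<Rightarrow> ('i \<Rightarrow> complex) measure" where
  "lam I = (\<Pi>\<^sub>M x\<in>I. (lborel :: complex measure))"

definition shift :: "'i set \<Rightarrow> ('i \<Rightarrow> complex) \<Rightarrow> ('i \<Rightarrow> complex) \<Rightarrow> ('i \<Rightarrow> complex)" where
  "shift I a G = (\<lambda>x\<in>I. G x + a x)"

definition sqn :: "'i set \<Rightarrow> ('i \<Rightarrow> complex) \<Rightarrow> real" where
  "sqn I G = (\<Sum>x\<in>I. (cmod (G x))\<^sup>2)"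

lemma space_lam: "space (lam I) = (\<Pi>\<^sub>E x\<in>I. UNIV)"
  unfolding lam_def by (simp add: space_PiM)

lemma lam_component: "x \<in> I \<Longrightarrow> (\<lambda>G. G x) \<in> borel_measurable (lam I)"
  unfolding lam_def using measurable_component_singleton[of x I "\<lambda>_. lborel :: complex measure"]
  by (simp add: measurable_lborel2)

lemma measurable_lam_iff:
  assumes "f \<in> space M \<rightarrow> extensional I" "\<And>x. x \<in> I \<Longrightarrow> (\<lambda>w. f w x) \<in> borel_measurable M"
  shows "f \<in> measurable M (lam I)"
  unfolding lam_def
proof (rule measurable_PiM_single')
  show "\<And>i. i \<in> I \<Longrightarrow> (\<lambda>\<omega>. f \<omega> i) \<in> M \<rightarrow>\<^sub>M lborel" using assms by simp
  show "f \<in> space M \<rightarrow> (\<Pi>\<^sub>E i\<in>I. space lborel)" using assms by (auto simp: PiE_def)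
qed

lemma shift_measurable: "shift I a \<in> measurable (lam I) (lam I)"
proof (rule measurable_lam_iff)
  fix x assume x: "x \<in> I"
  note [measurable] = lam_component[OF x]
  have "(\<lambda>G. G x + a x) \<in> borel_measurable (lam I)" by measurable
  then show "(\<lambda>G. shift I a G x) \<in> borel_measurable (lam I)" using x by (simp only: shift_def restrict_apply' if_True)
qed (auto simp: shift_def)

lemma lam_shift:
  assumes "finite I"
  shows "distr (lam I) (lam I) (shift I a) = lam I"
proof -
  interpret product_sigma_finite "\<lambda>_. lborel :: complex measure" by standard
  note meas = shift_measurable[of I a]
  have "distr (lam I) (lam I) (shift I a) = PiM I (\<lambda>_. lborel)"
  proof (rule PiM_eqI[OF assms])
    show "sets (distr (lam I) (lam I) (shift I a)) = sets (PiM I (\<lambda>_. lborel))"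
      by (simp add: lam_def)
    fix A :: "_ \<Rightarrow> complex set" assume A: "\<And>i. i \<in> I \<Longrightarrow> A i \<in> sets lborel"
    have pre: "shift I a -` (Pi\<^sub>E I A) \<inter> space (lam I) = Pi\<^sub>E I (\<lambda>i. (\<lambda>z. a i + z) -` A i)"
      by (auto simp: space_lam shift_def PiE_iff add.commute)
    have "Pi\<^sub>E I A \<in> sets (lam I)" unfolding lam_def
      by (rule sets_PiM_I_finite) (use assms A in auto)
    then have "emeasure (distr (lam I) (lam I) (shift I a)) (Pi\<^sub>E I A)
       = emeasure (lam I) (Pi\<^sub>E I (\<lambda>i. (\<lambda>z. a i + z) -` A i))"
      by (simp add: emeasure_distr[OF meas] pre)
    also have "\<dots> = (\<Prod>i\<in>I. emeasure lborel ((\<lambda>z. a i + z) -` A i))"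
      unfolding lam_def
    proof (rule emeasure_PiM[OF assms])
      fix i assume "i \<in> I"
      then show "(\<lambda>z. a i + z) -` A i \<in> sets lborel"
        using measurable_sets[of "\<lambda>z. a i + z" borel borel "A i"] A by simp
    qed
    also have "\<dots> = (\<Prod>i\<in>I. emeasure lborel (A i))"
    proof (rule prod.cong)
      fix i assume "i \<in> I"
      then have "A i \<in> sets borel" using A by auto
      then have "emeasure (distr lborel borel ((+) (a i))) (A i) = emeasure lborel ((+) (a i) -` A i)"
        by (subst emeasure_distr) auto
      then show "emeasure lborel ((\<lambda>z. a i + z) -` A i) = emeasure lborel (A i)"
        by (simp add: lborel_distr_plus)
    qed simp
    finally show "emeasure (distr (lam I) (lam I) (shift I a)) (Pi\<^sub>E I A) = (\<Prod>i\<in>I. emeasure lborel (A i))" .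
  qed
  then show ?thesis by (simp add: lam_def)
qed

lemma emeasure_lborel_ball_pos: "0 < r \<Longrightarrow> 0 < emeasure lborel (ball (c::complex) r)"
  using content_ball_pos[of r c] emeasure_lborel_ball_finite[of c r]
  by (subst emeasure_eq_ennreal_measure) auto

lemma lam_box:
  assumes "finite I"
  shows "emeasure (lam I) (Pi\<^sub>E I (\<lambda>i. ball (c i) r)) = (\<Prod>i\<in>I. emeasure lborel (ball (c i) r))"
    "Pi\<^sub>E I (\<lambda>i. ball (c i) r) \<in> sets (lam I)"
proof -
  interpret product_sigma_finite "\<lambda>_. lborel :: complex measure" by standard
  show "emeasure (lam I) (Pi\<^sub>E I (\<lambda>i. ball (c i) r)) = (\<Prod>i\<in>I. emeasure lborel (ball (c i) r))"
    unfolding lam_def by (rule emeasure_PiM[OF assms]) auto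
  show "Pi\<^sub>E I (\<lambda>i. ball (c i) r) \<in> sets (lam I)" unfolding lam_def
    by (rule sets_PiM_I_finite) (use assms in auto)
qed

lemma lam_box_pos:
  assumes "finite I" "0 < r"
  shows "0 < emeasure (lam I) (Pi\<^sub>E I (\<lambda>i. ball (c i) r))"
proof -
  have "(\<Prod>i\<in>I. emeasure lborel (ball (c i) r)) \<noteq> 0"
    using assms(1) emeasure_lborel_ball_pos[OF assms(2)] by (simp add: prod_zero_iff) (metis less_irrefl)
  then show ?thesis using lam_box(1)[OF assms(1)] by (metis zero_less_iff_neq_zero)
qed

lemma sqn_measurable [measurable]: "sqn I \<in> borel_measurable (lam I)"
proof -
  have "(\<lambda>G. \<Sum>x\<in>I. (cmod (G x))\<^sup>2) \<in> borel_measurable (lam I)"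
  proof (rule borel_measurable_sum)
    fix x assume x: "x \<in> I"
    note [measurable] = lam_component[OF x]
    show "(\<lambda>G. (cmod (G x))\<^sup>2) \<in> borel_measurable (lam I)" by measurable
  qed
  then show ?thesis unfolding sqn_def[abs_def] .
qed

lemma sqn_ball_finite:
  assumes "finite I" "0 < r"
  shows "emeasure (lam I) {G \<in> space (lam I). sqn I G < r\<^sup>2} < \<infinity>"
proof -
  have "{G \<in> space (lam I). sqn I G < r\<^sup>2} \<subseteq> Pi\<^sub>E I (\<lambda>i. ball 0 r)"
  proof
    fix G assume G: "G \<in> {G \<in> space (lam I). sqn I G < r\<^sup>2}"
    have "cmod (G i) < r" if "i \<in> I" for i
    proof -
      have "(cmod (G i))\<^sup>2 \<le> sqn I G" unfolding sqn_def
        using assms that by (intro member_le_sum) auto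
      then have "(cmod (G i))\<^sup>2 < r\<^sup>2" using G by auto
      then show ?thesis using \<open>0 < r\<close> by (simp add: power2_less_imp_less)
    qed
    then show "G \<in> Pi\<^sub>E I (\<lambda>i. ball 0 r)" using G by (auto simp: space_lam PiE_iff)
  qed
  then have "emeasure (lam I) {G \<in> space (lam I). sqn I G < r\<^sup>2} \<le> emeasure (lam I) (Pi\<^sub>E I (\<lambda>i. ball 0 r))"
    by (rule emeasure_mono) (rule lam_box(2)[OF assms(1)])
  also have "\<dots> < \<infinity>"
    unfolding lam_box(1)[OF assms(1)] using emeasure_lborel_ball_finite[of "0::complex" r]
    by (simp add: power_less_top_ennreal)
  finally show ?thesis .
qed

lemma sqn_ball_pos:
  assumes "finite I"
  shows "0 < emeasure (lam I) {G \<in> space (lam I). sqn I G < 1}"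
proof -
  define r where "r = 1 / (real (card I) + 1)"
  have r: "0 < r" "r \<le> 1" "real (card I) * r < 1" unfolding r_def by (auto simp: field_simps)
  have "Pi\<^sub>E I (\<lambda>i. ball 0 r) \<subseteq> {G \<in> space (lam I). sqn I G < 1}"
  proof
    fix G assume G: "G \<in> Pi\<^sub>E I (\<lambda>i. ball (0::complex) r)"
    have "sqn I G \<le> (\<Sum>x\<in>I. r)" unfolding sqn_def
    proof (rule sum_mono)
      fix x assume "x \<in> I"
      then have "cmod (G x) \<le> r" using G by (auto simp: PiE_iff less_imp_le)
      then have "(cmod (G x))\<^sup>2 \<le> r\<^sup>2" by (intro power_mono) auto
      also have "\<dots> \<le> r" using r by (simp add: power2_eq_square mult_left_le)
      finally show "(cmod (G x))\<^sup>2 \<le> r" .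
    qed
    then have "sqn I G < 1" using r by simp
    then show "G \<in> {G \<in> space (lam I). sqn I G < 1}" using G by (auto simp: space_lam PiE_iff)
  qed
  then have "emeasure (lam I) (Pi\<^sub>E I (\<lambda>i. ball 0 r)) \<le> emeasure (lam I) {G \<in> space (lam I). sqn I G < 1}"
    by (rule emeasure_mono) measurable
  then show ?thesis using lam_box_pos[OF assms r(1), of "\<lambda>_. 0"] by (rule less_le_trans[rotated])
qed

text \<open>Both Lebesgue measure and its image under a linear bijection are translation invariant, so
  by Fubini they are proportional; the factor is \<open>1\<close> because the unit ball is preserved.\<close>

lemma lam_isometry_invariant:
  assumes fin: "finite I"
    and T: "T \<in> measurable (lam I) (lam I)" and T': "T' \<in> measurable (lam I) (lam I)"
    and inv: "\<And>G. G \<in> space (lam I) \<Longrightarrow> T (T' G) = G" "\<And>G. G \<in> space (lam I) \<Longrightarrow> T' (T G) = G"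
    and lin: "\<And>G a. G \<in> space (lam I) \<Longrightarrow> a \<in> space (lam I) \<Longrightarrow> T (shift I a G) = shift I (T a) (T G)"
    and nrm: "\<And>G. G \<in> space (lam I) \<Longrightarrow> sqn I (T G) = sqn I G"
  shows "distr (lam I) (lam I) T = lam I"
proof -
  define L where "L = lam I"
  define L' where "L' = distr L L T"
  define S where "S = {G \<in> space L. sqn I G < 1}"
  note [measurable] = T[folded L_def] T'[folded L_def]
  have sp[simp]: "space L' = space L" "sets L' = sets L" unfolding L'_def by auto
  have spL: "space L = (\<Pi>\<^sub>E x\<in>I. UNIV)" unfolding L_def by (rule space_lam)
  have sqm[measurable]: "sqn I \<in> borel_measurable L" unfolding L_def by (rule sqn_measurable)
  have S[measurable]: "S \<in> sets L" unfolding S_def by measurable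
  interpret product_sigma_finite "\<lambda>_. lborel :: complex measure" by standard
  interpret fp: finite_product_sigma_finite "\<lambda>_. lborel :: complex measure" I by standard (rule fin)
  have sfL: "sigma_finite_measure L" unfolding L_def lam_def by (rule sigma_finite[OF fin])
  \<comment> \<open>Fubini needs the image measure to be sigma-finite; this is inherited from
    \<open>L\<close>, to which \<open>L'\<close> is carried back by the inverse map
    \<open>T'\<close>.\<close>
  have "distr L' L T' = L"
  proof -
    have "distr L' L T' = distr L L (T' \<circ> T)" unfolding L'_def by (subst distr_distr) auto
    also have "\<dots> = distr L L (\<lambda>x. x)" by (rule distr_cong) (auto simp: inv L_def)
    also have "\<dots> = L" by simp
    finally show ?thesis .
  qed
  then have sfL': "sigma_finite_measure L'"
    using sfL by (intro sigma_finite_measure_distr[of L' L T']) (auto simp: L'_def)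
  interpret L: sigma_finite_measure L by (rule sfL)
  interpret L': sigma_finite_measure L' by (rule sfL')
  interpret LL: pair_sigma_finite L L' by standard
  have shmeas: "(\<lambda>p. shift I (snd p) (fst p)) \<in> measurable (L \<Otimes>\<^sub>M L) L"
    "(\<lambda>p. shift I (\<lambda>x. - snd p x) (fst p)) \<in> measurable (L \<Otimes>\<^sub>M L) L"
  proof -
    have c: "(\<lambda>p. fst p x + snd p x) \<in> borel_measurable (lam I \<Otimes>\<^sub>M lam I)"
      "(\<lambda>p. fst p x + - snd p x) \<in> borel_measurable (lam I \<Otimes>\<^sub>M lam I)" if "x \<in> I" for x
    proof -
      have [measurable]: "(\<lambda>p. fst p x) \<in> borel_measurable (lam I \<Otimes>\<^sub>M lam I)"
        by (rule measurable_compose[OF measurable_fst lam_component[OF that]])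
      have [measurable]: "(\<lambda>p. snd p x) \<in> borel_measurable (lam I \<Otimes>\<^sub>M lam I)"
        by (rule measurable_compose[OF measurable_snd lam_component[OF that]])
      show "(\<lambda>p. fst p x + snd p x) \<in> borel_measurable (lam I \<Otimes>\<^sub>M lam I)"
        "(\<lambda>p. fst p x + - snd p x) \<in> borel_measurable (lam I \<Otimes>\<^sub>M lam I)" by measurable
    qed
    show "(\<lambda>p. shift I (snd p) (fst p)) \<in> measurable (L \<Otimes>\<^sub>M L) L"
      "(\<lambda>p. shift I (\<lambda>x. - snd p x) (fst p)) \<in> measurable (L \<Otimes>\<^sub>M L) L"
      unfolding L_def
      by (rule measurable_lam_iff, force simp: shift_def, use c in \<open>simp only: shift_def restrict_apply' if_True\<close>)+
  qed
  have neg: "(\<lambda>x\<in>I. - a x) \<in> space L" for a :: "'a \<Rightarrow> complex" by (auto simp: spL)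
  have shsp: "shift I a G \<in> space L" for a G by (auto simp: spL shift_def)
  have sheq: "shift I a G = shift I (\<lambda>x\<in>I. a x) G" for a G by (auto simp: shift_def restrict_def)
  have inL: "(\<integral>\<^sup>+x. f (shift I a x) \<partial>L) = (\<integral>\<^sup>+x. f x \<partial>L)"
    if [measurable]: "f \<in> borel_measurable L" for f a
  proof -
    note m = shift_measurable[of I a, folded L_def]
    have "(\<integral>\<^sup>+x. f x \<partial>L) = (\<integral>\<^sup>+x. f x \<partial>distr L L (shift I a))"
      unfolding L_def lam_shift[OF fin] ..
    also have "\<dots> = (\<integral>\<^sup>+x. f (shift I a x) \<partial>L)" by (rule nn_integral_distr[OF m]) simp
    finally show ?thesis by simp
  qed
  note shm[measurable] = shift_measurable[of I, folded L_def]
  have inL': "(\<integral>\<^sup>+x. f (shift I a x) \<partial>L') = (\<integral>\<^sup>+x. f x \<partial>L')"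
    if f[measurable]: "f \<in> borel_measurable L" and a: "a \<in> space L" for f a
  proof -
    have "(\<integral>\<^sup>+x. f (shift I a x) \<partial>L') = (\<integral>\<^sup>+x. f (shift I a (T x)) \<partial>L)"
      unfolding L'_def by (subst nn_integral_distr) auto
    also have "\<dots> = (\<integral>\<^sup>+x. f (T (shift I (T' a) x)) \<partial>L)"
    proof (rule nn_integral_cong)
      fix x assume x: "x \<in> space L"
      have "T' a \<in> space L" using a T' unfolding L_def by (auto dest: measurable_space)
      then show "f (shift I a (T x)) = f (T (shift I (T' a) x))"
        using lin[of x "T' a"] x inv(1)[of a] a unfolding L_def by simp
    qed
    also have "\<dots> = (\<integral>\<^sup>+x. f (T x) \<partial>L)" by (rule inL) measurable
    also have "\<dots> = (\<integral>\<^sup>+x. f x \<partial>L')" unfolding L'_def by (subst nn_integral_distr) auto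
    finally show ?thesis .
  qed
  have L'S: "emeasure L' S = emeasure L S"
  proof -
    have "T -` S \<inter> space L = S"
      using nrm T unfolding S_def L_def by (auto dest: measurable_space)
    then show ?thesis unfolding L'_def by (subst emeasure_distr) auto
  qed
  have Ssym: "shift I (\<lambda>i. - y i) x \<in> S \<longleftrightarrow> shift I (\<lambda>i. - x i) y \<in> S" for x y
  proof -
    have "sqn I (shift I (\<lambda>i. - y i) x) = sqn I (shift I (\<lambda>i. - x i) y)"
      unfolding sqn_def by (rule sum.cong) (auto simp: shift_def norm_minus_commute)
    then show ?thesis by (auto simp: S_def shsp)
  qed
  \<comment> \<open>The double integral of \<open>1_S(x) 1_B(x + y)\<close>, with \<open>L\<close>
    in \<open>x\<close> and \<open>L'\<close> in \<open>y\<close>, is evaluated in both orders.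
    Invariance of \<open>L'\<close> gives \<open>L(S) L'(B)\<close>; substituting
    \<open>x - y\<close> for \<open>x\<close> and using the symmetry of \<open>S\<close> gives
    \<open>L(B) L'(S)\<close>, and \<open>L'(S) = L(S)\<close>.\<close>
  have propor: "emeasure L S * emeasure L' B = emeasure L B * emeasure L S" if B[measurable]: "B \<in> sets L" for B
  proof -
    have m1: "(\<lambda>p. indicator S (fst p) * indicator B (shift I (snd p) (fst p)) :: ennreal) \<in> borel_measurable (L \<Otimes>\<^sub>M L')"
    proof -
      have "sets (L \<Otimes>\<^sub>M L') = sets (L \<Otimes>\<^sub>M L)" by (rule sets_pair_measure_cong) auto
      then show ?thesis using shmeas(1) by (subst measurable_cong_sets[OF _ refl]) auto
    qed
    have m2: "(\<lambda>p. indicator S (shift I (\<lambda>i. - snd p i) (fst p)) * indicator B (fst p) :: ennreal) \<in> borel_measurable (L \<Otimes>\<^sub>M L')"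
    proof -
      have "sets (L \<Otimes>\<^sub>M L') = sets (L \<Otimes>\<^sub>M L)" by (rule sets_pair_measure_cong) auto
      then show ?thesis using shmeas(2) by (subst measurable_cong_sets[OF _ refl]) auto
    qed
    have "emeasure L S * emeasure L' B = (\<integral>\<^sup>+x. indicator S x * emeasure L' B \<partial>L)"
      by (simp add: nn_integral_multc)
    also have "\<dots> = (\<integral>\<^sup>+x. (\<integral>\<^sup>+y. indicator S x * indicator B (shift I y x) \<partial>L') \<partial>L)"
    proof (rule nn_integral_cong)
      fix x assume x: "x \<in> space L"
      have "emeasure L' B = (\<integral>\<^sup>+y. indicator B y \<partial>L')" by simp
      also have "\<dots> = (\<integral>\<^sup>+y. indicator B (shift I x y) \<partial>L')" by (rule inL'[symmetric, OF _ x]) simp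
      also have "\<dots> = (\<integral>\<^sup>+y. indicator B (shift I y x) \<partial>L')"
        by (simp add: shift_def add.commute)
      finally have e: "emeasure L' B = (\<integral>\<^sup>+y. indicator B (shift I y x) \<partial>L')" .
      have sy: "shift I y x = shift I x y" for y by (auto simp: shift_def fun_eq_iff add.commute)
      have "(\<lambda>y. indicator B (shift I y x) :: ennreal) \<in> borel_measurable L'"
        unfolding sy measurable_cong_sets[OF sp(2) refl] by measurable
      then show "indicator S x * emeasure L' B = (\<integral>\<^sup>+y. indicator S x * indicator B (shift I y x) \<partial>L')"
        using e by (simp add: nn_integral_cmult)
    qed
    also have "\<dots> = (\<integral>\<^sup>+y. (\<integral>\<^sup>+x. indicator S x * indicator B (shift I y x) \<partial>L) \<partial>L')"
      using LL.Fubini'[of "\<lambda>x y. indicator S x * indicator B (shift I y x)"] m1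
      by (simp add: case_prod_beta')
    also have "\<dots> = (\<integral>\<^sup>+y. (\<integral>\<^sup>+x. indicator S (shift I (\<lambda>i. - y i) x) * indicator B x \<partial>L) \<partial>L')"
    proof (rule nn_integral_cong)
      fix y assume "y \<in> space L'"
      have "(\<integral>\<^sup>+x. indicator S x * indicator B (shift I y x) \<partial>L)
        = (\<integral>\<^sup>+x. indicator S (shift I (\<lambda>i. - y i) x) * indicator B (shift I y (shift I (\<lambda>i. - y i) x)) \<partial>L)"
        by (rule inL[symmetric]) measurable
      also have "\<dots> = (\<integral>\<^sup>+x. indicator S (shift I (\<lambda>i. - y i) x) * indicator B x \<partial>L)"
      proof (rule nn_integral_cong)
        fix x assume "x \<in> space L"
        then have "shift I y (shift I (\<lambda>i. - y i) x) = x"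
          by (auto simp: shift_def spL fun_eq_iff PiE_iff extensional_def)
        then show "indicator S (shift I (\<lambda>i. - y i) x) * indicator B (shift I y (shift I (\<lambda>i. - y i) x))
          = (indicator S (shift I (\<lambda>i. - y i) x) * indicator B x :: ennreal)" by simp
      qed
      finally show "(\<integral>\<^sup>+x. indicator S x * indicator B (shift I y x) \<partial>L) = \<dots>" .
    qed
    also have "\<dots> = (\<integral>\<^sup>+x. (\<integral>\<^sup>+y. indicator S (shift I (\<lambda>i. - y i) x) * indicator B x \<partial>L') \<partial>L)"
      using LL.Fubini'[of "\<lambda>x y. indicator S (shift I (\<lambda>i. - y i) x) * indicator B x"] m2
      by (simp add: case_prod_beta')
    also have "\<dots> = (\<integral>\<^sup>+x. emeasure L' S * indicator B x \<partial>L)"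
    proof (rule nn_integral_cong)
      fix x assume x: "x \<in> space L"
      have indi: "indicator S (shift I (\<lambda>i. - y i) x) = (indicator S (shift I (\<lambda>i\<in>I. - x i) y) :: ennreal)" for y
        using Ssym[of y x] unfolding sheq[of "\<lambda>i. - x i" y] indicator_def by presburger
      have "(\<integral>\<^sup>+y. indicator S (shift I (\<lambda>i. - y i) x) * indicator B x \<partial>L')
        = (\<integral>\<^sup>+y. indicator S (shift I (\<lambda>i\<in>I. - x i) y) * indicator B x \<partial>L')"
        by (rule nn_integral_cong) (subst indi, rule refl)
      also have "\<dots> = (\<integral>\<^sup>+y. indicator S y * indicator B x \<partial>L')"
        using inL'[of "\<lambda>y. indicator S y * indicator B x", OF _ neg[of x]] by simp
      also have "\<dots> = (\<integral>\<^sup>+y. indicator S y \<partial>L') * indicator B x"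
        by (rule nn_integral_multc, rule borel_measurable_indicator) (simp add: S)
      also have "\<dots> = emeasure L' S * indicator B x" by (simp add: S)
      finally show "(\<integral>\<^sup>+y. indicator S (shift I (\<lambda>i. - y i) x) * indicator B x \<partial>L') = \<dots>" .
    qed
    also have "\<dots> = emeasure L B * emeasure L S"
      by (subst nn_integral_cmult) (simp_all add: L'S mult.commute)
    finally show ?thesis .
  qed
  have fS: "emeasure L S \<noteq> \<infinity>" "emeasure L S \<noteq> 0"
    using sqn_ball_finite[OF fin, of 1] sqn_ball_pos[OF fin] unfolding S_def L_def by auto
  have "L' = L"
  proof (rule measure_eqI)
    fix B assume "B \<in> sets L'"
    then have "emeasure L S * emeasure L' B = emeasure L S * emeasure L B"
      using propor by (simp add: mult.commute)
    then show "emeasure L' B = emeasure L B"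
      using fS by (simp add: ennreal_mult_cancel_left)
  qed simp
  then show ?thesis unfolding L'_def L_def .
qed

section \<open>Left multiplication by unitaries and Gram-Schmidt on square arrays\<close>

definition sq_idx :: "nat \<Rightarrow> (nat \<times> nat) set" where "sq_idx d = {..<d} \<times> {..<d}"

definition cols_of :: "(nat \<times> nat \<Rightarrow> complex) \<Rightarrow> nat \<Rightarrow> nat \<Rightarrow> complex" where
  "cols_of G j i = G (i,j)"

definition lmul :: "nat \<Rightarrow> complex mat \<Rightarrow> (nat \<times> nat \<Rightarrow> complex) \<Rightarrow> nat \<times> nat \<Rightarrow> complex" where
  "lmul d V G = (\<lambda>(i,j)\<in>sq_idx d. \<Sum>l<d. V $$ (i,l) * G (l,j))"

lemma finite_sq_idx [simp]: "finite (sq_idx d)" unfolding sq_idx_def by simp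

lemma lmul_apply: "i < d \<Longrightarrow> j < d \<Longrightarrow> lmul d V G (i,j) = (\<Sum>l<d. V $$ (i,l) * G (l,j))"
  unfolding lmul_def sq_idx_def by simp

lemma lmul_space: "lmul d V G \<in> space (lam (sq_idx d))"
  by (auto simp: space_lam lmul_def)

lemma lmul_measurable: "lmul d V \<in> measurable (lam (sq_idx d)) (lam (sq_idx d))"
proof (rule measurable_lam_iff)
  fix x assume x: "x \<in> sq_idx d"
  obtain i j where ij: "x = (i,j)" "i < d" "j < d" using x unfolding sq_idx_def by auto
  have comp: "(\<lambda>G. G (l,j)) \<in> borel_measurable (lam (sq_idx d))" if "l \<in> {..<d}" for l
    by (rule lam_component) (use ij that in \<open>simp add: sq_idx_def\<close>)
  have "(\<lambda>G. V $$ (i,l) * G (l,j)) \<in> borel_measurable (lam (sq_idx d))" if "l \<in> {..<d}" for l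
    using comp[OF that] by (rule borel_measurable_times[OF borel_measurable_const])
  then have "(\<lambda>G. \<Sum>l<d. V $$ (i,l) * G (l,j)) \<in> borel_measurable (lam (sq_idx d))"
    by (rule borel_measurable_sum)
  moreover have "(\<lambda>G. lmul d V G x) = (\<lambda>G. \<Sum>l<d. V $$ (i,l) * G (l,j))"
    using ij by (simp add: lmul_apply)
  ultimately show "(\<lambda>G. lmul d V G x) \<in> borel_measurable (lam (sq_idx d))" by (simp only:)
qed (auto simp: lmul_def)

lemma ext_sq_idx_eqI:
  assumes "G \<in> space (lam (sq_idx d))" "H \<in> space (lam (sq_idx d))"
    "\<And>i j. i < d \<Longrightarrow> j < d \<Longrightarrow> G (i,j) = H (i,j)"
  shows "G = H"
proof (rule ext)
  fix x show "G x = H x"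
  proof (cases "x \<in> sq_idx d")
    case True
    then show ?thesis using assms(3) by (auto simp: sq_idx_def)
  next
    case False
    then show ?thesis using assms(1,2) by (cases x) (simp add: space_lam PiE_iff extensional_def)
  qed
qed

lemma lmul_lmul:
  assumes "V \<in> carrier_mat d d" "V' \<in> carrier_mat d d"
  shows "lmul d V (lmul d V' G) = lmul d (V * V') G"
proof (rule ext_sq_idx_eqI[OF lmul_space lmul_space])
  fix i j assume ij: "i < d" "j < d"
  have "lmul d V (lmul d V' G) (i,j) = (\<Sum>l<d. V $$ (i,l) * (\<Sum>m<d. V' $$ (l,m) * G (m,j)))"
    using ij by (simp add: lmul_apply)
  also have "\<dots> = (\<Sum>m<d. (\<Sum>l<d. V $$ (i,l) * V' $$ (l,m)) * G (m,j))"
    by (simp add: sum_distrib_left sum_distrib_right mult.assoc) (rule sum.swap)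
  also have "\<dots> = lmul d (V * V') G (i,j)"
    using ij by (simp add: lmul_apply mat_mult_index[OF assms] del: index_mult_mat)
  finally show "lmul d V (lmul d V' G) (i,j) = lmul d (V * V') G (i,j)" .
qed

lemma lmul_one: "G \<in> space (lam (sq_idx d)) \<Longrightarrow> lmul d (1\<^sub>m d) G = G"
  by (rule ext_sq_idx_eqI[OF lmul_space]) (auto simp: lmul_apply if_distrib[of "\<lambda>x. x * _"] cong: if_cong)

lemma ip_unitary:
  assumes V: "V \<in> unitaries d"
    and u': "\<And>i. i < d \<Longrightarrow> u' i = (\<Sum>l<d. V $$ (i,l) * u l)"
    and v': "\<And>i. i < d \<Longrightarrow> v' i = (\<Sum>l<d. V $$ (i,l) * v l)"
  shows "ip d u' v' = ip d u v"
proof -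
  have "ip d u' v' = (\<Sum>i<d. (\<Sum>l<d. cnj (V $$ (i,l)) * cnj (u l)) * (\<Sum>m<d. V $$ (i,m) * v m))"
    unfolding ip_def by (rule sum.cong) (auto simp: u' v')
  also have "\<dots> = (\<Sum>i<d. \<Sum>l<d. \<Sum>m<d. (cnj (V $$ (i,l)) * V $$ (i,m)) * (cnj (u l) * v m))"
    unfolding sum_product by (intro sum.cong refl) (simp add: mult_ac)
  also have "\<dots> = (\<Sum>l<d. \<Sum>m<d. \<Sum>i<d. (cnj (V $$ (i,l)) * V $$ (i,m)) * (cnj (u l) * v m))"
    by (subst sum.swap) (rule sum.cong[OF refl], rule sum.swap)
  also have "\<dots> = (\<Sum>l<d. \<Sum>m<d. (if l = m then 1 else 0) * (cnj (u l) * v m))"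
    by (intro sum.cong refl) (simp add: unitary_col_orthonormal[OF V] flip: sum_distrib_right)
  also have "\<dots> = ip d u v" unfolding ip_def
    by (rule sum.cong) (auto simp: if_distrib[of "\<lambda>x. x * _"] cong: if_cong)
  finally show ?thesis .
qed

lemma nrm_ip: "nrm d u = sqrt (Re (ip d u u))"
  by (simp add: ip_self nrm_def sum_nonneg)

text \<open>Gram-Schmidt uses only inner products and linear combinations, which a unitary respects,
  so it commutes with left multiplication. This equivariance is the source of the invariance of Haar
  measure.\<close>

lemma gs_unitary:
  assumes V: "V \<in> unitaries d"
    and g': "\<And>j i. i < d \<Longrightarrow> j < m \<Longrightarrow> g' j i = (\<Sum>l<d. V $$ (i,l) * g j l)"
    and j: "j < m"
  shows "(\<forall>i<d. gs d g' j i = (\<Sum>l<d. V $$ (i,l) * gs d g j l)) \<and>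
    (\<forall>i<d. gs_res d g' j i = (\<Sum>l<d. V $$ (i,l) * gs_res d g j l)) \<and>
    nrm d (gs_res d g' j) = nrm d (gs_res d g j)"
  using j
proof (induction j rule: less_induct)
  case (less j)
  have ips: "ip d (gs d g' l) (g' j) = ip d (gs d g l) (g j)" if "l < j" for l
    by (rule ip_unitary[OF V]) (use less that g' in auto)
  have res: "gs_res d g' j i = (\<Sum>l<d. V $$ (i,l) * gs_res d g j l)" if i: "i < d" for i
  proof -
    have "(\<Sum>l<j. ip d (gs d g' l) (g' j) * gs d g' l i)
       = (\<Sum>l<j. ip d (gs d g l) (g j) * (\<Sum>k<d. V $$ (i,k) * gs d g l k))"
      by (rule sum.cong) (use less i ips in auto)
    also have "\<dots> = (\<Sum>k<d. V $$ (i,k) * (\<Sum>l<j. ip d (gs d g l) (g j) * gs d g l k))"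
      by (simp add: sum_distrib_left mult.left_commute) (rule sum.swap)
    finally show ?thesis unfolding gs_res_def
      using g'[OF i less.prems] by (simp add: right_diff_distrib sum_subtractf)
  qed
  have n: "nrm d (gs_res d g' j) = nrm d (gs_res d g j)"
    unfolding nrm_ip using ip_unitary[OF V, of "gs_res d g' j" "gs_res d g j" "gs_res d g' j" "gs_res d g j"] res by simp
  have "gs d g' j i = (\<Sum>l<d. V $$ (i,l) * gs d g j l)" if "i < d" for i
    unfolding gs_eq[of d g' j] gs_eq[of d g j] n using res[OF that] by (simp add: sum_divide_distrib)
  then show ?case using res n by auto
qed

lemma sqn_lmul:
  assumes V: "V \<in> unitaries d"
  shows "sqn (sq_idx d) (lmul d V G) = sqn (sq_idx d) G"
proof -
  have *: "sqn (sq_idx d) H = (\<Sum>j<d. Re (ip d (cols_of H j) (cols_of H j)))" for H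
  proof -
    have "sqn (sq_idx d) H = (\<Sum>i<d. \<Sum>j<d. (cmod (H (i,j)))\<^sup>2)"
      unfolding sqn_def sq_idx_def sum.cartesian_product by (rule sum.cong) auto
    also have "\<dots> = (\<Sum>j<d. \<Sum>i<d. (cmod (H (i,j)))\<^sup>2)" by (rule sum.swap)
    finally show ?thesis unfolding ip_self nrm_def by (simp add: sum_nonneg cols_of_def)
  qed
  show ?thesis unfolding *
    by (rule sum.cong, simp, rule arg_cong[of _ _ Re], rule ip_unitary[OF V])
      (auto simp: cols_of_def lmul_apply)
qed

lemma lam_lmul:
  assumes V: "V \<in> unitaries d"
  shows "distr (lam (sq_idx d)) (lam (sq_idx d)) (lmul d V) = lam (sq_idx d)"
proof (rule lam_isometry_invariant[where T' = "lmul d (adj V)"])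
  note v = unitariesD[OF V]
  show "finite (sq_idx d)" by simp
  show "lmul d V \<in> measurable (lam (sq_idx d)) (lam (sq_idx d))"
    "lmul d (adj V) \<in> measurable (lam (sq_idx d)) (lam (sq_idx d))"
    by (rule lmul_measurable)+
  show "\<And>G. G \<in> space (lam (sq_idx d)) \<Longrightarrow> lmul d V (lmul d (adj V) G) = G"
    "\<And>G. G \<in> space (lam (sq_idx d)) \<Longrightarrow> lmul d (adj V) (lmul d V G) = G"
    using v by (simp_all add: lmul_lmul[of _ d] lmul_one)
  show "\<And>G. sqn (sq_idx d) (lmul d V G) = sqn (sq_idx d) G" by (rule sqn_lmul[OF V])
  fix G a :: "nat \<times> nat \<Rightarrow> complex"
  show "lmul d V (shift (sq_idx d) a G) = shift (sq_idx d) (lmul d V a) (lmul d V G)"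
    by (rule ext_sq_idx_eqI[OF lmul_space])
      (auto simp: space_lam shift_def lmul_apply sq_idx_def distrib_left sum.distrib)
qed

text \<open>Arrays with independent columns inside a ball. The ball keeps the measure finite, so
  that a uniform distribution exists; its radius leaves room for a neighbourhood of the identity, so
  that the measure is positive. Both conditions are invariant under left multiplication by
  unitaries.\<close>

definition gs_good :: "nat \<Rightarrow> (nat \<times> nat \<Rightarrow> complex) set" where
  "gs_good d = {G \<in> space (lam (sq_idx d)). (\<forall>j<d. nrm d (gs_res d (cols_of G) j) \<noteq> 0)
     \<and> sqn (sq_idx d) G < (2 * real d + 1)\<^sup>2}"

definition gs_mat :: "nat \<Rightarrow> (nat \<times> nat \<Rightarrow> complex) \<Rightarrow> complex mat" where
  "gs_mat d G = (if G \<in> gs_good d then Matrix.mat d d (\<lambda>(i,j). gs d (cols_of G) j i) else 1\<^sub>m d)"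

lemma gs_mat_unitary: "gs_mat d G \<in> unitaries d"
proof (cases "G \<in> gs_good d")
  case True
  then have "Matrix.mat d d (\<lambda>(i,j). gs d (cols_of G) j i) \<in> unitaries d"
    by (intro unitaries_of_orthonormal gs_orthonormal[where m = d]) (auto simp: gs_good_def)
  then show ?thesis using True by (simp add: gs_mat_def)
qed (simp add: gs_mat_def)

lemma gs_good_lmul:
  assumes V: "V \<in> unitaries d" and G: "G \<in> space (lam (sq_idx d))"
  shows "lmul d V G \<in> gs_good d \<longleftrightarrow> G \<in> gs_good d"
proof -
  have "nrm d (gs_res d (cols_of (lmul d V G)) j) = nrm d (gs_res d (cols_of G) j)" if "j < d" for j
    using gs_unitary[OF V, of d "cols_of (lmul d V G)" "cols_of G" j] that
    by (simp add: cols_of_def lmul_apply)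
  then show ?thesis using G by (auto simp: gs_good_def lmul_space sqn_lmul[OF V])
qed

lemma gs_mat_lmul:
  assumes V: "V \<in> unitaries d" and G: "G \<in> gs_good d"
  shows "gs_mat d (lmul d V G) = V * gs_mat d G"
proof (rule eq_matI)
  note v = unitariesD(1)[OF V] and g = unitariesD(1)[OF gs_mat_unitary[of d]]
  have sp: "G \<in> space (lam (sq_idx d))" using G by (simp add: gs_good_def)
  show "dim_row (gs_mat d (lmul d V G)) = dim_row (V * gs_mat d G)" using v g[of "lmul d V G"] by auto
  show "dim_col (gs_mat d (lmul d V G)) = dim_col (V * gs_mat d G)" using g[of "lmul d V G"] g[of G] by auto
  fix i j assume "i < dim_row (V * gs_mat d G)" "j < dim_col (V * gs_mat d G)"
  then have ij: "i < d" "j < d" using v g[of G] by auto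
  have "gs_mat d (lmul d V G) $$ (i,j) = gs d (cols_of (lmul d V G)) j i"
    using ij gs_good_lmul[OF V sp] G by (simp add: gs_mat_def)
  also have "\<dots> = (\<Sum>l<d. V $$ (i,l) * gs d (cols_of G) j l)"
    using gs_unitary[OF V, of d "cols_of (lmul d V G)" "cols_of G" j] ij
    by (simp add: cols_of_def lmul_apply)
  also have "\<dots> = (V * gs_mat d G) $$ (i,j)"
    unfolding mat_mult_index[OF v g ij] using ij G by (simp add: gs_mat_def)
  finally show "gs_mat d (lmul d V G) $$ (i,j) = (V * gs_mat d G) $$ (i,j)" .
qed

lemma borel_measurable_cnj [measurable (raw)]:
  "f \<in> borel_measurable M \<Longrightarrow> (\<lambda>x. cnj (f x)) \<in> borel_measurable M"
  by (rule borel_measurable_continuous_on[where f = cnj]) (auto intro: continuous_intros)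

lemma ip_measurable:
  assumes "\<And>i. i < d \<Longrightarrow> (\<lambda>x. u x i) \<in> borel_measurable M" "\<And>i. i < d \<Longrightarrow> (\<lambda>x. v x i) \<in> borel_measurable M"
  shows "(\<lambda>x. ip d (u x) (v x)) \<in> borel_measurable M"
  unfolding ip_def by (rule borel_measurable_sum, rule borel_measurable_times, rule borel_measurable_cnj) (use assms in blast)+

lemma nrm_measurable:
  assumes "\<And>i. i < d \<Longrightarrow> (\<lambda>x. u x i) \<in> borel_measurable M"
  shows "(\<lambda>x. nrm d (u x)) \<in> borel_measurable M"
proof -
  have "(\<lambda>x. \<Sum>i<d. (cmod (u x i))\<^sup>2) \<in> borel_measurable M"
  proof (rule borel_measurable_sum)
    fix i assume "i \<in> {..<d}"
    then have [measurable]: "(\<lambda>x. u x i) \<in> borel_measurable M" using assms by blast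
    show "(\<lambda>x. (cmod (u x i))\<^sup>2) \<in> borel_measurable M" by measurable
  qed
  then show ?thesis unfolding nrm_def by measurable
qed

lemma gs_measurable:
  assumes "j < d"
  shows "(\<forall>i<d. (\<lambda>G. gs d (cols_of G) j i) \<in> borel_measurable (lam (sq_idx d))) \<and>
    (\<forall>i<d. (\<lambda>G. gs_res d (cols_of G) j i) \<in> borel_measurable (lam (sq_idx d)))"
  using assms
proof (induction j rule: less_induct)
  case (less j)
  have c: "(\<lambda>G. cols_of G j i) \<in> borel_measurable (lam (sq_idx d))" if "i < d" for i
    unfolding cols_of_def by (rule lam_component) (use that less.prems in \<open>auto simp: sq_idx_def\<close>)
  have gm: "(\<lambda>G. gs d (cols_of G) l i) \<in> borel_measurable (lam (sq_idx d))" if "l < j" "i < d" for l i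
    using less.IH[OF that(1)] less.prems that by (meson less_trans)
  have r: "(\<lambda>G. gs_res d (cols_of G) j i) \<in> borel_measurable (lam (sq_idx d))" if "i < d" for i
    unfolding gs_res_def
  proof (rule borel_measurable_diff[OF c[OF that]], rule borel_measurable_sum, rule borel_measurable_times)
    fix l assume "l \<in> {..<j}"
    then have l: "l < j" by blast
    show "(\<lambda>G. ip d (gs d (cols_of G) l) (cols_of G j)) \<in> borel_measurable (lam (sq_idx d))"
      by (rule ip_measurable[OF gm[OF l] c])
    show "(\<lambda>G. gs d (cols_of G) l i) \<in> borel_measurable (lam (sq_idx d))"
      by (rule gm[OF l that])
  qed
  have "(\<lambda>G. gs d (cols_of G) j i) \<in> borel_measurable (lam (sq_idx d))" if "i < d" for i
  proof -
    note [measurable] = r[OF that]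
    have [measurable]: "(\<lambda>G. nrm d (gs_res d (cols_of G) j)) \<in> borel_measurable (lam (sq_idx d))"
      by (rule nrm_measurable) (rule r)
    show ?thesis unfolding gs_eq by measurable
  qed
  then show ?case using r by blast
qed

lemma gs_good_sets: "gs_good d \<in> sets (lam (sq_idx d))"
proof -
  have n: "(\<lambda>G. nrm d (gs_res d (cols_of G) j)) \<in> borel_measurable (lam (sq_idx d))" if "j < d" for j
    by (rule nrm_measurable) (use gs_measurable[OF that] in blast)
  have m: "{G \<in> space (lam (sq_idx d)). nrm d (gs_res d (cols_of G) j) \<noteq> 0} \<in> sets (lam (sq_idx d))"
    if "j \<in> {..<d}" for j
  proof -
    have [measurable]: "(\<lambda>G. nrm d (gs_res d (cols_of G) j)) \<in> borel_measurable (lam (sq_idx d))"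
      using n that by blast
    show ?thesis by measurable
  qed
  have 1: "{G \<in> space (lam (sq_idx d)). \<forall>j\<in>{..<d}. nrm d (gs_res d (cols_of G) j) \<noteq> 0} \<in> sets (lam (sq_idx d))"
    by (rule sets.sets_Collect_finite_All[OF m]) auto
  have 2: "{G \<in> space (lam (sq_idx d)). sqn (sq_idx d) G < (2 * real d + 1)\<^sup>2} \<in> sets (lam (sq_idx d))"
    by measurable
  have "gs_good d = {G \<in> space (lam (sq_idx d)). \<forall>j\<in>{..<d}. nrm d (gs_res d (cols_of G) j) \<noteq> 0} \<inter>
     {G \<in> space (lam (sq_idx d)). sqn (sq_idx d) G < (2 * real d + 1)\<^sup>2}"
    unfolding gs_good_def by auto
  then show ?thesis using sets.Int[OF 1 2] by (simp only:)
qed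

text \<open>Near the identity a matrix is strictly diagonally dominant, so its columns are
  independent. The box radius \<open>r\<close> is chosen such that \<open>(d + 1) * r = 1/2\<close>;
  the entries then have modulus at most 2, whence the squared norm is at most
  \<open>(2 * d)^2\<close>.\<close>

lemma gs_good_box:
  "Pi\<^sub>E (sq_idx d) (\<lambda>(i,j). ball (if i = j then 1 else 0 :: complex) (1 / (2 * (real d + 1)))) \<subseteq> gs_good d"
proof
  define r where "r = 1 / (2 * (real d + 1))"
  have r: "0 < r" "(real d + 1) * r = 1/2" "r \<le> 1" unfolding r_def by (auto simp: field_simps)
  fix G assume "G \<in> Pi\<^sub>E (sq_idx d) (\<lambda>(i,j). ball (if i = j then 1 else 0 :: complex) (1 / (2 * (real d + 1))))"
  then have G: "G \<in> space (lam (sq_idx d))"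
    and "\<And>x. x \<in> sq_idx d \<Longrightarrow> G x \<in> (case x of (i,j) \<Rightarrow> ball (if i = j then 1 else 0) r)"
    by (auto simp: space_lam PiE_iff r_def)
  then have "\<And>i j. i < d \<Longrightarrow> j < d \<Longrightarrow> G (i,j) \<in> ball (if i = j then 1 else 0) r"
    by (force simp: sq_idx_def)
  then have close: "\<And>i j. i < d \<Longrightarrow> j < d \<Longrightarrow> cmod (G (i,j) - (if i = j then 1 else 0)) < r"
    unfolding mem_ball dist_norm by (subst norm_minus_commute)
  have off: "cmod (G (i,j)) \<le> r" if "i < d" "j < d" "i \<noteq> j" for i j
    using close[OF that(1,2)] that by simp
  have on: "1 - r < cmod (G (i,i))" "cmod (G (i,i)) \<le> 2" if "i < d" for i
  proof -
    have "cmod (G (i,i) - 1) < r" using close[OF that that] by simp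
    moreover have "1 = cmod (G (i,i) - (G (i,i) - 1))" by simp
    then have "1 \<le> cmod (G (i,i)) + cmod (G (i,i) - 1)" by (metis norm_triangle_ineq4)
    moreover have "cmod (G (i,i)) \<le> cmod (G (i,i) - 1) + 1"
      using norm_triangle_ineq[of "G (i,i) - 1" 1] by simp
    ultimately show "1 - r < cmod (G (i,i))" "cmod (G (i,i)) \<le> 2" using r by linarith+
  qed
  have "nrm d (gs_res d (cols_of G) j) \<noteq> 0" if j: "j < d" for j
  proof
    assume "nrm d (gs_res d (cols_of G) j) = 0"
    then have z: "\<And>i. i < d \<Longrightarrow> gs_res d (cols_of G) j i = 0" by (simp add: nrm_eq_0)
    obtain c where c: "c j = 1" "\<And>i. gs_res d (cols_of G) j i = (\<Sum>m\<le>j. c m * cols_of G m i)"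
      using gs_res_lincomb by blast
    \<comment> \<open>A coefficient of maximal modulus: in row \<open>s\<close> of the linear
      relation the diagonal term outweighs all the others together.\<close>
    obtain s where s: "s \<le> j" "\<And>m. m \<le> j \<Longrightarrow> cmod (c m) \<le> cmod (c s)"
    proof -
      have fin: "finite ((\<lambda>m. cmod (c m)) ` {..j})" "(\<lambda>m. cmod (c m)) ` {..j} \<noteq> {}" by auto
      obtain s where "s \<le> j" "Max ((\<lambda>m. cmod (c m)) ` {..j}) = cmod (c s)"
        using Max_in[OF fin] by (metis (no_types, lifting) imageE atMost_iff)
      moreover then have "cmod (c m) \<le> cmod (c s)" if "m \<le> j" for m
        using Max_ge[OF fin(1), of "cmod (c m)"] that by auto
      ultimately show thesis using that by blast
    qed
    have sd: "s < d" using s j by auto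
    have pos: "1 \<le> cmod (c s)" using s(2)[of j] c(1) by simp
    have "0 = (\<Sum>m\<le>j. c m * G (s,m))" using z[OF sd] c(2)[of s] by (simp add: cols_of_def)
    also have "\<dots> = c s * G (s,s) + (\<Sum>m\<in>{..j} - {s}. c m * G (s,m))"
      using s by (simp add: sum.remove)
    finally have "c s * G (s,s) = - (\<Sum>m\<in>{..j} - {s}. c m * G (s,m))" by (simp add: eq_neg_iff_add_eq_0)
    then have "cmod (c s) * cmod (G (s,s)) = cmod (\<Sum>m\<in>{..j} - {s}. c m * G (s,m))"
      by (metis norm_minus_cancel norm_mult)
    also have "\<dots> \<le> (\<Sum>m\<in>{..j} - {s}. cmod (c s) * r)"
    proof (rule sum_norm_le)
      fix m assume "m \<in> {..j} - {s}"
      then have "cmod (G (s,m)) \<le> r" "cmod (c m) \<le> cmod (c s)" using off[of s m] sd j s by auto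
      then show "cmod (c m * G (s,m)) \<le> cmod (c s) * r" by (simp add: norm_mult mult_mono)
    qed
    also have "\<dots> = real j * (cmod (c s) * r)" using s by simp
    also have "\<dots> \<le> real d * (cmod (c s) * r)" using j r by (intro mult_right_mono) auto
    finally have "cmod (c s) * cmod (G (s,s)) \<le> cmod (c s) * (real d * r)" by (simp add: mult_ac)
    then have "cmod (G (s,s)) \<le> real d * r"
      by (rule mult_left_le_imp_le) (use pos in linarith)
    then have "1 - r < real d * r" using on(1)[OF sd] by linarith
    then show False using r(2) by (simp add: algebra_simps)
  qed
  moreover have "sqn (sq_idx d) G < (2 * real d + 1)\<^sup>2"
  proof -
    have "sqn (sq_idx d) G \<le> (\<Sum>x\<in>sq_idx d. 2\<^sup>2)" unfolding sqn_def
    proof (rule sum_mono)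
      fix x assume "x \<in> sq_idx d"
      then obtain i j where "x = (i,j)" "i < d" "j < d" unfolding sq_idx_def by auto
      then have "cmod (G x) \<le> 2" using on(2)[of i] off[of i j] r by (cases "i = j") auto
      then show "(cmod (G x))\<^sup>2 \<le> 2\<^sup>2" by (intro power_mono) auto
    qed
    also have "\<dots> = (2 * real d)\<^sup>2" by (simp add: sq_idx_def power2_eq_square)
    also have "\<dots> < (2 * real d + 1)\<^sup>2" by (intro power_strict_mono) auto
    finally show ?thesis .
  qed
  ultimately show "G \<in> gs_good d" using G unfolding gs_good_def by auto
qed

lemma gs_good_pos: "emeasure (lam (sq_idx d)) (gs_good d) \<noteq> 0"
proof -
  have "0 < emeasure (lam (sq_idx d)) (Pi\<^sub>E (sq_idx d) (\<lambda>p. ball (case p of (i,j) \<Rightarrow> if i = j then 1 else 0) (1 / (2 * (real d + 1)))))"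
    by (rule lam_box_pos) auto
  also have "\<dots> \<le> emeasure (lam (sq_idx d)) (gs_good d)"
  proof (rule emeasure_mono[OF _ gs_good_sets])
    show "Pi\<^sub>E (sq_idx d) (\<lambda>p. ball (case p of (i,j) \<Rightarrow> if i = j then 1 else 0) (1 / (2 * (real d + 1)))) \<subseteq> gs_good d"
      using gs_good_box[of d] by (simp add: case_prod_beta')
  qed
  finally show ?thesis by simp
qed

lemma gs_good_finite: "emeasure (lam (sq_idx d)) (gs_good d) \<noteq> \<infinity>"
proof -
  have m: "{G \<in> space (lam (sq_idx d)). sqn (sq_idx d) G < (2 * real d + 1)\<^sup>2} \<in> sets (lam (sq_idx d))" by measurable
  have "emeasure (lam (sq_idx d)) (gs_good d) \<le> emeasure (lam (sq_idx d)) {G \<in> space (lam (sq_idx d)). sqn (sq_idx d) G < (2 * real d + 1)\<^sup>2}"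
    by (rule emeasure_mono[OF _ m]) (auto simp: gs_good_def)
  also have "\<dots> < \<infinity>" by (rule sqn_ball_finite) auto
  finally show ?thesis by simp
qed

section \<open>Existence, uniqueness and invariance of Haar measure\<close>

definition haar_space :: "nat \<Rightarrow> complex mat measure" where
  "haar_space d = sigma (unitaries d)
     {(\<lambda>A. A $$ (i,j)) -` B \<inter> unitaries d | i j B. i < d \<and> j < d \<and> B \<in> sets borel}"

lemma space_haar_space [simp]: "space (haar_space d) = unitaries d"
  unfolding haar_space_def by (rule space_measure_of) auto

lemma sets_haar_space: "sets (haar_space d) = haar_sets d"
  unfolding haar_space_def haar_sets_def by (rule sets_measure_of) auto

lemma haar_space_entry:
  assumes "i < d" "j < d"
  shows "(\<lambda>U. U $$ (i,j)) \<in> borel_measurable (haar_space d)"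
proof (rule measurableI)
  fix B :: "complex set" assume "B \<in> sets borel"
  then show "(\<lambda>U. U $$ (i,j)) -` B \<inter> space (haar_space d) \<in> sets (haar_space d)"
    unfolding sets_haar_space space_haar_space haar_sets_def using assms
    by (intro sigma_sets.Basic) blast
qed simp

lemma measurable_haar_space:
  assumes "\<And>x. x \<in> space M \<Longrightarrow> f x \<in> unitaries d"
    "\<And>i j. i < d \<Longrightarrow> j < d \<Longrightarrow> (\<lambda>x. f x $$ (i,j)) \<in> borel_measurable M"
  shows "f \<in> measurable M (haar_space d)"
  unfolding haar_space_def
proof (rule measurable_measure_of)
  fix y assume "y \<in> {(\<lambda>A. A $$ (i,j)) -` B \<inter> unitaries d | i j B. i < d \<and> j < d \<and> B \<in> sets (borel :: complex measure)}"
  then obtain i j B where y: "y = (\<lambda>A. A $$ (i,j)) -` B \<inter> unitaries d" "i < d" "j < d" "B \<in> sets (borel :: complex measure)" by blast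
  have "f -` y \<inter> space M = (\<lambda>x. f x $$ (i,j)) -` B \<inter> space M" using y assms(1) by auto
  then show "f -` y \<inter> space M \<in> sets M" using measurable_sets[OF assms(2)[OF y(2,3)] y(4)] by simp
qed (use assms in auto)

definition is_haar :: "nat \<Rightarrow> complex mat measure \<Rightarrow> bool" where
  "is_haar d M \<longleftrightarrow> prob_space M \<and> space M = unitaries d \<and> sets M = haar_sets d \<and>
      (\<forall>V\<in>unitaries d. \<forall>A\<in>sets M.
         emeasure M ((\<lambda>U. V * U) -` A \<inter> space M) = emeasure M A)"

lemma mult_left_measurable:
  assumes V: "V \<in> unitaries d"
  shows "(\<lambda>U. V * U) \<in> measurable (haar_space d) (haar_space d)"
proof (rule measurable_haar_space)
  fix U assume "U \<in> space (haar_space d)"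
  then show "V * U \<in> unitaries d" using V by (simp add: unitaries_mult)
next
  fix i j assume ij: "i < d" "j < d"
  have "(\<lambda>U. \<Sum>l<d. V $$ (i,l) * U $$ (l,j)) \<in> borel_measurable (haar_space d)"
  proof (rule borel_measurable_sum)
    fix l assume "l \<in> {..<d}"
    then have [measurable]: "(\<lambda>U. U $$ (l,j)) \<in> borel_measurable (haar_space d)" using haar_space_entry ij by blast
    show "(\<lambda>U. V $$ (i,l) * U $$ (l,j)) \<in> borel_measurable (haar_space d)" by measurable
  qed
  then show "(\<lambda>U. (V * U) $$ (i,j)) \<in> borel_measurable (haar_space d)"
    by (rule measurable_cong[THEN iffD1, rotated])
      (use mat_mult_index[OF unitariesD(1)[OF V] unitariesD(1) ij] in auto)
qed

text \<open>Haar measure is the distribution of the Gram-Schmidt unitary of an array drawn uniformly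
  from \<open>gs_good d\<close>. Left multiplication by a unitary preserves Lebesgue measure, being
  a linear isometry, preserves \<open>gs_good d\<close>, and commutes with Gram-Schmidt.\<close>

lemma is_haar_exists: "\<exists>M. is_haar d M"
proof -
  define L where "L = lam (sq_idx d)"
  define N where "N = uniform_measure L (gs_good d)"
  define M where "M = distr N (haar_space d) (gs_mat d)"
  note good = gs_good_sets[of d, folded L_def]
  have pN: "prob_space N" unfolding N_def L_def
    by (rule prob_space_uniform_measure) (use gs_good_pos gs_good_finite in auto)
  have mL: "gs_mat d \<in> measurable L (haar_space d)"
  proof (rule measurable_haar_space)
    fix i j assume ij: "i < d" "j < d"
    have [measurable]: "(\<lambda>G. gs d (cols_of G) j i) \<in> borel_measurable L"
      unfolding L_def using gs_measurable ij by blast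
    have "(\<lambda>G. if G \<in> gs_good d then gs d (cols_of G) j i else 1\<^sub>m d $$ (i,j)) \<in> borel_measurable L"
      by (rule measurable_If_set) (use good in measurable)
    moreover have "(\<lambda>G. gs_mat d G $$ (i,j)) = (\<lambda>G. if G \<in> gs_good d then gs d (cols_of G) j i else 1\<^sub>m d $$ (i,j))"
      using ij by (auto simp: gs_mat_def)
    ultimately show "(\<lambda>G. gs_mat d G $$ (i,j)) \<in> borel_measurable L" by (simp only:)
  qed (rule gs_mat_unitary)
  have sN: "sets N = sets L" unfolding N_def by simp
  have mN: "gs_mat d \<in> measurable N (haar_space d)"
    using mL unfolding measurable_cong_sets[OF sN refl] .
  have pM: "prob_space M" unfolding M_def by (rule prob_space.prob_space_distr[OF pN mN])
  have setM: "sets M = haar_sets d" "space M = unitaries d" unfolding M_def by (simp_all add: sets_haar_space)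
  have emM: "emeasure M A = emeasure L (gs_good d \<inter> (gs_mat d -` A \<inter> space L)) / emeasure L (gs_good d)"
    if A: "A \<in> haar_sets d" for A
  proof -
    have A': "A \<in> sets (haar_space d)" using A by (simp add: sets_haar_space)
    have "emeasure M A = emeasure N (gs_mat d -` A \<inter> space N)"
      unfolding M_def by (rule emeasure_distr[OF mN A'])
    also have "space N = space L" by (simp add: N_def)
    also have "emeasure N (gs_mat d -` A \<inter> space L) = emeasure L (gs_good d \<inter> (gs_mat d -` A \<inter> space L)) / emeasure L (gs_good d)"
      unfolding N_def by (rule emeasure_uniform_measure[OF good measurable_sets[OF mL A']])
    finally show ?thesis .
  qed
  have "emeasure M ((\<lambda>U. V * U) -` A \<inter> space M) = emeasure M A" if V: "V \<in> unitaries d" and A: "A \<in> sets M" for V A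
  proof -
    have A1: "A \<in> sets (haar_space d)" using A setM by (simp add: sets_haar_space)
    have B: "(\<lambda>U. V * U) -` A \<inter> unitaries d \<in> sets (haar_space d)"
      using measurable_sets[OF mult_left_measurable[OF V] A1] by simp
    have gsub: "gs_good d \<subseteq> space L" unfolding L_def gs_good_def by auto
    have lm: "lmul d V \<in> measurable L L" unfolding L_def by (rule lmul_measurable)
    have S: "gs_good d \<inter> (gs_mat d -` A \<inter> space L) \<in> sets L"
      using good measurable_sets[OF mL A1] by (rule sets.Int)
    \<comment> \<open>Multiplying by \<open>V\<close> after Gram-Schmidt is the same as multiplying
      the array by \<open>V\<close> before, so the event is a preimage under
      \<open>lmul d V\<close>.\<close>
    have "gs_good d \<inter> (gs_mat d -` ((\<lambda>U. V * U) -` A \<inter> unitaries d) \<inter> space L)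
       = lmul d V -` (gs_good d \<inter> (gs_mat d -` A \<inter> space L)) \<inter> space L"
      using gs_good_lmul[OF V] gs_mat_lmul[OF V] gs_mat_unitary gsub lmul_space[of d V]
      unfolding L_def by auto
    then have "emeasure L (gs_good d \<inter> (gs_mat d -` ((\<lambda>U. V * U) -` A \<inter> unitaries d) \<inter> space L))
       = emeasure (distr L L (lmul d V)) (gs_good d \<inter> (gs_mat d -` A \<inter> space L))"
      by (simp add: emeasure_distr[OF lm S])
    also have "distr L L (lmul d V) = L" unfolding L_def by (rule lam_lmul[OF V])
    finally show ?thesis
      using emM[of A] emM[of "(\<lambda>U. V * U) -` A \<inter> unitaries d"] A B setM by (simp add: sets_haar_space)
  qed
  then have "is_haar d M" unfolding is_haar_def using pM setM by blast
  then show ?thesis ..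
qed

text \<open>Integrate the indicator of \<open>A\<close> at \<open>adj z * x\<close> over both
  measures. For fixed \<open>z\<close>, left invariance of \<open>M1\<close> gives the left-hand
  side; for fixed \<open>x\<close>, \<open>adj z * x\<close> is the adjoint of
  \<open>adj x * z\<close>, so left invariance of \<open>M2\<close> gives the right-hand
  side.\<close>

lemma is_haar_adj:
  assumes M1: "is_haar d M1" and M2: "is_haar d M2" and A: "A \<in> haar_sets d"
  shows "emeasure M1 A = emeasure M2 (adj -` A \<inter> unitaries d)"
proof -
  interpret M1: prob_space M1 using M1 unfolding is_haar_def by blast
  interpret M2: prob_space M2 using M2 unfolding is_haar_def by blast
  interpret P: pair_sigma_finite M2 M1 by standard
  have s: "space M1 = unitaries d" "sets M1 = sets (haar_space d)" "space M2 = unitaries d" "sets M2 = sets (haar_space d)"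
    using M1 M2 unfolding is_haar_def by (auto simp: sets_haar_space)
  have A': "A \<in> sets (haar_space d)" using A by (simp add: sets_haar_space)
  have e1: "(\<lambda>U. U $$ (i,j)) \<in> borel_measurable M1" if "i < d" "j < d" for i j
    using haar_space_entry[OF that] unfolding measurable_cong_sets[OF s(2) refl] .
  have e2: "(\<lambda>U. U $$ (i,j)) \<in> borel_measurable M2" if "i < d" "j < d" for i j
    using haar_space_entry[OF that] unfolding measurable_cong_sets[OF s(4) refl] .
  have m: "(\<lambda>p. adj (fst p) * snd p) \<in> measurable (M2 \<Otimes>\<^sub>M M1) (haar_space d)"
  proof (rule measurable_haar_space)
    fix p assume "p \<in> space (M2 \<Otimes>\<^sub>M M1)"
    then show "adj (fst p) * snd p \<in> unitaries d"
      by (auto simp: space_pair_measure s intro!: unitaries_mult unitariesD(4))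
  next
    fix i j assume ij: "i < d" "j < d"
    have "(\<lambda>p. \<Sum>l<d. cnj (fst p $$ (l,i)) * snd p $$ (l,j)) \<in> borel_measurable (M2 \<Otimes>\<^sub>M M1)"
    proof (rule borel_measurable_sum)
      fix l assume l: "l \<in> {..<d}"
      have [measurable]: "(\<lambda>p. fst p $$ (l,i)) \<in> borel_measurable (M2 \<Otimes>\<^sub>M M1)"
        by (rule measurable_compose[OF measurable_fst e2]) (use l ij in auto)
      have [measurable]: "(\<lambda>p. snd p $$ (l,j)) \<in> borel_measurable (M2 \<Otimes>\<^sub>M M1)"
        by (rule measurable_compose[OF measurable_snd e1]) (use l ij in auto)
      show "(\<lambda>p. cnj (fst p $$ (l,i)) * snd p $$ (l,j)) \<in> borel_measurable (M2 \<Otimes>\<^sub>M M1)" by measurable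
    qed
    then show "(\<lambda>p. (adj (fst p) * snd p) $$ (i,j)) \<in> borel_measurable (M2 \<Otimes>\<^sub>M M1)"
    proof (rule measurable_cong[THEN iffD1, rotated])
      fix p assume "p \<in> space (M2 \<Otimes>\<^sub>M M1)"
      then have p: "fst p \<in> carrier_mat d d" "snd p \<in> carrier_mat d d"
        by (auto simp: space_pair_measure s dest: unitariesD)
      show "(\<Sum>l<d. cnj (fst p $$ (l,i)) * snd p $$ (l,j)) = (adj (fst p) * snd p) $$ (i,j)"
        unfolding mat_mult_index[OF adj_carrier[OF p(1)] p(2) ij] using p ij by (intro sum.cong) auto
    qed
  qed
  have ma: "adj \<in> measurable (haar_space d) (haar_space d)"
  proof (rule measurable_haar_space)
    fix i j assume ij: "i < d" "j < d"
    note [measurable] = haar_space_entry[OF ij(2,1)]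
    have "(\<lambda>U. cnj (U $$ (j,i))) \<in> borel_measurable (haar_space d)" by measurable
    then show "(\<lambda>U. adj U $$ (i,j)) \<in> borel_measurable (haar_space d)"
      by (rule measurable_cong[THEN iffD1, rotated]) (use ij in \<open>auto dest!: unitariesD(1)\<close>)
  qed (auto dest: unitariesD(4))
  have pm: "(\<lambda>p. indicator A (adj (fst p) * snd p) :: ennreal) \<in> borel_measurable (M2 \<Otimes>\<^sub>M M1)"
    by (rule measurable_compose[OF m borel_measurable_indicator[OF A']])
  have i1: "(\<integral>\<^sup>+x. indicator A (adj z * x) \<partial>M1) = emeasure M1 A" if z: "z \<in> unitaries d" for z
  proof -
    have az: "adj z \<in> unitaries d" by (rule unitariesD(4)[OF z])
    have B: "(\<lambda>U. adj z * U) -` A \<inter> space M1 \<in> sets M1"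
      using measurable_sets[OF mult_left_measurable[OF az] A'] s by simp
    have "(\<integral>\<^sup>+x. indicator A (adj z * x) \<partial>M1) = (\<integral>\<^sup>+x. indicator ((\<lambda>U. adj z * U) -` A \<inter> space M1) x \<partial>M1)"
      by (rule nn_integral_cong) (auto simp: indicator_def)
    also have "\<dots> = emeasure M1 ((\<lambda>U. adj z * U) -` A \<inter> space M1)" using B by simp
    also have "\<dots> = emeasure M1 A" using M1 az A unfolding is_haar_def by blast
    finally show ?thesis .
  qed
  have i2: "(\<integral>\<^sup>+z. indicator A (adj z * x) \<partial>M2) = emeasure M2 (adj -` A \<inter> unitaries d)" if x: "x \<in> unitaries d" for x
  proof -
    have ax: "adj x \<in> unitaries d" by (rule unitariesD(4)[OF x])
    have A2: "adj -` A \<inter> unitaries d \<in> sets M2" using measurable_sets[OF ma A'] s by simp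
    have B: "(\<lambda>U. adj x * U) -` (adj -` A \<inter> unitaries d) \<inter> space M2 \<in> sets M2"
      using measurable_sets[OF mult_left_measurable[OF ax] A2[unfolded s(4)]] unfolding s by (simp only: space_haar_space)
    have "(\<integral>\<^sup>+z. indicator A (adj z * x) \<partial>M2) = (\<integral>\<^sup>+z. indicator ((\<lambda>U. adj x * U) -` (adj -` A \<inter> unitaries d) \<inter> space M2) z \<partial>M2)"
    proof (rule nn_integral_cong)
      fix z assume "z \<in> space M2"
      then have z: "z \<in> unitaries d" using s by simp
      have "adj (adj x * z) = adj z * x"
        using adj_mult[OF unitariesD(1)[OF ax] unitariesD(1)[OF z]] by simp
      then show "indicator A (adj z * x) = (indicator ((\<lambda>U. adj x * U) -` (adj -` A \<inter> unitaries d) \<inter> space M2) z :: ennreal)"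
        using z s unitaries_mult[OF ax z] by (simp add: indicator_def)
    qed
    also have "\<dots> = emeasure M2 ((\<lambda>U. adj x * U) -` (adj -` A \<inter> unitaries d) \<inter> space M2)" using B by simp
    also have "\<dots> = emeasure M2 (adj -` A \<inter> unitaries d)" using M2 ax A2 unfolding is_haar_def by blast
    finally show ?thesis .
  qed
  have "emeasure M1 A = (\<integral>\<^sup>+z. \<integral>\<^sup>+x. indicator A (adj z * x) \<partial>M1 \<partial>M2)"
  proof -
    have "(\<integral>\<^sup>+z. \<integral>\<^sup>+x. indicator A (adj z * x) \<partial>M1 \<partial>M2) = (\<integral>\<^sup>+z. emeasure M1 A \<partial>M2)"
      by (rule nn_integral_cong) (use i1 s in blast)
    then show ?thesis by (simp add: M2.emeasure_space_1)
  qed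
  also have "\<dots> = (\<integral>\<^sup>+x. \<integral>\<^sup>+z. indicator A (adj z * x) \<partial>M2 \<partial>M1)"
    using P.Fubini'[of "\<lambda>z x. indicator A (adj z * x)"] pm by (simp add: case_prod_beta')
  also have "\<dots> = emeasure M2 (adj -` A \<inter> unitaries d)"
  proof -
    have "(\<integral>\<^sup>+x. \<integral>\<^sup>+z. indicator A (adj z * x) \<partial>M2 \<partial>M1) = (\<integral>\<^sup>+x. emeasure M2 (adj -` A \<inter> unitaries d) \<partial>M1)"
      by (rule nn_integral_cong) (use i2 s in blast)
    then show ?thesis by (simp add: M1.emeasure_space_1)
  qed
  finally show ?thesis .
qed

lemma is_haar_haar: "is_haar d (haar d)"
proof -
  have "\<exists>!M. is_haar d M"
  proof (rule ex_ex1I[OF is_haar_exists])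
    fix M1 M2 assume m: "is_haar d M1" "is_haar d M2"
    show "M1 = M2"
    proof (rule measure_eqI)
      show "sets M1 = sets M2" using m unfolding is_haar_def by simp
      fix A assume "A \<in> sets M1"
      then have "A \<in> haar_sets d" using m unfolding is_haar_def by simp
      \<comment> \<open>Both sides equal the \<open>M1\<close>-measure of the set of adjoints: once
        with \<open>M1\<close> paired with itself, once with \<open>M2\<close> paired with
        \<open>M1\<close>.\<close>
      then show "emeasure M1 A = emeasure M2 A" using is_haar_adj[OF m(1) m(1)] is_haar_adj[OF m(2) m(1)] by simp
    qed
  qed
  then have "is_haar d (THE M. is_haar d M)" by (rule theI')
  then show ?thesis unfolding haar_def is_haar_def .
qed

lemma haar_entry_measurable: "i < d \<Longrightarrow> j < d \<Longrightarrow> (\<lambda>U. U $$ (i,j)) \<in> borel_measurable (haar d)"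
proof -
  have s: "sets (haar d) = sets (haar_space d)" using is_haar_haar unfolding is_haar_def by (simp add: sets_haar_space)
  show "i < d \<Longrightarrow> j < d \<Longrightarrow> (\<lambda>U. U $$ (i,j)) \<in> borel_measurable (haar d)"
    using haar_space_entry unfolding measurable_cong_sets[OF s refl] .
qed

lemma haar_left_invariant:
  fixes f :: "complex mat \<Rightarrow> real"
  assumes V: "V \<in> unitaries d" and f: "f \<in> borel_measurable (haar d)"
  shows "(\<integral>U. f (V * U) \<partial>haar d) = (\<integral>U. f U \<partial>haar d)"
proof -
  have s: "sets (haar d) = sets (haar_space d)" "space (haar d) = unitaries d"
    using is_haar_haar unfolding is_haar_def by (simp_all add: sets_haar_space)
  have m: "(\<lambda>U. V * U) \<in> measurable (haar d) (haar d)"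
    using mult_left_measurable[OF V] unfolding measurable_cong_sets[OF s(1) s(1)] .
  have "distr (haar d) (haar d) (\<lambda>U. V * U) = haar d"
  proof (rule measure_eqI)
    fix A assume "A \<in> sets (distr (haar d) (haar d) (\<lambda>U. V * U))"
    then have A: "A \<in> sets (haar d)" by simp
    then show "emeasure (distr (haar d) (haar d) (\<lambda>U. V * U)) A = emeasure (haar d) A"
      unfolding emeasure_distr[OF m A] using is_haar_haar V unfolding is_haar_def by blast
  qed simp
  then have "(\<integral>U. f U \<partial>haar d) = (\<integral>U. f U \<partial>distr (haar d) (haar d) (\<lambda>U. V * U))" by simp
  also have "\<dots> = (\<integral>U. f (V * U) \<partial>haar d)" by (rule integral_distr[OF m f])
  finally show ?thesis by simp
qed

section \<open>Domination of the blocked ensemble\<close>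

text \<open>The content of patch \<open>p\<close> in a basis index; distinctness of outputs is
  demanded patch by patch.\<close>

definition dig :: "nat \<Rightarrow> nat \<Rightarrow> nat \<Rightarrow> nat" where
  "dig m p z = (z div 2^(m*p)) mod 2^m"

text \<open>The falling factorial Q (Q - 1) ... (Q - k + 1); gluing across one shared patch
  contributes it once.\<close>

definition inj_tups :: "nat \<Rightarrow> nat \<Rightarrow> nat" where
  "inj_tups k Q = card {m \<in> tup k {..<Q}. inj_on m {..<k}}"

lemma bij_pair_pow:
  "bij_betw (\<lambda>(l,q). q * 2^a + l) ({..<2^a} \<times> {..<2^b}) {..<(2::nat)^(a+b)}"
proof (rule bij_betw_byWitness[where f' = "\<lambda>z. (z mod 2^a, z div 2^a)"])
  show "(\<lambda>(l,q). q * 2^a + l) ` ({..<2^a} \<times> {..<2^b}) \<subseteq> {..<(2::nat)^(a+b)}"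
  proof safe
    fix l q :: nat assume lq: "l < 2^a" "q < 2^b"
    then have "(q + 1) * 2^a \<le> 2^b * 2^a" by (intro mult_right_mono) auto
    then show "q * 2^a + l < 2^(a+b)" using lq by (simp add: power_add mult.commute)
  qed
  show "(\<lambda>z. (z mod 2^a, z div 2^a)) ` {..<(2::nat)^(a+b)} \<subseteq> {..<2^a} \<times> {..<2^b}"
    by (auto intro!: less_mult_imp_div_less simp: power_add mult.commute)
qed (auto simp: mult.commute div_mult_mod_eq)

lemma bij_split_pow:
  "bij_betw (\<lambda>z. (z mod 2^a, z div 2^a)) {..<(2::nat)^(a+b)} ({..<2^a} \<times> {..<2^b})"
proof (rule bij_betw_byWitness[where f' = "\<lambda>(l,q). q * 2^a + l"])
  show "(\<lambda>z. (z mod 2^a, z div 2^a)) ` {..<(2::nat)^(a+b)} \<subseteq> {..<2^a} \<times> {..<2^b}"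
    by (auto intro!: less_mult_imp_div_less simp: power_add mult.commute)
  show "(\<lambda>(l,q). q * 2^a + l) ` ({..<2^a} \<times> {..<2^b}) \<subseteq> {..<(2::nat)^(a+b)}"
    using bij_pair_pow[of a b] unfolding bij_betw_def by blast
qed (auto simp: mult.commute div_mult_mod_eq)

lemma bij_pair_swap: "bij_betw (\<lambda>(a,b). (b,a)) (A \<times> B) (B \<times> A)"
  by (rule bij_betw_byWitness[where f' = "\<lambda>(a,b). (b,a)"]) auto

text \<open>After the shift by \<open>m * p\<close> the high part still carries at least
  \<open>m\<close> factors of 2 and vanishes modulo \<open>2^m\<close>.\<close>

lemma dig_low: "p < r \<Longrightarrow> dig m p (q * 2^(m*r) + l) = dig m p l"
proof -
  assume p: "p < r"
  define e where "e = m * r - m * p"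
  have le: "m \<le> e"
  proof -
    have "m * Suc p \<le> m * r" using p by (intro mult_le_mono2) simp
    then show ?thesis unfolding e_def by simp
  qed
  have mr: "m * r = m * p + e" unfolding e_def using p by (simp add: mult_le_mono2)
  have "(q * 2^(m*r) + l) div 2^(m*p) = q * 2^e + l div 2^(m*p)"
    unfolding mr power_add by (simp add: mult.assoc[symmetric] mult.commute[of "2^(m*p)"])
  moreover have "(q * 2^e + x) mod 2^m = x mod (2::nat)^m" for x
  proof -
    have "(2::nat)^m dvd q * 2^e" using le by (simp add: le_imp_power_dvd dvd_mult)
    then show ?thesis by (metis mod_add_left_eq dvd_imp_mod_0 add_0)
  qed
  ultimately show ?thesis unfolding dig_def by simp
qed

lemma dig_mod: "p < r \<Longrightarrow> dig m p (z mod 2^(m*r)) = dig m p z"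
  using dig_low[of p r m "z div 2^(m*r)" "z mod 2^(m*r)"] by (simp add: mult.commute)

lemma good_image: "good k (f ` A) Y \<longleftrightarrow> (\<forall>a\<in>A. inj_on (\<lambda>j. f a (Y j)) {..<k})"
  unfolding good_def by blast

lemma inj_on_tup_cong:
  "(\<And>j. j < k \<Longrightarrow> f (Y j) = g (Y j)) \<Longrightarrow> inj_on (\<lambda>j. f (Y j)) {..<k} \<longleftrightarrow> inj_on (\<lambda>j. g (Y j)) {..<(k::nat)}"
  by (rule inj_on_cong) auto

lemma all_less_Suc: "(\<forall>a\<in>{..<Suc n}. Pr a) \<longleftrightarrow> (\<forall>a\<in>{..<n}. Pr a) \<and> Pr n"
  by (auto simp: less_Suc_eq)

text \<open>The old operator and the new block overlap in one patch, whose value \<open>q\<close> is summed over.\<close>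

lemma ext_left_index:
  assumes "y < 2^(m * Suc (Suc r))" "x < 2^(m * Suc (Suc r))" "t \<in> carrier_mat (2^(m * Suc r)) (2^(m * Suc r))"
  shows "ext_left m (Suc r) (t,V) $$ (y,x) = (\<Sum>q<2^m. t $$ (q * 2^(m*r) + y mod 2^(m*r), x mod 2^(m * Suc r)) * V $$ (y div 2^(m*r), (x div 2^(m * Suc r)) * 2^m + q))"
proof -
  let ?N = "m * Suc (Suc r)" and ?n = "m * Suc r" and ?s = "m * r"
  have sN: "?s + 2*m \<le> ?N" "?s + 2*m = ?N" "?n = ?s + m" "?N = ?n + m" by simp_all
  have y2: "y div 2^(?s + 2*m) = 0" unfolding sN(2) by (rule div_less[OF assms(1)])
  have yd: "y div 2^?s < 2^(2*m)"
    using assms(1)[folded sN(2)] by (intro less_mult_imp_div_less) (simp only: power_add mult.commute)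
  have xn: "x div 2^?n < 2^m" using assms(2)[unfolded sN(4)] by (intro less_mult_imp_div_less) (simp only: power_add mult.commute)
  have "ext_left m (Suc r) (t,V) $$ (y,x) = (\<Sum>b<2^(2*m). V $$ (y div 2^?s, b) * embed ?N 0 ?n t $$ (b * 2^?s + y mod 2^?s, x))"
    unfolding ext_left_def prod.case diff_Suc_1
    using embed_mult_left[OF sN(1) assms(1,2) embed_carrier, of V 0 ?n t] y2 yd by simp
  also have "\<dots> = (\<Sum>b\<in>{..<2^m * 2^m}. if b div 2^m = x div 2^?n then V $$ (y div 2^?s, b) * t $$ ((b mod 2^m) * 2^?s + y mod 2^?s, x mod 2^?n) else 0)"
  proof (rule sum.cong)
    show "{..<2^(2*m)} = {..<2^m * (2::nat)^m}" by (simp add: mult_2 power_add)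
    fix b :: nat assume "b \<in> {..<2^m * 2^m}"
    then have b: "b < 2^(2*m)" by (simp add: mult_2 power_add)
    let ?z = "b * 2^?s + y mod 2^?s"
    have lt: "?z < 2^?N" using embed_pos_lt[OF assms(1) sN(1) b, of "y mod 2^?s"] y2 by simp
    have zs: "?z div 2^?s = b" "?z mod 2^?s = y mod 2^?s" by simp_all
    have zn: "?z div 2^?n = b div 2^m" unfolding sN(3) power_add div_mult2_eq zs(1) ..
    have zm: "?z mod 2^?n = (b mod 2^m) * 2^?s + y mod 2^?s"
    proof -
      have "?z mod (2^?s * 2^m) = 2^?s * (?z div 2^?s mod 2^m) + ?z mod 2^?s" by (rule mod_mult2_eq)
      then show ?thesis unfolding zs by (simp only: sN(3) power_add mult.commute)
    qed
    show "V $$ (y div 2^?s, b) * embed ?N 0 ?n t $$ (?z, x) = (if b div 2^m = x div 2^?n then V $$ (y div 2^?s, b) * t $$ ((b mod 2^m) * 2^?s + y mod 2^?s, x mod 2^?n) else 0)"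
      unfolding embed_index[OF lt assms(2)] add_0 power_0 div_by_1 zn zm by simp
  qed
  also have "\<dots> = (\<Sum>q<2^m. V $$ (y div 2^?s, (x div 2^?n) * 2^m + q) * t $$ (q * 2^?s + y mod 2^?s, x mod 2^?n))"
  proof -
    have "(\<Sum>q<2^m. V $$ (y div 2^?s, (x div 2^?n) * 2^m + q) * t $$ (q * 2^?s + y mod 2^?s, x mod 2^?n)) =
      (\<Sum>b\<in>{b\<in>{..<2^m * 2^m}. b div 2^m = x div 2^?n}. V $$ (y div 2^?s, b) * t $$ ((b mod 2^m) * 2^?s + y mod 2^?s, x mod 2^?n))"
    proof (rule sum.reindex_bij_witness[of _ "\<lambda>b. b mod 2^m" "\<lambda>q. (x div 2^?n) * 2^m + q"])
      fix q :: nat assume "q \<in> {..<2^m}"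
      then have q: "q < 2^m" by simp
      show "((x div 2^?n) * 2^m + q) mod 2^m = q" using q by simp
      show "(x div 2^?n) * 2^m + q \<in> {b\<in>{..<2^m * 2^m}. b div 2^m = x div 2^?n}"
        using halves_lt[OF xn q] q by (simp add: mult_2 power_add)
      show "V $$ (y div 2^?s, (x div 2^?n) * 2^m + q) * t $$ (((x div 2^?n) * 2^m + q) mod 2^m * 2^?s + y mod 2^?s, x mod 2^?n) = V $$ (y div 2^?s, (x div 2^?n) * 2^m + q) * t $$ (q * 2^?s + y mod 2^?s, x mod 2^?n)"
        using q by simp
    next
      fix b :: nat assume b: "b \<in> {b\<in>{..<2^m * 2^m}. b div 2^m = x div 2^?n}"
      then have bd: "x div 2^?n = b div 2^m" by simp
      show "(x div 2^?n) * 2^m + b mod 2^m = b" unfolding bd by (rule div_mult_mod_eq)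
      show "b mod 2^m \<in> {..<2^m}" by simp
    qed
    also have "\<dots> = (\<Sum>b\<in>{..<2^m * 2^m}. if b div 2^m = x div 2^?n then V $$ (y div 2^?s, b) * t $$ ((b mod 2^m) * 2^?s + y mod 2^?s, x mod 2^?n) else 0)"
      by (rule sum.inter_filter) simp
    finally show ?thesis by (rule sym)
  qed
  finally show ?thesis by (simp only: mult.commute[of "V $$ _"])
qed

lemma ext_right_index:
  assumes "y < 2^(m * Suc (Suc r))" "x < 2^(m * Suc (Suc r))" "t \<in> carrier_mat (2^(m * Suc r)) (2^(m * Suc r))"
  shows "ext_right m (Suc r) (t,V) $$ (y,x) = (\<Sum>q<2^m. V $$ ((y div 2^(m * Suc r)) * 2^m + q, x div 2^(m*r)) * t $$ (y mod 2^(m * Suc r), q * 2^(m*r) + x mod 2^(m*r)))"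
proof -
  let ?N = "m * Suc (Suc r)" and ?n = "m * Suc r" and ?s = "m * r"
  have sN: "?s + 2*m \<le> ?N" "?s + 2*m = ?N" "?n = ?s + m" "0 + ?n \<le> ?N" "?N = ?n + m" by simp_all
  have xd: "x div 2^?s < 2^(2*m)"
    using assms(2)[folded sN(2)] by (intro less_mult_imp_div_less) (simp only: power_add mult.commute)
  have yn: "y div 2^?n < 2^m" using assms(1)[unfolded sN(5)] by (intro less_mult_imp_div_less) (simp only: power_add mult.commute)
  have "ext_right m (Suc r) (t,V) $$ (y,x) = (\<Sum>a<2^?n. t $$ (y mod 2^?n, a) * embed ?N ?s (2*m) V $$ ((y div 2^?n) * 2^?n + a, x))"
    unfolding ext_right_def prod.case diff_Suc_1
    using embed_mult_left[OF sN(4) assms(1,2) embed_carrier, of t ?s "2*m" V] by simp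
  also have "\<dots> = (\<Sum>a\<in>{..<2^?n}. if a mod 2^?s = x mod 2^?s then t $$ (y mod 2^?n, a) * V $$ ((y div 2^?n) * 2^m + a div 2^?s, x div 2^?s) else 0)"
  proof (rule sum.cong[OF refl])
    fix a :: nat assume "a \<in> {..<2^?n}"
    then have a: "a < 2^?n" by simp
    let ?z = "(y div 2^?n) * 2^?n + a"
    have lt: "?z < 2^?N" using embed_pos_lt[OF assms(1) sN(4) a, of 0] by simp
    have as: "a div 2^?s < 2^m" using a by (intro less_mult_imp_div_less) (simp add: power_add[symmetric] add.commute)
    have zz: "?z = ((y div 2^?n) * 2^m) * 2^?s + a" by (simp add: power_add)
    have zs: "?z div 2^?s = (y div 2^?n) * 2^m + a div 2^?s" "?z mod 2^?s = a mod 2^?s" unfolding zz by simp_all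
    have hi: "?z div 2^(?s + 2*m) = x div 2^(?s + 2*m)" unfolding sN(2) using div_less[OF lt] div_less[OF assms(2)] by (rule trans[OF _ sym])
    have zl: "(y div 2^?n) * 2^m + a div 2^?s < 2^(2*m)" by (rule halves_lt[OF yn as])
    show "t $$ (y mod 2^?n, a) * embed ?N ?s (2*m) V $$ (?z, x) = (if a mod 2^?s = x mod 2^?s then t $$ (y mod 2^?n, a) * V $$ ((y div 2^?n) * 2^m + a div 2^?s, x div 2^?s) else 0)"
      unfolding embed_index[OF lt assms(2)] zs using hi zl xd by simp
  qed
  also have "\<dots> = (\<Sum>q<2^m. t $$ (y mod 2^?n, q * 2^?s + x mod 2^?s) * V $$ ((y div 2^?n) * 2^m + q, x div 2^?s))"
  proof -
    have "(\<Sum>q<2^m. t $$ (y mod 2^?n, q * 2^?s + x mod 2^?s) * V $$ ((y div 2^?n) * 2^m + q, x div 2^?s)) =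
      (\<Sum>a\<in>{a\<in>{..<2^?n}. a mod 2^?s = x mod 2^?s}. t $$ (y mod 2^?n, a) * V $$ ((y div 2^?n) * 2^m + a div 2^?s, x div 2^?s))"
    proof (rule sum.reindex_bij_witness[of _ "\<lambda>a. a div 2^?s" "\<lambda>q. q * 2^?s + x mod 2^?s"])
      fix q :: nat assume "q \<in> {..<2^m}"
      then have q: "q < 2^m" by simp
      show "(q * 2^?s + x mod 2^?s) div 2^?s = q" by simp
      have "q * 2^?s + x mod 2^?s < 2^(?s + m)"
        using bij_pair_pow[of ?s m] q unfolding bij_betw_def by force
      then show "q * 2^?s + x mod 2^?s \<in> {a\<in>{..<2^?n}. a mod 2^?s = x mod 2^?s}" by (simp add: add.commute)
      show "t $$ (y mod 2^?n, q * 2^?s + x mod 2^?s) * V $$ ((y div 2^?n) * 2^m + (q * 2^?s + x mod 2^?s) div 2^?s, x div 2^?s) = t $$ (y mod 2^?n, q * 2^?s + x mod 2^?s) * V $$ ((y div 2^?n) * 2^m + q, x div 2^?s)"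
        by simp
    next
      fix a :: nat assume a: "a \<in> {a\<in>{..<2^?n}. a mod 2^?s = x mod 2^?s}"
      then have ad: "x mod 2^?s = a mod 2^?s" by simp
      show "(a div 2^?s) * 2^?s + x mod 2^?s = a" unfolding ad by (rule div_mult_mod_eq)
      show "a div 2^?s \<in> {..<2^m}" using a by (auto intro!: less_mult_imp_div_less simp: power_add[symmetric] add.commute)
    qed
    also have "\<dots> = (\<Sum>a\<in>{..<2^?n}. if a mod 2^?s = x mod 2^?s then t $$ (y mod 2^?n, a) * V $$ ((y div 2^?n) * 2^m + a div 2^?s, x div 2^?s) else 0)"
      by (rule sum.inter_filter) simp
    finally show ?thesis by (rule sym)
  qed
  finally show ?thesis by (simp only: mult.commute[of "t $$ _"])
qed

text \<open>An instance of \<open>dominated_glue\<close> with the old circuit acting first: its top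
  patch is the shared one, and the new block turns it and the fresh patch into the two top output
  patches.\<close>

lemma dominated_ext_left:
  assumes t: "dominated k {..<2^(m * Suc r)} {..<2^(m * Suc r)} (dig m ` {..<Suc r}) \<alpha>1 p (\<lambda>T y x. T $$ (y,x))"
    and V: "dominated k {..<2^(2*m)} {..<2^(2*m)} {\<lambda>z. z mod 2^m, \<lambda>z. z div 2^m} \<alpha>2 pV (\<lambda>V y x. V $$ (y,x))"
    and nn: "0 \<le> \<alpha>1" "0 \<le> \<alpha>2" and car: "\<And>T. T \<in> set_pmf p \<Longrightarrow> T \<in> carrier_mat (2^(m * Suc r)) (2^(m * Suc r))"
  shows "dominated k {..<2^(m * Suc (Suc r))} {..<2^(m * Suc (Suc r))} (dig m ` {..<Suc (Suc r)}) (\<alpha>1 * \<alpha>2 * real (inj_tups k (2^m)))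
    (map_pmf (ext_left m (Suc r)) (pair_pmf p pV)) (\<lambda>T y x. T $$ (y,x))"
proof -
  let ?s = "m * r" and ?n = "m * Suc r" and ?N = "m * Suc (Suc r)"
  have ex: "?n = ?s + m" "?N = ?s + 2*m" "?N = ?n + m" by simp_all
  have t1: "dominated k {..<2^?n} ({..<2^?s} \<times> {..<2^m}) ((\<lambda>d. d \<circ> fst) ` (dig m ` {..<r}) \<union> {snd}) \<alpha>1 p (\<lambda>T (l,q) x. T $$ (q * 2^?s + l, x))"
  proof (rule dominated_digits_cong)
    have "dominated k {..<2^?n} ({..<2^?s} \<times> {..<2^m}) ((\<lambda>d. d \<circ> (\<lambda>(l,q). q * 2^?s + l)) ` (dig m ` {..<Suc r})) \<alpha>1 p (\<lambda>T y x. T $$ ((\<lambda>(l,q). q * 2^?s + l) y, id x))"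
      by (rule dominated_relabel[OF t bij_betw_id bij_pair_pow[of ?s m, folded ex(1)]]) auto
    then show "dominated k {..<2^?n} ({..<2^?s} \<times> {..<2^m}) ((\<lambda>d. d \<circ> (\<lambda>(l,q). q * 2^?s + l)) ` (dig m ` {..<Suc r})) \<alpha>1 p (\<lambda>T (l,q) x. T $$ (q * 2^?s + l, x))"
      by (rule dominated_cong) auto
    fix Y :: "nat \<Rightarrow> nat \<times> nat" assume Y: "Y \<in> tup k ({..<2^?s} \<times> {..<2^m})"
    have lt: "fst (Y j) < 2^?s" "snd (Y j) < 2^m" if "j < k" for j using tup_app[OF Y that] by auto
    have 1: "inj_on (\<lambda>j. (dig m p \<circ> (\<lambda>(l,q). q * 2^?s + l)) (Y j)) {..<k} \<longleftrightarrow> inj_on (\<lambda>j. (dig m p \<circ> fst) (Y j)) {..<k}" if "p < r" for p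
      by (rule inj_on_tup_cong) (simp add: case_prod_beta' dig_low that)
    have 2: "inj_on (\<lambda>j. (dig m r \<circ> (\<lambda>(l,q). q * 2^?s + l)) (Y j)) {..<k} \<longleftrightarrow> inj_on (\<lambda>j. snd (Y j)) {..<k}"
      by (rule inj_on_tup_cong[where g = snd]) (use lt in \<open>simp add: case_prod_beta' dig_def\<close>)
    show "good k ((\<lambda>d. d \<circ> (\<lambda>(l,q). q * 2^?s + l)) ` (dig m ` {..<Suc r})) Y = good k ((\<lambda>d. d \<circ> fst) ` (dig m ` {..<r}) \<union> {snd}) Y"
    proof -
      have "good k ((\<lambda>d. d \<circ> (\<lambda>(l,q). q * 2^?s + l)) ` (dig m ` {..<Suc r})) Y \<longleftrightarrow> (\<forall>p\<in>{..<r}. inj_on (\<lambda>j. (dig m p \<circ> (\<lambda>(l,q). q * 2^?s + l)) (Y j)) {..<k})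
          \<and> inj_on (\<lambda>j. (dig m r \<circ> (\<lambda>(l,q). q * 2^?s + l)) (Y j)) {..<k}"
        unfolding image_image good_image all_less_Suc ..
      also have "\<dots> \<longleftrightarrow> (\<forall>p\<in>{..<r}. inj_on (\<lambda>j. (dig m p \<circ> fst) (Y j)) {..<k}) \<and> inj_on (\<lambda>j. snd (Y j)) {..<k}"
        using 1 2 by simp
      also have "\<dots> \<longleftrightarrow> good k ((\<lambda>d. d \<circ> fst) ` (dig m ` {..<r}) \<union> {snd}) Y"
        unfolding image_image good_def ball_Un by simp
      finally show ?thesis .
    qed
  qed
  have V1: "dominated k ({..<2^m} \<times> {..<2^m}) {..<2^(2*m)} {\<lambda>z. z mod 2^m, \<lambda>z. z div 2^m} \<alpha>2 pV (\<lambda>V y (q,n). V $$ (y, n * 2^m + q))"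
  proof -
    have "dominated k ({..<2^m} \<times> {..<2^m}) {..<2^(2*m)} ((\<lambda>d. d \<circ> id) ` {\<lambda>z. z mod 2^m, \<lambda>z. z div 2^m}) \<alpha>2 pV (\<lambda>V y x. V $$ (id y, (\<lambda>(q,n). n * 2^m + q) x))"
      by (rule dominated_relabel[OF V _ bij_betw_id]) (use bij_pair_pow[of m m] in \<open>auto simp: mult_2\<close>)
    then show ?thesis by (simp add: case_prod_beta')
  qed
  have g: "dominated k ({..<2^?n} \<times> {..<2^m}) ({..<2^?s} \<times> {..<2^(2*m)})
     ((\<lambda>d. d \<circ> fst) ` (dig m ` {..<r}) \<union> (\<lambda>d. d \<circ> snd) ` {\<lambda>z. z mod 2^m, \<lambda>z. z div 2^m})
     (\<alpha>1 * \<alpha>2 * real (inj_tups k (2^m))) (pair_pmf p pV)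
     (\<lambda>(T,V) (l,w) (i,n). \<Sum>q\<in>{..<2^m}. (case (l,q) of (l,q) \<Rightarrow> \<lambda>x. T $$ (q * 2^?s + l, x)) i * (case (q,n) of (q,n) \<Rightarrow> V $$ (w, n * 2^m + q)))"
    unfolding inj_tups_def by (rule dominated_glue[OF t1 V1]) (use nn in auto)
  have "dominated k {..<2^?N} {..<2^?N}
     ((\<lambda>d. d \<circ> (\<lambda>z. (z mod 2^?s, z div 2^?s))) ` ((\<lambda>d. d \<circ> fst) ` (dig m ` {..<r}) \<union> (\<lambda>d. d \<circ> snd) ` {\<lambda>z. z mod 2^m, \<lambda>z. z div 2^m}))
     (\<alpha>1 * \<alpha>2 * real (inj_tups k (2^m))) (pair_pmf p pV)
     (\<lambda>r' y x. (\<lambda>(T,V) (l,w) (i,n). \<Sum>q\<in>{..<2^m}. (case (l,q) of (l,q) \<Rightarrow> \<lambda>x. T $$ (q * 2^?s + l, x)) i * (case (q,n) of (q,n) \<Rightarrow> V $$ (w, n * 2^m + q))) r' (y mod 2^?s, y div 2^?s) (x mod 2^?n, x div 2^?n))"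
    by (rule dominated_relabel[OF g bij_split_pow[of ?n m, folded ex(3)] bij_split_pow[of ?s "2*m", folded ex(2)]]) auto
  then have "dominated k {..<2^?N} {..<2^?N}
     ((\<lambda>d. d \<circ> (\<lambda>z. (z mod 2^?s, z div 2^?s))) ` ((\<lambda>d. d \<circ> fst) ` (dig m ` {..<r}) \<union> (\<lambda>d. d \<circ> snd) ` {\<lambda>z. z mod 2^m, \<lambda>z. z div 2^m}))
     (\<alpha>1 * \<alpha>2 * real (inj_tups k (2^m))) (pair_pmf p pV) (\<lambda>r' y x. ext_left m (Suc r) r' $$ (y,x))"
  proof (rule dominated_cong)
    fix r' y x assume "r' \<in> set_pmf (pair_pmf p pV)" "y \<in> {..<(2::nat)^?N}" "x \<in> {..<(2::nat)^?N}"
    then show "(\<lambda>(T,V) (l,w) (i,n). \<Sum>q\<in>{..<2^m}. (case (l,q) of (l,q) \<Rightarrow> \<lambda>x. T $$ (q * 2^?s + l, x)) i * (case (q,n) of (q,n) \<Rightarrow> V $$ (w, n * 2^m + q))) r' (y mod 2^?s, y div 2^?s) (x mod 2^?n, x div 2^?n) = ext_left m (Suc r) r' $$ (y,x)"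
      using ext_left_index[of y m r x "fst r'" "snd r'"] car by (cases r') auto
  qed
  then have "dominated k {..<2^?N} {..<2^?N} (dig m ` {..<Suc (Suc r)}) (\<alpha>1 * \<alpha>2 * real (inj_tups k (2^m))) (pair_pmf p pV) (\<lambda>r' y x. ext_left m (Suc r) r' $$ (y,x))"
  proof (rule dominated_digits_cong)
    fix Y assume Y: "Y \<in> tup k {..<(2::nat)^?N}"
    have lt: "Y j < 2^?N" if "j < k" for j using tup_app[OF Y that] by simp
    have 1: "inj_on (\<lambda>j. dig m p (Y j mod 2^?s)) {..<k} \<longleftrightarrow> inj_on (\<lambda>j. dig m p (Y j)) {..<k}" if "p < r" for p
      by (rule inj_on_cong) (simp add: dig_mod that)
    have 3: "inj_on (\<lambda>j. (Y j div 2^?s) div 2^m) {..<k} \<longleftrightarrow> inj_on (\<lambda>j. dig m (Suc r) (Y j)) {..<k}"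
    proof (rule inj_on_cong)
      fix j assume "j \<in> {..<k}"
      then have "Y j div 2^?n < 2^m" using lt[of j] by (intro less_mult_imp_div_less) (simp add: power_add[symmetric] algebra_simps)
      then show "(Y j div 2^?s) div 2^m = dig m (Suc r) (Y j)" unfolding dig_def ex(1) power_add div_mult2_eq by simp
    qed
    show "good k ((\<lambda>d. d \<circ> (\<lambda>z. (z mod 2^?s, z div 2^?s))) ` ((\<lambda>d. d \<circ> fst) ` (dig m ` {..<r}) \<union> (\<lambda>d. d \<circ> snd) ` {\<lambda>z. z mod 2^m, \<lambda>z. z div 2^m})) Y = good k (dig m ` {..<Suc (Suc r)}) Y"
      using 1 3 unfolding image_Un image_image good_def ball_Un all_less_Suc
      by (auto simp: all_less_Suc dig_def[of m r])
  qed
  then show ?thesis by (rule dominated_map)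
qed

text \<open>Here the new block acts first: its lower half is the shared patch and becomes the top
  input of the old circuit, while its upper half is already an output. Hence the reversed order in
  \<open>pair_pmf\<close>.\<close>

lemma dominated_ext_right:
  assumes t: "dominated k {..<2^(m * Suc r)} {..<2^(m * Suc r)} (dig m ` {..<Suc r}) \<alpha>1 p (\<lambda>T y x. T $$ (y,x))"
    and V: "dominated k {..<2^(2*m)} {..<2^(2*m)} {\<lambda>z. z mod 2^m, \<lambda>z. z div 2^m} \<alpha>2 pV (\<lambda>V y x. V $$ (y,x))"
    and nn: "0 \<le> \<alpha>1" "0 \<le> \<alpha>2" and car: "\<And>T. T \<in> set_pmf p \<Longrightarrow> T \<in> carrier_mat (2^(m * Suc r)) (2^(m * Suc r))"
  shows "dominated k {..<2^(m * Suc (Suc r))} {..<2^(m * Suc (Suc r))} (dig m ` {..<Suc (Suc r)}) (\<alpha>2 * \<alpha>1 * real (inj_tups k (2^m)))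
    (map_pmf (\<lambda>(V,T). ext_right m (Suc r) (T,V)) (pair_pmf pV p)) (\<lambda>T y x. T $$ (y,x))"
proof -
  let ?s = "m * r" and ?n = "m * Suc r" and ?N = "m * Suc (Suc r)"
  have ex: "?n = ?s + m" "?N = ?s + 2*m" "?N = ?n + m" by simp_all
  have V1: "dominated k {..<2^(2*m)} ({..<2^m} \<times> {..<2^m}) ((\<lambda>d. d \<circ> fst) ` {\<lambda>z. z} \<union> {snd}) \<alpha>2 pV (\<lambda>V (l,q) x. V $$ (l * 2^m + q, x))"
  proof (rule dominated_digits_cong)
    have bij: "bij_betw (\<lambda>(l,q). l * 2^m + q) ({..<2^m} \<times> {..<2^m}) {..<(2::nat)^(2*m)}"
      using bij_betw_trans[OF bij_pair_swap bij_pair_pow[of m m]] by (simp add: case_prod_beta' o_def mult_2)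
    have "dominated k {..<2^(2*m)} ({..<2^m} \<times> {..<2^m}) ((\<lambda>d. d \<circ> (\<lambda>(l,q). l * 2^m + q)) ` {\<lambda>z. z mod 2^m, \<lambda>z. z div 2^m}) \<alpha>2 pV (\<lambda>V y x. V $$ ((\<lambda>(l,q). l * 2^m + q) y, id x))"
      by (rule dominated_relabel[OF V bij_betw_id bij]) auto
    then show "dominated k {..<2^(2*m)} ({..<2^m} \<times> {..<2^m}) ((\<lambda>d. d \<circ> (\<lambda>(l,q). l * 2^m + q)) ` {\<lambda>z. z mod 2^m, \<lambda>z. z div 2^m}) \<alpha>2 pV (\<lambda>V (l,q) x. V $$ (l * 2^m + q, x))"
      by (rule dominated_cong) auto
    fix Y :: "nat \<Rightarrow> nat \<times> nat" assume Y: "Y \<in> tup k ({..<2^m} \<times> {..<2^m})"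
    have lt: "fst (Y j) < 2^m" "snd (Y j) < 2^m" if "j < k" for j using tup_app[OF Y that] by auto
    have 1: "inj_on (\<lambda>j. (fst (Y j) * 2^m + snd (Y j)) mod 2^m) {..<k} \<longleftrightarrow> inj_on (\<lambda>j. snd (Y j)) {..<k}"
      by (rule inj_on_cong) (use lt in simp)
    have 2: "inj_on (\<lambda>j. (fst (Y j) * 2^m + snd (Y j)) div 2^m) {..<k} \<longleftrightarrow> inj_on (\<lambda>j. fst (Y j)) {..<k}"
      by (rule inj_on_cong) (use lt in simp)
    show "good k ((\<lambda>d. d \<circ> (\<lambda>(l,q). l * 2^m + q)) ` {\<lambda>z. z mod 2^m, \<lambda>z. z div 2^m}) Y = good k ((\<lambda>d. d \<circ> fst) ` {\<lambda>z. z} \<union> {snd}) Y"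
      using 1 2 unfolding good_def by (auto simp: case_prod_beta')
  qed
  have t1: "dominated k ({..<2^m} \<times> {..<2^?s}) {..<2^?n} (dig m ` {..<Suc r}) \<alpha>1 p (\<lambda>T y (q,n). T $$ (y, q * 2^?s + n))"
  proof -
    have bij: "bij_betw (\<lambda>(q,n). q * 2^?s + n) ({..<2^m} \<times> {..<2^?s}) {..<(2::nat)^?n}"
      unfolding ex(1) using bij_betw_trans[OF bij_pair_swap bij_pair_pow[of ?s m]] by (simp add: case_prod_beta' o_def)
    have "dominated k ({..<2^m} \<times> {..<2^?s}) {..<2^?n} ((\<lambda>d. d \<circ> id) ` (dig m ` {..<Suc r})) \<alpha>1 p (\<lambda>T y x. T $$ (id y, (\<lambda>(q,n). q * 2^?s + n) x))"
      by (rule dominated_relabel[OF t bij bij_betw_id]) auto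
    then show ?thesis by (simp add: case_prod_beta' image_image)
  qed
  have g: "dominated k ({..<2^(2*m)} \<times> {..<2^?s}) ({..<2^m} \<times> {..<2^?n})
     ((\<lambda>d. d \<circ> fst) ` {\<lambda>z. z} \<union> (\<lambda>d. d \<circ> snd) ` (dig m ` {..<Suc r}))
     (\<alpha>2 * \<alpha>1 * real (inj_tups k (2^m))) (pair_pmf pV p)
     (\<lambda>(V,T) (l,w) (i,n). \<Sum>q\<in>{..<2^m}. (case (l,q) of (l,q) \<Rightarrow> \<lambda>x. V $$ (l * 2^m + q, x)) i * (case (q,n) of (q,n) \<Rightarrow> T $$ (w, q * 2^?s + n)))"
    unfolding inj_tups_def by (rule dominated_glue[OF V1 t1]) (use nn in auto)
  have b1: "bij_betw (\<lambda>z. (z div 2^?s, z mod 2^?s)) {..<(2::nat)^?N} ({..<2^(2*m)} \<times> {..<2^?s})"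
    unfolding ex(2) using bij_betw_trans[OF bij_split_pow[of ?s "2*m"] bij_pair_swap] by (simp add: o_def)
  have b2: "bij_betw (\<lambda>z. (z div 2^?n, z mod 2^?n)) {..<(2::nat)^?N} ({..<2^m} \<times> {..<2^?n})"
    unfolding ex(3) using bij_betw_trans[OF bij_split_pow[of ?n m] bij_pair_swap] by (simp add: o_def)
  have "dominated k {..<2^?N} {..<2^?N}
     ((\<lambda>d. d \<circ> (\<lambda>z. (z div 2^?n, z mod 2^?n))) ` ((\<lambda>d. d \<circ> fst) ` {\<lambda>z. z} \<union> (\<lambda>d. d \<circ> snd) ` (dig m ` {..<Suc r})))
     (\<alpha>2 * \<alpha>1 * real (inj_tups k (2^m))) (pair_pmf pV p)
     (\<lambda>r' y x. (\<lambda>(V,T) (l,w) (i,n). \<Sum>q\<in>{..<2^m}. (case (l,q) of (l,q) \<Rightarrow> \<lambda>x. V $$ (l * 2^m + q, x)) i * (case (q,n) of (q,n) \<Rightarrow> T $$ (w, q * 2^?s + n))) r' (y div 2^?n, y mod 2^?n) (x div 2^?s, x mod 2^?s))"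
    by (rule dominated_relabel[OF g b1 b2]) auto
  then have "dominated k {..<2^?N} {..<2^?N}
     ((\<lambda>d. d \<circ> (\<lambda>z. (z div 2^?n, z mod 2^?n))) ` ((\<lambda>d. d \<circ> fst) ` {\<lambda>z. z} \<union> (\<lambda>d. d \<circ> snd) ` (dig m ` {..<Suc r})))
     (\<alpha>2 * \<alpha>1 * real (inj_tups k (2^m))) (pair_pmf pV p) (\<lambda>r' y x. (\<lambda>(V,T). ext_right m (Suc r) (T,V)) r' $$ (y,x))"
  proof (rule dominated_cong)
    fix r' y x assume "r' \<in> set_pmf (pair_pmf pV p)" "y \<in> {..<(2::nat)^?N}" "x \<in> {..<(2::nat)^?N}"
    then show "(\<lambda>(V,T) (l,w) (i,n). \<Sum>q\<in>{..<2^m}. (case (l,q) of (l,q) \<Rightarrow> \<lambda>x. V $$ (l * 2^m + q, x)) i * (case (q,n) of (q,n) \<Rightarrow> T $$ (w, q * 2^?s + n))) r' (y div 2^?n, y mod 2^?n) (x div 2^?s, x mod 2^?s) = (\<lambda>(V,T). ext_right m (Suc r) (T,V)) r' $$ (y,x)"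
      using ext_right_index[of y m r x "snd r'" "fst r'"] car by (cases r') auto
  qed
  then have "dominated k {..<2^?N} {..<2^?N} (dig m ` {..<Suc (Suc r)}) (\<alpha>2 * \<alpha>1 * real (inj_tups k (2^m))) (pair_pmf pV p) (\<lambda>r' y x. (\<lambda>(V,T). ext_right m (Suc r) (T,V)) r' $$ (y,x))"
  proof (rule dominated_digits_cong)
    fix Y assume Y: "Y \<in> tup k {..<(2::nat)^?N}"
    have lt: "Y j < 2^?N" if "j < k" for j using tup_app[OF Y that] by simp
    have 1: "inj_on (\<lambda>j. dig m p (Y j mod 2^?n)) {..<k} \<longleftrightarrow> inj_on (\<lambda>j. dig m p (Y j)) {..<k}" if "p < Suc r" for p
      by (rule inj_on_cong) (simp only: dig_mod[OF that])
    have 3: "inj_on (\<lambda>j. Y j div 2^?n) {..<k} \<longleftrightarrow> inj_on (\<lambda>j. dig m (Suc r) (Y j)) {..<k}"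
    proof (rule inj_on_cong)
      fix j assume "j \<in> {..<k}"
      then have "Y j div 2^?n < 2^m" using lt[of j] by (intro less_mult_imp_div_less) (simp add: power_add[symmetric] algebra_simps)
      then show "Y j div 2^?n = dig m (Suc r) (Y j)" unfolding dig_def by simp
    qed
    have "good k ((\<lambda>d. d \<circ> (\<lambda>z. (z div 2^?n, z mod 2^?n))) ` ((\<lambda>d. d \<circ> fst) ` {\<lambda>z. z} \<union> (\<lambda>d. d \<circ> snd) ` (dig m ` {..<Suc r}))) Y
      \<longleftrightarrow> inj_on (\<lambda>j. Y j div 2^?n) {..<k} \<and> (\<forall>p\<in>{..<Suc r}. inj_on (\<lambda>j. dig m p (Y j mod 2^?n)) {..<k})"
      unfolding image_Un image_image good_def ball_Un by simp
    also have "\<dots> \<longleftrightarrow> inj_on (\<lambda>j. dig m (Suc r) (Y j)) {..<k} \<and> (\<forall>p\<in>{..<Suc r}. inj_on (\<lambda>j. dig m p (Y j)) {..<k})"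
      using 1 3 by simp
    also have "\<dots> \<longleftrightarrow> good k (dig m ` {..<Suc (Suc r)}) Y" unfolding good_image all_less_Suc[of "Suc r"] by blast
    finally show "good k ((\<lambda>d. d \<circ> (\<lambda>z. (z div 2^?n, z mod 2^?n))) ` ((\<lambda>d. d \<circ> fst) ` {\<lambda>z. z} \<union> (\<lambda>d. d \<circ> snd) ` (dig m ` {..<Suc r}))) Y = good k (dig m ` {..<Suc (Suc r)}) Y" .
  qed
  then show ?thesis by (rule dominated_map)
qed

text \<open>The exponents count \<open>P - 1\<close> blocks, each with its own constant from
  \<open>LRFC_dominated\<close>, and \<open>P - 2\<close> shared patches, each with one count of
  injective tuples.\<close>

theorem blocked_dominated:
  fixes m k :: nat
  defines "\<epsilon> \<equiv> 1 - (real k)\<^sup>2 / 2^m"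
  assumes m: "0 < m" and e: "0 \<le> \<epsilon>" and P: "2 \<le> P"
  shows "dominated k {..<2^(m * P)} {..<2^(m * P)} (dig m ` {..<P})
    ((\<epsilon> / (2^m)^(2*k)) ^ (P - 1) * real (inj_tups k (2^m)) ^ (P - 2)) (blocked_LRFC3 (m * P) m) (\<lambda>T y x. T $$ (y,x))"
  using P
proof (induction P rule: nat_induct_at_least)
  case base
  \<comment> \<open>With two patches the circuit is a single block, whose halves are the two
    digits.\<close>
  have o: "odd_pairs 2 = [0]" "even_pairs 2 = []" unfolding odd_pairs_def even_pairs_def by (simp_all add: numeral_2_eq_2)
  have div: "m * 2 div m = 2" using m by simp
  have b: "blocked_LRFC3 (m * 2) m = map_pmf (\<lambda>V. 1\<^sub>m (2^(m*2)) * (embed (m*2) 0 (2*m) V * 1\<^sub>m (2^(m*2)))) (LRFC m)"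
    unfolding blocked_LRFC3_def div o by (simp add: map_pmf_def bind_assoc_pmf bind_return_pmf)
  have "dominated k {..<2^(2*m)} {..<2^(2*m)} {\<lambda>z. z mod 2^m, \<lambda>z. z div 2^m} (\<epsilon> / (2^m)^(2*k)) (LRFC m)
     (\<lambda>V y x. (1\<^sub>m (2^(m*2)) * (embed (m*2) 0 (2*m) V * 1\<^sub>m (2^(m*2)))) $$ (y,x))"
  proof (rule dominated_cong[OF LRFC_dominated[OF m, of k, folded \<epsilon>_def]])
    fix V and y x :: nat assume "y \<in> {..<2^(2*m)}" "x \<in> {..<2^(2*m)}"
    then have yx: "y < 2^(m*2)" "x < 2^(m*2)" by (simp_all add: mult.commute)
    have "1\<^sub>m (2^(m*2)) * (embed (m*2) 0 (2*m) V * 1\<^sub>m (2^(m*2))) = embed (m*2) 0 (2*m) V"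
      using right_mult_one_mat[OF embed_carrier] left_mult_one_mat[OF embed_carrier] by simp
    then show "V $$ (y,x) = (1\<^sub>m (2^(m*2)) * (embed (m*2) 0 (2*m) V * 1\<^sub>m (2^(m*2)))) $$ (y,x)"
      using embed_index[OF yx, of 0 "2*m" V] yx by (simp add: mult.commute)
  qed
  then have "dominated k {..<2^(2*m)} {..<2^(2*m)} (dig m ` {..<2}) (\<epsilon> / (2^m)^(2*k)) (LRFC m)
     (\<lambda>V y x. (1\<^sub>m (2^(m*2)) * (embed (m*2) 0 (2*m) V * 1\<^sub>m (2^(m*2)))) $$ (y,x))"
  proof (rule dominated_digits_cong)
    fix Y assume Y: "Y \<in> tup k {..<(2::nat)^(2*m)}"
    have 1: "inj_on (\<lambda>j. Y j div 2^m) {..<k} \<longleftrightarrow> inj_on (\<lambda>j. dig m 1 (Y j)) {..<k}"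
    proof (rule inj_on_cong)
      fix j assume "j \<in> {..<k}"
      then have "Y j div 2^m < 2^m" using tup_app[OF Y, of j] half_lt by simp
      then show "Y j div 2^m = dig m 1 (Y j)" by (simp add: dig_def)
    qed
    have "good k {\<lambda>z. z mod 2^m, \<lambda>z. z div 2^m} Y \<longleftrightarrow> inj_on (\<lambda>j. Y j mod 2^m) {..<k} \<and> inj_on (\<lambda>j. Y j div 2^m) {..<k}"
      unfolding good_def by simp
    also have "\<dots> \<longleftrightarrow> good k (dig m ` {..<2}) Y"
      unfolding good_image 1 by (auto simp: numeral_2_eq_2 all_less_Suc dig_def)
    finally show "good k {\<lambda>z. z mod 2^m, \<lambda>z. z div 2^m} Y = good k (dig m ` {..<2}) Y" .
  qed
  then show ?case unfolding b by (intro dominated_map) (simp add: mult.commute)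
next
  case (Suc P)
  obtain r where r: "P = Suc r" "1 \<le> r" using Suc.hyps by (cases P) auto
  let ?a = "\<epsilon> / (2^m)^(2*k)" and ?J = "real (inj_tups k (2^m))"
  have a0: "0 \<le> ?a" using e by simp
  have al0: "0 \<le> ?a ^ (P - 1) * ?J ^ (P - 2)" using a0 by simp
  have car: "\<And>T. T \<in> set_pmf (blocked_LRFC3 (m * Suc r) m) \<Longrightarrow> T \<in> carrier_mat (2^(m * Suc r)) (2^(m * Suc r))"
    using unitariesD(1)[OF blocked_unitary[OF _ m]] by blast
  note IH = Suc.IH[unfolded r(1)] and V = LRFC_dominated[OF m, of k, folded \<epsilon>_def]
  have eq: "?a ^ (Suc r - 1) * ?J ^ (Suc r - 2) * ?a * ?J = ?a ^ (Suc (Suc r) - 1) * ?J ^ (Suc (Suc r) - 2)"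
    using r(2) by (cases r) (simp_all add: mult_ac)
  show ?case
  proof (cases "even (P - 1)")
    case True
    have "blocked_LRFC3 (m * Suc P) m = map_pmf (ext_right m P) (pair_pmf (blocked_LRFC3 (m * P) m) (LRFC m))"
      using blocked_step[OF m Suc.hyps] True by simp
    also have "\<dots> = map_pmf (\<lambda>(V,T). ext_right m P (T,V)) (pair_pmf (LRFC m) (blocked_LRFC3 (m * P) m))"
      by (subst pair_commute_pmf) (simp add: map_pmf_comp case_prod_beta')
    finally have b: "blocked_LRFC3 (m * Suc (Suc r)) m = map_pmf (\<lambda>(V,T). ext_right m (Suc r) (T,V)) (pair_pmf (LRFC m) (blocked_LRFC3 (m * Suc r) m))"
      unfolding r(1) .
    have eq': "?a * (?a ^ (Suc r - 1) * ?J ^ (Suc r - 2)) * ?J = ?a ^ (Suc (Suc r) - 1) * ?J ^ (Suc (Suc r) - 2)"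
      using eq by (simp only: mult_ac)
    show ?thesis unfolding r(1) b eq'[symmetric] by (rule dominated_ext_right[OF IH V al0[unfolded r(1)] a0 car])
  next
    case False
    have b: "blocked_LRFC3 (m * Suc (Suc r)) m = map_pmf (ext_left m (Suc r)) (pair_pmf (blocked_LRFC3 (m * Suc r) m) (LRFC m))"
      using blocked_step[OF m Suc.hyps] False unfolding r(1) by simp
    show ?thesis unfolding r(1) b eq[symmetric] by (rule dominated_ext_left[OF IH V al0[unfolded r(1)] a0 car])
  qed
qed

section \<open>Query amplitudes\<close>

lemma sum_tup_Suc:
  "(\<Sum>X\<in>tup (Suc j) S. f X) = (\<Sum>X\<in>tup j S. \<Sum>x\<in>S. f (X(j := x)))"
proof -
  have "(\<Sum>X\<in>tup (Suc j) S. f X) = (\<Sum>(X,x)\<in>tup j S \<times> S. f (X(j := x)))"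
  proof (rule sum.reindex_bij_witness[of _ "\<lambda>(X,x). X(j := x)" "\<lambda>X. (X(j := undefined), X j)"])
    fix X assume X: "X \<in> tup (Suc j) S"
    show "(case (X(j := undefined), X j) of (X,x) \<Rightarrow> X(j := x)) = X" by simp
    have "X(j := undefined) \<in> tup j S"
      by (rule tupI) (use tup_app[OF X] tup_undef[OF X] in \<open>auto simp: less_Suc_eq\<close>)
    then show "(X(j := undefined), X j) \<in> tup j S \<times> S" using tup_app[OF X, of j] by simp
    show "(case (X(j := undefined), X j) of (X,x) \<Rightarrow> f (X(j := x))) = f X" by simp
  next
    fix p assume "p \<in> tup j S \<times> S"
    then obtain X x where p: "p = (X,x)" "X \<in> tup j S" "x \<in> S" by auto
    have u: "X j = undefined" using tup_undef[OF p(2), of j] by simp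
    show "((case p of (X,x) \<Rightarrow> X(j := x))(j := undefined), (case p of (X,x) \<Rightarrow> X(j := x)) j) = p"
      unfolding p(1) using u by auto
    show "(case p of (X,x) \<Rightarrow> X(j := x)) \<in> tup (Suc j) S"
      unfolding p(1) prod.case
      by (rule tupI) (use tup_app[OF p(2)] tup_undef[OF p(2)] p(3) in \<open>auto simp: less_Suc_eq\<close>)
  qed
  then show ?thesis by (simp add: sum.cartesian_product)
qed

lemma sum_pow_pair:
  "(\<Sum>l<2^(n+m). f l) = (\<Sum>y<2^n. \<Sum>s<2^m. f (y * 2^m + s :: nat))"
proof -
  have "(\<Sum>l<2^(n+m). f l) = (\<Sum>(s,y)\<in>{..<2^m} \<times> {..<2^n}. f (y * 2^m + s))"
    using sum.reindex_bij_betw[OF bij_pair_pow[of m n], of f] by (simp add: case_prod_beta' add.commute)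
  also have "\<dots> = (\<Sum>s<2^m. \<Sum>y<2^n. f (y * 2^m + s))" by (simp only: sum.cartesian_product)
  also have "\<dots> = (\<Sum>y<2^n. \<Sum>s<2^m. f (y * 2^m + s))" by (rule sum.swap)
  finally show ?thesis .
qed

text \<open>The experiment with its queries cut open: query \<open>j\<close> receives the system
  value \<open>X j\<close> and returns \<open>Y j\<close>, while the ancilla value \<open>s\<close>
  passes through. Only the gates \<open>W\<close> enter, so these are the coefficients of the query
  state as a polynomial in the entries of \<open>U\<close>.\<close>

fun qamp :: "nat \<Rightarrow> (nat \<Rightarrow> complex mat) \<Rightarrow> nat \<Rightarrow> (nat \<Rightarrow> nat) \<Rightarrow> (nat \<Rightarrow> nat) \<Rightarrow> nat \<Rightarrow> complex" where
  "qamp m W 0 X Y i = W 0 $$ (i,0)"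
| "qamp m W (Suc j) X Y i = (\<Sum>s<2^m. W (Suc j) $$ (i, Y j * 2^m + s) * qamp m W j X Y (X j * 2^m + s))"

lemma qamp_cong:
  "(\<And>l. l < j \<Longrightarrow> X l = X' l) \<Longrightarrow> (\<And>l. l < j \<Longrightarrow> Y l = Y' l) \<Longrightarrow> qamp m W j X Y i = qamp m W j X' Y' i"
proof (induction j arbitrary: i)
  case (Suc j)
  have "qamp m W j X Y i' = qamp m W j X' Y' i'" for i' by (rule Suc.IH) (use Suc.prems in auto)
  then show ?case using Suc.prems by simp
qed simp

lemma amp_Suc: "amp (Suc j) T (X(j := x)) (Y(j := y)) = amp j T X Y * T y x"
proof -
  have "amp j T (X(j := x)) (Y(j := y)) = amp j T X Y" unfolding amp_def by (rule prod.cong) auto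
  then show ?thesis unfolding amp_def by simp
qed

lemma query_state_carrier:
  "(\<And>i. i \<le> j \<Longrightarrow> W i \<in> carrier_mat (2^(n+m)) (2^(n+m))) \<Longrightarrow> query_state n m W U j \<in> carrier_mat (2^(n+m)) 1"
proof (induction j)
  case 0
  have "zero_state (2^(n+m)) \<in> carrier_mat (2^(n+m)) 1" unfolding zero_state_def by simp
  then show ?case using 0[of 0] by (auto intro: mult_carrier_mat)
next
  case (Suc j)
  have "query_state n m W U j \<in> carrier_mat (2^(n+m)) 1" by (rule Suc.IH) (use Suc.prems in auto)
  then show ?case unfolding query_state.simps tensor_id_def
    by (intro mult_carrier_mat[OF Suc.prems[OF order_refl]] mult_carrier_mat[OF embed_carrier])
qed

text \<open>Expanding the last query over its input \<open>x\<close> and output \<open>y\<close>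
  appends these two values to the tuples of the earlier queries; the rest is a reordering of finite
  sums.\<close>

lemma query_state_qamp:
  assumes "\<And>i. i \<le> j \<Longrightarrow> W i \<in> carrier_mat (2^(n+m)) (2^(n+m))" "i < 2^(n+m)"
  shows "query_state n m W U j $$ (i,0) = form j {..<2^n} {..<2^n} (\<lambda>y x. U $$ (y,x)) (\<lambda>X Y. qamp m W j X Y i)"
  using assms
proof (induction j arbitrary: i)
  case 0
  have z: "zero_state (2^(n+m)) \<in> carrier_mat (2^(n+m)) 1" unfolding zero_state_def by simp
  have "(W 0 * zero_state (2^(n+m))) $$ (i,0) = (\<Sum>l<2^(n+m). W 0 $$ (i,l) * zero_state (2^(n+m)) $$ (l,0))"
    by (rule mat_mult_index[OF 0(1) z 0(2)]) auto
  also have "\<dots> = (\<Sum>l<(2::nat)^(n+m). if l = 0 then W 0 $$ (i,0) else 0)"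
    by (rule sum.cong) (auto simp: zero_state_def)
  also have "\<dots> = W 0 $$ (i,0)" by simp
  finally show ?case by (simp add: form_def amp_def tup_def)
next
  case (Suc j)
  let ?q = "query_state n m W U j" and ?N = "2^(n+m) :: nat" and ?D = "{..<2^n} :: nat set"
  have q: "?q \<in> carrier_mat ?N 1" by (rule query_state_carrier) (use Suc.prems in auto)
  have IH: "?q $$ (l,0) = form j ?D ?D (\<lambda>y x. U $$ (y,x)) (\<lambda>X Y. qamp m W j X Y l)" if "l < ?N" for l
    by (rule Suc.IH[OF _ that]) (use Suc.prems in auto)
  have lt: "y * 2^m + s < ?N" if "y < 2^n" "s < 2^m" for y s :: nat
    using bij_betwE[OF bij_pair_pow[of m n]] that by (auto simp: add.commute[of n])
  have e: "(embed (n+m) m n U * ?q) $$ (y * 2^m + s, 0) = (\<Sum>x<2^n. U $$ (y,x) * ?q $$ (x * 2^m + s, 0))"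
    if "y < 2^n" "s < 2^m" for y s
  proof -
    have d: "(y * 2^m + s) div 2^(m+n) = 0" using lt[OF that] by (simp add: add.commute)
    have "(y * 2^m + s) div 2^m = y" "(y * 2^m + s) mod 2^m = s" using that by auto
    then show ?thesis using embed_mult_left[OF _ lt[OF that] _ q, of m n 0 U] that d by simp
  qed
  have "query_state n m W U (Suc j) $$ (i,0) = (\<Sum>l<?N. W (Suc j) $$ (i,l) * (embed (n+m) m n U * ?q) $$ (l,0))"
    unfolding query_state.simps tensor_id_def
    by (rule mat_mult_index[OF Suc.prems(1)[OF order_refl] mult_carrier_mat[OF embed_carrier q] Suc.prems(2)]) simp
  also have "\<dots> = (\<Sum>y\<in>?D. \<Sum>s<2^m. W (Suc j) $$ (i,y * 2^m + s) * (\<Sum>x\<in>?D. U $$ (y,x) * ?q $$ (x * 2^m + s, 0)))"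
    unfolding sum_pow_pair by (intro sum.cong refl) (simp add: e)
  also have "\<dots> = (\<Sum>y\<in>?D. \<Sum>s<2^m. \<Sum>x\<in>?D. \<Sum>X\<in>tup j ?D. \<Sum>Y\<in>tup j ?D.
      (amp j (\<lambda>y x. U $$ (y,x)) X Y * U $$ (y,x)) * (W (Suc j) $$ (i,y * 2^m + s) * qamp m W j X Y (x * 2^m + s)))"
    unfolding sum_distrib_left
    by (intro sum.cong refl) (simp add: IH lt form_def sum_distrib_left mult_ac)
  also have "\<dots> = (\<Sum>X\<in>tup j ?D. \<Sum>x\<in>?D. \<Sum>Y\<in>tup j ?D. \<Sum>y\<in>?D. \<Sum>s<2^m.
      (amp j (\<lambda>y x. U $$ (y,x)) X Y * U $$ (y,x)) * (W (Suc j) $$ (i,y * 2^m + s) * qamp m W j X Y (x * 2^m + s)))"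
    (is "(\<Sum>y\<in>?D. \<Sum>s<2^m. \<Sum>x\<in>?D. \<Sum>X\<in>_. \<Sum>Y\<in>_. ?F X x Y y s) = _")
  proof -
    have "(\<Sum>y\<in>?D. \<Sum>s<2^m. \<Sum>x\<in>?D. \<Sum>X\<in>tup j ?D. \<Sum>Y\<in>tup j ?D. ?F X x Y y s)
        = (\<Sum>(y,s,x,X,Y)\<in>?D \<times> {..<2^m} \<times> ?D \<times> tup j ?D \<times> tup j ?D. ?F X x Y y s)"
      by (simp only: sum.cartesian_product case_prod_beta')
    also have "\<dots> = (\<Sum>(X,x,Y,y,s)\<in>tup j ?D \<times> ?D \<times> tup j ?D \<times> ?D \<times> {..<2^m}. ?F X x Y y s)"
      by (rule sum.reindex_bij_witness[of _ "\<lambda>(X,x,Y,y,s). (y,s,x,X,Y)" "\<lambda>(y,s,x,X,Y). (X,x,Y,y,s)"]) auto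
    also have "\<dots> = (\<Sum>X\<in>tup j ?D. \<Sum>x\<in>?D. \<Sum>Y\<in>tup j ?D. \<Sum>y\<in>?D. \<Sum>s<2^m. ?F X x Y y s)"
      by (simp only: sum.cartesian_product case_prod_beta')
    finally show ?thesis .
  qed
  also have "\<dots> = (\<Sum>X\<in>tup j ?D. \<Sum>x\<in>?D. \<Sum>Y\<in>tup j ?D. \<Sum>y\<in>?D.
      amp (Suc j) (\<lambda>y x. U $$ (y,x)) (X(j := x)) (Y(j := y)) * qamp m W (Suc j) (X(j := x)) (Y(j := y)) i)"
  proof (intro sum.cong refl)
    fix X Y and x y :: nat
    have "qamp m W j (X(j := x)) (Y(j := y)) l = qamp m W j X Y l" for l by (rule qamp_cong) auto
    then show "(\<Sum>s<2^m. ?F X x Y y s) = amp (Suc j) (\<lambda>y x. U $$ (y,x)) (X(j := x)) (Y(j := y)) * qamp m W (Suc j) (X(j := x)) (Y(j := y)) i"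
      unfolding amp_Suc by (simp add: sum_distrib_left)
  qed
  finally show ?case unfolding form_def sum_tup_Suc .
qed

text \<open>Exchanging \<open>X c\<close> with an extra variable \<open>x\<close> is an involution,
  and the first argument of \<open>G\<close> does not notice it; the factor \<open>d\<close> counts
  the values of the extra variable.\<close>

lemma sum_tup_swap:
  fixes G :: "(nat \<Rightarrow> nat) \<Rightarrow> nat \<Rightarrow> 'a::comm_semiring_1"
  assumes c: "c < k" and G: "\<And>X x z. G (X(c := x)) z = G X z"
  shows "of_nat d * (\<Sum>X\<in>tup k {..<d}. G X (X c)) = (\<Sum>X\<in>tup k {..<d}. \<Sum>x<d. G X x)"
proof -
  have "of_nat d * (\<Sum>X\<in>tup k {..<d}. G X (X c)) = (\<Sum>(X,x)\<in>tup k {..<d} \<times> {..<d}. G X (X c))"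
    by (simp add: sum.cartesian_product[symmetric] sum_distrib_left)
  also have "\<dots> = (\<Sum>(X,x)\<in>tup k {..<d} \<times> {..<d}. G X x)"
  proof (rule sum.reindex_bij_witness[of _ "\<lambda>(X,x). (X(c := x), X c)" "\<lambda>(X,x). (X(c := x), X c)"])
    fix p assume "p \<in> tup k {..<d} \<times> {..<d}"
    then obtain X x where p: "p = (X,x)" "X \<in> tup k {..<d}" "x < d" by auto
    have "X(c := x) \<in> tup k {..<d}" by (rule tupI) (use tup_app[OF p(2)] tup_undef[OF p(2)] p(3) c in auto)
    then show "(case p of (X,x) \<Rightarrow> (X(c := x), X c)) \<in> tup k {..<d} \<times> {..<d}"
      "(case p of (X,x) \<Rightarrow> (X(c := x), X c)) \<in> tup k {..<d} \<times> {..<d}"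
      unfolding p(1) using tup_app[OF p(2) c] by auto
    show "(case case p of (X,x) \<Rightarrow> (X(c := x), X c) of (X,x) \<Rightarrow> (X(c := x), X c)) = p"
      "(case case p of (X,x) \<Rightarrow> (X(c := x), X c) of (X,x) \<Rightarrow> (X(c := x), X c)) = p"
      unfolding p(1) by auto
    show "(case case p of (X,x) \<Rightarrow> (X(c := x), X c) of (X,x) \<Rightarrow> G X x) = (case p of (X,x) \<Rightarrow> G X (X c))"
      unfolding p(1) by (simp add: G)
  qed
  finally show ?thesis by (simp add: sum.cartesian_product)
qed

lemma card_tup: "card (tup k {..<d}) = d^k"
  unfolding tup_def by (simp add: card_PiE)

text \<open>Orthonormal columns of the last gate force both the query outputs and the ancilla values
  to agree.\<close>

lemma ip_qamp_Suc:
  assumes W: "W (Suc j) \<in> unitaries (2^(n+m))" and Y: "Y j < 2^n" "Y' j < 2^n"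
  shows "ip (2^(n+m)) (qamp m W (Suc j) X Y) (qamp m W (Suc j) X' Y') =
    (if Y j = Y' j then \<Sum>s<2^m. cnj (qamp m W j X Y (X j * 2^m + s)) * qamp m W j X' Y' (X' j * 2^m + s) else 0)"
proof -
  let ?N = "2^(n+m) :: nat"
  let ?W = "W (Suc j)" and ?a = "\<lambda>s. qamp m W j X Y (X j * 2^m + s)" and ?b = "\<lambda>s. qamp m W j X' Y' (X' j * 2^m + s)"
  have lt: "y * 2^m + s < ?N" if "y < 2^n" "s < 2^m" for y s :: nat
    using bij_betwE[OF bij_pair_pow[of m n]] that by (auto simp: add.commute[of n])
  have "ip ?N (qamp m W (Suc j) X Y) (qamp m W (Suc j) X' Y')
      = (\<Sum>i<?N. \<Sum>s<2^m. \<Sum>s'<2^m. (cnj (?W $$ (i, Y j * 2^m + s)) * ?W $$ (i, Y' j * 2^m + s')) * (cnj (?a s) * ?b s'))"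
    unfolding ip_def qamp.simps cnj_sum sum_product by (intro sum.cong refl) (simp add: mult_ac)
  also have "\<dots> = (\<Sum>s<2^m. \<Sum>s'<2^m. (\<Sum>i<?N. cnj (?W $$ (i, Y j * 2^m + s)) * ?W $$ (i, Y' j * 2^m + s')) * (cnj (?a s) * ?b s'))"
    unfolding sum_distrib_right by (subst sum.swap) (intro sum.cong refl sum.swap)
  also have "\<dots> = (\<Sum>s<2^m. \<Sum>s'<2^m. if s = s' then (if Y j = Y' j then cnj (?a s) * ?b s' else 0) else 0)"
  proof (intro sum.cong refl)
    fix s s' :: nat assume "s \<in> {..<2^m}" "s' \<in> {..<2^m}"
    then have s: "s < 2^m" "s' < 2^m" by auto
    have "Y j * 2^m + s = Y' j * 2^m + s' \<longleftrightarrow> Y j = Y' j \<and> s = s'"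
    proof
      assume eq: "Y j * 2^m + s = Y' j * 2^m + s'"
      have "Y j = (Y j * 2^m + s) div 2^m" "Y' j = (Y' j * 2^m + s') div 2^m" using s by simp_all
      then show "Y j = Y' j \<and> s = s'" using eq by (metis add_left_cancel)
    qed auto
    then show "(\<Sum>i<?N. cnj (?W $$ (i, Y j * 2^m + s)) * ?W $$ (i, Y' j * 2^m + s')) * (cnj (?a s) * ?b s')
        = (if s = s' then (if Y j = Y' j then cnj (?a s) * ?b s' else 0) else 0)"
      unfolding unitary_col_orthonormal[OF W lt[OF Y(1) s(1)] lt[OF Y(2) s(2)]] by simp
  qed
  also have "\<dots> = (\<Sum>s<2^m. if Y j = Y' j then cnj (?a s) * ?b s else 0)" by (intro sum.cong refl) simp
  finally show ?thesis by simp
qed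

text \<open>Unitarity of the last gate forces equal outputs, injectivity of \<open>Y\<close> then gives \<open>\<pi> j = \<pi>' j\<close>,
  and the amplitude after \<open>j\<close> queries does not depend on the input of query \<open>j\<close>, so that one can sum over it.\<close>
lemma sum_ip_qamp:
  assumes W: "\<And>i. i \<le> k \<Longrightarrow> W i \<in> unitaries (2^(n+m))"
    and Y: "Y \<in> tup k {..<2^n}" "inj_on Y {..<k}"
  shows "j \<le> k \<Longrightarrow> \<pi> \<in> perms k \<Longrightarrow> \<pi>' \<in> perms k \<Longrightarrow> (\<And>l. j \<le> l \<Longrightarrow> l < k \<Longrightarrow> \<pi> l = \<pi>' l) \<Longrightarrow>
    (\<Sum>X\<in>tup k {..<2^n}. ip (2^(n+m)) (qamp m W j (X \<circ> \<pi>) (Y \<circ> \<pi>)) (qamp m W j (X \<circ> \<pi>') (Y \<circ> \<pi>')))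
      = (if \<pi> = \<pi>' then (2^n)^(k - j) else 0)"
proof (induction j)
  case 0
  have out: "\<pi> l = l" "\<pi>' l = l" if "\<not> l < k" for l
    using 0(2,3) that unfolding perms_def permutes_def by auto
  have "\<pi> = \<pi>'" by (rule ext) (metis 0(4) le0 out)
  moreover have "ip (2^(n+m)) (qamp m W 0 X Y) (qamp m W 0 X' Y') = 1" for X Y X' Y'
    using unitary_col_orthonormal[OF W[of 0], of 0 0] unfolding ip_def by simp
  ultimately show ?case by (simp only: card_tup sum_constant) simp
next
  case (Suc j)
  let ?N = "2^(n+m) :: nat" and ?T = "tup k {..<2^n} :: (nat \<Rightarrow> nat) set"
  have j: "j < k" using Suc.prems(1) by simp
  have pl: "\<pi> j < k" "\<pi>' j < k" using perms_lt Suc.prems(2,3) j by auto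
  have Yl: "(Y \<circ> \<pi>) j < 2^n" "(Y \<circ> \<pi>') j < 2^n" using tup_app[OF Y(1)] pl by auto
  have Yeq: "(Y \<circ> \<pi>) j = (Y \<circ> \<pi>') j \<longleftrightarrow> \<pi> j = \<pi>' j" using inj_onD[OF Y(2)] pl by auto
  note st = ip_qamp_Suc[where n = n and m = m and W = W and j = j and Y = "Y \<circ> \<pi>" and Y' = "Y \<circ> \<pi>'", OF W[OF Suc.prems(1)] Yl, unfolded Yeq]
  show ?case
  proof (cases "\<pi> j = \<pi>' j")
    case False
    then show ?thesis unfolding st by auto
  next
    case True
    let ?G = "\<lambda>X x. \<Sum>s<2^m. cnj (qamp m W j (X \<circ> \<pi>) (Y \<circ> \<pi>) (x * 2^m + s)) * qamp m W j (X \<circ> \<pi>') (Y \<circ> \<pi>') (x * 2^m + s)"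
    have indep: "qamp m W j (X(\<pi> j := x) \<circ> \<kappa>) Z i = qamp m W j (X \<circ> \<kappa>) Z i"
      if "\<kappa> \<in> perms k" "\<kappa> j = \<pi> j" for X x \<kappa> Z i
    proof (rule qamp_cong)
      fix l assume "l < j"
      moreover have "inj \<kappa>" using that(1) unfolding perms_def by (auto intro: permutes_inj)
      ultimately have "\<kappa> l \<noteq> \<pi> j" using that(2) by (metis injD less_irrefl)
      then show "(X(\<pi> j := x) \<circ> \<kappa>) l = (X \<circ> \<kappa>) l" by simp
    qed simp
    have "of_nat (2^n) * (\<Sum>X\<in>?T. ?G X (X (\<pi> j))) = (\<Sum>X\<in>?T. \<Sum>x<2^n. ?G X x)"
      by (rule sum_tup_swap[OF pl(1)]) (simp only: indep[OF Suc.prems(2) refl] indep[OF Suc.prems(3) True[symmetric]])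
    \<comment> \<open>The freed input \<open>x\<close> and the ancilla value \<open>s\<close>
      together run over a full basis, so the sum is an inner product after \<open>j\<close>
      queries.\<close>
    also have "\<dots> = (\<Sum>X\<in>?T. ip ?N (qamp m W j (X \<circ> \<pi>) (Y \<circ> \<pi>)) (qamp m W j (X \<circ> \<pi>') (Y \<circ> \<pi>')))"
      unfolding ip_def sum_pow_pair ..
    also have "\<dots> = (if \<pi> = \<pi>' then (2^n)^(k - j) else 0)"
    proof (rule Suc.IH)
      fix l assume "j \<le> l" "l < k"
      then show "\<pi> l = \<pi>' l" using True Suc.prems(4)[of l] by (cases "l = j") auto
    qed (use Suc.prems in auto)
    also have "((2::complex)^n) ^ (k - j) = of_nat (2^n) * (2^n)^(k - Suc j)"
      unfolding Suc_diff_Suc[OF j, symmetric] by simp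
    finally have eq: "of_nat (2^n) * (\<Sum>X\<in>?T. ?G X (X (\<pi> j))) = (if \<pi> = \<pi>' then of_nat (2^n) * (2^n)^(k - Suc j) else 0)" .
    have cancel: "a = (if b then z else 0)" if "of_nat (2^n) * a = (if b then of_nat (2^n) * z else 0)" for a z :: complex and b
      using that by (auto split: if_splits)
    have "(\<Sum>X\<in>?T. ?G X (X (\<pi> j))) = (if \<pi> = \<pi>' then (2^n)^(k - Suc j) else 0)" by (rule cancel[OF eq])
    then show ?thesis unfolding st using True by simp
  qed
qed

text \<open>Expanding the square gives a double sum over permutations; \<open>sum_ip_qamp\<close> at
  \<open>j = k\<close> kills all pairs except the equal ones, each of which contributes 1.\<close>

lemma sum_norm_symz_qamp:
  assumes W: "\<And>i. i \<le> k \<Longrightarrow> W i \<in> unitaries (2^(n+m))"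
    and Y: "Y \<in> tup k {..<2^n}" "inj_on Y {..<k}"
  shows "(\<Sum>X\<in>tup k {..<2^n}. \<Sum>i<2^(n+m). (cmod (symz k (\<lambda>X Y. qamp m W k X Y i) X Y))\<^sup>2) = fact k"
proof -
  let ?N = "2^(n+m) :: nat" and ?T = "tup k {..<2^n} :: (nat \<Rightarrow> nat) set"
  let ?q = "\<lambda>X \<pi>. qamp m W k (X \<circ> \<pi>) (Y \<circ> \<pi>)"
  have "complex_of_real (\<Sum>X\<in>?T. \<Sum>i<?N. (cmod (symz k (\<lambda>X Y. qamp m W k X Y i) X Y))\<^sup>2)
     = (\<Sum>X\<in>?T. \<Sum>i<?N. \<Sum>\<pi>\<in>perms k. \<Sum>\<pi>'\<in>perms k. cnj (?q X \<pi> i) * ?q X \<pi>' i)"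
    unfolding of_real_sum symz_def complex_norm_square
    by (intro sum.cong refl, subst mult.commute) (simp add: sum_product)
  also have "\<dots> = (\<Sum>X\<in>?T. \<Sum>\<pi>\<in>perms k. \<Sum>\<pi>'\<in>perms k. ip ?N (?q X \<pi>) (?q X \<pi>'))"
    unfolding ip_def by (intro sum.cong refl) (subst sum.swap, intro sum.cong refl sum.swap)
  also have "\<dots> = (\<Sum>\<pi>\<in>perms k. \<Sum>\<pi>'\<in>perms k. \<Sum>X\<in>?T. ip ?N (?q X \<pi>) (?q X \<pi>'))"
    by (subst sum.swap) (intro sum.cong refl sum.swap)
  also have "\<dots> = (\<Sum>\<pi>\<in>perms k. \<Sum>\<pi>'\<in>perms k. if \<pi> = \<pi>' then 1 else 0)"
    by (intro sum.cong refl) (use sum_ip_qamp[OF W Y order_refl] in simp)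
  also have "\<dots> = complex_of_real (fact k)" by (simp add: card_perms)
  finally show ?thesis using of_real_eq_iff by blast
qed

lemma query_state_norm:
  assumes W: "\<And>i. i \<le> j \<Longrightarrow> W i \<in> unitaries (2^(n+m))" and U: "U \<in> unitaries (2^n)"
  shows "(\<Sum>i<2^(n+m). (cmod (query_state n m W U j $$ (i,0)))\<^sup>2) = 1"
proof -
  let ?N = "2^(n+m) :: nat"
  have z: "zero_state ?N \<in> carrier_mat ?N 1" unfolding zero_state_def by simp
  have "\<exists>A\<in>unitaries ?N. query_state n m W U j = A * zero_state ?N"
    using W
  proof (induction j)
    case (Suc j)
    then obtain A where A: "A \<in> unitaries ?N" "query_state n m W U j = A * zero_state ?N" by force
    have E: "tensor_id n m U \<in> unitaries ?N" unfolding tensor_id_def by (rule embed_unitary[OF _ U]) simp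
    have "query_state n m W U (Suc j) = (W (Suc j) * (tensor_id n m U * A)) * zero_state ?N"
      unfolding query_state.simps A(2)
      using unitariesD(1)[OF A(1)] unitariesD(1)[OF E] unitariesD(1)[OF Suc.prems[OF order_refl]] z
      by (simp add: assoc_mult_mat[of _ ?N ?N _ ?N _ 1] mult_carrier_mat[of _ ?N ?N _ ?N])
    then show ?case using unitaries_mult[OF Suc.prems[OF order_refl] unitaries_mult[OF E A(1)]] by blast
  qed auto
  then obtain A where A: "A \<in> unitaries ?N" "query_state n m W U j = A * zero_state ?N" by blast
  have q: "query_state n m W U j $$ (i,0) = A $$ (i,0)" if "i < ?N" for i
  proof -
    have "(A * zero_state ?N) $$ (i,0) = (\<Sum>l<?N. A $$ (i,l) * zero_state ?N $$ (l,0))"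
      by (rule mat_mult_index[OF unitariesD(1)[OF A(1)] z that]) simp
    also have "\<dots> = (\<Sum>l<?N. if l = 0 then A $$ (i,0) else 0)" by (rule sum.cong) (auto simp: zero_state_def)
    finally show ?thesis unfolding A(2) by simp
  qed
  have "complex_of_real (\<Sum>i<?N. (cmod (query_state n m W U j $$ (i,0)))\<^sup>2) = (\<Sum>i<?N. cnj (A $$ (i,0)) * A $$ (i,0))"
    unfolding of_real_sum by (intro sum.cong refl) (simp add: q complex_norm_square mult.commute del: of_real_power)
  also have "\<dots> = 1" using unitary_col_orthonormal[OF A(1), of 0 0] by simp
  finally show ?thesis using of_real_eq_1_iff by blast
qed

lemma orthonormal_parseval:
  assumes "\<And>a b. a < d \<Longrightarrow> b < d \<Longrightarrow> ip d (u a) (u b) = (if a = b then 1 else 0)"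
  shows "(\<Sum>a<d. (cmod (ip d (u a) v))\<^sup>2) = (\<Sum>i<d. (cmod (v i))\<^sup>2)"
proof -
  let ?Q = "Matrix.mat d d (\<lambda>(i,j). u j i)"
  have Q: "?Q \<in> unitaries d" using unitaries_of_orthonormal[OF assms] .
  have row: "(\<Sum>a<d. u a i * cnj (u a j)) = (if i = j then 1 else 0)" if "i < d" "j < d" for i j
    using unitary_row_orthonormal[OF Q that] that by simp
  have "complex_of_real (\<Sum>a<d. (cmod (ip d (u a) v))\<^sup>2) = (\<Sum>a<d. \<Sum>i<d. \<Sum>j<d. (u a i * cnj (u a j)) * (cnj (v i) * v j))"
    unfolding of_real_sum complex_norm_square
    by (intro sum.cong refl, subst mult.commute, unfold ip_def cnj_sum sum_product, intro sum.cong refl) (simp add: mult_ac)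
  also have "\<dots> = (\<Sum>i<d. \<Sum>j<d. (\<Sum>a<d. u a i * cnj (u a j)) * (cnj (v i) * v j))"
    unfolding sum_distrib_right by (subst sum.swap) (intro sum.cong refl sum.swap)
  also have "\<dots> = (\<Sum>i<d. \<Sum>j<d. if i = j then cnj (v i) * v j else 0)"
    by (intro sum.cong refl) (simp add: row)
  also have "\<dots> = complex_of_real (\<Sum>i<d. (cmod (v i))\<^sup>2)"
    unfolding of_real_sum by (intro sum.cong refl) (simp add: complex_norm_square mult.commute del: of_real_power)
  finally show ?thesis using of_real_eq_iff by blast
qed

section \<open>Comparison with Haar measure\<close>

text \<open>Union bound over ordered pairs of distinct positions, of which there are at most
  \<open>k^2\<close>; each collision set is exactly a fraction \<open>1 / Q\<close> of all
  tuples.\<close>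

lemma inj_tups_lower:
  assumes "0 < Q"
  shows "1 - (real k)\<^sup>2 / real Q \<le> real (inj_tups k Q) / real Q ^ k"
proof -
  let ?T = "tup k {..<Q} :: (nat \<Rightarrow> nat) set" and ?I = "{X \<in> tup k {..<Q}. inj_on X {..<k}}"
  let ?C = "\<lambda>(a,b). {X\<in>?T. X b = X a}" and ?P = "{(a,b). a < k \<and> b < k \<and> a \<noteq> b}"
  have fP: "finite ?P" by (rule finite_subset[of _ "{..<k} \<times> {..<k}"]) auto
  have cP: "card ?P \<le> k\<^sup>2"
    using card_mono[of "{..<k} \<times> {..<k}" ?P] by (auto simp: power2_eq_square card_cartesian_product)
  have cC: "Q * card (?C p) = Q^k" if p: "p \<in> ?P" for p
  proof -
    obtain a b where ab: "p = (a,b)" "a < k" "a \<noteq> b" using p by auto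
    \<comment> \<open>Freeing the coordinate \<open>a\<close> in the condition
      \<open>X b = X a\<close> leaves exactly one admissible value, so \<open>Q\<close> times the
      collision count is the number of all tuples.\<close>
    have "of_nat Q * (\<Sum>X\<in>?T. (if X b = X a then 1 else 0 :: nat)) = (\<Sum>X\<in>?T. \<Sum>x<Q. if X b = x then 1 else 0)"
      by (rule sum_tup_swap[OF ab(2)]) (use ab(3) in auto)
    also have "\<dots> = (\<Sum>X\<in>?T. 1)"
    proof (rule sum.cong[OF refl])
      fix X assume "X \<in> ?T"
      then have "X b < Q" using p ab(1) tup_app[of X k "{..<Q}" b] by auto
      then show "(\<Sum>x<Q. if X b = x then 1 else 0 :: nat) = 1" by simp
    qed
    finally show ?thesis unfolding ab(1) by (simp add: sum.If_cases card_tup Int_def)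
  qed
  have "?T \<subseteq> ?I \<union> (\<Union>p\<in>?P. ?C p)"
  proof
    fix X assume X: "X \<in> ?T"
    show "X \<in> ?I \<union> (\<Union>p\<in>?P. ?C p)"
    proof (cases "inj_on X {..<k}")
      case False
      then obtain a b where "a < k" "b < k" "a \<noteq> b" "X b = X a" unfolding inj_on_def by force
      then show ?thesis using X by blast
    qed (use X in auto)
  qed
  then have "card ?T \<le> card (?I \<union> (\<Union>p\<in>?P. ?C p))" using fP by (intro card_mono) auto
  also have "\<dots> \<le> card ?I + (\<Sum>p\<in>?P. card (?C p))"
    using card_Un_le[of ?I "\<Union>p\<in>?P. ?C p"] card_UN_le[OF fP, of ?C] by linarith
  finally have "Q * Q^k \<le> Q * card ?I + (\<Sum>p\<in>?P. Q * card (?C p))"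
    unfolding card_tup sum_distrib_left[symmetric] distrib_left[symmetric] by (rule mult_le_mono2)
  also have "(\<Sum>p\<in>?P. Q * card (?C p)) = card ?P * Q^k" using cC by simp
  also have "\<dots> \<le> k\<^sup>2 * Q^k" using cP by (rule mult_right_mono) simp
  finally have "Q * Q^k \<le> Q * inj_tups k Q + k\<^sup>2 * Q^k" unfolding inj_tups_def by simp
  then have "real (Q * Q^k) \<le> real (Q * inj_tups k Q + k\<^sup>2 * Q^k)" using of_nat_mono by blast
  then have "real Q * real Q ^ k \<le> real Q * real (inj_tups k Q) + (real k)\<^sup>2 * real Q ^ k" by simp
  then show ?thesis using assms by (simp add: field_simps)
qed

text \<open>Injective tuples chosen separately for each patch assemble, one patch at a time, into a
  tuple all of whose digits are distinct.\<close>

lemma card_good_lower: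
  "real (inj_tups k (2^m)) ^ P \<le> real (card {Y\<in>tup k {..<2^(m*P)}. good k (dig m ` {..<P}) Y})"
proof (induction P)
  case 0
  have "{Y\<in>tup k {..<2^(m*0)}. good k (dig m ` {..<0}) Y} = tup k {..<1::nat}" by (auto simp: good_def)
  then show ?case using card_tup[of k 1] by simp
next
  case (Suc r)
  let ?G = "\<lambda>P. {Y\<in>tup k {..<2^(m*P)}. good k (dig m ` {..<P}) Y}"
  let ?I = "{X\<in>tup k {..<2^m}. inj_on X {..<k}} :: (nat \<Rightarrow> nat) set"
  let ?f = "\<lambda>(Y,X). \<lambda>j\<in>{..<k}. X j * 2^(m*r) + (Y j :: nat)"
  have lt: "Y j < 2^(m*r)" if "Y \<in> ?G r" "j < k" for Y j using tup_app[of Y k _ j] that by auto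
  have ltX: "X j < 2^m" if "X \<in> ?I" "j < k" for X j using tup_app[of X k _ j] that by auto
  have inj: "inj_on ?f (?G r \<times> ?I)"
  proof (rule inj_onI)
    fix p q assume a: "p \<in> ?G r \<times> ?I" "q \<in> ?G r \<times> ?I" "?f p = ?f q"
    obtain Y X Y' X' where pq: "p = (Y,X)" "q = (Y',X')" by (metis surj_pair)
    have m: "Y \<in> ?G r" "X \<in> ?I" "Y' \<in> ?G r" "X' \<in> ?I" using a(1,2) unfolding pq by (auto simp only: mem_Times_iff fst_conv snd_conv)
    have e: "Y j = Y' j \<and> X j = X' j" if j: "j < k" for j
    proof -
      have eq: "X j * 2^(m*r) + Y j = X' j * 2^(m*r) + Y' j"
        using fun_cong[OF a(3), of j] j unfolding pq by simp
      have "(X j * 2^(m*r) + Y j) div 2^(m*r) = X j" "(X' j * 2^(m*r) + Y' j) div 2^(m*r) = X' j"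
        using lt[OF m(1) j] lt[OF m(3) j] by simp_all
      then have "X j = X' j" unfolding eq by simp
      then show ?thesis using eq by simp
    qed
    have "Y = Y'" by (rule tup_eqI[of Y k "{..<2^(m*r)}" _ "{..<2^(m*r)}"]) (use m e in auto)
    moreover have "X = X'" by (rule tup_eqI[of X k "{..<2^m}" _ "{..<2^m}"]) (use m e in auto)
    ultimately show "p = q" unfolding pq by simp
  qed
  have sub: "?f ` (?G r \<times> ?I) \<subseteq> ?G (Suc r)"
  proof
    fix Z assume "Z \<in> ?f ` (?G r \<times> ?I)"
    then obtain Y X where YX: "Y \<in> ?G r" "X \<in> ?I" and Z: "Z = (\<lambda>j\<in>{..<k}. X j * 2^(m*r) + Y j)" by auto
    have Zj: "Z j = X j * 2^(m*r) + Y j" if "j < k" for j unfolding Z using that by simp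
    have "X j * 2^(m*r) + Y j < 2^(m*r+m)" if "j < k" for j
      using bij_betwE[OF bij_pair_pow[of "m*r" m]] lt[OF YX(1) that] ltX[OF YX(2) that] by auto
    then have "Z \<in> tup k {..<2^(m * Suc r)}"
      by (intro tupI) (simp_all add: Zj add.commute[of m], simp add: Z)
    moreover have "good k (dig m ` {..<Suc r}) Z"
      unfolding good_image all_less_Suc
    proof
      show "\<forall>p\<in>{..<r}. inj_on (\<lambda>j. dig m p (Z j)) {..<k}"
      proof
        fix p assume p: "p \<in> {..<r}"
        have "inj_on (\<lambda>j. dig m p (Y j)) {..<k}" using YX(1) p unfolding mem_Collect_eq good_image by blast
        moreover have "inj_on (\<lambda>j. dig m p (Y j)) {..<k} \<longleftrightarrow> inj_on (\<lambda>j. dig m p (Z j)) {..<k}"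
          by (rule inj_on_cong) (use p in \<open>simp add: Zj dig_low\<close>)
        ultimately show "inj_on (\<lambda>j. dig m p (Z j)) {..<k}" by simp
      qed
      have "inj_on X {..<k} \<longleftrightarrow> inj_on (\<lambda>j. dig m r (Z j)) {..<k}"
        by (rule inj_on_cong) (use lt[OF YX(1)] ltX[OF YX(2)] in \<open>simp add: Zj dig_def\<close>)
      then show "inj_on (\<lambda>j. dig m r (Z j)) {..<k}" using YX(2) by simp
    qed
    ultimately show "Z \<in> ?G (Suc r)" by simp
  qed
  have "card (?G r \<times> ?I) \<le> card (?G (Suc r))" by (rule card_inj_on_le[OF inj sub]) simp
  then have "real (card (?G r)) * real (inj_tups k (2^m)) \<le> real (card (?G (Suc r)))"
    unfolding card_cartesian_product inj_tups_def of_nat_mult[symmetric] of_nat_le_iff .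
  moreover have "real (inj_tups k (2^m)) ^ Suc r \<le> real (card (?G r)) * real (inj_tups k (2^m))"
    unfolding power_Suc2 by (rule mult_right_mono[OF Suc.IH]) simp
  ultimately show ?case by linarith
qed

definition qprob :: "nat \<Rightarrow> nat \<Rightarrow> nat \<Rightarrow> (nat \<Rightarrow> complex mat) \<Rightarrow> (nat \<Rightarrow> complex) \<Rightarrow> complex mat \<Rightarrow> real" where
  "qprob n m k W u U = (cmod (ip (2^(n+m)) u (\<lambda>i. query_state n m W U k $$ (i,0))))\<^sup>2"

text \<open>The sum in \<open>dominated\<close> at the coefficients that describe the outcome
  \<open>u\<close>, i.e. the path amplitudes projected onto \<open>u\<close>.\<close>

definition path_weight :: "nat \<Rightarrow> nat \<Rightarrow> nat \<Rightarrow> (nat \<Rightarrow> complex mat) \<Rightarrow> (nat \<Rightarrow> nat) set \<Rightarrow> (nat \<Rightarrow> complex) \<Rightarrow> real" where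
  "path_weight n m k W Ds u = (\<Sum>X\<in>tup k {..<2^n}. \<Sum>Y\<in>{Y\<in>tup k {..<2^n}. good k Ds Y}.
     (cmod (symz k (\<lambda>X Y. ip (2^(n+m)) u (qamp m W k X Y)) X Y))\<^sup>2)"

lemma qprob_form:
  assumes "\<And>i. i \<le> k \<Longrightarrow> W i \<in> unitaries (2^(n+m))"
  shows "qprob n m k W u U = (cmod (form k {..<2^n} {..<2^n} (\<lambda>y x. U $$ (y,x)) (\<lambda>X Y. ip (2^(n+m)) u (qamp m W k X Y))))\<^sup>2"
proof -
  let ?N = "2^(n+m) :: nat" and ?T = "tup k {..<2^n} :: (nat \<Rightarrow> nat) set"
  have "ip ?N u (\<lambda>i. query_state n m W U k $$ (i,0)) = (\<Sum>i<?N. \<Sum>X\<in>?T. \<Sum>Y\<in>?T. amp k (\<lambda>y x. U $$ (y,x)) X Y * (cnj (u i) * qamp m W k X Y i))"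
    unfolding ip_def
    by (intro sum.cong refl, subst query_state_qamp[OF unitariesD(1)[OF assms]])
       (auto simp: form_def sum_distrib_left mult_ac)
  also have "\<dots> = (\<Sum>X\<in>?T. \<Sum>Y\<in>?T. \<Sum>i<?N. amp k (\<lambda>y x. U $$ (y,x)) X Y * (cnj (u i) * qamp m W k X Y i))"
    by (subst sum.swap) (intro sum.cong refl sum.swap)
  finally show ?thesis unfolding qprob_def form_def ip_def sum_distrib_left by simp
qed

lemma sum_qprob:
  fixes u :: "nat \<Rightarrow> nat \<Rightarrow> complex"
  assumes "\<And>i. i \<le> k \<Longrightarrow> W i \<in> unitaries (2^(n+m))" "U \<in> unitaries (2^n)"
    and "\<And>a b. a < 2^(n+m) \<Longrightarrow> b < 2^(n+m) \<Longrightarrow> ip (2^(n+m)) (u a) (u b) = (if a = b then 1 else 0)"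
  shows "(\<Sum>a<2^(n+m). qprob n m k W (u a) U) = 1"
proof -
  have "(\<Sum>a<2^(n+m). qprob n m k W (u a) U) = (\<Sum>i<2^(n+m). (cmod (query_state n m W U k $$ (i,0)))\<^sup>2)"
    unfolding qprob_def by (rule orthonormal_parseval) (rule assms(3))
  also have "\<dots> = 1" by (rule query_state_norm) (use assms in auto)
  finally show ?thesis .
qed

text \<open>Parseval in the basis \<open>u\<close> reduces the total to
  \<open>sum_norm_symz_qamp\<close>, which gives \<open>fact k\<close> for every admissible output
  tuple.\<close>

lemma sum_path_weight:
  fixes u :: "nat \<Rightarrow> nat \<Rightarrow> complex"
  assumes W: "\<And>i. i \<le> k \<Longrightarrow> W i \<in> unitaries (2^(n+m))"
    and u: "\<And>a b. a < 2^(n+m) \<Longrightarrow> b < 2^(n+m) \<Longrightarrow> ip (2^(n+m)) (u a) (u b) = (if a = b then 1 else 0)"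
    and inj: "\<And>Y. Y \<in> tup k {..<2^n} \<Longrightarrow> good k Ds Y \<Longrightarrow> inj_on Y {..<k}"
  shows "(\<Sum>a<2^(n+m). path_weight n m k W Ds (u a)) = fact k * real (card {Y\<in>tup k {..<2^n}. good k Ds Y})"
proof -
  let ?N = "2^(n+m) :: nat" and ?T = "tup k {..<2^n} :: (nat \<Rightarrow> nat) set" and ?G = "{Y\<in>tup k {..<2^n}. good k Ds Y}"
  have sz: "symz k (\<lambda>X Y. ip ?N v (qamp m W k X Y)) X Y = ip ?N v (\<lambda>i. symz k (\<lambda>X Y. qamp m W k X Y i) X Y)" for v X Y
    unfolding symz_def ip_def sum_distrib_left by (rule sum.swap)
  have "(\<Sum>a<?N. path_weight n m k W Ds (u a)) = (\<Sum>X\<in>?T. \<Sum>Y\<in>?G. \<Sum>a<?N. (cmod (ip ?N (u a) (\<lambda>i. symz k (\<lambda>X Y. qamp m W k X Y i) X Y)))\<^sup>2)"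
    unfolding path_weight_def sz by (subst sum.swap) (intro sum.cong refl sum.swap)
  also have "\<dots> = (\<Sum>Y\<in>?G. \<Sum>X\<in>?T. \<Sum>i<?N. (cmod (symz k (\<lambda>X Y. qamp m W k X Y i) X Y))\<^sup>2)"
    by (subst sum.swap, intro sum.cong refl orthonormal_parseval) (rule u)
  also have "\<dots> = (\<Sum>Y\<in>?G. fact k)"
    by (rule sum.cong[OF refl]) (use sum_norm_symz_qamp[OF W] inj in auto)
  finally show ?thesis by simp
qed

lemma form_mult:
  assumes "T \<in> carrier_mat d d" "U \<in> carrier_mat d d"
  shows "form k {..<d} {..<d} (\<lambda>y x. (T * U) $$ (y,x)) \<phi> =
    form k {..<d} {..<d} (\<lambda>y x. T $$ (y,x)) (\<lambda>Z Y. \<Sum>X\<in>tup k {..<d}. amp k (\<lambda>y x. U $$ (y,x)) X Z * \<phi> X Y)"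
proof -
  let ?S = "tup k {..<d} :: (nat \<Rightarrow> nat) set"
  have a: "amp k (\<lambda>y x. (T * U) $$ (y,x)) X Y = (\<Sum>Z\<in>?S. amp k (\<lambda>y x. T $$ (y,x)) Z Y * amp k (\<lambda>y x. U $$ (y,x)) X Z)"
    if "X \<in> ?S" "Y \<in> ?S" for X Y
  proof -
    have "amp k (\<lambda>y x. (T * U) $$ (y,x)) X Y = (\<Prod>j<k. \<Sum>z<d. T $$ (Y j, z) * U $$ (z, X j))"
      unfolding amp_def
      by (rule prod.cong[OF refl]) (use tup_app[OF that(1)] tup_app[OF that(2)] mat_mult_index[OF assms] in auto)
    also have "\<dots> = (\<Sum>Z\<in>?S. \<Prod>j<k. T $$ (Y j, Z j) * U $$ (Z j, X j))" by (rule prod_sum_tup) simp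
    finally show ?thesis unfolding amp_def prod.distrib .
  qed
  have "form k {..<d} {..<d} (\<lambda>y x. (T * U) $$ (y,x)) \<phi> = (\<Sum>X\<in>?S. \<Sum>Y\<in>?S. \<Sum>Z\<in>?S. amp k (\<lambda>y x. T $$ (y,x)) Z Y * (amp k (\<lambda>y x. U $$ (y,x)) X Z * \<phi> X Y))"
    unfolding form_def by (intro sum.cong refl) (simp add: a sum_distrib_right mult.assoc)
  also have "\<dots> = (\<Sum>Y\<in>?S. \<Sum>Z\<in>?S. \<Sum>X\<in>?S. amp k (\<lambda>y x. T $$ (y,x)) Z Y * (amp k (\<lambda>y x. U $$ (y,x)) X Z * \<phi> X Y))"
    by (subst sum.swap) (intro sum.cong refl sum.swap)
  also have "\<dots> = (\<Sum>Z\<in>?S. \<Sum>Y\<in>?S. \<Sum>X\<in>?S. amp k (\<lambda>y x. T $$ (y,x)) Z Y * (amp k (\<lambda>y x. U $$ (y,x)) X Z * \<phi> X Y))"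
    by (rule sum.swap)
  finally show ?thesis unfolding form_def sum_distrib_left .
qed

text \<open>Rotating all inputs by \<open>U\<close> commutes with symmetrisation and preserves the
  norm over the full set of input tuples, so the lower bound in \<open>dominated\<close> is
  unchanged under right multiplication by \<open>U\<close>.\<close>

lemma symz_rotate:
  assumes U: "U \<in> unitaries d"
  shows "(\<Sum>Z\<in>tup k {..<d}. (cmod (symz k (\<lambda>Z Y. \<Sum>X\<in>tup k {..<d}. amp k (\<lambda>y x. U $$ (y,x)) X Z * \<phi> X Y) Z Y))\<^sup>2)
    = (\<Sum>X\<in>tup k {..<d}. (cmod (symz k \<phi> X Y))\<^sup>2)"
proof -
  let ?S = "tup k {..<d} :: (nat \<Rightarrow> nat) set" and ?U = "\<lambda>y x. U $$ (y,x)"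
  have amp: "amp k ?U (X \<circ> \<pi>) (Z \<circ> \<pi>) = amp k ?U X Z" if "\<pi> \<in> perms k" for \<pi> X Z
    unfolding amp_def using prod_perm_comp[OF that, of "\<lambda>j. U $$ (Z j, X j)"] by simp
  have "symz k (\<lambda>Z Y. \<Sum>X\<in>?S. amp k ?U X Z * \<phi> X Y) Z Y = (\<Sum>X\<in>?S. amp k ?U X Z * symz k \<phi> X Y)" for Z
  proof -
    have "symz k (\<lambda>Z Y. \<Sum>X\<in>?S. amp k ?U X Z * \<phi> X Y) Z Y = (\<Sum>\<pi>\<in>perms k. \<Sum>X\<in>?S. amp k ?U X Z * \<phi> (X \<circ> \<pi>) (Y \<circ> \<pi>))"
      unfolding symz_def
    proof (rule sum.cong[OF refl])
      fix \<pi> assume p: "\<pi> \<in> perms k"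
      have "(\<Sum>X\<in>?S. amp k ?U X (Z \<circ> \<pi>) * \<phi> X (Y \<circ> \<pi>)) = (\<Sum>X\<in>?S. amp k ?U (X \<circ> \<pi>) (Z \<circ> \<pi>) * \<phi> (X \<circ> \<pi>) (Y \<circ> \<pi>))"
        by (rule sum_tup_comp[OF p, symmetric])
      then show "(\<Sum>X\<in>?S. amp k ?U X (Z \<circ> \<pi>) * \<phi> X (Y \<circ> \<pi>)) = (\<Sum>X\<in>?S. amp k ?U X Z * \<phi> (X \<circ> \<pi>) (Y \<circ> \<pi>))"
        unfolding amp[OF p] .
    qed
    also have "\<dots> = (\<Sum>X\<in>?S. amp k ?U X Z * symz k \<phi> X Y)"
      unfolding symz_def sum_distrib_left by (rule sum.swap)
    finally show ?thesis .
  qed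
  then show ?thesis using tensor_parseval[of d ?U k "\<lambda>X. symz k \<phi> X Y"] unitary_col_orthonormal[OF U] by simp
qed

text \<open>The bound does not involve \<open>U\<close>, which is what permits averaging over
  \<open>U\<close> afterwards.\<close>

lemma expectation_qprob_mult_ge:
  assumes dom: "dominated k {..<2^n} {..<2^n} Ds \<alpha> p (\<lambda>T y x. T $$ (y,x))"
    and p: "\<And>T. T \<in> set_pmf p \<Longrightarrow> T \<in> unitaries (2^n)"
    and W: "\<And>i. i \<le> k \<Longrightarrow> W i \<in> unitaries (2^(n+m))" and U: "U \<in> unitaries (2^n)"
  shows "\<alpha> / fact k * path_weight n m k W Ds u \<le> measure_pmf.expectation p (\<lambda>T. qprob n m k W u (T * U))"
proof -
  let ?d = "2^n :: nat"
  let ?S = "tup k {..<?d} :: (nat \<Rightarrow> nat) set" and ?G = "{Y\<in>tup k {..<?d}. good k Ds Y}"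
  let ?\<phi> = "\<lambda>X Y. ip (2^(n+m)) u (qamp m W k X Y)"
  let ?\<psi> = "\<lambda>Z Y. \<Sum>X\<in>?S. amp k (\<lambda>y x. U $$ (y,x)) X Z * ?\<phi> X Y"
  have "path_weight n m k W Ds u = (\<Sum>Y\<in>?G. \<Sum>X\<in>?S. (cmod (symz k ?\<phi> X Y))\<^sup>2)"
    unfolding path_weight_def by (rule sum.swap)
  also have "\<dots> = (\<Sum>Y\<in>?G. \<Sum>Z\<in>?S. (cmod (symz k ?\<psi> Z Y))\<^sup>2)" by (simp only: symz_rotate[OF U])
  also have "\<dots> = (\<Sum>Z\<in>?S. \<Sum>Y\<in>?G. (cmod (symz k ?\<psi> Z Y))\<^sup>2)" by (rule sum.swap)
  finally have "\<alpha> / fact k * path_weight n m k W Ds u \<le> measure_pmf.expectation p (\<lambda>T. (cmod (form k {..<?d} {..<?d} (\<lambda>y x. T $$ (y,x)) ?\<psi>))\<^sup>2)"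
    using dom unfolding dominated_def by simp
  also have "\<dots> = measure_pmf.expectation p (\<lambda>T. qprob n m k W u (T * U))"
  proof (rule integral_cong_AE)
    show "AE T in measure_pmf p. (cmod (form k {..<?d} {..<?d} (\<lambda>y x. T $$ (y,x)) ?\<psi>))\<^sup>2 = qprob n m k W u (T * U)"
      unfolding AE_measure_pmf_iff
    proof
      fix T assume "T \<in> set_pmf p"
      then show "(cmod (form k {..<?d} {..<?d} (\<lambda>y x. T $$ (y,x)) ?\<psi>))\<^sup>2 = qprob n m k W u (T * U)"
        using form_mult[OF unitariesD(1)[OF p] unitariesD(1)[OF U], of T k ?\<phi>] qprob_form[where W = W and u = u and U = "T * U", OF W] by simp
    qed
  qed simp_all
  finally show ?thesis .
qed

lemma haar_prob_space: "prob_space (haar d)" and space_haar: "space (haar d) = unitaries d"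
  using is_haar_haar unfolding is_haar_def by auto

lemma haar_mult_measurable:
  assumes "V \<in> unitaries d"
  shows "(\<lambda>U. V * U) \<in> measurable (haar d) (haar d)"
proof -
  have s: "sets (haar d) = sets (haar_space d)" using is_haar_haar unfolding is_haar_def by (simp add: sets_haar_space)
  show ?thesis using mult_left_measurable[OF assms] unfolding measurable_cong_sets[OF s s] .
qed

lemma haar_form_measurable: "(\<lambda>U. form k {..<d} {..<d} (\<lambda>y x. U $$ (y,x)) \<phi>) \<in> borel_measurable (haar d)"
  unfolding form_def amp_def
proof (intro borel_measurable_sum borel_measurable_times borel_measurable_prod borel_measurable_const)
  fix X Y j assume "X \<in> tup k {..<d}" "Y \<in> tup k {..<d}" "j \<in> {..<k}"
  then show "(\<lambda>U. U $$ (Y j, X j)) \<in> borel_measurable (haar d)"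
    using tup_app[of X k "{..<d}" j] tup_app[of Y k "{..<d}" j] by (intro haar_entry_measurable) auto
qed

lemma haar_qprob_measurable:
  assumes "\<And>i. i \<le> k \<Longrightarrow> W i \<in> unitaries (2^(n+m))"
  shows "qprob n m k W u \<in> borel_measurable (haar (2^n))"
proof -
  have "qprob n m k W u = (\<lambda>U. (cmod (form k {..<2^n} {..<2^n} (\<lambda>y x. U $$ (y,x)) (\<lambda>X Y. ip (2^(n+m)) u (qamp m W k X Y))))\<^sup>2)"
    by (rule ext) (rule qprob_form[OF assms])
  then show ?thesis using haar_form_measurable by simp
qed

text \<open>Average \<open>expectation_qprob_mult_ge\<close> over Haar-random \<open>U\<close>. For
  each fixed \<open>T\<close>, left invariance replaces \<open>T * U\<close> by \<open>U\<close>,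
  the ensemble of \<open>T\<close> drops out, and Haar measure inherits the lower bound with the
  same constant.\<close>

lemma haar_qprob_ge:
  assumes dom: "dominated k {..<2^n} {..<2^n} Ds \<alpha> p (\<lambda>T y x. T $$ (y,x))"
    and p: "\<And>T. T \<in> set_pmf p \<Longrightarrow> T \<in> unitaries (2^n)"
    and W: "\<And>i. i \<le> k \<Longrightarrow> W i \<in> unitaries (2^(n+m))"
    and le: "\<And>U. U \<in> unitaries (2^n) \<Longrightarrow> qprob n m k W u U \<le> 1"
  shows "\<alpha> / fact k * path_weight n m k W Ds u \<le> (\<integral>U. qprob n m k W u U \<partial>haar (2^n))"
proof -
  let ?H = "haar (2^n)" and ?q = "qprob n m k W u"
  interpret prob_space ?H by (rule haar_prob_space)
  have fin: "finite (set_pmf p)" using dom unfolding dominated_def by blast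
  have int: "integrable ?H (\<lambda>U. ?q (T * U))" if "T \<in> set_pmf p" for T
  proof (rule integrable_const_bound[where B = 1])
    show "(\<lambda>U. ?q (T * U)) \<in> borel_measurable ?H"
      by (rule measurable_compose[OF haar_mult_measurable[OF p[OF that]] haar_qprob_measurable[OF W]])
    show "AE U in ?H. norm (?q (T * U)) \<le> 1"
      by (rule AE_I2) (use le unitaries_mult[OF p[OF that]] in \<open>auto simp: space_haar qprob_def\<close>)
  qed
  have "\<alpha> / fact k * path_weight n m k W Ds u = (\<integral>U. \<alpha> / fact k * path_weight n m k W Ds u \<partial>?H)"
    by (simp add: prob_space)
  also have "\<dots> \<le> (\<integral>U. (\<Sum>T\<in>set_pmf p. pmf p T * ?q (T * U)) \<partial>?H)"
  proof (rule integral_mono)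
    fix U assume "U \<in> space ?H"
    then show "\<alpha> / fact k * path_weight n m k W Ds u \<le> (\<Sum>T\<in>set_pmf p. pmf p T * ?q (T * U))"
      using expectation_qprob_mult_ge[OF dom p W, where U = U and u = u] unfolding expectation_finite[OF fin] space_haar by simp
  qed (use int in \<open>auto intro!: Bochner_Integration.integrable_sum\<close>)
  also have "\<dots> = (\<Sum>T\<in>set_pmf p. pmf p T * (\<integral>U. ?q (T * U) \<partial>?H))"
    using int by (simp add: Bochner_Integration.integral_sum)
  also have "\<dots> = (\<Sum>T\<in>set_pmf p. pmf p T * (\<integral>U. ?q U \<partial>?H))"
    by (intro sum.cong refl) (simp add: haar_left_invariant[OF p haar_qprob_measurable[OF W]])
  also have "\<dots> = (\<integral>U. ?q U \<partial>?H)"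
    using sum_pmf_eq_1[OF fin order_refl] by (simp add: sum_distrib_right[symmetric])
  finally show ?thesis .
qed

lemma output_state_index:
  assumes "\<And>i. i \<le> k \<Longrightarrow> W i \<in> unitaries (2^(n+m))" "i < 2^(n+m)" "j < 2^(n+m)"
  shows "output_state n m k W U $$ (i,j) = query_state n m W U k $$ (i,0) * cnj (query_state n m W U k $$ (j,0))"
proof -
  have q: "query_state n m W U k \<in> carrier_mat (2^(n+m)) 1"
    by (rule query_state_carrier) (use unitariesD(1)[OF assms(1)] in auto)
  show ?thesis unfolding output_state_def Let_def
    using mat_mult_index[OF q adj_carrier[OF q] assms(2,3)] q assms(3) by simp
qed

text \<open>The bridge from the trace norm, expressed by quadratic forms, to outcome
  probabilities.\<close>

lemma quadratic_expected_output:
  assumes W: "\<And>i. i \<le> k \<Longrightarrow> W i \<in> unitaries (2^(n+m))"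
    and int: "\<And>i j. i < 2^(n+m) \<Longrightarrow> j < 2^(n+m) \<Longrightarrow> integrable \<mu> (\<lambda>U. output_state n m k W U $$ (i,j))"
  shows "(\<Sum>i<2^(n+m). \<Sum>j<2^(n+m). cnj (u i) * expected_output \<mu> n m k W $$ (i,j) * u j) = complex_of_real (\<integral>U. qprob n m k W u U \<partial>\<mu>)"
    and "integrable \<mu> (qprob n m k W u)"
proof -
  let ?N = "2^(n+m) :: nat"
  have pt: "complex_of_real (qprob n m k W u U) = (\<Sum>i<?N. \<Sum>j<?N. cnj (u i) * output_state n m k W U $$ (i,j) * u j)" for U
    unfolding qprob_def complex_norm_square ip_def cnj_sum sum_product
    by (intro sum.cong refl) (simp add: output_state_index[OF W] mult_ac)
  have I: "integrable \<mu> (\<lambda>U. \<Sum>i<?N. \<Sum>j<?N. cnj (u i) * output_state n m k W U $$ (i,j) * u j)"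
    using int by (intro Bochner_Integration.integrable_sum integrable_mult_left integrable_mult_right) auto
  then show "integrable \<mu> (qprob n m k W u)" unfolding pt[symmetric] complex_of_real_integrable_eq .
  have "complex_of_real (\<integral>U. qprob n m k W u U \<partial>\<mu>) = (\<integral>U. (\<Sum>i<?N. \<Sum>j<?N. cnj (u i) * output_state n m k W U $$ (i,j) * u j) \<partial>\<mu>)"
    unfolding integral_complex_of_real[symmetric] pt ..
  also have "\<dots> = (\<Sum>i<?N. \<integral>U. (\<Sum>j<?N. cnj (u i) * output_state n m k W U $$ (i,j) * u j) \<partial>\<mu>)"
    using int by (intro Bochner_Integration.integral_sum Bochner_Integration.integrable_sum integrable_mult_left integrable_mult_right) auto
  also have "\<dots> = (\<Sum>i<?N. \<Sum>j<?N. \<integral>U. cnj (u i) * output_state n m k W U $$ (i,j) * u j \<partial>\<mu>)"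
    using int by (intro sum.cong refl Bochner_Integration.integral_sum integrable_mult_left integrable_mult_right) auto
  also have "\<dots> = (\<Sum>i<?N. \<Sum>j<?N. cnj (u i) * expected_output \<mu> n m k W $$ (i,j) * u j)"
    unfolding expected_output_def by (intro sum.cong refl) simp
  finally show "(\<Sum>i<?N. \<Sum>j<?N. cnj (u i) * expected_output \<mu> n m k W $$ (i,j) * u j) = complex_of_real (\<integral>U. qprob n m k W u U \<partial>\<mu>)" by simp
qed

lemma adj_expected_output:
  assumes "\<And>i. i \<le> k \<Longrightarrow> W i \<in> unitaries (2^(n+m))"
  shows "adj (expected_output \<mu> n m k W) = expected_output \<mu> n m k W"
proof (rule eq_matI)
  fix i j assume "i < dim_row (expected_output \<mu> n m k W)" "j < dim_col (expected_output \<mu> n m k W)"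
  then have ij: "i < 2^(n+m)" "j < 2^(n+m)" unfolding expected_output_def by simp_all
  have "cnj (output_state n m k W U $$ (j,i)) = output_state n m k W U $$ (i,j)" for U
    using ij by (simp add: output_state_index[OF assms])
  then show "adj (expected_output \<mu> n m k W) $$ (i,j) = expected_output \<mu> n m k W $$ (i,j)"
    using ij unfolding expected_output_def adj_def by (simp flip: Bochner_Integration.integral_cnj)
qed (simp_all add: expected_output_def)

lemma sum_expected_qprob:
  fixes u :: "nat \<Rightarrow> nat \<Rightarrow> complex"
  assumes W: "\<And>i. i \<le> k \<Longrightarrow> W i \<in> unitaries (2^(n+m))" and \<mu>: "prob_space \<mu>" "AE U in \<mu>. U \<in> unitaries (2^n)"
    and int: "\<And>a. integrable \<mu> (qprob n m k W (u a))"
    and u: "\<And>a b. a < 2^(n+m) \<Longrightarrow> b < 2^(n+m) \<Longrightarrow> ip (2^(n+m)) (u a) (u b) = (if a = b then 1 else 0)"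
  shows "(\<Sum>a<2^(n+m). \<integral>U. qprob n m k W (u a) U \<partial>\<mu>) = 1"
proof -
  interpret prob_space \<mu> by (rule \<mu>(1))
  have "(\<Sum>a<2^(n+m). \<integral>U. qprob n m k W (u a) U \<partial>\<mu>) = (\<integral>U. (\<Sum>a<2^(n+m). qprob n m k W (u a) U) \<partial>\<mu>)"
    using int by (intro Bochner_Integration.integral_sum[symmetric]) auto
  also have "\<dots> = (\<integral>U. 1 \<partial>\<mu>)"
  proof (rule integral_cong_AE)
    show "AE U in \<mu>. (\<Sum>a<2^(n+m). qprob n m k W (u a) U) = 1"
      using \<mu>(2) by eventually_elim (rule sum_qprob[OF W _ u])
  qed (use int in \<open>auto intro!: borel_measurable_sum borel_measurable_integrable\<close>)
  finally show ?thesis by (simp add: prob_space)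
qed

text \<open>In an eigenbasis of the difference the trace norm is the l1 distance of two probability
  distributions \<open>p\<close> and \<open>q\<close>. A common minorant \<open>s\<close> gives
  \<open>|p - q| \<le> (p - s) + (q - s)\<close>, which sums to at most \<open>2 * \<delta>\<close>.
  The minorant may depend on the basis, which is known only once both ensembles are fixed.\<close>

lemma trace_norm_expected_output_le:
  assumes W: "\<And>i. i \<le> k \<Longrightarrow> W i \<in> unitaries (2^(n+m))"
    and \<mu>: "prob_space \<mu>" "AE U in \<mu>. U \<in> unitaries (2^n)"
      "\<And>i j. i < 2^(n+m) \<Longrightarrow> j < 2^(n+m) \<Longrightarrow> integrable \<mu> (\<lambda>U. output_state n m k W U $$ (i,j))"
    and \<nu>: "prob_space \<nu>" "AE U in \<nu>. U \<in> unitaries (2^n)"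
      "\<And>i j. i < 2^(n+m) \<Longrightarrow> j < 2^(n+m) \<Longrightarrow> integrable \<nu> (\<lambda>U. output_state n m k W U $$ (i,j))"
    and s: "\<And>u :: nat \<Rightarrow> nat \<Rightarrow> complex. (\<And>a b. a < 2^(n+m) \<Longrightarrow> b < 2^(n+m) \<Longrightarrow> ip (2^(n+m)) (u a) (u b) = (if a = b then 1 else 0)) \<Longrightarrow>
      \<exists>s. (\<forall>a<2^(n+m). s a \<le> (\<integral>U. qprob n m k W (u a) U \<partial>\<mu>) \<and> s a \<le> (\<integral>U. qprob n m k W (u a) U \<partial>\<nu>)) \<and> 1 - \<delta> \<le> (\<Sum>a<2^(n+m). s a)"
  shows "trace_norm (expected_output \<mu> n m k W - expected_output \<nu> n m k W) \<le> 2 * \<delta>"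
proof -
  let ?N = "2^(n+m) :: nat" and ?R = "\<lambda>\<mu>. expected_output \<mu> n m k W"
  have car: "?R \<rho> \<in> carrier_mat ?N ?N" for \<rho> unfolding expected_output_def by simp
  have carD: "?R \<mu> - ?R \<nu> \<in> carrier_mat ?N ?N" using car by (rule minus_carrier_mat)
  have h: "cnj (?R \<rho> $$ (j,i)) = ?R \<rho> $$ (i,j)" if "i < ?N" "j < ?N" for i j \<rho>
    using adj_expected_output[where \<mu> = \<rho> and W = W, OF W] adj_index[of i "?R \<rho>" j] car[of \<rho>] that by simp
  have "adj (?R \<mu> - ?R \<nu>) = ?R \<mu> - ?R \<nu>"
    by (rule eq_matI) (use car[of \<mu>] car[of \<nu>] h in \<open>auto simp: adj_def\<close>)
  from trace_norm_hermitian_le[OF carD this] obtain u where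
    u: "\<And>a b. a < ?N \<Longrightarrow> b < ?N \<Longrightarrow> ip ?N (u a) (u b) = (if a = b then 1 else 0)"
    and tn: "trace_norm (?R \<mu> - ?R \<nu>) = (\<Sum>a<?N. cmod (\<Sum>i<?N. \<Sum>j<?N. cnj (u a i) * (?R \<mu> - ?R \<nu>) $$ (i,j) * u a j))"
    by blast
  let ?q = "\<lambda>\<rho> a. \<integral>U. qprob n m k W (u a) U \<partial>\<rho>"
  obtain s where sle: "\<And>a. a < ?N \<Longrightarrow> s a \<le> ?q \<mu> a" "\<And>a. a < ?N \<Longrightarrow> s a \<le> ?q \<nu> a" and ss: "1 - \<delta> \<le> (\<Sum>a<?N. s a)"
    using s[of u, OF u] by blast
  note q\<mu> = quadratic_expected_output[OF W \<mu>(3)] and q\<nu> = quadratic_expected_output[OF W \<nu>(3)]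
  have "trace_norm (?R \<mu> - ?R \<nu>) = (\<Sum>a<?N. \<bar>?q \<mu> a - ?q \<nu> a\<bar>)"
    unfolding tn
  proof (rule sum.cong[OF refl])
    fix a
    have "(\<Sum>i<?N. \<Sum>j<?N. cnj (u a i) * (?R \<mu> - ?R \<nu>) $$ (i,j) * u a j)
        = (\<Sum>i<?N. \<Sum>j<?N. cnj (u a i) * ?R \<mu> $$ (i,j) * u a j) - (\<Sum>i<?N. \<Sum>j<?N. cnj (u a i) * ?R \<nu> $$ (i,j) * u a j)"
      unfolding sum_subtractf[symmetric]
      by (intro sum.cong refl) (use car[of \<mu>] car[of \<nu>] in \<open>simp add: algebra_simps\<close>)
    also have "\<dots> = complex_of_real (?q \<mu> a - ?q \<nu> a)" using q\<mu>(1)[of "u a"] q\<nu>(1)[of "u a"] by simp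
    finally show "cmod (\<Sum>i<?N. \<Sum>j<?N. cnj (u a i) * (?R \<mu> - ?R \<nu>) $$ (i,j) * u a j) = \<bar>?q \<mu> a - ?q \<nu> a\<bar>"
      by (simp only: norm_of_real)
  qed
  also have "\<dots> \<le> (\<Sum>a<?N. (?q \<mu> a - s a) + (?q \<nu> a - s a))"
  proof (rule sum_mono)
    fix a assume "a \<in> {..<?N}"
    then show "\<bar>?q \<mu> a - ?q \<nu> a\<bar> \<le> (?q \<mu> a - s a) + (?q \<nu> a - s a)" using sle[of a] by (simp add: abs_le_iff)
  qed
  also have "\<dots> = (\<Sum>a<?N. ?q \<mu> a) + (\<Sum>a<?N. ?q \<nu> a) - 2 * (\<Sum>a<?N. s a)"
    by (simp add: sum.distrib sum_subtractf sum_distrib_left)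
  also have "(\<Sum>a<?N. ?q \<mu> a) = 1" by (rule sum_expected_qprob[OF W \<mu>(1,2) _ u]) (use q\<mu>(2) in auto)
  also have "(\<Sum>a<?N. ?q \<nu> a) = 1" by (rule sum_expected_qprob[OF W \<nu>(1,2) _ u]) (use q\<nu>(2) in auto)
  finally show ?thesis using ss by linarith
qed

lemma haar_output_integrable:
  assumes W: "\<And>i. i \<le> k \<Longrightarrow> W i \<in> unitaries (2^(n+m))" and ij: "i < 2^(n+m)" "j < 2^(n+m)"
  shows "integrable (haar (2^n)) (\<lambda>U. output_state n m k W U $$ (i,j))"
proof -
  interpret prob_space "haar (2^n)" by (rule haar_prob_space)
  have q: "(\<lambda>U. query_state n m W U k $$ (l,0)) \<in> borel_measurable (haar (2^n))" if "l < 2^(n+m)" for l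
  proof -
    have "(\<lambda>U. query_state n m W U k $$ (l,0)) = (\<lambda>U. form k {..<2^n} {..<2^n} (\<lambda>y x. U $$ (y,x)) (\<lambda>X Y. qamp m W k X Y l))"
      by (rule ext, rule query_state_qamp[OF _ that]) (use unitariesD(1)[OF W] in auto)
    then show ?thesis using haar_form_measurable by simp
  qed
  have b: "cmod (query_state n m W U k $$ (l,0)) \<le> 1" if "l < 2^(n+m)" "U \<in> unitaries (2^n)" for l U
  proof -
    have "(cmod (query_state n m W U k $$ (l,0)))\<^sup>2 \<le> (\<Sum>i<2^(n+m). (cmod (query_state n m W U k $$ (i,0)))\<^sup>2)"
      by (rule member_le_sum) (use that in auto)
    also have "\<dots> = 1" by (rule query_state_norm) (use W that in auto)
    finally show ?thesis by (simp add: power2_le_iff_abs_le power_le_one_iff)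
  qed
  have eq: "(\<lambda>U. output_state n m k W U $$ (i,j)) = (\<lambda>U. query_state n m W U k $$ (i,0) * cnj (query_state n m W U k $$ (j,0)))"
    by (rule ext) (rule output_state_index[OF W ij])
  show ?thesis unfolding eq
  proof (rule integrable_const_bound[where B = 1])
    show "(\<lambda>U. query_state n m W U k $$ (i,0) * cnj (query_state n m W U k $$ (j,0))) \<in> borel_measurable (haar (2^n))"
      using q ij by measurable
    show "AE U in haar (2^n). norm (query_state n m W U k $$ (i,0) * cnj (query_state n m W U k $$ (j,0))) \<le> 1"
      by (rule AE_I2) (use b ij in \<open>auto simp: space_haar norm_mult intro: mult_le_one\<close>)
  qed
qed

text \<open>Each count of injective tuples is at least \<open>\<epsilon>\<close> times
  \<open>(2^m)^k\<close>. There are \<open>P - 2\<close> of them from gluing and \<open>P\<close>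
  from the output digits, matching the \<open>2 * (P - 1)\<close> powers of \<open>(2^m)^k\<close>
  in the denominator; with the \<open>P - 1\<close> explicit factors \<open>\<epsilon>\<close> this
  leaves \<open>\<epsilon>\<close> to the power \<open>3 * (P - 1)\<close>, which Bernoulli's
  inequality linearises.\<close>

lemma blocked_weight_ge:
  fixes m k P :: nat
  defines "\<epsilon> \<equiv> 1 - (real k)\<^sup>2 / 2^m"
  assumes e: "0 \<le> \<epsilon>" and P: "2 \<le> P"
  shows "1 - 3 * (real P - 1) * (real k)\<^sup>2 / 2^m \<le>
    (\<epsilon> / (2^m)^(2*k)) ^ (P - 1) * real (inj_tups k (2^m)) ^ (P - 2) * real (card {Y\<in>tup k {..<2^(m*P)}. good k (dig m ` {..<P}) Y})"
proof -
  let ?J = "real (inj_tups k (2^m))" and ?Q = "2^m :: real"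
  have J: "\<epsilon> \<le> ?J / ?Q^k" using inj_tups_lower[of "2^m" k] unfolding \<epsilon>_def by simp
  obtain r where r: "P = Suc (Suc r)" using P by (metis add_2_eq_Suc le_Suc_ex)
  have "1 - 3 * (real P - 1) * (real k)\<^sup>2 / 2^m = 1 + real (3 * (P - 1)) * (- ((real k)\<^sup>2 / 2^m))"
    using P by (simp add: of_nat_diff)
  also have "\<dots> \<le> (1 + - ((real k)\<^sup>2 / 2^m)) ^ (3 * (P - 1))"
    by (rule Bernoulli_inequality) (use e in \<open>simp add: \<epsilon>_def\<close>)
  also have "\<dots> = (\<epsilon> * \<epsilon>\<^sup>2) ^ (P - 1)"
    unfolding \<epsilon>_def by (simp add: power_mult power3_eq_cube power2_eq_square mult_ac)
  also have "\<dots> \<le> (\<epsilon> * (?J / ?Q^k)\<^sup>2) ^ (P - 1)"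
    using e J by (intro power_mono mult_left_mono mult_nonneg_nonneg) auto
  also have "\<dots> = (\<epsilon> / ?Q^(2*k)) ^ (P - 1) * ?J ^ (P - 2) * ?J ^ P"
  proof -
    have "\<epsilon> * (?J / ?Q^k)\<^sup>2 = \<epsilon> / ?Q^(2*k) * ?J\<^sup>2"
      by (simp add: power_divide power_mult[symmetric] mult.commute)
    moreover have "(?J\<^sup>2) ^ (P - 1) = ?J ^ (P - 2) * ?J ^ P"
      unfolding r power_mult[symmetric] power_add[symmetric] by (simp add: mult_2)
    ultimately show ?thesis by (simp only: power_mult_distrib mult.assoc)
  qed
  also have "\<dots> \<le> (\<epsilon> / ?Q^(2*k)) ^ (P - 1) * ?J ^ (P - 2) * real (card {Y\<in>tup k {..<2^(m*P)}. good k (dig m ` {..<P}) Y})"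
    by (rule mult_left_mono[OF card_good_lower]) (use e in auto)
  finally show ?thesis .
qed

lemma blocked_LRFC3_trace_norm:
  assumes xi: "0 < xi" and P: "2 \<le> P" and n: "n = xi * P"
    and W: "\<And>i. i \<le> k \<Longrightarrow> W i \<in> unitaries (2^(n+m))"
  shows "trace_norm (expected_output (measure_pmf (blocked_LRFC3 n xi)) n m k W - expected_output (haar (2^n)) n m k W)
    \<le> 6 * real n * (real k)\<^sup>2 / 2^xi"
proof -
  let ?p = "blocked_LRFC3 n xi" and ?Q = "2^xi :: real" and ?N = "2^(n+m) :: nat"
  let ?Ds = "dig xi ` {..<P}"
  \<comment> \<open>Finiteness of the support is read off from domination at \<open>k = 0\<close>,
    where the condition on \<open>\<epsilon>\<close> holds for every \<open>xi\<close>.\<close>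
  have finp: "finite (set_pmf ?p)"
    using blocked_dominated[OF xi _ P, of 0] unfolding dominated_def n by simp
  have up: "\<And>T. T \<in> set_pmf ?p \<Longrightarrow> T \<in> unitaries (2^n)" using blocked_unitary[OF _ xi, of _ P] unfolding n by blast
  have le: "P \<le> n" unfolding n using xi by simp
  note tn = trace_norm_expected_output_le[OF W measure_pmf.prob_space_axioms[of ?p] _ _ haar_prob_space[of "2^n"] _ haar_output_integrable[OF W]]
  have base: "AE U in measure_pmf ?p. U \<in> unitaries (2^n)"
    "\<And>i j. integrable (measure_pmf ?p) (\<lambda>U. output_state n m k W U $$ (i,j))" "AE U in haar (2^n). U \<in> unitaries (2^n)"
    using up integrable_measure_pmf_finite[OF finp] AE_space[of "haar (2^n)"] by (auto simp: AE_measure_pmf_iff space_haar)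
  show ?thesis
  proof (cases "(real k)\<^sup>2 \<le> ?Q")
    \<comment> \<open>For \<open>k^2 > 2^xi\<close> the claimed bound exceeds 2, which bounds the
      trace norm of any difference of two expected states: take the zero minorant with defect
      1.\<close>
    case False
    have "trace_norm (expected_output (measure_pmf ?p) n m k W - expected_output (haar (2^n)) n m k W) \<le> 2 * 1"
      by (rule tn) (use base in \<open>auto intro!: exI[of _ "\<lambda>_. 0 :: real"] simp: qprob_def\<close>)
    also have "\<dots> \<le> 6 * real n * ((real k)\<^sup>2 / ?Q)"
    proof -
      have "1 \<le> (real k)\<^sup>2 / ?Q" using False by simp
      moreover have "2 \<le> 6 * real n" using le P by simp
      ultimately have "2 * 1 \<le> 6 * real n * ((real k)\<^sup>2 / ?Q)" by (intro mult_mono) auto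
      then show ?thesis by simp
    qed
    finally show ?thesis by simp
  next
    case True
    define \<alpha> where "\<alpha> = ((1 - (real k)\<^sup>2 / ?Q) / ?Q^(2*k)) ^ (P - 1) * real (inj_tups k (2^xi)) ^ (P - 2)"
    let ?\<delta> = "3 * (real P - 1) * (real k)\<^sup>2 / ?Q"
    have e: "0 \<le> 1 - (real k)\<^sup>2 / ?Q" using True by simp
    have dom: "dominated k {..<2^n} {..<2^n} ?Ds \<alpha> ?p (\<lambda>T y x. T $$ (y,x))"
      using blocked_dominated[OF xi e P] unfolding n \<alpha>_def .
    \<comment> \<open>Distinct values of the lowest digit already make the tuple injective.\<close>
    have inj: "inj_on Y {..<k}" if "good k ?Ds Y" for Y
    proof -
      have "inj_on (dig xi 0 \<circ> Y) {..<k}" using that P unfolding good_image by (auto simp: o_def)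
      then show ?thesis by (rule inj_on_imageI2)
    qed
    have "trace_norm (expected_output (measure_pmf ?p) n m k W - expected_output (haar (2^n)) n m k W) \<le> 2 * ?\<delta>"
    proof (rule tn)
      fix u :: "nat \<Rightarrow> nat \<Rightarrow> complex"
      assume u: "\<And>a b. a < ?N \<Longrightarrow> b < ?N \<Longrightarrow> ip ?N (u a) (u b) = (if a = b then 1 else 0)"
      let ?s = "\<lambda>a. \<alpha> / fact k * path_weight n m k W ?Ds (u a)"
      have s1: "?s a \<le> (\<integral>U. qprob n m k W (u a) U \<partial>measure_pmf ?p)" for a
        using dom W unfolding dominated_def path_weight_def by (simp add: qprob_form)
      have le1: "qprob n m k W (u a) U \<le> 1" if "a < ?N" "U \<in> unitaries (2^n)" for a U
      proof -
        have "qprob n m k W (u a) U \<le> (\<Sum>a<?N. qprob n m k W (u a) U)"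
          by (rule member_le_sum) (use that in \<open>auto simp: qprob_def\<close>)
        then show ?thesis using sum_qprob[OF W that(2) u] by simp
      qed
      have s2: "?s a \<le> (\<integral>U. qprob n m k W (u a) U \<partial>haar (2^n))" if "a < ?N" for a
        by (rule haar_qprob_ge[OF dom up W le1[OF that]])
      have "(\<Sum>a<?N. ?s a) = \<alpha> * real (card {Y\<in>tup k {..<2^n}. good k ?Ds Y})"
        unfolding sum_distrib_left[symmetric] using sum_path_weight[OF W u inj] by simp
      then have "1 - ?\<delta> \<le> (\<Sum>a<?N. ?s a)"
        using blocked_weight_ge[OF e P] unfolding \<alpha>_def n by simp
      then show "\<exists>s. (\<forall>a<?N. s a \<le> (\<integral>U. qprob n m k W (u a) U \<partial>measure_pmf ?p) \<and> s a \<le> (\<integral>U. qprob n m k W (u a) U \<partial>haar (2^n))) \<and> 1 - ?\<delta> \<le> (\<Sum>a<?N. s a)"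
        using s1 s2 by (intro exI[of _ ?s]) blast
    qed (use base in auto)
    also have "\<dots> = 6 * (real P - 1) * ((real k)\<^sup>2 / ?Q)" by simp
    \<comment> \<open>Every patch holds at least one qubit, so \<open>P - 1 \<le> n\<close>.\<close>
    also have "\<dots> \<le> 6 * real n * ((real k)\<^sup>2 / ?Q)" using le by (intro mult_right_mono) auto
    finally show ?thesis by simp
  qed
qed

text \<open>With fewer than two patches both layers are empty and the circuit is the identity, hence
  the condition \<open>2 * xi \<le> n\<close>. The constant is uniform in the number of ancillas and
  the choice of gates, over which \<open>measurable_error\<close> quantifies.\<close>

theorem mainTheorem9:
  "\<exists>c::real. \<forall>n xi k. 0 < xi \<longrightarrow> xi dvd n \<longrightarrow> 2 * xi \<le> n \<longrightarrow>
     measurable_error (measure_pmf (blocked_LRFC3 n xi)) n k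
       (c * real n * real k ^ 2 / 2 ^ xi)"
proof (intro exI[of _ 6] allI impI)
  fix n xi k :: nat assume xi: "0 < xi" and "xi dvd n" and le: "2 * xi \<le> n"
  then obtain P where n: "n = xi * P" by blast
  then have P: "2 \<le> P" using xi le by (simp add: mult.commute)
  show "measurable_error (measure_pmf (blocked_LRFC3 n xi)) n k (6 * real n * real k ^ 2 / 2 ^ xi)"
    unfolding measurable_error_def using blocked_LRFC3_trace_norm[OF xi P n] by blast
qed

end
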